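(* Let $M$ be a complete $C^1$ Finsler manifold modeled on a Banach space that admits a $C^1$ Lipschitz bump function. Let $H:M\times\mathbb{R}\to\mathbb{R}$ be a continuous function. Assume that there are constants $K_0,K_1>0$ such that $K_0\le H(x,0)\le K_1$ for all $x\in M$, and that at least one of the following conditions holds: (i) $H$ is uniformly continuous and $\liminf_{t\to\infty}H(x,t)>K_1$ for each $x\in M$; (ii) $H$ satisfies condition (A) (defined in the context), there is a constant $K_1'$ such that $\liminf_{t\to\infty}H(x,t)\ge K_1'>K_1$ for each $x\in M$, and the limit is locally uniform on $M$. Then there exists a unique bounded viscosity solution $u:M\to\mathbb{R}$ of the equation $$u(x)+H(x,\|du(x)\|_x)=0\quad\text{on }M.$$ Moreover, if $$\mathcal{F}=\{w:M\to\mathbb{R}:\ -K_1\le w\le-K_0\text{ on }M\text{ and }w\text{ is a viscosity subsolution of this equation}\},$$ then the viscosity solution is $u=\sup\{w:w\in\mathcal{F}\}$, and $u$ is locally Lipschitz.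
   Context: $C^1$ Finsler manifold (in the sense of Palais): a connected, paracompact $C^1$ Banach manifold $M$ modeled on a Banach space $(X,\|\cdot\|)$, with a continuous map $\|\cdot\|_M:TM\to[0,\infty)$ such that: (P1) for every $x\in M$ the restriction $\|\cdot\|_x$ of $\|\cdot\|_M$ to $T_xM$ is a norm such that for every chart $\varphi:U\to X$ with $x\in U$, the norm $v\in X\mapsto\|d\varphi^{-1}(\varphi(x))(v)\|_x$ is equivalent to $\|\cdot\|$; (P2) for every $x_0\in M$, $\varepsilon>0$ and chart $\varphi:U\to X$ with $x_0\in U$ there is an open neighborhood $W$ of $x_0$ such that for all $x\in W$, $v\in X$, $\frac{1}{1+\varepsilon}\|d\varphi^{-1}(\varphi(x_0))(v)\|_{x_0}\le\|d\varphi^{-1}(\varphi(x))(v)\|_x\le(1+\varepsilon)\|d\varphi^{-1}(\varphi(x_0))(v)\|_{x_0}$. Finsler metric: $d(p,q)$ is the infimum of the lengths $\ell(c)=\int_a^b\|c'(t)\|_{c(t)}\,dt$ over piecewise $C^1$ paths $c:[a,b]\to M$ connecting $p$ to $q$. $M$ is complete if $(M,d)$ is complete; Lipschitz and uniform continuity are with respect to $d$ (and the usual metric on $\mathbb{R}$). $C^1$ Lipschitz bump function on $X$: a $C^1$, Lipschitz function $b:X\to\mathbb{R}$ with bounded, non-empty support. Sub/superdifferential: $D^-f(x)$ (resp. $D^+f(x)$) is the set of $dg(x)\in T_xM^*$ where $g:M\to\mathbb{R}$ is $C^1$ and $f-g$ attains a local minimum (resp. local maximum) at $x$. For $\xi\in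 T_xM^*$, $\|\xi\|_x$ denotes the dual norm $\sup\{|\xi(v)|:v\in T_xM,\ \|v\|_x=1\}$. Viscosity subsolution: $u$ is upper semicontinuous and $u(x)+H(x,\|\Delta\|_x)\le0$ for every $x\in M$, $\Delta\in D^+u(x)$. Viscosity supersolution: $u$ is lower semicontinuous and $u(x)+H(x,\|\Delta\|_x)\ge0$ for every $x\in M$, $\Delta\in D^-u(x)$. Viscosity solution: both. Condition (A): there are a constant $C\ge0$ and a continuous function $\omega:\mathbb{R}\times\mathbb{R}\to\mathbb{R}$ with $\omega(0,0)=0$ such that for all $x_1,x_2\in M$ and $t_1,t_2\in\mathbb{R}$, $|H(x_1,t_1)-H(x_2,t_2)|\le\omega(d(x_1,x_2),t_1-t_2)+C\max\{|t_1|,|t_2|\}\,d(x_1,x_2)$. In (ii), "the limit is locally uniform on $M$" means: for every $x_0\in M$ and every $\eta>0$ there are a neighborhood $V$ of $x_0$ and $R>0$ such that $H(x,t)\ge K_1'-\eta$ for all $x\in V$ and $t\ge R$. *)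

theory Defs
  imports "HOL-Analysis.Analysis"
begin

section \<open>Banach manifolds of class C1\<close>

definition C1_on :: "'a::real_normed_vector set \<Rightarrow> ('a \<Rightarrow> 'b::real_normed_vector) \<Rightarrow> bool" where
  "C1_on S f \<longleftrightarrow>
     (\<exists>f' :: 'a \<Rightarrow> 'a \<Rightarrow>\<^sub>L 'b.
        (\<forall>x\<in>S. (f has_derivative blinfun_apply (f' x)) (at x)) \<and> continuous_on S f')"

text \<open>
  A chart is a pair \<open>(U, \<phi>)\<close>. Only the values of \<open>\<phi>\<close> on \<open>U\<close> are meaningful, and a maximal atlas
  contains every extension of \<open>\<phi>\<close> from \<open>U\<close> to the whole type.
\<close>

type_synonym ('m, 'x) chart = "'m set \<times> ('m \<Rightarrow> 'x)"

abbreviation chart_inv :: "('m, 'x) chart \<Rightarrow> 'x \<Rightarrow> 'm" where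
  "chart_inv c \<equiv> inv_into (fst c) (snd c)"

definition is_chart :: "('m::topological_space, 'x::real_normed_vector) chart \<Rightarrow> bool" where
  "is_chart c \<longleftrightarrow> open (fst c) \<and> open (snd c ` fst c) \<and>
     homeomorphism (fst c) (snd c ` fst c) (snd c) (chart_inv c)"

definition C1_compatible ::
    "('m, 'x::real_normed_vector) chart \<Rightarrow> ('m, 'x) chart \<Rightarrow> bool" where
  "C1_compatible c c' \<longleftrightarrow>
     C1_on (snd c ` (fst c \<inter> fst c')) (snd c' \<circ> chart_inv c) \<and>
     C1_on (snd c' ` (fst c \<inter> fst c')) (snd c \<circ> chart_inv c')"

text \<open>
  The differentiable structure is given by its maximal atlas, so ``every chart'' means
  every element of the atlas. The manifold is the whole type \<open>'m\<close>.
\<close>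

locale C1_banach_manifold =
  fixes atlas :: "('m::t2_space, 'x::banach) chart set"
  assumes charts: "c \<in> atlas \<Longrightarrow> is_chart c"
    and covers: "(\<Union>c\<in>atlas. fst c) = UNIV"
    and compatible: "c \<in> atlas \<Longrightarrow> c' \<in> atlas \<Longrightarrow> C1_compatible c c'"
    and maximal: "is_chart c \<Longrightarrow> (\<And>c'. c' \<in> atlas \<Longrightarrow> C1_compatible c c') \<Longrightarrow> c \<in> atlas"

definition charts_at :: "('m, 'x) chart set \<Rightarrow> 'm \<Rightarrow> ('m, 'x) chart set" where
  "charts_at A x = {c \<in> A. x \<in> fst c}"

text \<open>
  A tangent vector at \<open>x\<close> is the family of its coordinate representations in all charts around
  \<open>x\<close> (and \<open>0\<close> at the other charts, so that equality of families is equality of tangent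
  vectors). This family is the equivalence class of a pair (chart, vector) written as a function.
  The vector space operations are pointwise, and the differential of the chart \<open>c\<close> at \<open>x\<close> is
  evaluation at \<open>c\<close>.
\<close>

type_synonym ('m, 'x) tangent = "('m, 'x) chart \<Rightarrow> 'x"

definition tangent_space ::
    "('m, 'x::real_normed_vector) chart set \<Rightarrow> 'm \<Rightarrow> ('m, 'x) tangent set" where
  "tangent_space A x =
     {\<xi>. (\<forall>c. c \<notin> charts_at A x \<longrightarrow> \<xi> c = 0) \<and>
         (\<forall>c\<in>charts_at A x. \<forall>c'\<in>charts_at A x.
            \<xi> c' = frechet_derivative (snd c' \<circ> chart_inv c) (at (snd c x)) (\<xi> c))}"

text \<open>
  The tangent vector at \<open>x\<close> with representation \<open>v\<close> in the chart \<open>c\<close>, that is,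
  the derivative of \<open>chart_inv c\<close> at \<open>snd c x\<close> applied to \<open>v\<close>.
\<close>

definition tangent_of ::
    "('m, 'x::real_normed_vector) chart set \<Rightarrow> ('m, 'x) chart \<Rightarrow> 'm \<Rightarrow> 'x \<Rightarrow> ('m, 'x) tangent" where
  "tangent_of A c x v =
     (\<lambda>c'. if c' \<in> charts_at A x
           then frechet_derivative (snd c' \<circ> chart_inv c) (at (snd c x)) v else 0)"

section \<open>Finsler manifolds in the sense of Palais\<close>

text \<open>
  Paracompactness is meant to include the Hausdorff property, which is provided
  by the sort \<open>t2_space\<close> of the manifold type.
\<close>

definition paracompact_space :: "'a topology \<Rightarrow> bool" where
  "paracompact_space X \<longleftrightarrow>
     (\<forall>\<U>. (\<forall>U\<in>\<U>. openin X U) \<and> \<Union>\<U> = topspace X \<longrightarrow>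
        (\<exists>\<V>. (\<forall>V\<in>\<V>. openin X V \<and> (\<exists>U\<in>\<U>. V \<subseteq> U)) \<and> \<Union>\<V> = topspace X \<and>
             locally_finite_in X \<V>))"

text \<open>
  \<open>nrm x\<close> is the norm on the tangent space at \<open>x\<close>; its values off the tangent space are
  irrelevant. The charts of the tangent bundle are the maps \<open>(x, v) \<mapsto> (snd c x, v)\<close> on
  the restriction of the bundle to \<open>fst c\<close>, so continuity on the bundle is
  continuity in \<open>(x, v)\<close> for each chart \<open>c\<close>.
\<close>

locale C1_finsler_manifold = C1_banach_manifold atlas
  for atlas :: "('m::t2_space, 'x::banach) chart set" +
  fixes nrm :: "'m \<Rightarrow> ('m, 'x) tangent \<Rightarrow> real"
  assumes connected: "connected (UNIV :: 'm set)"
    and paracompact: "paracompact_space (euclidean :: 'm topology)"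
    and nrm_continuous:
      "c \<in> atlas \<Longrightarrow>
         continuous_on (fst c \<times> UNIV) (\<lambda>(x, v). nrm x (tangent_of atlas c x v))"
    and nrm_nonneg: "\<xi> \<in> tangent_space atlas x \<Longrightarrow> 0 \<le> nrm x \<xi>"
    and nrm_eq_0: "\<xi> \<in> tangent_space atlas x \<Longrightarrow> nrm x \<xi> = 0 \<longleftrightarrow> \<xi> = (\<lambda>_. 0)"
    and nrm_scale: "\<xi> \<in> tangent_space atlas x \<Longrightarrow> nrm x (\<lambda>c. r *\<^sub>R \<xi> c) = \<bar>r\<bar> * nrm x \<xi>"
    and nrm_triangle:
      "\<xi> \<in> tangent_space atlas x \<Longrightarrow> \<eta> \<in> tangent_space atlas x \<Longrightarrow>
         nrm x (\<lambda>c. \<xi> c + \<eta> c) \<le> nrm x \<xi> + nrm x \<eta>"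
    and nrm_equivalent:
      "c \<in> charts_at atlas x \<Longrightarrow>
         \<exists>a>0. \<exists>b>0. \<forall>v. a * norm v \<le> nrm x (tangent_of atlas c x v) \<and>
                          nrm x (tangent_of atlas c x v) \<le> b * norm v"
    and nrm_palais:
      "c \<in> charts_at atlas x\<^sub>0 \<Longrightarrow> 0 < \<epsilon> \<Longrightarrow>
         \<exists>W. open W \<and> x\<^sub>0 \<in> W \<and> W \<subseteq> fst c \<and>
           (\<forall>x\<in>W. \<forall>v.
              1 / (1 + \<epsilon>) * nrm x\<^sub>0 (tangent_of atlas c x\<^sub>0 v) \<le> nrm x (tangent_of atlas c x v) \<and>
              nrm x (tangent_of atlas c x v) \<le> (1 + \<epsilon>) * nrm x\<^sub>0 (tangent_of atlas c x\<^sub>0 v))"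

text \<open>
  Continuously differentiable paths on a closed interval, with one-sided derivatives at the end
  points. The library's \<open>piecewise_C1_differentiable_on\<close> is not used because it puts no
  condition on the derivative near the exceptional points, so that the length integral
  might not exist.
\<close>

definition C1_path_on ::
    "('m::topological_space, 'x::real_normed_vector) chart set \<Rightarrow> real \<Rightarrow> real \<Rightarrow> (real \<Rightarrow> 'm) \<Rightarrow> bool"
where
  "C1_path_on A s t \<gamma> \<longleftrightarrow> continuous_on {s..t} \<gamma> \<and>
     (\<forall>c\<in>A. \<exists>v. continuous_on {\<tau>\<in>{s..t}. \<gamma> \<tau> \<in> fst c} v \<and>
        (\<forall>\<tau>\<in>{s..t}. \<gamma> \<tau> \<in> fst c \<longrightarrow>
           ((snd c \<circ> \<gamma>) has_vector_derivative v \<tau>) (at \<tau> within {s..t})))"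

definition piecewise_C1_path ::
    "('m::topological_space, 'x::real_normed_vector) chart set \<Rightarrow> real \<Rightarrow> real \<Rightarrow> (real \<Rightarrow> 'm) \<Rightarrow> bool"
where
  "piecewise_C1_path A a b \<gamma> \<longleftrightarrow>
     (\<exists>n (p :: nat \<Rightarrow> real). p 0 = a \<and> p n = b \<and>
        (\<forall>i<n. p i < p (Suc i) \<and> C1_path_on A (p i) (p (Suc i)) \<gamma>))"

definition velocity ::
    "('m, 'x::real_normed_vector) chart set \<Rightarrow> real \<Rightarrow> real \<Rightarrow> (real \<Rightarrow> 'm) \<Rightarrow> real \<Rightarrow> ('m, 'x) tangent"
where
  "velocity A a b \<gamma> t =
     (\<lambda>c. if c \<in> charts_at A (\<gamma> t)
          then vector_derivative (snd c \<circ> \<gamma>) (at t within {a..b}) else 0)"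

definition path_len ::
    "('m, 'x::real_normed_vector) chart set \<Rightarrow> ('m \<Rightarrow> ('m, 'x) tangent \<Rightarrow> real) \<Rightarrow>
     real \<Rightarrow> real \<Rightarrow> (real \<Rightarrow> 'm) \<Rightarrow> real"
where
  "path_len A nrm a b \<gamma> = integral {a..b} (\<lambda>t. nrm (\<gamma> t) (velocity A a b \<gamma> t))"

definition finsler_dist ::
    "('m::topological_space, 'x::real_normed_vector) chart set \<Rightarrow>
     ('m \<Rightarrow> ('m, 'x) tangent \<Rightarrow> real) \<Rightarrow> 'm \<Rightarrow> 'm \<Rightarrow> real"
where
  "finsler_dist A nrm x y =
     Inf {path_len A nrm a b \<gamma> | a b \<gamma>.
            a < b \<and> piecewise_C1_path A a b \<gamma> \<and> \<gamma> a = x \<and> \<gamma> b = y}"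

locale complete_C1_finsler_manifold = C1_finsler_manifold +
  assumes complete: "Metric_space.mcomplete UNIV (finsler_dist atlas nrm)"

definition locally_lipschitz ::
    "('m::topological_space \<Rightarrow> 'm \<Rightarrow> real) \<Rightarrow> ('m \<Rightarrow> real) \<Rightarrow> bool" where
  "locally_lipschitz d u \<longleftrightarrow>
     (\<forall>x. \<exists>V. open V \<and> x \<in> V \<and> (\<exists>L. \<forall>y\<in>V. \<forall>z\<in>V. \<bar>u y - u z\<bar> \<le> L * d y z))"

definition C1_lipschitz_bump :: "('x::real_normed_vector \<Rightarrow> real) \<Rightarrow> bool" where
  "C1_lipschitz_bump b \<longleftrightarrow> C1_on UNIV b \<and> (\<exists>L. L-lipschitz_on UNIV b) \<and>
     bounded (closure {x. b x \<noteq> 0}) \<and> closure {x. b x \<noteq> 0} \<noteq> {}"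

section \<open>Viscosity solutions\<close>

definition C1_fun :: "('m, 'x::real_normed_vector) chart set \<Rightarrow> ('m \<Rightarrow> real) \<Rightarrow> bool" where
  "C1_fun A g \<longleftrightarrow> (\<forall>c\<in>A. C1_on (snd c ` fst c) (g \<circ> chart_inv c))"

text \<open>
  For a function of class C1 the choice of the chart does not matter, by the chain rule. Covectors
  at \<open>x\<close> are functions on the tangent space at \<open>x\<close>, \<open>undefined\<close> elsewhere.
\<close>

definition differential ::
    "('m, 'x::real_normed_vector) chart set \<Rightarrow> ('m \<Rightarrow> real) \<Rightarrow> 'm \<Rightarrow> ('m, 'x) tangent \<Rightarrow> real" where
  "differential A g x =
     (let c = SOME c. c \<in> charts_at A x in
      restrict (\<lambda>\<xi>. frechet_derivative (g \<circ> chart_inv c) (at (snd c x)) (\<xi> c)) (tangent_space A x))"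

definition subdifferential ::
    "('m::topological_space, 'x::real_normed_vector) chart set \<Rightarrow> ('m \<Rightarrow> real) \<Rightarrow> 'm \<Rightarrow>
     (('m, 'x) tangent \<Rightarrow> real) set" where
  "subdifferential A f x =
     {differential A g x | g.
        C1_fun A g \<and> (\<forall>\<^sub>F y in nhds x. f x - g x \<le> f y - g y)}"

definition superdifferential ::
    "('m::topological_space, 'x::real_normed_vector) chart set \<Rightarrow> ('m \<Rightarrow> real) \<Rightarrow> 'm \<Rightarrow>
     (('m, 'x) tangent \<Rightarrow> real) set" where
  "superdifferential A f x =
     {differential A g x | g.
        C1_fun A g \<and> (\<forall>\<^sub>F y in nhds x. f y - g y \<le> f x - g x)}"

text \<open>
  Inserting \<open>0\<close> only matters for the zero-dimensional model space, where there are no unit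
  vectors and the supremum of the empty set would be unspecified.
\<close>

definition dual_norm ::
    "('m, 'x::real_normed_vector) chart set \<Rightarrow> ('m \<Rightarrow> ('m, 'x) tangent \<Rightarrow> real) \<Rightarrow> 'm \<Rightarrow>
     (('m, 'x) tangent \<Rightarrow> real) \<Rightarrow> real" where
  "dual_norm A nrm x \<Delta> = Sup (insert 0 {\<bar>\<Delta> \<xi>\<bar> | \<xi>. \<xi> \<in> tangent_space A x \<and> nrm x \<xi> = 1})"

definition upper_semicontinuous :: "('a::topological_space \<Rightarrow> real) \<Rightarrow> bool" where
  "upper_semicontinuous u \<longleftrightarrow> (\<forall>r. open {x. u x < r})"

definition lower_semicontinuous :: "('a::topological_space \<Rightarrow> real) \<Rightarrow> bool" where
  "lower_semicontinuous u \<longleftrightarrow> (\<forall>r. open {x. r < u x})"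

definition viscosity_subsolution ::
    "('m::topological_space, 'x::real_normed_vector) chart set \<Rightarrow>
     ('m \<Rightarrow> ('m, 'x) tangent \<Rightarrow> real) \<Rightarrow> ('m \<Rightarrow> real \<Rightarrow> real) \<Rightarrow> ('m \<Rightarrow> real) \<Rightarrow> bool" where
  "viscosity_subsolution A nrm H u \<longleftrightarrow> upper_semicontinuous u \<and>
     (\<forall>x. \<forall>\<Delta>\<in>superdifferential A u x. u x + H x (dual_norm A nrm x \<Delta>) \<le> 0)"

definition viscosity_supersolution ::
    "('m::topological_space, 'x::real_normed_vector) chart set \<Rightarrow>
     ('m \<Rightarrow> ('m, 'x) tangent \<Rightarrow> real) \<Rightarrow> ('m \<Rightarrow> real \<Rightarrow> real) \<Rightarrow> ('m \<Rightarrow> real) \<Rightarrow> bool" where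
  "viscosity_supersolution A nrm H u \<longleftrightarrow> lower_semicontinuous u \<and>
     (\<forall>x. \<forall>\<Delta>\<in>subdifferential A u x. u x + H x (dual_norm A nrm x \<Delta>) \<ge> 0)"

definition viscosity_solution ::
    "('m::topological_space, 'x::real_normed_vector) chart set \<Rightarrow>
     ('m \<Rightarrow> ('m, 'x) tangent \<Rightarrow> real) \<Rightarrow> ('m \<Rightarrow> real \<Rightarrow> real) \<Rightarrow> ('m \<Rightarrow> real) \<Rightarrow> bool" where
  "viscosity_solution A nrm H u \<longleftrightarrow>
     viscosity_subsolution A nrm H u \<and> viscosity_supersolution A nrm H u"

section \<open>Conditions on the Hamiltonian\<close>

definition uniformly_continuous_H :: "('m \<Rightarrow> 'm \<Rightarrow> real) \<Rightarrow> ('m \<Rightarrow> real \<Rightarrow> real) \<Rightarrow> bool" where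
  "uniformly_continuous_H d H \<longleftrightarrow>
     (\<forall>\<epsilon>>0. \<exists>\<delta>>0. \<forall>x\<^sub>1 x\<^sub>2 t\<^sub>1 t\<^sub>2. d x\<^sub>1 x\<^sub>2 < \<delta> \<and> \<bar>t\<^sub>1 - t\<^sub>2\<bar> < \<delta> \<longrightarrow> \<bar>H x\<^sub>1 t\<^sub>1 - H x\<^sub>2 t\<^sub>2\<bar> < \<epsilon>)"

definition condition_A :: "('m \<Rightarrow> 'm \<Rightarrow> real) \<Rightarrow> ('m \<Rightarrow> real \<Rightarrow> real) \<Rightarrow> bool" where
  "condition_A d H \<longleftrightarrow>
     (\<exists>C \<omega>. 0 \<le> C \<and> continuous_on UNIV \<omega> \<and> \<omega> (0, 0) = 0 \<and>
        (\<forall>x\<^sub>1 x\<^sub>2 t\<^sub>1 t\<^sub>2.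
           \<bar>H x\<^sub>1 t\<^sub>1 - H x\<^sub>2 t\<^sub>2\<bar>
             \<le> \<omega> (d x\<^sub>1 x\<^sub>2, t\<^sub>1 - t\<^sub>2) + C * max \<bar>t\<^sub>1\<bar> \<bar>t\<^sub>2\<bar> * d x\<^sub>1 x\<^sub>2))"

end

theory Submission
  imports Defs
begin

text \<open>
  Perron's method and a comparison principle by doubling of variables. Since the distance is not
  differentiable and the manifold carries no uniform smooth bump functions, near maxima of
  \<open>u x - v y - \<theta> (d x y)\<close> are first turned into strict ones by Ekeland's principle in the complete
  Finsler metric; then, inside two charts, the smooth variational principle of Deville, Godefroy and
  Zizler (for which one C1 Lipschitz bump function on the model space suffices) is applied after
  decoupling the variables of the distance from those of \<open>u\<close> and \<open>v\<close>. What makes the equation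
  accessible, although \<open>H\<close> need not be monotone in the norm of the differential, is that every
  subgradient of \<open>\<theta> (d x y)\<close> in either variable has norm exactly \<open>\<theta>' (d x y)\<close>, because the Finsler
  metric is a length metric. The same doubling argument yields the comparison principle, the common
  local Lipschitz constants of the subsolutions in \<open>\<F>\<close> (from the coercivity of \<open>H\<close>), and
  the fact that \<open>sup \<F>\<close> is a subsolution.
\<close>

section \<open>Functions of class C1 on normed spaces\<close>

text \<open>Without local compactness no supremum is attained, and penalties cannot be sent to
  infinity along convergent maximizers. Every limit argument becomes one with a fixed penalty and a
  near-minimum of controlled error. In the comparison the error \<open>C * max |t| * d\<close> with
  \<open>t\<close> about \<open>2 * lam * d\<close> forces \<open>lam * d\<^sup>2\<close>, not just
  \<open>d\<close>, to be small; this comes from infima for the penalties \<open>2 ^ j\<close>,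
  which increase but stay bounded, so that some doubling of the penalty hardly changes the infimum.
  The functions compared are only semicontinuous, so the points found by Ekeland's principle need
  not carry any sub- or superdifferential. Differentials live at nearby points, whence the slope
  errors \<open>4 * \<delta>\<close>. Coercivity makes the Perron class locally equi-Lipschitz, so
  its supremum is continuous and no semicontinuous envelopes occur. A member \<open>w\<close> that
  is nearly optimal at a point is doubled against a test function lifted away from that point, since
  a maximum of \<open>w\<close> minus the test function may not exist. Of the bounds on the class,
  \<open>- K\<^sub>1\<close> is a subsolution, and where the supremum reaches
  \<open>- K\<^sub>0\<close> its subdifferential contains only \<open>0\<close>, so
  \<open>K\<^sub>0 \<le> H x 0\<close> suffices there.\<close>

lemma C1_on_subset: "C1_on T f \<Longrightarrow> S \<subseteq> T \<Longrightarrow> C1_on S f"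
  unfolding C1_on_def by (elim exE, rule exI, auto intro: continuous_on_subset)

lemma C1_on_differentiable:
  assumes "C1_on S f" "x \<in> S"
  shows "(f has_derivative frechet_derivative f (at x)) (at x)"
proof -
  obtain f' where f': "(f has_derivative f') (at x)" using assms unfolding C1_on_def by blast
  with frechet_derivative_at[OF f'] show ?thesis by simp
qed

lemma C1_on_cong:
  assumes "C1_on S f" "open S" "\<And>x. x \<in> S \<Longrightarrow> f x = g x"
  shows "C1_on S g"
proof -
  obtain f' where f': "\<forall>x\<in>S. (f has_derivative blinfun_apply (f' x)) (at x)" "continuous_on S f'"
    using assms(1) unfolding C1_on_def by blast
  have "\<forall>x\<in>S. (g has_derivative blinfun_apply (f' x)) (at x)"
    using f'(1) assms(2,3) by (auto intro: has_derivative_transform_within_open)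
  with f'(2) show ?thesis unfolding C1_on_def by blast
qed

text \<open>Uniqueness of derivatives lets the local choices agree: the globally chosen Frechet
  derivative coincides on each neighbourhood with the continuous one given there.\<close>

lemma C1_on_local:
  assumes "\<And>x. x \<in> S \<Longrightarrow> \<exists>T. open T \<and> x \<in> T \<and> C1_on T f"
  shows "C1_on S f"
proof -
  define f' where "f' x = Blinfun (frechet_derivative f (at x))" for x
  have loc: "\<exists>T. open T \<and> x \<in> T \<and> continuous_on T f' \<and> (f has_derivative blinfun_apply (f' x)) (at x)"
    if x: "x \<in> S" for x
  proof -
    obtain T g where T: "open T" "x \<in> T" and g: "\<And>y. y \<in> T \<Longrightarrow> (f has_derivative blinfun_apply (g y)) (at y)"
      and gc: "continuous_on T g"
      using assms[OF x] unfolding C1_on_def by blast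
    have eq: "f' y = g y" if "y \<in> T" for y
      using frechet_derivative_at[OF g[OF that]] unfolding f'_def
      by (metis blinfun_apply_inverse)
    have "continuous_on T f'"
      using gc eq by (metis continuous_on_cong)
    then show ?thesis using T g eq by metis
  qed
  have "continuous_on S f'"
    using loc by (metis continuous_at_imp_continuous_on continuous_on_eq_continuous_at)
  then show ?thesis unfolding C1_on_def using loc by blast
qed

lemma C1_on_compose:
  assumes f: "C1_on S f" and g: "C1_on T g" and sub: "f ` S \<subseteq> T"
  shows "C1_on S (g \<circ> f)"
proof -
  obtain f' where f': "\<And>x. x \<in> S \<Longrightarrow> (f has_derivative blinfun_apply (f' x)) (at x)" "continuous_on S f'"
    using f unfolding C1_on_def by blast
  obtain g' where g': "\<And>x. x \<in> T \<Longrightarrow> (g has_derivative blinfun_apply (g' x)) (at x)" "continuous_on T g'"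
    using g unfolding C1_on_def by blast
  have cf: "continuous_on S f"
    using f'(1) by (meson continuous_at_imp_continuous_on has_derivative_continuous)
  have "continuous_on S (\<lambda>x. g' (f x) o\<^sub>L f' x)"
    by (rule bounded_bilinear.continuous_on[OF bounded_bilinear_blinfun_compose])
      (use f'(2) continuous_on_compose2[OF g'(2) cf sub] in auto)
  moreover have "(g \<circ> f has_derivative blinfun_apply (g' (f x) o\<^sub>L f' x)) (at x)" if "x \<in> S" for x
  proof -
    have "(g has_derivative blinfun_apply (g' (f x))) (at (f x))" using g'(1) sub that by blast
    moreover have "blinfun_apply (g' (f x) o\<^sub>L f' x) = blinfun_apply (g' (f x)) \<circ> blinfun_apply (f' x)"
      by (simp add: fun_eq_iff)
    ultimately show ?thesis using diff_chain_at[OF f'(1)[OF that]] by metis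
  qed
  ultimately show ?thesis
    unfolding C1_on_def by (intro exI[of _ "\<lambda>x. g' (f x) o\<^sub>L f' x"] conjI ballI)
qed

lemma C1_on_blinfun_affine: "C1_on S (\<lambda>x. k *\<^sub>R (x - a))"
proof -
  have "((\<lambda>x. k *\<^sub>R (x - a)) has_derivative blinfun_apply (k *\<^sub>R id_blinfun)) (at x)" for x
    by (auto intro!: derivative_eq_intros simp: blinfun.scaleR_left)
  then show ?thesis unfolding C1_on_def by (intro exI[of _ "\<lambda>x. k *\<^sub>R id_blinfun"]) auto
qed

lemma C1_on_const: "C1_on S (\<lambda>x. c)"
  unfolding C1_on_def by (intro exI[of _ "\<lambda>x. 0"]) (auto simp: zero_blinfun.rep_eq)

lemma C1_on_add:
  assumes "C1_on S f" "C1_on S g"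
  shows "C1_on S (\<lambda>x. f x + g x)"
proof -
  obtain f' g' where
    "\<And>x. x \<in> S \<Longrightarrow> (f has_derivative blinfun_apply (f' x)) (at x)" "continuous_on S f'"
    "\<And>x. x \<in> S \<Longrightarrow> (g has_derivative blinfun_apply (g' x)) (at x)" "continuous_on S g'"
    using assms unfolding C1_on_def by blast
  then show ?thesis unfolding C1_on_def
    by (intro exI[of _ "\<lambda>x. f' x + g' x"])
      (auto intro!: continuous_intros derivative_eq_intros simp: blinfun.add_left)
qed

lemma C1_on_mult:
  fixes f g :: "'a::real_normed_vector \<Rightarrow> real"
  assumes "C1_on S f" "C1_on S g"
  shows "C1_on S (\<lambda>x. f x * g x)"
proof -
  obtain f' g' where d:
    "\<And>x. x \<in> S \<Longrightarrow> (f has_derivative blinfun_apply (f' x)) (at x)" "continuous_on S f'"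
    "\<And>x. x \<in> S \<Longrightarrow> (g has_derivative blinfun_apply (g' x)) (at x)" "continuous_on S g'"
    using assms unfolding C1_on_def by blast
  have "continuous_on S f" "continuous_on S g"
    using d by (meson continuous_at_imp_continuous_on has_derivative_continuous)+
  then show ?thesis unfolding C1_on_def using d
    by (intro exI[of _ "\<lambda>x. f x *\<^sub>R g' x + g x *\<^sub>R f' x"])
      (auto intro!: continuous_intros derivative_eq_intros simp: blinfun.add_left blinfun.scaleR_left)
qed

lemma C1_on_real:
  fixes \<tau> \<tau>' :: "real \<Rightarrow> real"
  assumes "\<And>t. (\<tau> has_real_derivative \<tau>' t) (at t)" "continuous_on UNIV \<tau>'"
  shows "C1_on UNIV \<tau>"
proof -
  have "blinfun_apply (\<tau>' t *\<^sub>R id_blinfun) = (*) (\<tau>' t)" for t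
    by (simp add: fun_eq_iff blinfun.scaleR_left)
  then show ?thesis
    unfolding C1_on_def using assms
    by (intro exI[of _ "\<lambda>t. \<tau>' t *\<^sub>R id_blinfun"])
      (auto intro!: continuous_intros simp: has_field_derivative_def)
qed

lemma has_derivative_ray:
  assumes "(f has_derivative f') (at x)"
  shows "((\<lambda>t. f (x + t *\<^sub>R v)) has_vector_derivative f' v) (at 0)"
proof -
  have "((\<lambda>t. x + t *\<^sub>R v) has_derivative (\<lambda>t. t *\<^sub>R v)) (at 0)"
    by (auto intro!: derivative_eq_intros)
  from has_derivative_compose[OF this, of f f'] assms
  show ?thesis
    using linear_scale[OF has_derivative_linear[OF assms]]
    by (simp add: has_vector_derivative_def)
qed

text \<open>Only positive \<open>t\<close> are tested because the bounds to come are positively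
  homogeneous in the direction, like a norm. Two-sided bounds follow by inserting
  \<open>- v\<close>.\<close>

lemma has_derivative_le_of_eventually:
  fixes f :: "'a::real_normed_vector \<Rightarrow> real"
  assumes d: "(f has_derivative f') (at x)"
    and e: "\<forall>\<^sub>F t in at_right 0. f (x + t *\<^sub>R v) - f x \<le> k * t"
  shows "f' v \<le> k"
proof -
  have "((\<lambda>t. f (x + t *\<^sub>R v)) has_real_derivative f' v) (at 0)"
    using has_derivative_ray[OF d] by (simp add: has_real_derivative_iff_has_vector_derivative)
  then have "((\<lambda>t. (f (x + t *\<^sub>R v) - f x) / t) \<longlongrightarrow> f' v) (at 0)"
    by (simp add: DERIV_def)
  then have l: "((\<lambda>t. (f (x + t *\<^sub>R v) - f x) / t) \<longlongrightarrow> f' v) (at_right 0)"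
    by (rule tendsto_within_subset) auto
  have "\<forall>\<^sub>F t in at_right 0. (f (x + t *\<^sub>R v) - f x) / t \<le> k"
    using e eventually_at_right_less[of "0::real"]
    by eventually_elim (simp add: field_simps)
  from tendsto_upperbound[OF l this] show ?thesis by simp
qed

lemma has_derivative_local_min_zero:
  fixes f :: "'a::real_normed_vector \<Rightarrow> real"
  assumes d: "(f has_derivative f') (at x)" and e: "\<forall>\<^sub>F y in nhds x. f x \<le> f y"
  shows "f' v = 0"
proof -
  have *: "- f' v \<le> 0" for v
  proof -
    have "((\<lambda>t. x + t *\<^sub>R v) \<longlongrightarrow> x) (at_right 0)"
      by (auto intro!: tendsto_eq_intros)
    with e have "\<forall>\<^sub>F t in at_right 0. f x \<le> f (x + t *\<^sub>R v)"
      by (rule eventually_compose_filterlim)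
    then have "\<forall>\<^sub>F t in at_right 0. (- f (x + t *\<^sub>R v)) - (- f x) \<le> 0 * t"
      by eventually_elim simp
    from has_derivative_le_of_eventually[OF has_derivative_minus[OF d] this] show ?thesis .
  qed
  have "f' (- v) = - f' v"
    using linear_neg[OF has_derivative_linear[OF d]] by simp
  with *[of v] *[of "- v"] show ?thesis by simp
qed

text \<open>Building block of the cutoff in \<open>real_cutoff_exists\<close>: squaring removes the
  kink at \<open>0\<close>, and the resulting derivative is continuous.\<close>

lemma has_real_derivative_max0_sq: "((\<lambda>t. (max 0 t)\<^sup>2) has_real_derivative 2 * max 0 t) (at t)"
proof -
  consider "t > 0" | "t < 0" | "t = 0" by linarith
  then show ?thesis
  proof cases
    case 1
    have "((\<lambda>t. t\<^sup>2) has_real_derivative 2 * max 0 t) (at t)"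
      using 1 by (auto intro!: derivative_eq_intros)
    then show ?thesis
      by (rule DERIV_cong_ev[THEN iffD1, rotated -1, OF _ refl _ refl])
        (use 1 in \<open>auto simp: eventually_nhds intro!: exI[of _ "{0<..}"]\<close>)
  next
    case 2
    have "((\<lambda>t. 0) has_real_derivative 2 * max 0 t) (at t)"
      using 2 by (auto intro!: derivative_eq_intros)
    then show ?thesis
      by (rule DERIV_cong_ev[THEN iffD1, rotated -1, OF _ refl _ refl])
        (use 2 in \<open>auto simp: eventually_nhds intro!: exI[of _ "{..<0}"]\<close>)
  next
    case 3
    have "((\<lambda>h. (max 0 h)\<^sup>2 / h) \<longlongrightarrow> 0) (at (0::real))"
    proof (rule Lim_null_comparison)
      show "\<forall>\<^sub>F h in at (0::real). norm ((max 0 h)\<^sup>2 / h) \<le> \<bar>h\<bar>"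
        by (auto simp: max_def power2_eq_square)
      show "((\<lambda>h::real. \<bar>h\<bar>) \<longlongrightarrow> 0) (at 0)"
        by (auto intro!: tendsto_eq_intros)
    qed
    then show ?thesis using 3 by (simp add: DERIV_def)
  qed
qed

lemma lipschitz_on_derivative_bound:
  fixes b :: "'a::real_normed_vector \<Rightarrow> real"
  assumes lip: "L-lipschitz_on UNIV b" and d: "(b has_derivative blinfun_apply b') (at x)"
  shows "norm b' \<le> L"
proof (rule norm_blinfun_bound)
  show L: "0 \<le> L" using lip by (rule lipschitz_on_nonneg)
  have *: "b' v \<le> L * norm v" for v
  proof (rule has_derivative_le_of_eventually[OF d])
    show "\<forall>\<^sub>F t in at_right 0. b (x + t *\<^sub>R v) - b x \<le> L * norm v * t"
      using eventually_at_right_less[of "0::real"]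
    proof eventually_elim
      case (elim t)
      have "dist (b (x + t *\<^sub>R v)) (b x) \<le> L * dist (x + t *\<^sub>R v) x"
        using lip by (rule lipschitz_onD) auto
      then show ?case using elim by (simp add: dist_norm mult_ac)
    qed
  qed
  show "norm (b' v) \<le> L * norm v" for v
    using *[of v] *[of "- v"] by (simp add: blinfun.minus_right)
qed


section \<open>Smooth gauges\<close>

text \<open>
  A smooth gauge plays the role of a C1 version of \<open>min 1 (norm z)\<close>; unlike the latter it may
  vanish at other points than the origin of the unit ball.
\<close>

locale smooth_gauge =
  fixes N :: "'x::banach \<Rightarrow> real" and N' :: "'x \<Rightarrow> 'x \<Rightarrow>\<^sub>L real" and B L :: real
  assumes N_deriv: "(N has_derivative blinfun_apply (N' z)) (at z)"
    and N'_cont: "continuous_on UNIV N'"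
    and N_nonneg: "0 \<le> N z" and N_le: "N z \<le> B" and N_0: "N 0 = 0"
    and N_ge_1: "1 \<le> norm z \<Longrightarrow> 1 \<le> N z"
    and N'_bound: "norm (N' z) \<le> L"

text \<open>The value \<open>b a\<close> may be of either sign and need not be extremal. Squaring
  \<open>1 - b / b a\<close> gives a nonnegative C1 function that is \<open>0\<close> at
  \<open>a\<close> and \<open>1\<close> off the support; an affine change of variable moves
  \<open>a\<close> to the origin and everything outside the open unit ball off the support.\<close>

lemma smooth_gauge_exists:
  fixes b :: "'x::banach \<Rightarrow> real"
  assumes "C1_lipschitz_bump b"
  shows "\<exists>(N :: 'x \<Rightarrow> real) N' B L. smooth_gauge N N' B L"
proof -
  obtain b' where b': "\<And>x. (b has_derivative blinfun_apply (b' x)) (at x)" "continuous_on UNIV b'"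
    using assms unfolding C1_lipschitz_bump_def C1_on_def by blast
  obtain L where L: "L-lipschitz_on UNIV b"
    using assms unfolding C1_lipschitz_bump_def by blast
  have L0: "0 \<le> L" using L by (rule lipschitz_on_nonneg)
  obtain R where R: "\<And>x. x \<in> closure {x. b x \<noteq> 0} \<Longrightarrow> norm x \<le> R"
    using assms unfolding C1_lipschitz_bump_def bounded_iff by blast
  have R: "norm x \<le> R" if "b x \<noteq> 0" for x
    using that by (intro R closure_subset[THEN subsetD]) simp
  obtain a where a: "b a \<noteq> 0"
    using assms unfolding C1_lipschitz_bump_def by (metis (mono_tags) Collect_empty_eq closure_empty)
  have R0: "0 \<le> R" using R[OF a] norm_ge_zero order_trans by blast
  \<comment> \<open>Any two points where \<open>b\<close> is nonzero are at most
    \<open>2 * R\<close> apart, so the Lipschitz constant bounds \<open>b\<close> in terms of its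
    value at \<open>a\<close>.\<close>
  define M where "M = \<bar>b a\<bar> + L * (2 * R)"
  have M0: "0 \<le> M" using L0 R0 by (simp add: M_def)
  have bM: "\<bar>b x\<bar> \<le> M" for x
  proof (cases "b x = 0")
    case False
    have "dist (b x) (b a) \<le> L * dist x a" using L by (rule lipschitz_onD) auto
    moreover have "dist x a \<le> 2 * R"
      using norm_triangle_ineq4[of x a] R[OF False] R[OF a] by (simp add: dist_norm)
    ultimately have "dist (b x) (b a) \<le> L * (2 * R)"
      using L0 by (meson mult_left_mono order_trans)
    then show ?thesis by (simp add: M_def dist_real_def)
  qed (use M0 in simp)
  \<comment> \<open>A vector of norm at least \<open>1\<close>, scaled by \<open>2 * R + 1\<close>
    and shifted by \<open>a\<close> with \<open>norm a \<le> R\<close>, has norm above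
    \<open>R\<close> and misses the support.\<close>
  define \<rho> where "\<rho> = 2 * R + 1"
  have \<rho>: "\<rho> > 0" using R0 by (simp add: \<rho>_def)
  define q where "q z = 1 - b (a + \<rho> *\<^sub>R z) / b a" for z
  define N where "N z = (q z)\<^sup>2" for z
  define N' where "N' z = (2 * q z * (- \<rho> / b a)) *\<^sub>R b' (a + \<rho> *\<^sub>R z)" for z
  have q1: "\<bar>q z\<bar> \<le> 1 + M / \<bar>b a\<bar>" for z
  proof -
    have "\<bar>q z\<bar> \<le> 1 + \<bar>b (a + \<rho> *\<^sub>R z)\<bar> / \<bar>b a\<bar>"
      using abs_triangle_ineq4[of 1 "b (a + \<rho> *\<^sub>R z) / b a"] by (simp add: q_def abs_divide)
    also have "\<dots> \<le> 1 + M / \<bar>b a\<bar>" using bM by (simp add: divide_right_mono)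
    finally show ?thesis .
  qed
  have Nd: "(N has_derivative blinfun_apply (N' z)) (at z)" for z
  proof -
    have "((\<lambda>z. b (a + \<rho> *\<^sub>R z)) has_derivative (\<lambda>h. b' (a + \<rho> *\<^sub>R z) (\<rho> *\<^sub>R h))) (at z)"
      by (rule has_derivative_compose[OF _ b'(1)]) (auto intro!: derivative_eq_intros)
    then have q': "(q has_derivative (\<lambda>h. - (\<rho> / b a) * b' (a + \<rho> *\<^sub>R z) h)) (at z)"
      unfolding q_def
      by (intro has_derivative_eq_rhs[OF has_derivative_diff[OF has_derivative_const bounded_linear.has_derivative[OF bounded_linear_divide]]])
        (auto simp: blinfun.scaleR_right fun_eq_iff)
    have Nq: "(N has_derivative (\<lambda>h. 2 * q z * (- \<rho> / b a) * b' (a + \<rho> *\<^sub>R z) h)) (at z)"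
      unfolding N_def power2_eq_square
      by (rule has_derivative_eq_rhs[OF has_derivative_mult[OF q' q']]) (simp add: fun_eq_iff)
    have "blinfun_apply (N' z) = (\<lambda>h. 2 * q z * (- \<rho> / b a) * b' (a + \<rho> *\<^sub>R z) h)"
      by (rule ext) (simp add: N'_def blinfun.scaleR_left blinfun.minus_left)
    with Nq show ?thesis by simp
  qed
  have cq: "continuous_on UNIV q"
  proof -
    have "continuous_on UNIV (\<lambda>z. b (a + \<rho> *\<^sub>R z))"
      by (rule continuous_on_compose2[OF lipschitz_on_continuous_on[OF L]]) (intro continuous_intros, simp)
    then show ?thesis unfolding q_def by (intro continuous_intros) (use a in auto)
  qed
  have "continuous_on UNIV N'"
  proof -
    have "continuous_on UNIV (\<lambda>z. b' (a + \<rho> *\<^sub>R z))"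
      by (rule continuous_on_compose2[OF b'(2)]) (intro continuous_intros, simp)
    then show ?thesis unfolding N'_def by (intro continuous_intros cq) (use a in auto)
  qed
  moreover have "N z \<le> (1 + M / \<bar>b a\<bar>)\<^sup>2" for z
    unfolding N_def using power_mono[OF q1[of z] abs_ge_zero, of 2] by simp
  moreover have "1 \<le> N z" if "1 \<le> norm z" for z
  proof -
    have "\<rho> \<le> norm (\<rho> *\<^sub>R z)" using that \<rho> by simp
    also have "\<dots> \<le> norm (a + \<rho> *\<^sub>R z) + norm a"
      using norm_triangle_ineq4[of "a + \<rho> *\<^sub>R z" a] by simp
    finally have "norm (a + \<rho> *\<^sub>R z) > R" using R[OF a] unfolding \<rho>_def by simp
    then have "b (a + \<rho> *\<^sub>R z) = 0" using R by force
    then show ?thesis by (simp add: N_def q_def)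
  qed
  moreover have "norm (N' z) \<le> 2 * (1 + M / \<bar>b a\<bar>) * (\<rho> / \<bar>b a\<bar>) * L" for z
  proof -
    have "norm (N' z) = 2 * \<bar>q z\<bar> * (\<rho> / \<bar>b a\<bar>) * norm (b' (a + \<rho> *\<^sub>R z))"
      unfolding N'_def using \<rho> by (simp add: abs_mult)
    also have "\<dots> \<le> 2 * (1 + M / \<bar>b a\<bar>) * (\<rho> / \<bar>b a\<bar>) * L"
      using q1[of z] \<rho> lipschitz_on_derivative_bound[OF L b'(1)] M0
      by (intro mult_mono) auto
    finally show ?thesis .
  qed
  ultimately have "smooth_gauge N N' ((1 + M / \<bar>b a\<bar>)\<^sup>2) (2 * (1 + M / \<bar>b a\<bar>) * (\<rho> / \<bar>b a\<bar>) * L)"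
    using Nd by unfold_locales (auto simp: N_def q_def a)
  then show ?thesis by blast
qed

context smooth_gauge
begin

lemma B_nonneg: "0 \<le> B" by (rule order_trans[OF N_nonneg N_le])
lemma L_nonneg: "0 \<le> L" by (rule order_trans[OF norm_ge_zero N'_bound])

lemma N_continuous: "continuous_on UNIV N"
  by (intro continuous_at_imp_continuous_on ballI has_derivative_continuous[OF N_deriv])

lemma C1_on_N: "C1_on UNIV N"
  unfolding C1_on_def by (intro exI[of _ N'] conjI ballI N_deriv N'_cont)

lemma N_affine_deriv:
  "((\<lambda>z. N (k *\<^sub>R (z - a))) has_derivative blinfun_apply (k *\<^sub>R N' (k *\<^sub>R (z - a)))) (at z)"
proof -
  have "((\<lambda>z. N (k *\<^sub>R (z - a))) has_derivative (\<lambda>h. N' (k *\<^sub>R (z - a)) (k *\<^sub>R h))) (at z)"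
    by (rule has_derivative_compose[OF _ N_deriv]) (auto intro!: derivative_eq_intros)
  then show ?thesis
    by (rule has_derivative_eq_rhs) (simp add: fun_eq_iff blinfun.scaleR_left blinfun.scaleR_right)
qed

text \<open>The perturbation produced by the variational principle. The weights
  \<open>1 / 4 ^ n\<close> beat the factors \<open>2 ^ n\<close> that the chain rule yields, so
  value and derivative converge uniformly and are both of order \<open>c\<close>.\<close>

definition gauge_series :: "real \<Rightarrow> (nat \<Rightarrow> 'x) \<Rightarrow> 'x \<Rightarrow> real" where
  "gauge_series c a z = (\<Sum>n. c / 4 ^ n * N (2 ^ n *\<^sub>R (z - a n)))"

lemma gauge_series_summable:
  assumes "0 \<le> c"
  shows "summable (\<lambda>n. c / 4 ^ n * N (2 ^ n *\<^sub>R (z - a n)))"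
proof (rule summable_comparison_test')
  show "summable (\<lambda>n. c * B * (1 / 4) ^ n)" by (intro summable_mult summable_geometric) simp
  show "norm (c / 4 ^ n * N (2 ^ n *\<^sub>R (z - a n))) \<le> c * B * (1 / 4) ^ n" for n
    using assms N_nonneg N_le by (simp add: power_one_over divide_right_mono mult_left_mono)
qed

lemma gauge_series_nonneg: "0 \<le> c \<Longrightarrow> 0 \<le> gauge_series c a z"
  unfolding gauge_series_def
  by (rule suminf_nonneg[OF gauge_series_summable]) (simp_all add: N_nonneg)

lemma gauge_series_le:
  assumes c: "0 \<le> c" shows "gauge_series c a z \<le> 2 * c * B"
proof -
  have "gauge_series c a z \<le> (\<Sum>n. c * B * (1 / 2) ^ n)"
    unfolding gauge_series_def
  proof (rule suminf_le[OF _ gauge_series_summable[OF c]])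
    show "summable (\<lambda>n. c * B * (1 / 2) ^ n)" by (intro summable_mult summable_geometric) simp
    fix n
    have "c / 4 ^ n * N (2 ^ n *\<^sub>R (z - a n)) \<le> c / 2 ^ n * B"
      using c N_le N_nonneg by (intro mult_mono divide_left_mono power_mono) auto
    then show "c / 4 ^ n * N (2 ^ n *\<^sub>R (z - a n)) \<le> c * B * (1 / 2) ^ n"
      by (simp add: power_one_over)
  qed
  also have "\<dots> = 2 * c * B"
    by (subst suminf_mult) (auto simp: suminf_geometric intro!: summable_geometric)
  finally show ?thesis .
qed

lemma gauge_series_deriv:
  assumes c: "0 \<le> c"
  shows "\<exists>P'. (\<forall>z. (gauge_series c a has_derivative blinfun_apply (P' z)) (at z)) \<and>
              continuous_on UNIV P' \<and> (\<forall>z. norm (P' z) \<le> 2 * c * L)"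
proof -
  define f' where "f' n z = (c / 4 ^ n * 2 ^ n) *\<^sub>R N' (2 ^ n *\<^sub>R (z - a n))" for n z
  define P' where "P' z = (\<Sum>n. f' n z)" for z
  have eq: "c / 4 ^ n * 2 ^ n = c * (1 / 2) ^ n" for n
    by (simp add: power_one_over field_simps flip: power_mult_distrib)
  have bd: "norm (f' n z) \<le> c * L * (1 / 2) ^ n" for n z
  proof -
    have "norm (f' n z) = c * (1 / 2) ^ n * norm (N' (2 ^ n *\<^sub>R (z - a n)))"
      unfolding f'_def eq using c by simp
    also have "\<dots> \<le> c * (1 / 2) ^ n * L" using c by (intro mult_left_mono N'_bound) simp
    finally show ?thesis by (simp add: mult_ac)
  qed
  have sm: "summable (\<lambda>n. c * L * (1 / 2) ^ n)"
    by (intro summable_mult summable_geometric) simp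
  have ul: "uniform_limit UNIV (\<lambda>n z. \<Sum>i<n. f' i z) P' sequentially"
    unfolding P'_def by (rule Weierstrass_m_test[OF bd sm])
  have cont: "continuous_on UNIV P'"
  proof (rule uniform_limit_theorem[OF _ ul])
    show "\<forall>\<^sub>F n in sequentially. continuous_on UNIV (\<lambda>z. \<Sum>i<n. f' i z)"
      unfolding f'_def
      by (intro always_eventually allI continuous_intros continuous_on_compose2[OF N'_cont]) auto
  qed simp
  have der: "((\<lambda>z. c / 4 ^ n * N (2 ^ n *\<^sub>R (z - a n))) has_derivative blinfun_apply (f' n z)) (at z)"
    for n z
    using has_derivative_mult_right[OF N_affine_deriv, of "c / 4 ^ n" "2 ^ n" "a n" z]
    by (rule has_derivative_eq_rhs)
      (simp add: f'_def fun_eq_iff blinfun.scaleR_left mult.assoc)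
  have "\<exists>g. \<forall>z\<in>UNIV. (\<lambda>n. c / 4 ^ n * N (2 ^ n *\<^sub>R (z - a n))) sums g z \<and>
          (g has_derivative blinfun_apply (P' z)) (at z within UNIV)"
  proof (rule has_derivative_series[OF convex_UNIV has_derivative_at_withinI[OF der]])
    fix e :: real assume "0 < e"
    then have "\<forall>\<^sub>F n in sequentially. \<forall>z\<in>UNIV. dist (\<Sum>i<n. f' i z) (P' z) < e"
      using ul unfolding uniform_limit_iff by blast
    then show "\<forall>\<^sub>F n in sequentially. \<forall>z\<in>UNIV. \<forall>h.
        norm ((\<Sum>i<n. blinfun_apply (f' i z) h) - blinfun_apply (P' z) h) \<le> e * norm h"
    proof eventually_elim
      case (elim n)
      show ?case
      proof (intro ballI allI)
        fix z h
        have "norm (blinfun_apply ((\<Sum>i<n. f' i z) - P' z) h) \<le> norm ((\<Sum>i<n. f' i z) - P' z) * norm h"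
          by (rule norm_blinfun)
        also have "\<dots> \<le> e * norm h"
          using elim by (intro mult_right_mono) (auto simp: dist_norm less_imp_le)
        finally show "norm ((\<Sum>i<n. blinfun_apply (f' i z) h) - blinfun_apply (P' z) h) \<le> e * norm h"
          by (simp add: blinfun.diff_left blinfun.sum_left)
      qed
    qed
  next
    show "(\<lambda>n. c / 4 ^ n * N (2 ^ n *\<^sub>R (0 - a n))) sums (\<Sum>n. c / 4 ^ n * N (2 ^ n *\<^sub>R (0 - a n)))"
      using gauge_series_summable[OF c] by (rule summable_sums)
  qed auto
  then obtain g where g: "\<And>z. (\<lambda>n. c / 4 ^ n * N (2 ^ n *\<^sub>R (z - a n))) sums g z"
    "\<And>z. (g has_derivative blinfun_apply (P' z)) (at z)" by auto
  have "g = gauge_series c a"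
    using g(1) unfolding gauge_series_def by (auto simp: sums_iff)
  moreover have "norm (P' z) \<le> 2 * c * L" for z
  proof -
    have "norm (P' z) \<le> (\<Sum>n. c * L * (1 / 2) ^ n)"
      unfolding P'_def using bd sm by (rule norm_suminf_le)
    also have "\<dots> = 2 * c * L"
      by (subst suminf_mult) (auto simp: suminf_geometric intro!: summable_geometric)
    finally show ?thesis .
  qed
  ultimately show ?thesis using g(2) cont by blast
qed

end

section \<open>A gauge-type variational principle\<close>

text \<open>
  With \<open>\<rho> n a x = min 1 (2 ^ n * dist a x)\<close> this is Ekeland's principle, with a smooth gauge it is
  the smooth variational principle of Deville, Godefroy and Zizler.
\<close>

lemma gauge_variational_principle:
  fixes f :: "'a::topological_space \<Rightarrow> real" and \<rho> :: "nat \<Rightarrow> 'a \<Rightarrow> 'a \<Rightarrow> real"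
  assumes ne: "S \<noteq> {}" and low: "\<And>x. x \<in> S \<Longrightarrow> m \<le> f x" and c: "0 < c"
    and \<rho>_nonneg: "\<And>n a x. 0 \<le> \<rho> n a x" and \<rho>_le: "\<And>n a x. \<rho> n a x \<le> M" and \<rho>_refl: "\<And>n a. \<rho> n a a = 0"
    and \<rho>_cont: "\<And>n a. continuous_on UNIV (\<rho> n a)"
    and complete: "\<And>z. (\<And>n. z n \<in> S) \<Longrightarrow> (\<And>n. \<rho> n (z n) (z (Suc n)) < 1) \<Longrightarrow> \<exists>l\<in>S. z \<longlonglongrightarrow> l"
    and lsc: "\<And>z l e. (\<And>n. z n \<in> S) \<Longrightarrow> z \<longlonglongrightarrow> l \<Longrightarrow> l \<in> S \<Longrightarrow> 0 < e \<Longrightarrow>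
                \<forall>\<^sub>F n in sequentially. f l < f (z n) + e"
  shows "\<exists>a. \<exists>l\<in>S. \<forall>x\<in>S. f l + (\<Sum>n. c / 4 ^ n * \<rho> n (a n) l) \<le> f x + (\<Sum>n. c / 4 ^ n * \<rho> n (a n) x)"
proof -
  \<comment> \<open>State of the recursion: the function perturbed so far, and a point minimizing it
    up to half of the weight \<open>c / 4 ^ n\<close> of the next penalty.\<close>
  define P where "P n gx \<longleftrightarrow> (case gx of (g, x) \<Rightarrow> x \<in> S \<and> (\<forall>y\<in>S. m \<le> g y) \<and> (\<forall>y\<in>S. g x \<le> g y + c / 4 ^ n / 2))"
    for n :: nat and gx :: "('a \<Rightarrow> real) \<times> 'a"
  have near_min: "\<exists>x. P n (g, x)" if "\<forall>y\<in>S. m \<le> g y" for g n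
  proof -
    have bdd: "bdd_below (g ` S)" using that by (auto intro!: bdd_belowI)
    have "Inf (g ` S) < Inf (g ` S) + c / 4 ^ n / 2" using c by simp
    then obtain x where x: "x \<in> S" "g x < Inf (g ` S) + c / 4 ^ n / 2"
      using ne bdd by (subst (asm) cInf_less_iff) auto
    have "g x \<le> g y + c / 4 ^ n / 2" if "y \<in> S" for y
      using x(2) cINF_lower[OF bdd that] by linarith
    then show ?thesis using x(1) that unfolding P_def by auto
  qed
  have "\<exists>F. \<forall>n. P n (F n) \<and> fst (F (Suc n)) = (\<lambda>y. fst (F n) y + c / 4 ^ n * \<rho> n (snd (F n)) y) \<and> fst (F 0) = f"
  proof -
    have "\<exists>F. \<forall>n. (P n (F n) \<and> (n = 0 \<longrightarrow> fst (F n) = f)) \<and>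
        fst (F (Suc n)) = (\<lambda>y. fst (F n) y + c / 4 ^ n * \<rho> n (snd (F n)) y)"
    proof (rule dependent_nat_choice)
      show "\<exists>x. P 0 x \<and> (0 = 0 \<longrightarrow> fst x = f)"
        using near_min[of f 0] low by fastforce
      fix gx n assume "P n gx \<and> (n = 0 \<longrightarrow> fst gx = f)"
      then have "\<forall>y\<in>S. m \<le> fst gx y + c / 4 ^ n * \<rho> n (snd gx) y"
        unfolding P_def using c \<rho>_nonneg by (auto simp: add_increasing2)
      from near_min[OF this, of "Suc n"]
      show "\<exists>y. (P (Suc n) y \<and> (Suc n = 0 \<longrightarrow> fst y = f)) \<and>
               fst y = (\<lambda>y. fst gx y + c / 4 ^ n * \<rho> n (snd gx) y)"
        by fastforce
    qed
    then show ?thesis by blast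
  qed
  then obtain F where F: "\<And>n. P n (F n)"
    "\<And>n. fst (F (Suc n)) = (\<lambda>y. fst (F n) y + c / 4 ^ n * \<rho> n (snd (F n)) y)" "fst (F 0) = f"
    by blast
  define a where "a n = snd (F n)" for n
  define g where "g n = fst (F n)" for n
  have g_Suc: "g (Suc n) y = g n y + c / 4 ^ n * \<rho> n (a n) y" for n y
    using F(2) by (simp add: g_def a_def)
  have g_eq: "g n y = f y + (\<Sum>k<n. c / 4 ^ k * \<rho> k (a k) y)" for n y
    by (induction n) (auto simp: g_Suc, simp add: g_def F(3))
  have aS: "a n \<in> S" and amin: "y \<in> S \<Longrightarrow> g n (a n) \<le> g n y + c / 4 ^ n / 2" for n y
    using F(1)[of n] by (auto simp: P_def a_def g_def split: prod.splits)
  \<comment> \<open>\<open>a n\<close> pays nothing for its own penalty, so the penalty paid by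
    \<open>a (Suc n)\<close> is at most the sum of the two tolerances, which is
    \<open>1/2 + 1/8\<close> of the weight.\<close>
  have close: "\<rho> n (a n) (a (Suc n)) < 1" for n
  proof -
    have "g n (a (Suc n)) + c / 4 ^ n * \<rho> n (a n) (a (Suc n)) = g (Suc n) (a (Suc n))"
      by (simp add: g_Suc)
    also have "\<dots> \<le> g (Suc n) (a n) + c / 4 ^ Suc n / 2" by (rule amin[OF aS])
    also have "\<dots> = g n (a n) + c / 4 ^ Suc n / 2" by (simp add: g_Suc \<rho>_refl)
    also have "\<dots> \<le> g n (a (Suc n)) + c / 4 ^ n / 2 + c / 4 ^ Suc n / 2"
      using amin[OF aS, of n "Suc n"] by simp
    finally have "c / 4 ^ n * \<rho> n (a n) (a (Suc n)) \<le> c / 4 ^ n * (5 / 8)" by simp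
    then have "\<rho> n (a n) (a (Suc n)) \<le> 5 / 8"
      by (rule mult_le_cancel_left_pos[THEN iffD1, rotated]) (use c in simp)
    then show ?thesis by simp
  qed
  obtain l where l: "l \<in> S" "a \<longlonglongrightarrow> l" using complete[OF aS close] by blast
  have summ: "summable (\<lambda>n. c / 4 ^ n * \<rho> n (a n) x)" for x
  proof (rule summable_comparison_test')
    show "summable (\<lambda>n. c * M * (1 / 4) ^ n)" by (intro summable_mult summable_geometric) simp
    show "norm (c / 4 ^ n * \<rho> n (a n) x) \<le> c * M * (1 / 4) ^ n" for n
      using c \<rho>_nonneg \<rho>_le by (simp add: power_one_over divide_right_mono mult_left_mono)
  qed
  have g_le: "g n y \<le> f y + (\<Sum>n. c / 4 ^ n * \<rho> n (a n) y)" for n y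
    unfolding g_eq using c \<rho>_nonneg by (intro add_left_mono sum_le_suminf summ) auto
  \<comment> \<open>Semicontinuity is applied with the finitely many penalties in \<open>g n\<close>
    only. As penalties are nonnegative, \<open>g n (a j) \<le> g j (a j)\<close> for
    \<open>j \<ge> n\<close>, and \<open>a j\<close> nearly minimizes \<open>g j\<close>.\<close>
  have "g n l \<le> f y + (\<Sum>n. c / 4 ^ n * \<rho> n (a n) y)" if y: "y \<in> S" for n y
  proof (rule field_le_epsilon)
    fix e :: real assume e: "0 < e"
    have "(\<lambda>j. \<Sum>k<n. c / 4 ^ k * \<rho> k (a k) (a j)) \<longlonglongrightarrow> (\<Sum>k<n. c / 4 ^ k * \<rho> k (a k) l)"
      by (intro tendsto_intros continuous_on_tendsto_compose[OF \<rho>_cont l(2)]) auto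
    then have "\<forall>\<^sub>F j in sequentially. (\<Sum>k<n. c / 4 ^ k * \<rho> k (a k) l) - e / 4 < (\<Sum>k<n. c / 4 ^ k * \<rho> k (a k) (a j))"
      by (rule order_tendstoD(1)) (use e in simp)
    moreover have "\<forall>\<^sub>F j in sequentially. f l < f (a j) + e / 4"
      using e by (intro lsc aS l) auto
    moreover have "(\<lambda>j. c / 2 * (1 / 4) ^ j) \<longlonglongrightarrow> c / 2 * 0"
      by (intro tendsto_intros) (auto intro!: LIMSEQ_power_zero)
    then have "\<forall>\<^sub>F j in sequentially. c / 2 * (1 / 4) ^ j < e / 4"
      by (rule order_tendstoD(2)) (use e in simp)
    ultimately have "\<forall>\<^sub>F j in sequentially. n \<le> j \<and> f l < f (a j) + e / 4 \<and> c / 4 ^ j / 2 < e / 4 \<and>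
       (\<Sum>k<n. c / 4 ^ k * \<rho> k (a k) l) - e / 4 < (\<Sum>k<n. c / 4 ^ k * \<rho> k (a k) (a j))"
      using eventually_ge_at_top[of n] by eventually_elim (auto simp: power_one_over)
    then obtain j where j: "n \<le> j" "f l < f (a j) + e / 4" "c / 4 ^ j / 2 < e / 4"
      "(\<Sum>k<n. c / 4 ^ k * \<rho> k (a k) l) - e / 4 < (\<Sum>k<n. c / 4 ^ k * \<rho> k (a k) (a j))"
      by (auto simp: eventually_sequentially)
    have "g n l \<le> g n (a j) + e / 2" using j by (simp add: g_eq)
    also have "g n (a j) \<le> g j (a j)"
      unfolding g_eq using j(1) c \<rho>_nonneg by (auto intro!: sum_mono2)
    also have "g j (a j) \<le> g j y + e / 2" using amin[OF y, of j] j(3) e by linarith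
    also have "g j y \<le> f y + (\<Sum>n. c / 4 ^ n * \<rho> n (a n) y)" by (rule g_le)
    finally show "g n l \<le> f y + (\<Sum>n. c / 4 ^ n * \<rho> n (a n) y) + e" by simp
  qed
  moreover have "(\<lambda>n. g n l) \<longlonglongrightarrow> f l + (\<Sum>n. c / 4 ^ n * \<rho> n (a n) l)"
    unfolding g_eq by (intro tendsto_intros summable_LIMSEQ summ)
  ultimately have "f l + (\<Sum>n. c / 4 ^ n * \<rho> n (a n) l) \<le> f y + (\<Sum>n. c / 4 ^ n * \<rho> n (a n) y)"
    if "y \<in> S" for y
    using that by (intro LIMSEQ_le_const2) auto
  then show ?thesis using l(1) by blast
qed

lemma convergent_of_geometric_steps:
  fixes x :: "nat \<Rightarrow> 'a::banach"
  assumes "\<And>n. norm (2 ^ n *\<^sub>R (x (Suc n) - x n)) < 1"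
  shows "convergent x"
proof -
  have "norm (x (Suc n) - x n) \<le> (1 / 2) ^ n" for n
  proof -
    have "2 ^ n * norm (x (Suc n) - x n) < 1" using assms[of n] unfolding norm_scaleR by simp
    then show ?thesis by (simp add: power_one_over field_simps)
  qed
  then have "summable (\<lambda>n. x (Suc n) - x n)"
    by (intro summable_comparison_test'[OF summable_geometric[of "1 / 2"]]) auto
  then have "convergent (\<lambda>n. (\<Sum>k<n. x (Suc k) - x k) + x 0)"
    by (simp add: summable_iff_convergent convergent_add_const_right_iff)
  moreover have "(\<lambda>n. (\<Sum>k<n. x (Suc k) - x k) + x 0) = x"
    by (simp add: sum_lessThan_telescope)
  ultimately show ?thesis by simp
qed

section \<open>Fuzzy sum rule: separating the distance from the semicontinuous functions\<close>

context smooth_gauge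
begin

text \<open>
  The variables of \<open>G\<close> are decoupled from those of \<open>A\<close> and \<open>A'\<close>; a large multiple \<open>K\<close> of a rescaled
  gauge of the differences keeps both pairs together. Its partial derivatives cancel, so no
  bound on them is needed.
\<close>

lemma fuzzy_sum_rule:
  fixes A A' :: "'x \<Rightarrow> real" and G :: "'x \<Rightarrow> 'x \<Rightarrow> real"
  assumes r: "0 < r" and \<kappa>: "0 < \<kappa>" and \<Lambda>: "0 \<le> \<Lambda>" and \<sigma>: "0 < \<sigma>"
    and lscA: "\<And>z l e. (\<And>n. z n \<in> cball a r) \<Longrightarrow> z \<longlonglongrightarrow> l \<Longrightarrow> l \<in> cball a r \<Longrightarrow> 0 < e \<Longrightarrow>
                 \<forall>\<^sub>F n in sequentially. A l < A (z n) + e"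
    and lscA': "\<And>z l e. (\<And>n. z n \<in> cball b r) \<Longrightarrow> z \<longlonglongrightarrow> l \<Longrightarrow> l \<in> cball b r \<Longrightarrow> 0 < e \<Longrightarrow>
                 \<forall>\<^sub>F n in sequentially. A' l < A' (z n) + e"
    and lowA: "\<And>x. x \<in> cball a r \<Longrightarrow> m\<^sub>0 \<le> A x" and lowA': "\<And>y. y \<in> cball b r \<Longrightarrow> m\<^sub>0 \<le> A' y"
    and G: "\<And>x y x' y'. x \<in> cball a r \<Longrightarrow> x' \<in> cball a r \<Longrightarrow> y \<in> cball b r \<Longrightarrow> y' \<in> cball b r \<Longrightarrow>
              \<bar>G x y - G x' y'\<bar> \<le> \<Lambda> * (norm (x - x') + norm (y - y'))"
    and min: "\<And>x y. x \<in> cball a r \<Longrightarrow> y \<in> cball b r \<Longrightarrow>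
              A a + A' b + G a b + \<kappa> * (norm (x - a) + norm (y - b)) \<le> A x + A' y + G x y"
  obtains x y x' y' g\<^sub>1 g\<^sub>2 h\<^sub>1 h\<^sub>2 D\<^sub>1 D\<^sub>2 E\<^sub>1 E\<^sub>2 where
    "x \<in> ball a \<sigma> \<inter> ball a r" "x' \<in> ball a \<sigma> \<inter> ball a r" "y \<in> ball b \<sigma> \<inter> ball b r" "y' \<in> ball b \<sigma> \<inter> ball b r"
    "A x + A' y \<le> A a + A' b + \<sigma>"
    "C1_on UNIV g\<^sub>1" "C1_on UNIV g\<^sub>2" "(g\<^sub>1 has_derivative D\<^sub>1) (at x)" "(g\<^sub>2 has_derivative D\<^sub>2) (at y)"
    "(h\<^sub>1 has_derivative E\<^sub>1) (at x')" "(h\<^sub>2 has_derivative E\<^sub>2) (at y')"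
    "\<forall>z\<in>cball a r. A x + g\<^sub>1 x \<le> A z + g\<^sub>1 z" "\<forall>z\<in>cball b r. A' y + g\<^sub>2 y \<le> A' z + g\<^sub>2 z"
    "\<forall>z\<in>cball a r. G x' y' - h\<^sub>1 x' \<le> G z y' - h\<^sub>1 z" "\<forall>z\<in>cball b r. G x' y' - h\<^sub>2 y' \<le> G x' z - h\<^sub>2 z"
    "\<forall>v. \<bar>D\<^sub>1 v - E\<^sub>1 v\<bar> \<le> \<sigma> * norm v" "\<forall>v. \<bar>D\<^sub>2 v - E\<^sub>2 v\<bar> \<le> \<sigma> * norm v"
proof -
  \<comment> \<open>All four points will lie within \<open>\<sigma>\<^sub>0\<close> of
    \<open>a\<close> or \<open>b\<close>, where \<open>G\<close> differs from \<open>G a b\<close>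
    by at most \<open>\<sigma> / 2\<close>. The gap inside each pair will be below \<open>s\<close>,
    the loss of value is at most \<open>\<eta>\<close>, and \<open>c\<close> makes the perturbations
    small in value (\<open>8 * c * B \<le> \<eta>\<close>) and in slope
    (\<open>4 * c * L \<le> \<sigma>\<close>).\<close>
  define \<sigma>\<^sub>0 where "\<sigma>\<^sub>0 = min (min \<sigma> r) (\<sigma> / (4 * (\<Lambda> + 1)))"
  define s where "s = min (\<sigma>\<^sub>0 / 2) (\<kappa> * \<sigma>\<^sub>0 / (8 * (\<Lambda> + 1)))"
  define \<eta> where "\<eta> = min (\<kappa> * \<sigma>\<^sub>0 / 4) (\<sigma> / 2)"
  define c where "c = min (\<eta> / (8 * (B + 1))) (\<sigma> / (4 * (L + 1)))"
  \<comment> \<open>Decoupling can gain at most \<open>4 * \<Lambda> * r\<close>, and the loss of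
    value is at most \<open>\<eta>\<close>; this \<open>K\<close> therefore forces the two gauge
    terms to sum to less than \<open>1\<close>. A gauge value below \<open>1\<close> means a norm
    below \<open>1\<close>, hence a gap below \<open>s\<close>.\<close>
  define K where "K = \<eta> + 4 * \<Lambda> * r + 1"
  have \<sigma>\<^sub>0: "0 < \<sigma>\<^sub>0" "\<sigma>\<^sub>0 \<le> \<sigma>" "\<sigma>\<^sub>0 \<le> r" using r \<sigma> \<Lambda> by (auto simp: \<sigma>\<^sub>0_def)
  have "\<sigma>\<^sub>0 * (4 * (\<Lambda> + 1)) \<le> \<sigma>" using \<Lambda> by (simp add: \<sigma>\<^sub>0_def pos_le_divide_eq[symmetric])
  then have \<sigma>\<^sub>0': "2 * \<Lambda> * \<sigma>\<^sub>0 \<le> \<sigma> / 2" using \<sigma>\<^sub>0 by (simp add: algebra_simps)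
  have s: "0 < s" "s \<le> \<sigma>\<^sub>0 / 2"
    using \<sigma>\<^sub>0 \<Lambda> \<kappa> min.cobounded1[of "\<sigma>\<^sub>0 / 2"] unfolding s_def by simp_all
  have "s * (8 * (\<Lambda> + 1)) \<le> \<kappa> * \<sigma>\<^sub>0" using \<Lambda> by (simp add: s_def pos_le_divide_eq[symmetric])
  then have s': "2 * \<Lambda> * s \<le> \<kappa> * \<sigma>\<^sub>0 / 4" using s by (simp add: algebra_simps)
  have \<eta>: "0 < \<eta>" "\<eta> \<le> \<kappa> * \<sigma>\<^sub>0 / 4" "\<eta> \<le> \<sigma> / 2" using \<sigma>\<^sub>0 \<sigma> \<kappa> by (auto simp: \<eta>_def)
  have c: "0 < c" using \<eta> \<sigma> B_nonneg L_nonneg by (auto simp: c_def)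
  have "c * (8 * (B + 1)) \<le> \<eta>" using B_nonneg by (simp add: c_def pos_le_divide_eq[symmetric])
  then have cB: "8 * c * B \<le> \<eta>" using c by (simp add: algebra_simps)
  have "c * (4 * (L + 1)) \<le> \<sigma>" using L_nonneg by (simp add: c_def pos_le_divide_eq[symmetric])
  then have cL: "4 * c * L \<le> \<sigma>" using c by (simp add: algebra_simps)
  have K: "0 < K" using \<eta> r \<Lambda> by (simp add: K_def add_pos_nonneg)

  define S where "S = cball a r \<times> cball b r \<times> cball a r \<times> cball b r"
  define f where "f z = A (fst z) + A' (fst (snd z)) + (G (fst (snd (snd z))) (snd (snd (snd z)))
      + K * (N ((1 / s) *\<^sub>R (fst z - fst (snd (snd z)))) + N ((1 / s) *\<^sub>R (fst (snd z) - snd (snd (snd z))))))"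
    for z :: "'x \<times> 'x \<times> 'x \<times> 'x"
  define \<rho> where "\<rho> n p z = N (2 ^ n *\<^sub>R (fst z - fst p)) + N (2 ^ n *\<^sub>R (fst (snd z) - fst (snd p)))
      + N (2 ^ n *\<^sub>R (fst (snd (snd z)) - fst (snd (snd p)))) + N (2 ^ n *\<^sub>R (snd (snd (snd z)) - snd (snd (snd p))))"
    for n and p z :: "'x \<times> 'x \<times> 'x \<times> 'x"
  define m where "m = A a + A' b + G a b"
  have f_low: "m + \<kappa> * (norm (x - a) + norm (y - b)) - \<Lambda> * (norm (x - x') + norm (y - y'))
      + K * (N ((1 / s) *\<^sub>R (x - x')) + N ((1 / s) *\<^sub>R (y - y'))) \<le> f (x, y, x', y')"
    if "(x, y, x', y') \<in> S" for x y x' y'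
  proof -
    have "m + \<kappa> * (norm (x - a) + norm (y - b)) \<le> A x + A' y + G x y"
      unfolding m_def using that by (intro min) (auto simp: S_def)
    moreover have "\<bar>G x y - G x' y'\<bar> \<le> \<Lambda> * (norm (x - x') + norm (y - y'))"
      using that by (intro G) (auto simp: S_def)
    ultimately show ?thesis by (simp add: f_def)
  qed
  have diam: "norm (x - x') \<le> 2 * r" if "x \<in> cball p r" "x' \<in> cball p r" for x x' p :: 'x
    using that dist_triangle[of x x' p] by (simp add: dist_norm norm_minus_commute)
  have diam': "\<Lambda> * (norm (x - x') + norm (y - y')) \<le> 4 * \<Lambda> * r" if "(x, y, x', y') \<in> S" for x y x' y'
  proof -
    have "norm (x - x') + norm (y - y') \<le> 4 * r"
      using diam[of x a x'] diam[of y b y'] that by (auto simp: S_def)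
    then show ?thesis using mult_left_mono[OF _ \<Lambda>] by fastforce
  qed
  obtain p l where l: "l \<in> S" and lmin: "\<And>z. z \<in> S \<Longrightarrow>
      f l + (\<Sum>n. c / 4 ^ n * \<rho> n (p n) l) \<le> f z + (\<Sum>n. c / 4 ^ n * \<rho> n (p n) z)"
  proof -
    have "\<exists>p. \<exists>l\<in>S. \<forall>z\<in>S. f l + (\<Sum>n. c / 4 ^ n * \<rho> n (p n) l) \<le> f z + (\<Sum>n. c / 4 ^ n * \<rho> n (p n) z)"
    proof (rule gauge_variational_principle[where m = "m - 4 * \<Lambda> * r" and M = "4 * B"])
      show "S \<noteq> {}" using r by (auto simp: S_def)
      show "m - 4 * \<Lambda> * r \<le> f z" if "z \<in> S" for z
      proof -
        obtain x y x' y' where z: "z = (x, y, x', y')" by (metis prod.exhaust)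
        have "0 \<le> \<kappa> * (norm (x - a) + norm (y - b))" using \<kappa> by simp
        moreover have "0 \<le> K * (N ((1 / s) *\<^sub>R (x - x')) + N ((1 / s) *\<^sub>R (y - y')))"
          using K N_nonneg by (simp add: add_nonneg_nonneg)
        ultimately show ?thesis using f_low diam' that unfolding z by fastforce
      qed
      show "0 < c" by (rule c)
      show "0 \<le> \<rho> n p z" for n p z unfolding \<rho>_def by (intro add_nonneg_nonneg N_nonneg)
      show "\<rho> n p z \<le> 4 * B" for n p z
        unfolding \<rho>_def
        using N_le[of "2 ^ n *\<^sub>R (fst z - fst p)"] N_le[of "2 ^ n *\<^sub>R (fst (snd z) - fst (snd p))"]
          N_le[of "2 ^ n *\<^sub>R (fst (snd (snd z)) - fst (snd (snd p)))"]
          N_le[of "2 ^ n *\<^sub>R (snd (snd (snd z)) - snd (snd (snd p)))"] by linarith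
      show "\<rho> n p p = 0" for n p by (simp add: \<rho>_def N_0)
      show "continuous_on UNIV (\<rho> n p)" for n p
        unfolding \<rho>_def
        by (intro continuous_on_add continuous_on_compose2[OF N_continuous] continuous_intros) auto
    next
      fix z :: "nat \<Rightarrow> 'x \<times> 'x \<times> 'x \<times> 'x"
      assume zS: "\<And>n. z n \<in> S" and close: "\<And>n. \<rho> n (z n) (z (Suc n)) < 1"
      have lt1: "norm v < 1" if "N v < 1" for v using N_ge_1[of v] that by linarith
      have *: "N v1 < 1" "N v2 < 1" "N v3 < 1" "N v4 < 1" if "N v1 + N v2 + N v3 + N v4 < 1" for v1 v2 v3 v4
        using that N_nonneg[of v1] N_nonneg[of v2] N_nonneg[of v3] N_nonneg[of v4] by linarith+
      have "convergent (\<lambda>n. fst (z n))" "convergent (\<lambda>n. fst (snd (z n)))"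
        "convergent (\<lambda>n. fst (snd (snd (z n))))" "convergent (\<lambda>n. snd (snd (snd (z n))))"
        using *[OF close[unfolded \<rho>_def]] by (auto intro!: convergent_of_geometric_steps lt1)
      then obtain l1 l2 l3 l4 where "(\<lambda>n. fst (z n)) \<longlonglongrightarrow> l1" "(\<lambda>n. fst (snd (z n))) \<longlonglongrightarrow> l2"
        "(\<lambda>n. fst (snd (snd (z n)))) \<longlonglongrightarrow> l3" "(\<lambda>n. snd (snd (snd (z n)))) \<longlonglongrightarrow> l4"
        unfolding convergent_def by blast
      then have "(\<lambda>n. (fst (z n), fst (snd (z n)), fst (snd (snd (z n))), snd (snd (snd (z n)))))
          \<longlonglongrightarrow> (l1, l2, l3, l4)" by (intro tendsto_Pair)
      then have lim: "z \<longlonglongrightarrow> (l1, l2, l3, l4)" by simp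
      have "closed S" unfolding S_def by (intro closed_Times closed_cball)
      then show "\<exists>l\<in>S. z \<longlonglongrightarrow> l" using closed_sequentially[OF _ zS lim] lim by blast
    next
      fix z :: "nat \<Rightarrow> 'x \<times> 'x \<times> 'x \<times> 'x" and l e
      assume zS: "\<And>n. z n \<in> S" and lim: "z \<longlonglongrightarrow> l" and lS: "l \<in> S" and e: "(0::real) < e"
      have lims: "(\<lambda>n. fst (z n)) \<longlonglongrightarrow> fst l" "(\<lambda>n. fst (snd (z n))) \<longlonglongrightarrow> fst (snd l)"
        "(\<lambda>n. fst (snd (snd (z n)))) \<longlonglongrightarrow> fst (snd (snd l))" "(\<lambda>n. snd (snd (snd (z n)))) \<longlonglongrightarrow> snd (snd (snd l))"
        using lim by (intro tendsto_fst tendsto_snd; simp)+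
      define Q where "Q z = G (fst (snd (snd z))) (snd (snd (snd z)))
        + K * (N ((1 / s) *\<^sub>R (fst z - fst (snd (snd z)))) + N ((1 / s) *\<^sub>R (fst (snd z) - snd (snd (snd z)))))"
        for z :: "'x \<times> 'x \<times> 'x \<times> 'x"
      have f_eq: "f z = A (fst z) + A' (fst (snd z)) + Q z" for z by (simp add: f_def Q_def)
      have 1: "\<forall>\<^sub>F n in sequentially. A (fst l) < A (fst (z n)) + e / 3"
        using zS lS e by (intro lscA lims) (auto simp: S_def mem_Times_iff)
      have 2: "\<forall>\<^sub>F n in sequentially. A' (fst (snd l)) < A' (fst (snd (z n))) + e / 3"
        using zS lS e by (intro lscA' lims) (auto simp: S_def mem_Times_iff)
      have "(\<lambda>n. G (fst (snd (snd (z n)))) (snd (snd (snd (z n))))) \<longlonglongrightarrow> G (fst (snd (snd l))) (snd (snd (snd l)))"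
      proof (rule LIM_zero_cancel, rule Lim_null_comparison[OF always_eventually])
        show "\<forall>n. norm (G (fst (snd (snd (z n)))) (snd (snd (snd (z n)))) - G (fst (snd (snd l))) (snd (snd (snd l))))
          \<le> \<Lambda> * (norm (fst (snd (snd (z n))) - fst (snd (snd l))) + norm (snd (snd (snd (z n))) - snd (snd (snd l))))"
          unfolding real_norm_def using zS lS by (intro allI G) (auto simp: S_def mem_Times_iff)
        have "(\<lambda>n. \<Lambda> * (norm (fst (snd (snd (z n))) - fst (snd (snd l))) + norm (snd (snd (snd (z n))) - snd (snd (snd l)))))
          \<longlonglongrightarrow> \<Lambda> * (norm (fst (snd (snd l)) - fst (snd (snd l))) + norm (snd (snd (snd l)) - snd (snd (snd l))))"
          by (intro tendsto_intros lims)
        then show "(\<lambda>n. \<Lambda> * (norm (fst (snd (snd (z n))) - fst (snd (snd l))) + norm (snd (snd (snd (z n))) - snd (snd (snd l)))))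
          \<longlonglongrightarrow> 0" by simp
      qed
      moreover have "(\<lambda>n. K * (N ((1 / s) *\<^sub>R (fst (z n) - fst (snd (snd (z n))))) + N ((1 / s) *\<^sub>R (fst (snd (z n)) - snd (snd (snd (z n)))))))
        \<longlonglongrightarrow> K * (N ((1 / s) *\<^sub>R (fst l - fst (snd (snd l)))) + N ((1 / s) *\<^sub>R (fst (snd l) - snd (snd (snd l)))))"
        by (intro tendsto_mult tendsto_add tendsto_const continuous_on_tendsto_compose[OF N_continuous]
            tendsto_scaleR tendsto_diff lims) auto
      ultimately have "(\<lambda>n. Q (z n)) \<longlonglongrightarrow> Q l" unfolding Q_def by (rule tendsto_add)
      then have 3: "\<forall>\<^sub>F n in sequentially. Q l - e / 3 < Q (z n)"
        by (rule order_tendstoD(1)) (use e in simp)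
      from 1 2 3 show "\<forall>\<^sub>F n in sequentially. f l < f (z n) + e"
        by eventually_elim (simp add: f_eq)
    qed
    then show ?thesis using that by blast
  qed
  obtain x y x' y' where lxy: "l = (x, y, x', y')" by (metis prod.exhaust)
  define P1 where "P1 = gauge_series c (\<lambda>n. fst (p n))"
  define P2 where "P2 = gauge_series c (\<lambda>n. fst (snd (p n)))"
  define P3 where "P3 = gauge_series c (\<lambda>n. fst (snd (snd (p n))))"
  define P4 where "P4 = gauge_series c (\<lambda>n. snd (snd (snd (p n))))"
  have P_eq: "(\<Sum>n. c / 4 ^ n * \<rho> n (p n) (z1, z2, z3, z4)) = P1 z1 + P2 z2 + P3 z3 + P4 z4" for z1 z2 z3 z4
  proof -
    have c0: "0 \<le> c" using c by simp
    note sm = gauge_series_summable[OF c0]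
    show ?thesis unfolding P1_def P2_def P3_def P4_def gauge_series_def \<rho>_def
      by (subst suminf_add suminf_add[OF summable_add] suminf_add[OF summable_add[OF summable_add]],
          (intro sm summable_add)+)+ (simp add: distrib_left)
  qed
  have P_nonneg: "0 \<le> P1 z" "0 \<le> P2 z" "0 \<le> P3 z" "0 \<le> P4 z"
    and P_le: "P1 z \<le> 2 * c * B" "P2 z \<le> 2 * c * B" "P3 z \<le> 2 * c * B" "P4 z \<le> 2 * c * B" for z
    unfolding P1_def P2_def P3_def P4_def using c gauge_series_nonneg gauge_series_le by auto
  have lmin: "f (x, y, x', y') + (P1 x + P2 y + P3 x' + P4 y') \<le> f (z1, z2, z3, z4) + (P1 z1 + P2 z2 + P3 z3 + P4 z4)"
    if "(z1, z2, z3, z4) \<in> S" for z1 z2 z3 z4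
    using lmin[OF that] unfolding lxy P_eq .
  have lS: "x \<in> cball a r" "y \<in> cball b r" "x' \<in> cball a r" "y' \<in> cball b r"
    using l by (auto simp: lxy S_def)
  have "(a, b, a, b) \<in> S" using r by (simp add: S_def)
  \<comment> \<open>At the coupled point \<open>(a, b, a, b)\<close> the gauge terms vanish and the
    four perturbations cost at most \<open>8 * c * B\<close>.\<close>
  from lmin[OF this] have f_le: "f (x, y, x', y') \<le> m + \<eta>"
    using P_nonneg(1)[of x] P_nonneg(2)[of y] P_nonneg(3)[of x'] P_nonneg(4)[of y']
      P_le(1)[of a] P_le(2)[of b] P_le(3)[of a] P_le(4)[of b] cB
    by (simp add: f_def m_def N_0)
  have ineq: "\<kappa> * (norm (x - a) + norm (y - b)) + K * (N ((1 / s) *\<^sub>R (x - x')) + N ((1 / s) *\<^sub>R (y - y')))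
      \<le> \<eta> + \<Lambda> * (norm (x - x') + norm (y - y'))"
    using f_low[OF l[unfolded lxy]] f_le by linarith
  have close: "norm (x - x') < s" "norm (y - y') < s"
  proof -
    have "0 \<le> \<kappa> * (norm (x - a) + norm (y - b))" using \<kappa> by simp
    with ineq diam'[OF l[unfolded lxy]]
    have "K * (N ((1 / s) *\<^sub>R (x - x')) + N ((1 / s) *\<^sub>R (y - y'))) \<le> \<eta> + 4 * \<Lambda> * r"
      by linarith
    also have "\<dots> < K * 1" by (simp add: K_def)
    finally have "K * (N ((1 / s) *\<^sub>R (x - x')) + N ((1 / s) *\<^sub>R (y - y'))) < K * 1" .
    then have "N ((1 / s) *\<^sub>R (x - x')) + N ((1 / s) *\<^sub>R (y - y')) < 1" using K by simp
    then have "N ((1 / s) *\<^sub>R (x - x')) < 1" "N ((1 / s) *\<^sub>R (y - y')) < 1"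
      using N_nonneg[of "(1 / s) *\<^sub>R (x - x')"] N_nonneg[of "(1 / s) *\<^sub>R (y - y')"] by linarith+
    then have "norm ((1 / s) *\<^sub>R (x - x')) < 1" "norm ((1 / s) *\<^sub>R (y - y')) < 1"
      using N_ge_1 by (meson not_le)+
    then show "norm (x - x') < s" "norm (y - y') < s"
      unfolding norm_scaleR using s by (simp_all add: divide_less_eq)
  qed
  \<comment> \<open>The growth \<open>\<kappa>\<close> around \<open>(a, b)\<close> is played
    against the gain from decoupling, which the gap bound \<open>s\<close> has made small.\<close>
  have near: "norm (x - a) + norm (y - b) \<le> \<sigma>\<^sub>0 / 2"
  proof -
    have "\<Lambda> * (norm (x - x') + norm (y - y')) \<le> \<Lambda> * (2 * s)"
      using close \<Lambda> by (intro mult_left_mono) auto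
    moreover have "0 \<le> K * (N ((1 / s) *\<^sub>R (x - x')) + N ((1 / s) *\<^sub>R (y - y')))"
      using K N_nonneg by (simp add: add_nonneg_nonneg)
    ultimately have "\<kappa> * (norm (x - a) + norm (y - b)) \<le> \<kappa> * (\<sigma>\<^sub>0 / 2)"
      using ineq s' \<eta>(2) by (simp add: algebra_simps)
    then show ?thesis using \<kappa> by simp
  qed
  have n0: "norm (x - a) < \<sigma>\<^sub>0" "norm (y - b) < \<sigma>\<^sub>0" "norm (x' - a) < \<sigma>\<^sub>0" "norm (y' - b) < \<sigma>\<^sub>0"
  proof -
    show "norm (x - a) < \<sigma>\<^sub>0" "norm (y - b) < \<sigma>\<^sub>0"
      using near \<sigma>\<^sub>0(1) norm_ge_zero[of "x - a"] norm_ge_zero[of "y - b"] by linarith+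
    show "norm (x' - a) < \<sigma>\<^sub>0"
      using near close(1) s(2) norm_triangle_sub[of "x' - a" "x - a"] norm_ge_zero[of "y - b"]
      by (simp add: norm_minus_commute del: norm_ge_zero)
    show "norm (y' - b) < \<sigma>\<^sub>0"
      using near close(2) s(2) norm_triangle_sub[of "y' - b" "y - b"] norm_ge_zero[of "x - a"]
      by (simp add: norm_minus_commute del: norm_ge_zero)
  qed
  have val: "A x + A' y \<le> A a + A' b + \<sigma>"
  proof -
    have "0 \<le> K * (N ((1 / s) *\<^sub>R (x - x')) + N ((1 / s) *\<^sub>R (y - y')))"
      using K N_nonneg by (simp add: add_nonneg_nonneg)
    with f_le have "A x + A' y \<le> m + \<eta> - G x' y'" by (simp add: f_def)
    moreover have "\<bar>G a b - G x' y'\<bar> \<le> \<Lambda> * (norm (a - x') + norm (b - y'))"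
      using lS r by (intro G) auto
    moreover have "\<Lambda> * (norm (a - x') + norm (b - y')) \<le> \<Lambda> * (2 * \<sigma>\<^sub>0)"
      using n0 \<Lambda> by (intro mult_left_mono) (auto simp: norm_minus_commute)
    ultimately show ?thesis using \<sigma>\<^sub>0' \<eta>(3) unfolding m_def by (simp add: algebra_simps)
  qed
  obtain P1' where P1': "\<And>z. (P1 has_derivative blinfun_apply (P1' z)) (at z)" "continuous_on UNIV P1'" "\<And>z. norm (P1' z) \<le> 2 * c * L"
    using gauge_series_deriv[of c "\<lambda>n. fst (p n)"] c unfolding P1_def by auto
  obtain P2' where P2': "\<And>z. (P2 has_derivative blinfun_apply (P2' z)) (at z)" "continuous_on UNIV P2'" "\<And>z. norm (P2' z) \<le> 2 * c * L"
    using gauge_series_deriv[of c "\<lambda>n. fst (snd (p n))"] c unfolding P2_def by auto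
  obtain P3' where P3': "\<And>z. (P3 has_derivative blinfun_apply (P3' z)) (at z)" "\<And>z. norm (P3' z) \<le> 2 * c * L"
    using gauge_series_deriv[of c "\<lambda>n. fst (snd (snd (p n)))"] c unfolding P3_def by auto
  obtain P4' where P4': "\<And>z. (P4 has_derivative blinfun_apply (P4' z)) (at z)" "\<And>z. norm (P4' z) \<le> 2 * c * L"
    using gauge_series_deriv[of c "\<lambda>n. snd (snd (snd (p n)))"] c unfolding P4_def by auto
  \<comment> \<open>\<open>g\<close> tests \<open>A\<close> or \<open>A'\<close> and has the moving
    point first in the coupling term; \<open>h\<close> tests \<open>G\<close>, has it second and
    carries the opposite sign. Both then have the same coupling derivative, taken at the same
    difference, and \<open>D - E\<close> consists of derivatives of perturbations alone.\<close>
  define g where "g Q w z = K * N ((1 / s) *\<^sub>R (z - w)) + Q z" for Q :: "'x \<Rightarrow> real" and w z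
  define h where "h Q w z = - (K * N ((- 1 / s) *\<^sub>R (z - w))) - Q z" for Q :: "'x \<Rightarrow> real" and w z
  have g_deriv: "(g Q w has_derivative (\<lambda>v. K * (1 / s) * N' ((1 / s) *\<^sub>R (z - w)) v + Q' v)) (at z)"
    if "(Q has_derivative Q') (at z)" for Q Q' w z
    unfolding g_def
    by (rule has_derivative_eq_rhs[OF has_derivative_add[OF has_derivative_mult_right[OF N_affine_deriv] that]])
      (simp add: fun_eq_iff blinfun.scaleR_left)
  have h_deriv: "(h Q w has_derivative (\<lambda>v. K * (1 / s) * N' ((1 / s) *\<^sub>R (w - z)) v - Q' v)) (at z)"
    if "(Q has_derivative Q') (at z)" for Q Q' w z
  proof -
    have eq: "- (1 / s) *\<^sub>R (z - w) = (1 / s) *\<^sub>R (w - z)"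
      by (metis divide_minus_left minus_diff_eq scaleR_minus_left scaleR_minus_right)
    show ?thesis unfolding h_def
      by (rule has_derivative_eq_rhs[OF has_derivative_diff[OF has_derivative_minus[OF has_derivative_mult_right[OF N_affine_deriv]] that]])
        (simp add: fun_eq_iff blinfun.scaleR_left eq del: scaleR_minus_left)
  qed
  have g_C1: "C1_on UNIV (g Q w)"
    if "\<And>z. (Q has_derivative blinfun_apply (Q' z)) (at z)" "continuous_on UNIV Q'" for Q Q' w
  proof -
    have 1: "C1_on UNIV (\<lambda>z. N ((1 / s) *\<^sub>R (z - w)))"
      using C1_on_compose[OF C1_on_blinfun_affine C1_on_N] by (simp add: comp_def)
    have 2: "C1_on UNIV Q" unfolding C1_on_def by (intro exI[of _ Q'] conjI ballI that)
    show ?thesis unfolding g_def by (intro C1_on_add C1_on_mult C1_on_const 1 2)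
  qed
  have diff: "\<bar>(k + blinfun_apply p1 v) - (k - blinfun_apply p2 v)\<bar> \<le> \<sigma> * norm v"
    if "norm p1 \<le> 2 * c * L" "norm p2 \<le> 2 * c * L" for p1 p2 :: "'x \<Rightarrow>\<^sub>L real" and k v
  proof -
    have "\<bar>(k + blinfun_apply p1 v) - (k - blinfun_apply p2 v)\<bar> \<le> norm ((p1 + p2) v)"
      by (simp add: blinfun.add_left)
    also have "\<dots> \<le> norm (p1 + p2) * norm v" by (rule norm_blinfun)
    also have "\<dots> \<le> \<sigma> * norm v"
      using norm_triangle_ineq[of p1 p2] that cL by (intro mult_right_mono) auto
    finally show ?thesis .
  qed
  have hN: "N ((- 1 / s) *\<^sub>R (z - w)) = N ((1 / s) *\<^sub>R (w - z))" for z w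
    by (metis divide_minus_left minus_diff_eq scaleR_minus_left scaleR_minus_right)
  have m1: "\<forall>z\<in>cball a r. A x + g P1 x' x \<le> A z + g P1 x' z"
    using lmin[of _ y x' y'] lS by (auto simp: S_def f_def g_def algebra_simps)
  have m2: "\<forall>z\<in>cball b r. A' y + g P2 y' y \<le> A' z + g P2 y' z"
    using lmin[of x _ x' y'] lS by (auto simp: S_def f_def g_def algebra_simps)
  have m3: "\<forall>z\<in>cball a r. G x' y' - h P3 x x' \<le> G z y' - h P3 x z"
    using lmin[of x y _ y'] lS unfolding h_def hN by (auto simp: S_def f_def algebra_simps)
  have m4: "\<forall>z\<in>cball b r. G x' y' - h P4 y y' \<le> G x' z - h P4 y z"
    using lmin[of x y x' _] lS unfolding h_def hN by (auto simp: S_def f_def algebra_simps)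
  have balls: "x \<in> ball a \<sigma> \<inter> ball a r" "x' \<in> ball a \<sigma> \<inter> ball a r" "y \<in> ball b \<sigma> \<inter> ball b r" "y' \<in> ball b \<sigma> \<inter> ball b r"
    using n0 \<sigma>\<^sub>0 by (auto simp: dist_norm norm_minus_commute)
  show ?thesis
  proof (rule that[OF balls val g_C1[OF P1'(1,2)] g_C1[OF P2'(1,2)] g_deriv[OF P1'(1)] g_deriv[OF P2'(1)]
        h_deriv[OF P3'(1)] h_deriv[OF P4'(1)] m1 m2 m3 m4])
    show "\<forall>v. \<bar>K * (1 / s) * N' ((1 / s) *\<^sub>R (x - x')) v + P1' x v - (K * (1 / s) * N' ((1 / s) *\<^sub>R (x - x')) v - P3' x' v)\<bar> \<le> \<sigma> * norm v"
      by (intro allI diff P1'(3) P3'(2))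
    show "\<forall>v. \<bar>K * (1 / s) * N' ((1 / s) *\<^sub>R (y - y')) v + P2' y v - (K * (1 / s) * N' ((1 / s) *\<^sub>R (y - y')) v - P4' y' v)\<bar> \<le> \<sigma> * norm v"
      by (intro allI diff P2'(3) P4'(2))
  qed
qed

end

section \<open>Charts and tangent vectors\<close>

lemma has_derivative_cong_nhds:
  assumes "(f has_derivative f') (at x)" "\<forall>\<^sub>F y in nhds x. f y = g y"
  shows "(g has_derivative f') (at x)"
  using assms(1)
proof (rule has_derivative_transform_eventually)
  show "\<forall>\<^sub>F y in at x. f y = g y" using assms(2) by (simp add: eventually_nhds_conv_at)
  show "f x = g x" using assms(2) by (rule eventually_nhds_x_imp_x)
qed simp

lemma isCont_tendsto_nhds: "isCont f x \<Longrightarrow> (f \<longlongrightarrow> f x) (nhds x)"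
  by (simp add: continuous_at tendsto_at_iff_tendsto_nhds)

text \<open>The Hausdorff property provides a cover by \<open>U\<close> and open sets whose closures
  miss \<open>x\<close>. In a locally finite refinement the closures of the members not inside
  \<open>U\<close> miss \<open>x\<close>, and their union is closed. \<open>local_structure\<close>
  takes from this a closed neighbourhood inside a chart domain.\<close>

lemma paracompact_space_imp_regular:
  fixes x :: "'m::t2_space"
  assumes pc: "paracompact_space (euclidean :: 'm topology)" and U: "open U" "x \<in> U"
  shows "\<exists>W. open W \<and> x \<in> W \<and> closure W \<subseteq> U"
proof -
  define \<U> where "\<U> = insert U {A. open A \<and> x \<notin> closure A}"
  have cover: "y \<in> \<Union>\<U>" for y
  proof (cases "y \<in> U")
    case False
    then have "x \<noteq> y" using U by auto
    then obtain A B where AB: "open A" "open B" "x \<in> A" "y \<in> B" "A \<inter> B = {}"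
      using hausdorff[OF \<open>x \<noteq> y\<close>] by auto
    then have "A \<inter> closure B = {}" by (simp add: open_Int_closure_eq_empty)
    then show ?thesis using AB by (auto simp: \<U>_def)
  qed (auto simp: \<U>_def)
  have "\<forall>A\<in>\<U>. openin euclidean A" using U by (auto simp: \<U>_def)
  moreover have "\<Union>\<U> = topspace euclidean" using cover by auto
  ultimately obtain \<V> where \<V>: "\<And>V. V \<in> \<V> \<Longrightarrow> open V \<and> (\<exists>A\<in>\<U>. V \<subseteq> A)" "\<Union>\<V> = UNIV"
    "locally_finite_in euclidean \<V>"
    using pc unfolding paracompact_space_def by (metis open_openin topspace_euclidean)
  define \<W> where "\<W> = {V \<in> \<V>. \<not> V \<subseteq> U}"
  have lf: "locally_finite_in euclidean \<W>"
    using \<V>(3) by (rule locally_finite_in_subset) (auto simp: \<W>_def)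
  have "closed (\<Union>(closure ` \<W>))"
    using closedin_Union_locally_finite_closure[OF lf] unfolding closed_closedin euclidean_closure_of .
  moreover have "x \<notin> closure V" if "V \<in> \<W>" for V
  proof -
    have V: "V \<in> \<V>" "\<not> V \<subseteq> U" using that by (auto simp: \<W>_def)
    obtain A where A: "A \<in> \<U>" "V \<subseteq> A" using \<V>(1)[OF V(1)] by blast
    then have "x \<notin> closure A" using V(2) by (auto simp: \<U>_def)
    then show ?thesis using closure_mono[OF A(2)] by blast
  qed
  moreover have "closure (- \<Union>(closure ` \<W>)) \<subseteq> - \<Union>\<W>"
  proof (rule closure_minimal)
    show "- \<Union>(closure ` \<W>) \<subseteq> - \<Union>\<W>" 
      by (auto intro: subsetD[OF closure_subset])
    have "open (\<Union>\<W>)" using \<V>(1) by (intro open_Union) (auto simp: \<W>_def)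
    then show "closed (- \<Union>\<W>)" by (rule closed_Compl)
  qed
  moreover have "- \<Union>\<W> \<subseteq> U" using \<V>(2) by (auto simp: \<W>_def)
  ultimately show ?thesis
    by (intro exI[of _ "- \<Union>(closure ` \<W>)"] conjI open_Compl) auto
qed

context C1_banach_manifold
begin

lemma chart_open: "c \<in> atlas \<Longrightarrow> open (fst c)" "c \<in> atlas \<Longrightarrow> open (snd c ` fst c)"
  using charts unfolding is_chart_def by auto

lemma chart_homeomorphism: "c \<in> atlas \<Longrightarrow> homeomorphism (fst c) (snd c ` fst c) (snd c) (chart_inv c)"
  using charts unfolding is_chart_def by auto

lemma chart_continuous: "c \<in> atlas \<Longrightarrow> continuous_on (fst c) (snd c)"
  by (rule homeomorphism_cont1[OF chart_homeomorphism])

lemma chart_inv_continuous: "c \<in> atlas \<Longrightarrow> continuous_on (snd c ` fst c) (chart_inv c)"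
  by (rule homeomorphism_cont2[OF chart_homeomorphism])

lemma chart_inv_chart: "c \<in> atlas \<Longrightarrow> x \<in> fst c \<Longrightarrow> chart_inv c (snd c x) = x"
  by (rule homeomorphism_apply1[OF chart_homeomorphism])

lemma chart_chart_inv: "v \<in> snd c ` fst c \<Longrightarrow> snd c (chart_inv c v) = v"
  by (rule f_inv_into_f)

lemma chart_inv_in: "v \<in> snd c ` fst c \<Longrightarrow> chart_inv c v \<in> fst c"
  by (rule inv_into_into)

lemma charts_atD: "c \<in> charts_at atlas x \<Longrightarrow> c \<in> atlas" "c \<in> charts_at atlas x \<Longrightarrow> x \<in> fst c"
  by (auto simp: charts_at_def)

lemma charts_at_nonempty: "\<exists>c. c \<in> charts_at atlas x"
proof -
  have "x \<in> (\<Union>c\<in>atlas. fst c)" using covers by simp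
  then show ?thesis unfolding charts_at_def by blast
qed

lemma eventually_chart_inv:
  assumes c: "c \<in> charts_at atlas x" and Q: "\<forall>\<^sub>F y in nhds x. Q y"
  shows "\<forall>\<^sub>F v in nhds (snd c x). v \<in> snd c ` fst c \<and> chart_inv c v \<in> fst c \<and> Q (chart_inv c v)"
proof -
  have x: "snd c x \<in> snd c ` fst c" and cA: "c \<in> atlas" using charts_atD[OF c] by auto
  have "isCont (chart_inv c) (snd c x)"
    using chart_inv_continuous[OF cA] chart_open[OF cA] x continuous_on_eq_continuous_at by blast
  then have "(chart_inv c \<longlongrightarrow> x) (nhds (snd c x))"
    using isCont_tendsto_nhds[of "snd c x" "chart_inv c"] chart_inv_chart[OF charts_atD[OF c]] by simp
  then have "\<forall>\<^sub>F v in nhds (snd c x). Q (chart_inv c v)"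
    using Q by (rule eventually_compose_filterlim[rotated])
  moreover have "\<forall>\<^sub>F v in nhds (snd c x). v \<in> snd c ` fst c"
    using chart_open(2)[OF cA] x by (rule eventually_nhds_in_open)
  ultimately show ?thesis by eventually_elim (auto intro: inv_into_into)
qed

lemma eventually_chart:
  assumes c: "c \<in> charts_at atlas x" and Q: "\<forall>\<^sub>F v in nhds (snd c x). Q v"
  shows "\<forall>\<^sub>F y in nhds x. y \<in> fst c \<and> Q (snd c y)"
proof -
  have x: "x \<in> fst c" and cA: "c \<in> atlas" using charts_atD[OF c] by auto
  have "isCont (snd c) x"
    using chart_continuous[OF cA] chart_open[OF cA] x continuous_on_eq_continuous_at by blast
  then have "(snd c \<longlongrightarrow> snd c x) (nhds x)" by (rule isCont_tendsto_nhds)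
  then have "\<forall>\<^sub>F y in nhds x. Q (snd c y)"
    using Q by (rule eventually_compose_filterlim[rotated])
  moreover have "\<forall>\<^sub>F y in nhds x. y \<in> fst c"
    using chart_open(1)[OF cA] x by (rule eventually_nhds_in_open)
  ultimately show ?thesis by eventually_elim auto
qed

definition transition_deriv :: "('m, 'x) chart \<Rightarrow> ('m, 'x) chart \<Rightarrow> 'm \<Rightarrow> 'x \<Rightarrow> 'x" where
  "transition_deriv c c' x = frechet_derivative (snd c' \<circ> chart_inv c) (at (snd c x))"

lemma transition_has_derivative:
  assumes "c \<in> charts_at atlas x" "c' \<in> charts_at atlas x"
  shows "((snd c' \<circ> chart_inv c) has_derivative transition_deriv c c' x) (at (snd c x))"
proof -
  have "C1_on (snd c ` (fst c \<inter> fst c')) (snd c' \<circ> chart_inv c)"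
    using compatible[of c c'] assms charts_atD unfolding C1_compatible_def by blast
  then show ?thesis unfolding transition_deriv_def
    by (rule C1_on_differentiable) (use assms charts_atD in auto)
qed

lemma transition_deriv_linear:
  assumes "c \<in> charts_at atlas x" "c' \<in> charts_at atlas x"
  shows "linear (transition_deriv c c' x)"
  using transition_has_derivative[OF assms] by (rule has_derivative_linear)

lemma transition_deriv_chain:
  assumes c: "c \<in> charts_at atlas x" and c': "c' \<in> charts_at atlas x" and c'': "c'' \<in> charts_at atlas x"
  shows "transition_deriv c c'' x v = transition_deriv c' c'' x (transition_deriv c c' x v)"
proof -
  have x: "chart_inv c (snd c x) = x" by (rule chart_inv_chart[OF charts_atD[OF c]])
  have "((snd c'' \<circ> chart_inv c') \<circ> (snd c' \<circ> chart_inv c) has_derivative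
      transition_deriv c' c'' x \<circ> transition_deriv c c' x) (at (snd c x))"
    by (rule diff_chain_at[OF transition_has_derivative[OF c c']])
      (use transition_has_derivative[OF c' c''] x in simp)
  moreover have "\<forall>\<^sub>F v in nhds (snd c x). ((snd c'' \<circ> chart_inv c') \<circ> (snd c' \<circ> chart_inv c)) v = (snd c'' \<circ> chart_inv c) v"
    using eventually_chart_inv[OF c eventually_nhds_in_open[OF chart_open(1)[OF charts_atD(1)[OF c']] charts_atD(2)[OF c']]]
    by eventually_elim (use charts_atD(1)[OF c'] chart_inv_chart in auto)
  ultimately have "((snd c'' \<circ> chart_inv c) has_derivative transition_deriv c' c'' x \<circ> transition_deriv c c' x) (at (snd c x))"
    by (rule has_derivative_cong_nhds)
  from has_derivative_unique[OF this transition_has_derivative[OF c c'']] show ?thesis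
    by (metis comp_apply)
qed

lemma transition_deriv_refl:
  assumes c: "c \<in> charts_at atlas x"
  shows "transition_deriv c c x v = v"
proof -
  have "((\<lambda>v. v) has_derivative (\<lambda>v. v)) (at (snd c x))" by simp
  moreover have "\<forall>\<^sub>F v in nhds (snd c x). v = (snd c \<circ> chart_inv c) v"
    using eventually_chart_inv[OF c eventually_True]
    by eventually_elim (simp add: chart_chart_inv)
  ultimately have "((snd c \<circ> chart_inv c) has_derivative (\<lambda>v. v)) (at (snd c x))"
    by (rule has_derivative_cong_nhds)
  from has_derivative_unique[OF this transition_has_derivative[OF c c]] show ?thesis by metis
qed

lemma tangent_of_apply:
  "c' \<in> charts_at atlas x \<Longrightarrow> tangent_of atlas c x v c' = transition_deriv c c' x v"
  by (simp add: tangent_of_def transition_deriv_def)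

lemma tangent_of_self: "c \<in> charts_at atlas x \<Longrightarrow> tangent_of atlas c x v c = v"
  by (simp add: tangent_of_apply transition_deriv_refl)

lemma tangent_of_in_tangent_space:
  assumes c: "c \<in> charts_at atlas x"
  shows "tangent_of atlas c x v \<in> tangent_space atlas x"
  unfolding tangent_space_def transition_deriv_def[symmetric]
proof (intro CollectI conjI allI impI ballI)
  fix c' c'' assume "c' \<in> charts_at atlas x" "c'' \<in> charts_at atlas x"
  then show "tangent_of atlas c x v c'' = transition_deriv c' c'' x (tangent_of atlas c x v c')"
    using transition_deriv_chain[OF c, of c' c'' v] by (simp only: tangent_of_apply)
qed (simp add: tangent_of_def)

lemma tangent_space_eq_tangent_of:
  assumes \<xi>: "\<xi> \<in> tangent_space atlas x" and c: "c \<in> charts_at atlas x"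
  shows "\<xi> = tangent_of atlas c x (\<xi> c)"
proof
  fix c'
  show "\<xi> c' = tangent_of atlas c x (\<xi> c) c'"
  proof (cases "c' \<in> charts_at atlas x")
    case True
    then have "\<xi> c' = frechet_derivative (snd c' \<circ> chart_inv c) (at (snd c x)) (\<xi> c)"
      using \<xi> c unfolding tangent_space_def by blast
    then show ?thesis by (simp only: tangent_of_def True if_True)
  next
    case False
    then have "\<xi> c' = 0" using \<xi> unfolding tangent_space_def by blast
    then show ?thesis by (simp only: tangent_of_def False if_False)
  qed
qed

lemma tangent_of_add:
  "c \<in> charts_at atlas x \<Longrightarrow>
     tangent_of atlas c x (v + w) = (\<lambda>c'. tangent_of atlas c x v c' + tangent_of atlas c x w c')"
proof
  fix c' assume c: "c \<in> charts_at atlas x"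
  show "tangent_of atlas c x (v + w) c' = tangent_of atlas c x v c' + tangent_of atlas c x w c'"
  proof (cases "c' \<in> charts_at atlas x")
    case True
    then show ?thesis by (simp add: tangent_of_apply linear_add[OF transition_deriv_linear[OF c True]])
  qed (simp add: tangent_of_def)
qed

lemma tangent_of_scaleR:
  "c \<in> charts_at atlas x \<Longrightarrow>
     tangent_of atlas c x (r *\<^sub>R v) = (\<lambda>c'. r *\<^sub>R tangent_of atlas c x v c')"
proof
  fix c' assume c: "c \<in> charts_at atlas x"
  show "tangent_of atlas c x (r *\<^sub>R v) c' = r *\<^sub>R tangent_of atlas c x v c'"
  proof (cases "c' \<in> charts_at atlas x")
    case True
    then show ?thesis by (simp add: tangent_of_apply linear_scale[OF transition_deriv_linear[OF c True]])
  qed (simp add: tangent_of_def)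
qed

end

context C1_finsler_manifold
begin

definition cnorm :: "('m, 'x) chart \<Rightarrow> 'm \<Rightarrow> 'x \<Rightarrow> real" where
  "cnorm c x v = nrm x (tangent_of atlas c x v)"

abbreviation d :: "'m \<Rightarrow> 'm \<Rightarrow> real" where "d \<equiv> finsler_dist atlas nrm"

context
  fixes c x assumes c: "c \<in> charts_at atlas x"
begin

lemma cnorm_nonneg: "0 \<le> cnorm c x v"
  unfolding cnorm_def by (rule nrm_nonneg[OF tangent_of_in_tangent_space[OF c]])

lemma cnorm_scaleR: "cnorm c x (r *\<^sub>R v) = \<bar>r\<bar> * cnorm c x v"
  unfolding cnorm_def tangent_of_scaleR[OF c] by (rule nrm_scale[OF tangent_of_in_tangent_space[OF c]])

lemma cnorm_minus: "cnorm c x (- v) = cnorm c x v"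
  using cnorm_scaleR[of "- 1" v] by simp

lemma cnorm_minus_commute: "cnorm c x (v - w) = cnorm c x (w - v)"
  using cnorm_minus[of "v - w"] by simp

lemma cnorm_0: "cnorm c x 0 = 0"
  using cnorm_scaleR[of 0 0] by simp

lemma cnorm_triangle: "cnorm c x (v + w) \<le> cnorm c x v + cnorm c x w"
  unfolding cnorm_def tangent_of_add[OF c]
  by (rule nrm_triangle[OF tangent_of_in_tangent_space[OF c] tangent_of_in_tangent_space[OF c]])

lemma cnorm_triangle3: "\<bar>cnorm c x v - cnorm c x w\<bar> \<le> cnorm c x (v - w)"
  using cnorm_triangle[of "v - w" w] cnorm_triangle[of "w - v" v] cnorm_minus_commute[of v w] by simp

lemma cnorm_equivalent:
  obtains a b where "0 < a" "0 < b" "\<And>v. a * norm v \<le> cnorm c x v" "\<And>v. cnorm c x v \<le> b * norm v"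
proof -
  obtain a where a: "0 < a" "\<exists>b>0. \<forall>v. a * norm v \<le> cnorm c x v \<and> cnorm c x v \<le> b * norm v"
    using nrm_equivalent[OF c] unfolding cnorm_def by auto
  then obtain b where "0 < b" "\<forall>v. a * norm v \<le> cnorm c x v \<and> cnorm c x v \<le> b * norm v" by auto
  with a(1) show ?thesis by (intro that[of a b]) auto
qed

lemma cnorm_eq_0: "cnorm c x v = 0 \<longleftrightarrow> v = 0"
proof
  assume v: "cnorm c x v = 0"
  obtain a b where ab: "0 < a" "0 < b" "\<And>v. a * norm v \<le> cnorm c x v" "\<And>v. cnorm c x v \<le> b * norm v"
    by (rule cnorm_equivalent) blast
  from ab(3)[of v] have "a * norm v \<le> 0" using v by simp
  then show "v = 0" using ab(1) by (simp add: mult_le_0_iff)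
qed (simp add: cnorm_0)

end

lemma cnorm_palais:
  assumes "c \<in> charts_at atlas x\<^sub>0" "0 < \<epsilon>"
  obtains W where "open W" "x\<^sub>0 \<in> W" "W \<subseteq> fst c"
    "\<And>x v. x \<in> W \<Longrightarrow> cnorm c x\<^sub>0 v \<le> (1 + \<epsilon>) * cnorm c x v"
    "\<And>x v. x \<in> W \<Longrightarrow> cnorm c x v \<le> (1 + \<epsilon>) * cnorm c x\<^sub>0 v"
proof -
  have "\<exists>W. open W \<and> x\<^sub>0 \<in> W \<and> W \<subseteq> fst c \<and>
    (\<forall>x\<in>W. \<forall>v. 1 / (1 + \<epsilon>) * cnorm c x\<^sub>0 v \<le> cnorm c x v \<and> cnorm c x v \<le> (1 + \<epsilon>) * cnorm c x\<^sub>0 v)"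
    using nrm_palais[OF assms] by (simp only: cnorm_def)
  then obtain W where W: "open W" "x\<^sub>0 \<in> W" "W \<subseteq> fst c"
    "\<forall>x\<in>W. \<forall>v. 1 / (1 + \<epsilon>) * cnorm c x\<^sub>0 v \<le> cnorm c x v \<and> cnorm c x v \<le> (1 + \<epsilon>) * cnorm c x\<^sub>0 v"
    by auto
  moreover have "cnorm c x\<^sub>0 v \<le> (1 + \<epsilon>) * cnorm c x v" if "x \<in> W" for x v
  proof -
    have "1 / (1 + \<epsilon>) * cnorm c x\<^sub>0 v \<le> cnorm c x v" using W(4) that by blast
    then show ?thesis using assms(2) by (simp add: field_simps)
  qed
  ultimately show ?thesis by (intro that[of W]) auto
qed

section \<open>The length of paths\<close>

definition speed :: "real \<Rightarrow> real \<Rightarrow> (real \<Rightarrow> 'm) \<Rightarrow> real \<Rightarrow> real" where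
  "speed s t \<gamma> \<tau> = nrm (\<gamma> \<tau>) (velocity atlas s t \<gamma> \<tau>)"

abbreviation len :: "real \<Rightarrow> real \<Rightarrow> (real \<Rightarrow> 'm) \<Rightarrow> real" where
  "len \<equiv> path_len atlas nrm"

lemma len_eq: "len s t \<gamma> = integral {s..t} (speed s t \<gamma>)"
  by (simp add: path_len_def speed_def[abs_def])

text \<open>By the chain rule a derivative in one chart determines the coordinates in all charts, so
  the speed can be computed in whichever chart is convenient.\<close>

lemma velocity_eq_tangent_of:
  assumes st: "s < t" and \<tau>: "\<tau> \<in> {s..t}" and c: "c \<in> charts_at atlas (\<gamma> \<tau>)"
    and cont: "continuous (at \<tau> within {s..t}) \<gamma>"
    and d: "((snd c \<circ> \<gamma>) has_vector_derivative w) (at \<tau> within {s..t})"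
  shows "velocity atlas s t \<gamma> \<tau> = tangent_of atlas c (\<gamma> \<tau>) w"
proof
  fix c'
  show "velocity atlas s t \<gamma> \<tau> c' = tangent_of atlas c (\<gamma> \<tau>) w c'"
  proof (cases "c' \<in> charts_at atlas (\<gamma> \<tau>)")
    case c': True
    let ?T = "transition_deriv c c' (\<gamma> \<tau>)"
    have "((snd c' \<circ> chart_inv c) \<circ> (snd c \<circ> \<gamma>) has_derivative ?T \<circ> (\<lambda>h. h *\<^sub>R w)) (at \<tau> within {s..t})"
    proof (rule diff_chain_within)
      show "(snd c \<circ> \<gamma> has_derivative (\<lambda>h. h *\<^sub>R w)) (at \<tau> within {s..t})"
        using d by (simp add: has_vector_derivative_def)
      show "(snd c' \<circ> chart_inv c has_derivative ?T) (at ((snd c \<circ> \<gamma>) \<tau>) within (snd c \<circ> \<gamma>) ` {s..t})"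
        using transition_has_derivative[OF c c'] by (simp add: has_derivative_at_withinI)
    qed
    moreover have "\<forall>\<^sub>F u in at \<tau> within {s..t}. ((snd c' \<circ> chart_inv c) \<circ> (snd c \<circ> \<gamma>)) u = (snd c' \<circ> \<gamma>) u"
    proof -
      have "\<forall>\<^sub>F u in at \<tau> within {s..t}. \<gamma> u \<in> fst c"
        using cont chart_open(1)[OF charts_atD(1)[OF c]] charts_atD(2)[OF c]
        by (auto simp: continuous_within intro: topological_tendstoD)
      then show ?thesis by eventually_elim (simp add: chart_inv_chart[OF charts_atD(1)[OF c]])
    qed
    ultimately have "((snd c' \<circ> \<gamma>) has_derivative ?T \<circ> (\<lambda>h. h *\<^sub>R w)) (at \<tau> within {s..t})"
      by (rule has_derivative_transform_eventually)
        (use \<tau> in \<open>auto simp: chart_inv_chart[OF charts_atD[OF c]]\<close>)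
    then have "((snd c' \<circ> \<gamma>) has_vector_derivative ?T w) (at \<tau> within {s..t})"
      unfolding has_vector_derivative_def
      by (rule has_derivative_eq_rhs) (simp add: fun_eq_iff linear_scale[OF transition_deriv_linear[OF c c']])
    then have "vector_derivative (snd c' \<circ> \<gamma>) (at \<tau> within {s..t}) = ?T w"
      using st \<tau> by (intro vector_derivative_within_cbox[of s t, unfolded cbox_interval]) auto
    then show ?thesis using c' by (simp add: velocity_def tangent_of_apply)
  qed (simp add: velocity_def tangent_of_def)
qed

lemma C1_path_derivative:
  assumes "C1_path_on atlas s t \<gamma>" "\<tau> \<in> {s..t}" "c \<in> charts_at atlas (\<gamma> \<tau>)"
  shows "\<exists>w. ((snd c \<circ> \<gamma>) has_vector_derivative w) (at \<tau> within {s..t})"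
proof -
  note c = charts_atD[OF assms(3)]
  obtain v where "\<forall>\<tau>\<in>{s..t}. \<gamma> \<tau> \<in> fst c \<longrightarrow> ((snd c \<circ> \<gamma>) has_vector_derivative v \<tau>) (at \<tau> within {s..t})"
    using assms(1) c(1) unfolding C1_path_on_def by blast
  then show ?thesis using assms(2) c(2) by auto
qed

lemma C1_path_continuous:
  "C1_path_on atlas s t \<gamma> \<Longrightarrow> \<tau> \<in> {s..t} \<Longrightarrow> continuous (at \<tau> within {s..t}) \<gamma>"
  unfolding C1_path_on_def by (simp add: continuous_on_eq_continuous_within)

lemma speed_eq_cnorm:
  assumes "C1_path_on atlas s t \<gamma>" "s < t" "\<tau> \<in> {s..t}" "c \<in> charts_at atlas (\<gamma> \<tau>)"
    "((snd c \<circ> \<gamma>) has_vector_derivative w) (at \<tau> within {s..t})"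
  shows "speed s t \<gamma> \<tau> = cnorm c (\<gamma> \<tau>) w"
  using velocity_eq_tangent_of[OF assms(2,3,4) C1_path_continuous[OF assms(1,3)] assms(5)]
  by (simp add: speed_def cnorm_def)

lemma speed_nonneg:
  assumes "C1_path_on atlas s t \<gamma>" "s < t" "\<tau> \<in> {s..t}"
  shows "0 \<le> speed s t \<gamma> \<tau>"
proof -
  obtain c where c: "c \<in> charts_at atlas (\<gamma> \<tau>)" using charts_at_nonempty by blast
  obtain w where w: "((snd c \<circ> \<gamma>) has_vector_derivative w) (at \<tau> within {s..t})"
    using C1_path_derivative[OF assms(1,3) c] by blast
  show ?thesis using speed_eq_cnorm[OF assms c w] cnorm_nonneg[OF c] by simp
qed

lemma speed_continuous:
  assumes C1: "C1_path_on atlas s t \<gamma>" and st: "s < t"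
  shows "continuous_on {s..t} (speed s t \<gamma>)"
  unfolding continuous_on_eq_continuous_within
proof
  fix \<tau> assume \<tau>: "\<tau> \<in> {s..t}"
  obtain c where c: "c \<in> charts_at atlas (\<gamma> \<tau>)" using charts_at_nonempty by blast
  note cA = charts_atD(1)[OF c]
  have \<gamma>c: "continuous_on {s..t} \<gamma>" using C1 unfolding C1_path_on_def by blast
  obtain v where v: "continuous_on {\<tau>\<in>{s..t}. \<gamma> \<tau> \<in> fst c} v"
    "\<And>\<tau>. \<tau> \<in> {s..t} \<Longrightarrow> \<gamma> \<tau> \<in> fst c \<Longrightarrow> ((snd c \<circ> \<gamma>) has_vector_derivative v \<tau>) (at \<tau> within {s..t})"
    using C1 cA unfolding C1_path_on_def by blast
  let ?S = "{\<tau>\<in>{s..t}. \<gamma> \<tau> \<in> fst c}"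
  obtain A where A: "open A" "A \<inter> {s..t} = \<gamma> -` fst c \<inter> {s..t}"
    using \<gamma>c chart_open(1)[OF cA] unfolding continuous_on_open_invariant by metis
  have "continuous_on ?S (\<lambda>\<tau>. (\<lambda>(x, v). nrm x (tangent_of atlas c x v)) (\<gamma> \<tau>, v \<tau>))"
  proof (rule continuous_on_compose2[OF nrm_continuous[OF cA]])
    show "continuous_on ?S (\<lambda>\<tau>. (\<gamma> \<tau>, v \<tau>))"
      by (intro continuous_on_Pair v continuous_on_subset[OF \<gamma>c]) auto
  qed auto
  moreover have "(\<lambda>(x, v). nrm x (tangent_of atlas c x v)) (\<gamma> \<tau>, v \<tau>) = speed s t \<gamma> \<tau>" if "\<tau> \<in> ?S" for \<tau>
    using speed_eq_cnorm[OF C1 st _ _ v(2)] that cA by (auto simp: charts_at_def cnorm_def)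
  ultimately have "continuous_on ?S (speed s t \<gamma>)"
    by (metis (no_types, lifting) continuous_on_cong)
  then have "continuous (at \<tau> within ?S) (speed s t \<gamma>)"
    using \<tau> charts_atD(2)[OF c] by (auto simp: continuous_on_eq_continuous_within)
  \<comment> \<open>The part of the parameter interval that is mapped into the chart domain is
    relatively open.\<close>
  moreover have "at \<tau> within ?S = at \<tau> within {s..t}"
  proof (rule at_within_nhd[OF _ A(1)])
    show "\<tau> \<in> A" using A(2) \<tau> charts_atD(2)[OF c] by blast
    show "?S \<inter> A - {\<tau>} = {s..t} \<inter> A - {\<tau>}" using A(2) by blast
  qed
  ultimately show "continuous (at \<tau> within {s..t}) (speed s t \<gamma>)" by simp
qed

lemma len_nonneg: "C1_path_on atlas s t \<gamma> \<Longrightarrow> s < t \<Longrightarrow> 0 \<le> len s t \<gamma>"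
  unfolding len_eq
  by (intro integral_nonneg integrable_continuous_real speed_continuous) (auto intro: speed_nonneg)

lemma velocity_cong:
  assumes "\<And>u. u \<in> {s..t} \<Longrightarrow> \<gamma> u = \<gamma>' u" "\<tau> \<in> {s..t}"
  shows "velocity atlas s t \<gamma> \<tau> = velocity atlas s t \<gamma>' \<tau>"
proof -
  have "((snd c \<circ> \<gamma>) has_vector_derivative w) (at \<tau> within {s..t}) \<longleftrightarrow>
        ((snd c \<circ> \<gamma>') has_vector_derivative w) (at \<tau> within {s..t})" for c :: "('m, 'x) chart" and w
    using assms by (intro has_vector_derivative_cong_ev) auto
  then have "vector_derivative (snd c \<circ> \<gamma>) (at \<tau> within {s..t}) =
      vector_derivative (snd c \<circ> \<gamma>') (at \<tau> within {s..t})" for c :: "('m, 'x) chart"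
    unfolding vector_derivative_def by simp
  then show ?thesis unfolding velocity_def using assms by (intro ext) simp
qed

lemma len_cong: "(\<And>u. u \<in> {s..t} \<Longrightarrow> \<gamma> u = \<gamma>' u) \<Longrightarrow> len s t \<gamma> = len s t \<gamma>'"
  unfolding len_eq speed_def by (intro integral_cong arg_cong2[of _ _ _ _ nrm] velocity_cong) auto

lemma C1_path_cong:
  assumes eq: "\<And>u. u \<in> {s..t} \<Longrightarrow> \<gamma> u = \<gamma>' u" and C1: "C1_path_on atlas s t \<gamma>"
  shows "C1_path_on atlas s t \<gamma>'"
proof -
  have 1: "{\<tau> \<in> {s..t}. \<gamma>' \<tau> \<in> fst c} = {\<tau> \<in> {s..t}. \<gamma> \<tau> \<in> fst c}" for c :: "('m, 'x) chart"
    using eq by auto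
  have 2: "((snd c \<circ> \<gamma>') has_vector_derivative w) (at \<tau> within {s..t}) \<longleftrightarrow>
        ((snd c \<circ> \<gamma>) has_vector_derivative w) (at \<tau> within {s..t})" if "\<tau> \<in> {s..t}" for c :: "('m, 'x) chart" and w \<tau>
    using eq that by (intro has_vector_derivative_cong_ev) auto
  have 3: "continuous_on {s..t} \<gamma>' \<longleftrightarrow> continuous_on {s..t} \<gamma>"
    using eq by (intro continuous_on_cong) auto
  show ?thesis using C1 eq unfolding C1_path_on_def 1 3 by (simp add: 2)
qed

lemma C1_path_subinterval:
  assumes C1: "C1_path_on atlas s t \<gamma>" and "s \<le> s'" "t' \<le> t"
  shows "C1_path_on atlas s' t' \<gamma>"
  unfolding C1_path_on_def
proof (intro conjI ballI)
  have sub: "{s'..t'} \<subseteq> {s..t}" using assms by auto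
  show "continuous_on {s'..t'} \<gamma>"
    using C1 sub unfolding C1_path_on_def by (blast intro: continuous_on_subset)
  fix c assume "c \<in> atlas"
  then obtain v where v: "continuous_on {\<tau>\<in>{s..t}. \<gamma> \<tau> \<in> fst c} v"
    "\<And>\<tau>. \<tau> \<in> {s..t} \<Longrightarrow> \<gamma> \<tau> \<in> fst c \<Longrightarrow> ((snd c \<circ> \<gamma>) has_vector_derivative v \<tau>) (at \<tau> within {s..t})"
    using C1 unfolding C1_path_on_def by blast
  have "continuous_on {\<tau>\<in>{s'..t'}. \<gamma> \<tau> \<in> fst c} v"
    using v(1) by (rule continuous_on_subset) (use sub in auto)
  moreover have "((snd c \<circ> \<gamma>) has_vector_derivative v \<tau>) (at \<tau> within {s'..t'})"
    if "\<tau> \<in> {s'..t'}" "\<gamma> \<tau> \<in> fst c" for \<tau>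
    using v(2)[of \<tau>] that sub has_vector_derivative_within_subset by blast
  ultimately show "\<exists>v. continuous_on {\<tau>\<in>{s'..t'}. \<gamma> \<tau> \<in> fst c} v \<and>
    (\<forall>\<tau>\<in>{s'..t'}. \<gamma> \<tau> \<in> fst c \<longrightarrow> ((snd c \<circ> \<gamma>) has_vector_derivative v \<tau>) (at \<tau> within {s'..t'}))"
    by (intro exI[of _ v] conjI) auto
qed

lemma speed_subinterval:
  assumes C1: "C1_path_on atlas s t \<gamma>" and "s \<le> s'" "s' < t'" "t' \<le> t" "\<tau> \<in> {s'..t'}"
  shows "speed s' t' \<gamma> \<tau> = speed s t \<gamma> \<tau>"
proof -
  obtain c where c: "c \<in> charts_at atlas (\<gamma> \<tau>)" using charts_at_nonempty by blast
  have \<tau>: "\<tau> \<in> {s..t}" and st: "s < t" using assms by auto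
  obtain w where w: "((snd c \<circ> \<gamma>) has_vector_derivative w) (at \<tau> within {s..t})"
    using C1_path_derivative[OF C1 \<tau> c] by blast
  have w': "((snd c \<circ> \<gamma>) has_vector_derivative w) (at \<tau> within {s'..t'})"
    using w by (rule has_vector_derivative_within_subset) (use assms in auto)
  show ?thesis
    using speed_eq_cnorm[OF C1 st \<tau> c w] speed_eq_cnorm[OF C1_path_subinterval[OF C1 assms(2,4)] assms(3,5) c w']
    by simp
qed

lemma len_split:
  assumes C1: "C1_path_on atlas s t \<gamma>" and "s < u" "u < t"
  shows "len s t \<gamma> = len s u \<gamma> + len u t \<gamma>"
proof -
  have "integral {s..u} (speed s t \<gamma>) + integral {u..t} (speed s t \<gamma>) = integral {s..t} (speed s t \<gamma>)"
    using assms by (intro Henstock_Kurzweil_Integration.integral_combine integrable_continuous_real speed_continuous) auto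
  moreover have "integral {s..u} (speed s t \<gamma>) = len s u \<gamma>" "integral {u..t} (speed s t \<gamma>) = len u t \<gamma>"
    unfolding len_eq using assms by (auto intro!: integral_cong speed_subinterval[OF C1, symmetric])
  ultimately show ?thesis by (simp add: len_eq)
qed

text \<open>Both translations (\<open>\<sigma> = 1\<close>) and reversals (\<open>\<sigma> = -1\<close>) of the parameter are needed.\<close>

lemma C1_path_reparametrize:
  assumes C1: "C1_path_on atlas s t \<gamma>" and st: "s < t" and st': "s' < t'" and \<sigma>: "\<bar>\<sigma>\<bar> = (1::real)"
    and m: "(\<lambda>\<tau>. \<sigma> * \<tau> + h) ` {s'..t'} = {s..t}"
  shows "C1_path_on atlas s' t' (\<lambda>\<tau>. \<gamma> (\<sigma> * \<tau> + h))" (is "C1_path_on _ _ _ ?\<gamma>")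
    and "len s' t' (\<lambda>\<tau>. \<gamma> (\<sigma> * \<tau> + h)) = len s t \<gamma>"
proof -
  define m where "m = (\<lambda>\<tau>. \<sigma> * \<tau> + h)"
  have m': "m \<tau> \<in> {s..t}" if "\<tau> \<in> {s'..t'}" for \<tau> using m that unfolding m_def by blast
  have mi: "m ` {s'..t'} = {s..t}" using m unfolding m_def .
  have mc: "continuous_on S m" for S unfolding m_def by (intro continuous_intros)
  have md: "(m has_vector_derivative \<sigma>) (at \<tau> within S)" for \<tau> S
    unfolding m_def by (auto intro!: derivative_eq_intros)
  have deriv: "((snd c \<circ> (\<lambda>\<tau>. \<gamma> (m \<tau>))) has_vector_derivative \<sigma> *\<^sub>R w) (at \<tau> within {s'..t'})"
    if "((snd c \<circ> \<gamma>) has_vector_derivative w) (at (m \<tau>) within {s..t})" for c :: "('m, 'x) chart" and w \<tau>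
    using vector_diff_chain_within[OF md, of "snd c \<circ> \<gamma>" w \<tau> "{s'..t'}"] that mi by (simp add: comp_def)
  have C1': "C1_path_on atlas s' t' (\<lambda>\<tau>. \<gamma> (m \<tau>))"
    unfolding C1_path_on_def
  proof (intro conjI ballI)
    show "continuous_on {s'..t'} (\<lambda>\<tau>. \<gamma> (m \<tau>))"
      by (rule continuous_on_compose2[OF _ mc]) (use C1 m' in \<open>auto simp: C1_path_on_def\<close>)
    fix c assume "c \<in> atlas"
    then obtain v where v: "continuous_on {\<tau>\<in>{s..t}. \<gamma> \<tau> \<in> fst c} v"
      "\<And>\<tau>. \<tau> \<in> {s..t} \<Longrightarrow> \<gamma> \<tau> \<in> fst c \<Longrightarrow> ((snd c \<circ> \<gamma>) has_vector_derivative v \<tau>) (at \<tau> within {s..t})"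
      using C1 unfolding C1_path_on_def by blast
    have "continuous_on {\<tau>\<in>{s'..t'}. \<gamma> (m \<tau>) \<in> fst c} (\<lambda>\<tau>. \<sigma> *\<^sub>R v (m \<tau>))"
      by (intro continuous_intros continuous_on_compose2[OF v(1) mc]) (use m' in auto)
    moreover have "((snd c \<circ> (\<lambda>\<tau>. \<gamma> (m \<tau>))) has_vector_derivative \<sigma> *\<^sub>R v (m \<tau>)) (at \<tau> within {s'..t'})"
      if "\<tau> \<in> {s'..t'}" "\<gamma> (m \<tau>) \<in> fst c" for \<tau>
      using that by (intro deriv v(2) m')
    ultimately show "\<exists>v. continuous_on {\<tau>\<in>{s'..t'}. \<gamma> (m \<tau>) \<in> fst c} v \<and>
       (\<forall>\<tau>\<in>{s'..t'}. \<gamma> (m \<tau>) \<in> fst c \<longrightarrow>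
          ((snd c \<circ> (\<lambda>\<tau>. \<gamma> (m \<tau>))) has_vector_derivative v \<tau>) (at \<tau> within {s'..t'}))"
      by (intro exI[of _ "\<lambda>\<tau>. \<sigma> *\<^sub>R v (m \<tau>)"] conjI) auto
  qed
  then show "C1_path_on atlas s' t' (\<lambda>\<tau>. \<gamma> (\<sigma> * \<tau> + h))" by (simp add: m_def)
  have sp: "speed s' t' (\<lambda>\<tau>. \<gamma> (m \<tau>)) \<tau> = speed s t \<gamma> (m \<tau>)" if \<tau>: "\<tau> \<in> {s'..t'}" for \<tau>
  proof -
    obtain c where c: "c \<in> charts_at atlas (\<gamma> (m \<tau>))" using charts_at_nonempty by blast
    obtain w where w: "((snd c \<circ> \<gamma>) has_vector_derivative w) (at (m \<tau>) within {s..t})"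
      using C1_path_derivative[OF C1 m'[OF \<tau>] c] by blast
    show ?thesis
      using speed_eq_cnorm[OF C1 st m'[OF \<tau>] c w] speed_eq_cnorm[OF C1' st' \<tau> c deriv[OF w]]
        cnorm_scaleR[OF c] \<sigma> by simp
  qed
  have \<sigma>0: "\<sigma> \<noteq> 0" using \<sigma> by auto
  have "(speed s t \<gamma> has_integral len s t \<gamma>) (cbox s t)"
    unfolding len_eq cbox_interval
    by (intro integrable_integral integrable_continuous_real speed_continuous C1 st)
  from has_integral_affinity[OF this \<sigma>0, of h]
  have "((\<lambda>\<tau>. speed s t \<gamma> (m \<tau>)) has_integral len s t \<gamma>) ((\<lambda>x. (1 / \<sigma>) *\<^sub>R x + - ((1 / \<sigma>) *\<^sub>R h)) ` cbox s t)"
    using \<sigma> by (simp add: m_def)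
  also have "(\<lambda>x. (1 / \<sigma>) *\<^sub>R x + - ((1 / \<sigma>) *\<^sub>R h)) ` cbox s t = {s'..t'}"
    unfolding cbox_interval mi[symmetric] m_def image_image using \<sigma>0 by (simp add: field_simps)
  finally have "((\<lambda>\<tau>. speed s t \<gamma> (m \<tau>)) has_integral len s t \<gamma>) {s'..t'}" .
  then have "(speed s' t' (\<lambda>\<tau>. \<gamma> (m \<tau>)) has_integral len s t \<gamma>) {s'..t'}"
    by (rule has_integral_eq[rotated]) (simp add: sp)
  then show "len s' t' (\<lambda>\<tau>. \<gamma> (\<sigma> * \<tau> + h)) = len s t \<gamma>"
    unfolding len_eq m_def by (rule integral_unique)
qed

end

text \<open>A mean value inequality for functions without derivative: it is applied to a truncated
  chart norm along a path, which is not differentiable. The bound is additive over adjacent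
  intervals and holds on short ones, so bisection extends it to the whole interval.\<close>

lemma growth_bound:
  fixes h g :: "real \<Rightarrow> real"
  assumes ab: "a \<le> b" and g: "continuous_on {a..b} g"
    and h: "\<And>\<tau> \<eta>. \<tau> \<in> {a..b} \<Longrightarrow> 0 < \<eta> \<Longrightarrow>
              \<forall>\<^sub>F t in at \<tau> within {a..b}. \<bar>h t - h \<tau>\<bar> \<le> (g \<tau> + \<eta>) * \<bar>t - \<tau>\<bar>"
  shows "\<bar>h b - h a\<bar> \<le> integral {a..b} g"
proof (rule field_le_epsilon)
  fix e :: real assume e: "0 < e"
  define \<eta> where "\<eta> = e / (b - a + 1)"
  have \<eta>: "0 < \<eta>" using e ab by (simp add: \<eta>_def)
  have gi: "g integrable_on {x..y}" if "a \<le> x" "y \<le> b" for x y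
    by (rule integrable_continuous_real[OF continuous_on_subset[OF g]]) (use that in auto)
  have "a \<le> a \<and> b \<le> b \<longrightarrow> \<bar>h b - h a\<bar> \<le> integral {a..b} g + \<eta> * (b - a)"
    using ab
  proof (induction rule: Bolzano[where P = "\<lambda>x y. a \<le> x \<and> y \<le> b \<longrightarrow> \<bar>h y - h x\<bar> \<le> integral {x..y} g + \<eta> * (y - x)"])
    case (trans x y z)
    show ?case
    proof
      assume *: "a \<le> x \<and> z \<le> b"
      then have "integral {x..y} g + integral {y..z} g = integral {x..z} g"
        using trans(3,4) by (intro Henstock_Kurzweil_Integration.integral_combine gi) auto
      moreover have "\<bar>h y - h x\<bar> \<le> integral {x..y} g + \<eta> * (y - x)" "\<bar>h z - h y\<bar> \<le> integral {y..z} g + \<eta> * (z - y)"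
        using trans * by auto
      ultimately show "\<bar>h z - h x\<bar> \<le> integral {x..z} g + \<eta> * (z - x)"
        by (simp add: algebra_simps)
    qed
  next
    case (local \<tau>)
    then have \<tau>: "\<tau> \<in> {a..b}" by auto
    obtain d1 where d1: "0 < d1" "\<And>t. t \<in> {a..b} \<Longrightarrow> \<bar>t - \<tau>\<bar> < d1 \<Longrightarrow> \<bar>h t - h \<tau>\<bar> \<le> (g \<tau> + \<eta> / 2) * \<bar>t - \<tau>\<bar>"
    proof -
      have "\<forall>\<^sub>F t in at \<tau> within {a..b}. \<bar>h t - h \<tau>\<bar> \<le> (g \<tau> + \<eta> / 2) * \<bar>t - \<tau>\<bar>"
        using h[OF \<tau>, of "\<eta> / 2"] \<eta> by simp
      then obtain d where "0 < d" "\<And>t. t \<in> {a..b} \<Longrightarrow> t \<noteq> \<tau> \<Longrightarrow> dist t \<tau> < d \<Longrightarrow> \<bar>h t - h \<tau>\<bar> \<le> (g \<tau> + \<eta> / 2) * \<bar>t - \<tau>\<bar>"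
        unfolding eventually_at by auto
      then show ?thesis by (intro that[of d]) (auto simp: dist_real_def, metis abs_zero diff_self mult_zero_right order_refl)
    qed
    obtain d2 where d2: "0 < d2" "\<And>t. t \<in> {a..b} \<Longrightarrow> \<bar>t - \<tau>\<bar> < d2 \<Longrightarrow> \<bar>g t - g \<tau>\<bar> < \<eta> / 2"
      using g \<tau> \<eta> unfolding continuous_on_iff dist_real_def by (meson half_gt_zero)
    show ?case
    proof (intro exI[of _ "min d1 d2"] conjI allI impI)
      show "0 < min d1 d2" using d1 d2 by simp
      fix x y assume *: "x \<le> \<tau> \<and> \<tau> \<le> y \<and> y - x < min d1 d2" "a \<le> x \<and> y \<le> b"
      have "\<bar>h x - h \<tau>\<bar> \<le> (g \<tau> + \<eta> / 2) * \<bar>x - \<tau>\<bar>" "\<bar>h y - h \<tau>\<bar> \<le> (g \<tau> + \<eta> / 2) * \<bar>y - \<tau>\<bar>"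
        by (rule d1(2); use * in auto)+
      then have "\<bar>h y - h x\<bar> \<le> (g \<tau> + \<eta> / 2) * (\<tau> - x) + (g \<tau> + \<eta> / 2) * (y - \<tau>)"
        using * by simp
      \<comment> \<open>The slope bound is rewritten with \<open>g \<tau> - \<eta> / 2\<close>,
        which lies below \<open>g\<close> on a short interval and so can be integrated; the
        difference is paid by the linear error.\<close>
      also have "\<dots> = (g \<tau> - \<eta> / 2) * (y - x) + \<eta> * (y - x)" by (simp add: field_simps)
      also have "(g \<tau> - \<eta> / 2) * (y - x) = integral {x..y} (\<lambda>_. g \<tau> - \<eta> / 2)"
        using * by simp
      also have "\<dots> \<le> integral {x..y} g"
      proof (rule Henstock_Kurzweil_Integration.integral_le)
        show "g integrable_on {x..y}" using * by (intro gi) auto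
        show "g \<tau> - \<eta> / 2 \<le> g t" if "t \<in> {x..y}" for t
        proof -
          have "\<bar>g t - g \<tau>\<bar> < \<eta> / 2" by (rule d2(2); use that * in auto)
          then show ?thesis by linarith
        qed
      qed auto
      finally show "\<bar>h y - h x\<bar> \<le> integral {x..y} g + \<eta> * (y - x)" by simp
    qed
  qed
  moreover have "\<eta> * (b - a) \<le> e"
    using ab e by (simp add: \<eta>_def divide_simps)
  ultimately show "\<bar>h b - h a\<bar> \<le> integral {a..b} g + e" by simp
qed

section \<open>Chains of C1 paths and the infimum of their lengths\<close>

context C1_finsler_manifold
begin


text \<open>A chain of C1 pieces with its total length, where every piece keeps its own parameter
  interval. Concatenation, reversal and induction along a path then require no gluing of
  parametrizations; \<open>finsler_dist_eq\<close> ties this back to the metric.\<close>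

inductive joined :: "'m \<Rightarrow> 'm \<Rightarrow> real \<Rightarrow> bool" where
  joined_refl: "joined x x 0"
| joined_step: "joined x (\<gamma> s) l \<Longrightarrow> s < t \<Longrightarrow> C1_path_on atlas s t \<gamma> \<Longrightarrow> joined x (\<gamma> t) (l + len s t \<gamma>)"

lemma joined_path: "s < t \<Longrightarrow> C1_path_on atlas s t \<gamma> \<Longrightarrow> joined (\<gamma> s) (\<gamma> t) (len s t \<gamma>)"
  using joined_step[OF joined_refl] by force

lemma joined_trans: "joined y z l' \<Longrightarrow> joined x y l \<Longrightarrow> joined x z (l + l')"
proof (induction rule: joined.induct)
  case (joined_step y \<gamma> s l' t)
  then show ?case using joined.joined_step[of x \<gamma> s "l + l'" t] by (simp add: add.assoc)
qed simp

lemma joined_sym: "joined x y l \<Longrightarrow> joined y x l"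
proof (induction rule: joined.induct)
  case (joined_step x \<gamma> s l t)
  have m: "(\<lambda>\<tau>. (- 1) * \<tau> + 0) ` {- t..- s} = {s..t}"
    by (auto simp: image_iff intro!: bexI[of _ "- _"])
  note r = C1_path_reparametrize[OF joined_step(3,2) _ _ m, simplified]
  have "joined (\<gamma> t) (\<gamma> s) (len s t \<gamma>)"
    using joined_path[of "- t" "- s" "\<lambda>\<tau>. \<gamma> (- \<tau>)"] r joined_step(2) by simp
  from joined_trans[OF joined_step(4) this] show ?case by (simp add: add.commute)
qed (rule joined_refl)

lemma joined_nonneg: "joined x y l \<Longrightarrow> 0 \<le> l"
  by (induction rule: joined.induct) (auto simp: len_nonneg)

lemma joined_piecewise:
  assumes ab: "a < b" and p: "p 0 = a" "p n = b" "\<And>i. i < n \<Longrightarrow> p i < p (Suc i) \<and> C1_path_on atlas (p i) (p (Suc i)) \<gamma>"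
  shows "joined (\<gamma> a) (\<gamma> b) (len a b \<gamma>)" and "len a b \<gamma> = (\<Sum>i<n. len (p i) (p (Suc i)) \<gamma>)"
proof -
  have mono: "p i \<le> p j" if "i \<le> j" "j \<le> n" for i j
    using that
  proof (induction j rule: dec_induct)
    case (step j)
    then show ?case using p(3)[of j] by simp
  qed simp
  have piece: "(speed a b \<gamma> has_integral len (p i) (p (Suc i)) \<gamma>) {p i..p (Suc i)}" if i: "i < n" for i
  proof -
    note pi = p(3)[OF i]
    have sub: "a \<le> p i" "p (Suc i) \<le> b" using mono[of 0 i] mono[of "Suc i" n] i p by auto
    have "(speed (p i) (p (Suc i)) \<gamma> has_integral len (p i) (p (Suc i)) \<gamma>) {p i..p (Suc i)}"
      unfolding len_eq using pi by (intro integrable_integral integrable_continuous_real speed_continuous) auto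
    then show ?thesis
    \<comment> \<open>At a break point the velocity relative to \<open>{a..b}\<close> and the
      one-sided velocity of the piece may differ; these points form a null set.\<close>
    proof (rule has_integral_spike_finite[rotated 2])
      show "finite {p i, p (Suc i)}" by simp
      fix \<tau> assume "\<tau> \<in> {p i..p (Suc i)} - {p i, p (Suc i)}"
      then have \<tau>: "p i < \<tau>" "\<tau> < p (Suc i)" by auto
      then have "at \<tau> within {a..b} = at \<tau> within {p i..p (Suc i)}"
        using sub by (simp add: at_within_Icc_at)
      then show "speed a b \<gamma> \<tau> = speed (p i) (p (Suc i)) \<gamma> \<tau>" by (simp add: speed_def velocity_def cong: if_cong)
    qed
  qed
  have *: "joined (\<gamma> a) (\<gamma> (p k)) (\<Sum>i<k. len (p i) (p (Suc i)) \<gamma>) \<and>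
      (speed a b \<gamma> has_integral (\<Sum>i<k. len (p i) (p (Suc i)) \<gamma>)) {a..p k}" if "k \<le> n" for k
    using that
  proof (induction k)
    case 0
    then show ?case using p(1) by (auto intro: joined_refl has_integral_null_real)
  next
    case (Suc k)
    then have k: "k < n" and IH: "joined (\<gamma> a) (\<gamma> (p k)) (\<Sum>i<k. len (p i) (p (Suc i)) \<gamma>)"
      "(speed a b \<gamma> has_integral (\<Sum>i<k. len (p i) (p (Suc i)) \<gamma>)) {a..p k}" by auto
    have "(speed a b \<gamma> has_integral ((\<Sum>i<k. len (p i) (p (Suc i)) \<gamma>) + len (p k) (p (Suc k)) \<gamma>)) {a..p (Suc k)}"
      using mono[of 0 k] k p(1) p(3)[OF k] by (intro has_integral_combine[OF _ _ IH(2) piece]) auto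
    then show ?case using joined_step[of "\<gamma> a" \<gamma> "p k", OF IH(1)] p(3)[OF k] by simp
  qed
  from *[of n] show eq: "len a b \<gamma> = (\<Sum>i<n. len (p i) (p (Suc i)) \<gamma>)"
    unfolding len_eq[of a b] by (auto simp: p(2) intro: integral_unique)
  from *[of n] show "joined (\<gamma> a) (\<gamma> b) (len a b \<gamma>)" unfolding eq by (simp add: p(2))
qed

lemma C1_path_const: "C1_path_on atlas s t (\<lambda>_. x)"
  unfolding C1_path_on_def by (auto simp: comp_def intro!: exI[of _ "\<lambda>_. 0"] derivative_eq_intros)

lemma len_const: "s < t \<Longrightarrow> len s t (\<lambda>_. x) = 0"
proof -
  assume st: "s < t"
  have "speed s t (\<lambda>_. x) \<tau> = 0" if "\<tau> \<in> {s..t}" for \<tau>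
  proof -
    obtain c where c: "c \<in> charts_at atlas x" using charts_at_nonempty by blast
    have "((snd c \<circ> (\<lambda>_. x)) has_vector_derivative 0) (at \<tau> within {s..t})"
      by (simp add: comp_def)
    from speed_eq_cnorm[OF C1_path_const st that c this] show ?thesis by (simp add: cnorm_0[OF c])
  qed
  then have "integral {s..t} (speed s t (\<lambda>_. x)) = integral {s..t} (\<lambda>_. 0)" by (rule integral_cong)
  then show ?thesis by (simp add: len_eq)
qed

lemma joined_imp_piecewise:
  "joined x y l \<Longrightarrow> \<exists>a b \<gamma>. a < b \<and> piecewise_C1_path atlas a b \<gamma> \<and> \<gamma> a = x \<and> \<gamma> b = y \<and> len a b \<gamma> = l"
proof (induction rule: joined.induct)
  case (joined_refl x)
  \<comment> \<open>Paths in the definition of the metric live on intervals with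
    \<open>a < b\<close>, so the empty chain becomes a constant path of one piece, with break points
    \<open>0\<close> and \<open>1\<close> given by \<open>real\<close>.\<close>
  have "piecewise_C1_path atlas 0 1 (\<lambda>_. x)"
    unfolding piecewise_C1_path_def by (intro exI[of _ 1] exI[of _ real]) (simp add: C1_path_const)
  then show ?case by (intro exI[of _ 0] exI[of _ 1] exI[of _ "\<lambda>_. x"]) (simp add: len_const)
next
  case (joined_step x \<gamma>\<^sub>1 s l t)
  then obtain a b \<gamma> where \<gamma>: "a < b" "piecewise_C1_path atlas a b \<gamma>" "\<gamma> a = x" "\<gamma> b = \<gamma>\<^sub>1 s" "len a b \<gamma> = l"
    by blast
  then obtain n p where p: "p 0 = a" "p n = b" "\<And>i. i < n \<Longrightarrow> p i < p (Suc i) \<and> C1_path_on atlas (p i) (p (Suc i)) \<gamma>"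
    unfolding piecewise_C1_path_def by blast
  define b' where "b' = b + (t - s)"
  define \<gamma>' where "\<gamma>' \<tau> = (if \<tau> \<le> b then \<gamma> \<tau> else \<gamma>\<^sub>1 (1 * \<tau> + (s - b)))" for \<tau>
  define p' where "p' i = (if i \<le> n then p i else b')" for i
  have mono: "p i \<le> p j" if "i \<le> j" "j \<le> n" for i j
    using that
  proof (induction j rule: dec_induct)
    case (step j)
    then show ?case using p(3)[of j] by simp
  qed simp
  have m: "(\<lambda>\<tau>. 1 * \<tau> + (s - b)) ` {b..b'} = {s..t}"
    by (auto simp: image_iff b'_def intro!: bexI[of _ "_ + (b - s)"])
  have bb': "b < b'" using joined_step by (simp add: b'_def)
  note r = C1_path_reparametrize[OF joined_step(3,2) bb' _ m]
  have eq1: "\<gamma> \<tau> = \<gamma>' \<tau>" if "\<tau> \<in> {p i..p (Suc i)}" "i < n" for \<tau> i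
    using that mono[of "Suc i" n] p(2) by (simp add: \<gamma>'_def)
  have eq2: "\<gamma>\<^sub>1 (1 * \<tau> + (s - b)) = \<gamma>' \<tau>" if "\<tau> \<in> {b..b'}" for \<tau>
    using that \<gamma>(4) by (auto simp: \<gamma>'_def)
  have pieces: "p' i < p' (Suc i) \<and> C1_path_on atlas (p' i) (p' (Suc i)) \<gamma>'" if "i < Suc n" for i
  proof (cases "i < n")
    case True
    then show ?thesis using p(3)[OF True] C1_path_cong[OF eq1[OF _ True]] by (simp add: p'_def)
  next
    case False
    then have "i = n" using that by simp
    then show ?thesis using bb' C1_path_cong[OF eq2 r(1)] p(2) by (simp add: p'_def)
  qed
  have p'0: "p' 0 = a" "p' (Suc n) = b'" using p(1) by (auto simp: p'_def)
  have ab': "a < b'" using \<gamma>(1) bb' by simp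
  have "len a b' \<gamma>' = (\<Sum>i<Suc n. len (p' i) (p' (Suc i)) \<gamma>')"
    by (rule joined_piecewise(2)[OF ab' p'0 pieces])
  also have "\<dots> = (\<Sum>i<n. len (p i) (p (Suc i)) \<gamma>) + len b b' \<gamma>'"
    using len_cong[OF eq1] p(2) by (simp add: p'_def)
  also have "(\<Sum>i<n. len (p i) (p (Suc i)) \<gamma>) = l"
    using joined_piecewise(2)[OF \<gamma>(1) p] \<gamma>(5) by simp
  also have "len b b' \<gamma>' = len s t \<gamma>\<^sub>1" using len_cong[OF eq2] r(2) by simp
  finally have "len a b' \<gamma>' = l + len s t \<gamma>\<^sub>1" .
  moreover have "piecewise_C1_path atlas a b' \<gamma>'"
    unfolding piecewise_C1_path_def using p'0 pieces by blast
  moreover have "\<gamma>' a = x" "\<gamma>' b' = \<gamma>\<^sub>1 t"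
    using \<gamma>(1,3) bb' by (auto simp: \<gamma>'_def b'_def)
  ultimately show ?case using ab' by blast
qed

lemma finsler_dist_eq: "d x y = Inf {l. joined x y l}"
proof -
  have "{len a b \<gamma> | a b \<gamma>. a < b \<and> piecewise_C1_path atlas a b \<gamma> \<and> \<gamma> a = x \<and> \<gamma> b = y} = {l. joined x y l}"
    (is "?A = ?B")
  proof
    show "?A \<subseteq> ?B" unfolding piecewise_C1_path_def using joined_piecewise(1) by blast
    show "?B \<subseteq> ?A" using joined_imp_piecewise by fastforce
  qed
  then show ?thesis by (simp add: finsler_dist_def)
qed


text \<open>The path that is straight in the chart has constant coordinate velocity
  \<open>snd c y - snd c x\<close>, so its speed is the norm of one fixed vector, measured at moving
  points.\<close>

lemma joined_segment:
  assumes c: "c \<in> atlas" and x: "x \<in> fst c" and y: "y \<in> fst c"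
    and seg: "\<And>\<tau>. \<tau> \<in> {0..1} \<Longrightarrow> snd c x + \<tau> *\<^sub>R (snd c y - snd c x) \<in> snd c ` fst c"
    and k: "\<And>\<tau>. \<tau> \<in> {0..1} \<Longrightarrow> cnorm c (chart_inv c (snd c x + \<tau> *\<^sub>R (snd c y - snd c x))) (snd c y - snd c x) \<le> k"
  shows "\<exists>l\<le>k. joined x y l"
proof -
  define w where "w = snd c y - snd c x"
  define ln where "ln \<tau> = snd c x + \<tau> *\<^sub>R w" for \<tau> :: real
  define \<gamma> where "\<gamma> \<tau> = chart_inv c (ln \<tau>)" for \<tau>
  have lnc: "continuous_on S ln" for S unfolding ln_def by (intro continuous_intros)
  have lnd: "(ln has_derivative (\<lambda>h. h *\<^sub>R w)) (at \<tau> within S)" for \<tau> S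
    unfolding ln_def by (auto intro!: derivative_eq_intros)
  have lnU: "ln \<tau> \<in> snd c ` fst c" if "\<tau> \<in> {0..1}" for \<tau> using seg[OF that] by (simp add: ln_def w_def)
  have \<gamma>U: "\<gamma> \<tau> \<in> fst c" if "\<tau> \<in> {0..1}" for \<tau> unfolding \<gamma>_def by (rule chart_inv_in[OF lnU[OF that]])
  have c\<gamma>: "snd c (\<gamma> \<tau>) = ln \<tau>" if "\<tau> \<in> {0..1}" for \<tau> unfolding \<gamma>_def by (rule chart_chart_inv[OF lnU[OF that]])
  have deriv: "((snd c' \<circ> \<gamma>) has_vector_derivative f' w) (at \<tau> within {0..1})"
    if "((snd c' \<circ> chart_inv c) has_derivative f') (at (ln \<tau>))" for c' :: "('m, 'x) chart" and f' \<tau>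
  proof -
    have "((snd c' \<circ> chart_inv c) \<circ> ln has_derivative f' \<circ> (\<lambda>h. h *\<^sub>R w)) (at \<tau> within {0..1})"
      by (rule diff_chain_within[OF lnd]) (use that in \<open>rule has_derivative_at_withinI\<close>)
    then show ?thesis unfolding has_vector_derivative_def
      using linear_scale[OF has_derivative_linear[OF that]] by (simp add: comp_def \<gamma>_def[abs_def])
  qed
  have C1: "C1_path_on atlas 0 1 \<gamma>"
    unfolding C1_path_on_def
  proof (intro conjI ballI)
    show "continuous_on {0..1} \<gamma>"
      unfolding \<gamma>_def by (rule continuous_on_compose2[OF chart_inv_continuous[OF c] lnc]) (use lnU in auto)
    fix c' assume c': "c' \<in> atlas"
    obtain f' where f': "\<And>v. v \<in> snd c ` (fst c \<inter> fst c') \<Longrightarrow> (snd c' \<circ> chart_inv c has_derivative blinfun_apply (f' v)) (at v)"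
      "continuous_on (snd c ` (fst c \<inter> fst c')) f'"
      using compatible[OF c c'] unfolding C1_compatible_def C1_on_def by blast
    have ln': "ln \<tau> \<in> snd c ` (fst c \<inter> fst c')" if "\<tau> \<in> {0..1}" "\<gamma> \<tau> \<in> fst c'" for \<tau>
      using that c\<gamma>[OF that(1)] \<gamma>U[OF that(1)] by (metis IntI image_eqI)
    have "continuous_on {\<tau> \<in> {0..1}. \<gamma> \<tau> \<in> fst c'} (\<lambda>\<tau>. f' (ln \<tau>) w)"
      by (intro blinfun.continuous_on continuous_on_compose2[OF f'(2) lnc] continuous_on_const) (use ln' in auto)
    moreover have "((snd c' \<circ> \<gamma>) has_vector_derivative f' (ln \<tau>) w) (at \<tau> within {0..1})"
      if "\<tau> \<in> {0..1}" "\<gamma> \<tau> \<in> fst c'" for \<tau>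
      by (rule deriv[OF f'(1)[OF ln'[OF that]]])
    ultimately show "\<exists>v. continuous_on {\<tau> \<in> {0..1}. \<gamma> \<tau> \<in> fst c'} v \<and>
      (\<forall>\<tau>\<in>{0..1}. \<gamma> \<tau> \<in> fst c' \<longrightarrow> (snd c' \<circ> \<gamma> has_vector_derivative v \<tau>) (at \<tau> within {0..1}))"
      by (intro exI[of _ "\<lambda>\<tau>. f' (ln \<tau>) w"] conjI) auto
  qed
  have sp: "speed 0 1 \<gamma> \<tau> \<le> k" if \<tau>: "\<tau> \<in> {0..1}" for \<tau>
  proof -
    have cx: "c \<in> charts_at atlas (\<gamma> \<tau>)" using c \<gamma>U[OF \<tau>] by (simp add: charts_at_def)
    have "((snd c \<circ> chart_inv c) has_derivative transition_deriv c c (\<gamma> \<tau>)) (at (ln \<tau>))"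
      using transition_has_derivative[OF cx cx] c\<gamma>[OF \<tau>] by simp
    from deriv[OF this] have "((snd c \<circ> \<gamma>) has_vector_derivative w) (at \<tau> within {0..1})"
      by (simp add: transition_deriv_refl[OF cx])
    from speed_eq_cnorm[OF C1 _ \<tau> cx this] k[OF \<tau>] show ?thesis
      by (simp add: \<gamma>_def ln_def w_def)
  qed
  have "len 0 1 \<gamma> \<le> integral {0..1} (\<lambda>_::real. k)"
    unfolding len_eq 
    by (rule Henstock_Kurzweil_Integration.integral_le)
      (auto intro!: integrable_continuous_real speed_continuous C1 sp)
  moreover have "joined (\<gamma> 0) (\<gamma> 1) (len 0 1 \<gamma>)" using C1 by (intro joined_path) auto
  moreover have "\<gamma> 0 = x" "\<gamma> 1 = y"
    using chart_inv_chart[OF c] x y by (auto simp: \<gamma>_def ln_def w_def)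
  ultimately show ?thesis by auto
qed

end

context C1_finsler_manifold
begin

section \<open>The Finsler metric\<close>

lemma cnorm_ball_chart:
  assumes c: "c \<in> charts_at atlas x\<^sub>0" and V: "open V" "x\<^sub>0 \<in> V"
  shows "\<exists>s>0. \<forall>v. cnorm c x\<^sub>0 (v - snd c x\<^sub>0) < s \<longrightarrow> v \<in> snd c ` fst c \<and> chart_inv c v \<in> V"
proof -
  obtain a b where ab: "0 < a" "\<And>v. a * norm v \<le> cnorm c x\<^sub>0 v" by (rule cnorm_equivalent[OF c]) blast
  have "\<forall>\<^sub>F v in nhds (snd c x\<^sub>0). v \<in> snd c ` fst c \<and> chart_inv c v \<in> fst c \<and> chart_inv c v \<in> V"
    by (rule eventually_chart_inv[OF c eventually_nhds_in_open[OF V]])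
  then obtain r where r: "0 < r" "\<And>v. dist v (snd c x\<^sub>0) < r \<Longrightarrow> v \<in> snd c ` fst c \<and> chart_inv c v \<in> V"
    unfolding eventually_nhds_metric by blast
  have "v \<in> snd c ` fst c \<and> chart_inv c v \<in> V" if "cnorm c x\<^sub>0 (v - snd c x\<^sub>0) < a * r" for v
  proof (rule r(2))
    have "a * norm (v - snd c x\<^sub>0) < a * r" using ab(2)[of "v - snd c x\<^sub>0"] that by linarith
    then show "dist v (snd c x\<^sub>0) < r" using ab(1) by (simp add: dist_norm)
  qed
  then show ?thesis using ab(1) r(1) by (intro exI[of _ "a * r"]) auto
qed

lemma cnorm_segment:
  assumes c: "c \<in> charts_at atlas x\<^sub>0" and v: "cnorm c x\<^sub>0 (v - z) < s" and w: "cnorm c x\<^sub>0 (w - z) < s"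
    and \<tau>: "\<tau> \<in> {0..1}"
  shows "cnorm c x\<^sub>0 (v + \<tau> *\<^sub>R (w - v) - z) < s"
proof -
  have "v + \<tau> *\<^sub>R (w - v) - z = (1 - \<tau>) *\<^sub>R (v - z) + \<tau> *\<^sub>R (w - z)" by (simp add: algebra_simps)
  then have "cnorm c x\<^sub>0 (v + \<tau> *\<^sub>R (w - v) - z) \<le> (1 - \<tau>) * cnorm c x\<^sub>0 (v - z) + \<tau> * cnorm c x\<^sub>0 (w - z)"
    using cnorm_triangle[OF c, of "(1 - \<tau>) *\<^sub>R (v - z)" "\<tau> *\<^sub>R (w - z)"] \<tau> by (simp add: cnorm_scaleR[OF c])
  also have "\<dots> \<le> (1 - \<tau>) * max (cnorm c x\<^sub>0 (v - z)) (cnorm c x\<^sub>0 (w - z)) + \<tau> * max (cnorm c x\<^sub>0 (v - z)) (cnorm c x\<^sub>0 (w - z))"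
    using \<tau> by (intro add_mono mult_left_mono) auto
  also have "\<dots> = max (cnorm c x\<^sub>0 (v - z)) (cnorm c x\<^sub>0 (w - z))" by (simp add: algebra_simps)
  also have "\<dots> < s" using v w by simp
  finally show ?thesis .
qed

lemma joined_locally:
  assumes c: "c \<in> charts_at atlas x\<^sub>0" and \<epsilon>: "0 < \<epsilon>"
    and pal: "\<And>x v. x \<in> W \<Longrightarrow> cnorm c x v \<le> (1 + \<epsilon>) * cnorm c x\<^sub>0 v"
    and s: "\<And>v. cnorm c x\<^sub>0 (v - snd c x\<^sub>0) < s \<Longrightarrow> v \<in> snd c ` fst c \<and> chart_inv c v \<in> W"
    and x: "x \<in> fst c" "cnorm c x\<^sub>0 (snd c x - snd c x\<^sub>0) < s"
    and y: "y \<in> fst c" "cnorm c x\<^sub>0 (snd c y - snd c x\<^sub>0) < s"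
  shows "\<exists>l\<le>(1 + \<epsilon>) * cnorm c x\<^sub>0 (snd c x - snd c y). joined x y l"
proof (rule joined_segment[OF charts_atD(1)[OF c] x(1) y(1)])
  fix \<tau> :: real assume \<tau>: "\<tau> \<in> {0..1}"
  note * = s[OF cnorm_segment[OF c x(2) y(2) \<tau>]]
  then show "snd c x + \<tau> *\<^sub>R (snd c y - snd c x) \<in> snd c ` fst c" by blast
  show "cnorm c (chart_inv c (snd c x + \<tau> *\<^sub>R (snd c y - snd c x))) (snd c y - snd c x)
      \<le> (1 + \<epsilon>) * cnorm c x\<^sub>0 (snd c x - snd c y)"
    using pal[of _ "snd c y - snd c x"] * cnorm_minus_commute[OF c, of "snd c x"] by metis
qed

lemma eventually_cnorm_less:
  assumes c: "c \<in> charts_at atlas x\<^sub>0" and s: "0 < s"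
  shows "\<forall>\<^sub>F y in nhds x\<^sub>0. y \<in> fst c \<and> cnorm c x\<^sub>0 (snd c y - snd c x\<^sub>0) < s"
proof (rule eventually_chart[OF c])
  obtain a b where ab: "0 < b" "\<And>v. cnorm c x\<^sub>0 v \<le> b * norm v" by (rule cnorm_equivalent[OF c]) blast
  show "\<forall>\<^sub>F v in nhds (snd c x\<^sub>0). cnorm c x\<^sub>0 (v - snd c x\<^sub>0) < s"
    unfolding eventually_nhds_metric
  proof (intro exI[of _ "s / b"] conjI allI impI)
    show "0 < s / b" using s ab by simp
    fix v assume "dist v (snd c x\<^sub>0) < s / b"
    then have "b * norm (v - snd c x\<^sub>0) < s" using ab(1) by (simp add: dist_norm field_simps)
    then show "cnorm c x\<^sub>0 (v - snd c x\<^sub>0) < s" using ab(2)[of "v - snd c x\<^sub>0"] by linarith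
  qed
qed

lemma eventually_joined: "\<forall>\<^sub>F y in nhds x. \<exists>l. joined x y l"
proof -
  obtain c where c: "c \<in> charts_at atlas x" using charts_at_nonempty by blast
  obtain W where W: "open W" "x \<in> W" "\<And>y v. y \<in> W \<Longrightarrow> cnorm c y v \<le> (1 + 1) * cnorm c x v"
    by (rule cnorm_palais[OF c, of 1]) auto
  obtain s where s: "0 < s" "\<And>v. cnorm c x (v - snd c x) < s \<Longrightarrow> v \<in> snd c ` fst c \<and> chart_inv c v \<in> W"
    using cnorm_ball_chart[OF c W(1,2)] by blast
  have x: "cnorm c x (snd c x - snd c x) < s" using s(1) cnorm_0[OF c] by simp
  from eventually_cnorm_less[OF c s(1)] show ?thesis
  proof eventually_elim
    case (elim y)
    then show ?case
      using joined_locally[OF c zero_less_one W(3) s(2) charts_atD(2)[OF c] x, of y] by blast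
  qed
qed

text \<open>Being joined is an equivalence relation with open classes, and a connected space has
  room for only one such class.\<close>

lemma joined_exists: "\<exists>l. joined x y l"
proof -
  define A where "A = {y. \<exists>l. joined x y l}"
  have "open A"
    unfolding open_subopen[of A]
  proof
    fix y assume y: "y \<in> A"
    obtain T where T: "open T" "y \<in> T" "\<And>z. z \<in> T \<Longrightarrow> \<exists>l. joined y z l"
      using eventually_joined[of y] unfolding eventually_nhds by blast
    have "T \<subseteq> A" using T(3) y joined_trans unfolding A_def by blast
    then show "\<exists>T. open T \<and> y \<in> T \<and> T \<subseteq> A" using T by blast
  qed
  moreover have "open (- A)"
    unfolding open_subopen[of "- A"]
  proof
    fix y assume y: "y \<in> - A"
    obtain T where T: "open T" "y \<in> T" "\<And>z. z \<in> T \<Longrightarrow> \<exists>l. joined y z l"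
      using eventually_joined[of y] unfolding eventually_nhds by blast
    have "T \<subseteq> - A"
    proof
      fix z assume "z \<in> T"
      then obtain l where "joined z y l" using T(3) joined_sym by blast
      then show "z \<in> - A" using y joined_trans unfolding A_def by blast
    qed
    then show "\<exists>T. open T \<and> y \<in> T \<and> T \<subseteq> - A" using T by blast
  qed
  ultimately have "A \<inter> UNIV = {} \<or> - A \<inter> UNIV = {}"
    by (intro connectedD[OF connected]) auto
  moreover have "x \<in> A" using joined_refl unfolding A_def by blast
  ultimately show ?thesis unfolding A_def by auto
qed

lemma bdd_below_joined: "bdd_below {l. joined x y l}"
  by (rule bdd_belowI[of _ 0]) (auto intro: joined_nonneg)

lemma d_le: "joined x y l \<Longrightarrow> d x y \<le> l"
  unfolding finsler_dist_eq by (rule cInf_lower[OF _ bdd_below_joined]) simp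

lemma d_less_joined: "d x y < e \<Longrightarrow> \<exists>l<e. joined x y l"
  using joined_exists[of x y] unfolding finsler_dist_eq
  by (subst (asm) cInf_less_iff[OF _ bdd_below_joined]) auto

lemma d_greatest: "(\<And>l. joined x y l \<Longrightarrow> k \<le> l) \<Longrightarrow> k \<le> d x y"
  unfolding finsler_dist_eq using joined_exists[of x y] by (intro cInf_greatest) auto

lemma d_nonneg: "0 \<le> d x y"
  by (rule d_greatest) (rule joined_nonneg)

lemma d_refl: "d x x = 0"
  using d_le[OF joined_refl[of x]] d_nonneg[of x x] by simp

lemma d_sym: "d x y = d y x"
  by (intro antisym d_greatest) (erule d_le[OF joined_sym])+

lemma d_triangle: "d x z \<le> d x y + d y z"
proof (rule field_le_epsilon)
  fix e :: real assume "0 < e"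
  then obtain l l' where "l < d x y + e / 2" "joined x y l" "l' < d y z + e / 2" "joined y z l'"
    using d_less_joined[of x y "d x y + e / 2"] d_less_joined[of y z "d y z + e / 2"] by auto
  with d_le[OF joined_trans] show "d x z \<le> d x y + d y z + e" by fastforce
qed

lemma d_abs_triangle: "\<bar>d x z - d y z\<bar> \<le> d x y"
  using d_triangle[of x z y] d_triangle[of y z x] d_sym[of x y] by simp

text \<open>
  Truncating the chart norm at \<open>2 s\<close> extends it continuously by a constant to the whole manifold,
  which bounds the length of paths that leave the chart domain.
\<close>

lemma local_structure:
  assumes c: "c \<in> charts_at atlas x\<^sub>0" and \<epsilon>: "0 < \<epsilon>" and V: "open V" "x\<^sub>0 \<in> V"
  shows "\<exists>s>0. (\<forall>v. cnorm c x\<^sub>0 (v - snd c x\<^sub>0) < s \<longrightarrow> v \<in> snd c ` fst c \<and> chart_inv c v \<in> V) \<and>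
    (\<forall>y. d x\<^sub>0 y < s / (1 + \<epsilon>) \<longrightarrow> y \<in> fst c \<and> cnorm c x\<^sub>0 (snd c y - snd c x\<^sub>0) < s) \<and>
    (\<forall>x y. x \<in> fst c \<and> cnorm c x\<^sub>0 (snd c x - snd c x\<^sub>0) < s \<and> y \<in> fst c \<and> cnorm c x\<^sub>0 (snd c y - snd c x\<^sub>0) < s \<longrightarrow>
       cnorm c x\<^sub>0 (snd c x - snd c y) \<le> (1 + \<epsilon>) * d x y \<and> d x y \<le> (1 + \<epsilon>) * cnorm c x\<^sub>0 (snd c x - snd c y))"
proof -
  note cA = charts_atD(1)[OF c]
  obtain W where W: "open W" "x\<^sub>0 \<in> W" "W \<subseteq> fst c"
    "\<And>x v. x \<in> W \<Longrightarrow> cnorm c x\<^sub>0 v \<le> (1 + \<epsilon>) * cnorm c x v"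
    "\<And>x v. x \<in> W \<Longrightarrow> cnorm c x v \<le> (1 + \<epsilon>) * cnorm c x\<^sub>0 v"
    by (rule cnorm_palais[OF c \<epsilon>]) blast
  obtain W' where W': "open W'" "x\<^sub>0 \<in> W'" "closure W' \<subseteq> W"
    using paracompact_space_imp_regular[OF paracompact W(1,2)] by blast
  obtain s' where s': "0 < s'" "\<And>v. cnorm c x\<^sub>0 (v - snd c x\<^sub>0) < s' \<Longrightarrow> v \<in> snd c ` fst c \<and> chart_inv c v \<in> W' \<inter> V"
    using cnorm_ball_chart[OF c open_Int[OF W'(1) V(1)]] W'(2) V(2) by blast
  \<comment> \<open>Radii \<open>s\<close>, \<open>2 * s\<close> and \<open>3 * s\<close> are in
    play: seen from a centre in \<open>B 1\<close>, every chart point outside \<open>B 3\<close> is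
    at chart distance at least \<open>3 * s - s\<close>, where the truncation at
    \<open>2 * s\<close> is already active.\<close>
  define s where "s = s' / 3"
  have s: "0 < s" and s3: "3 * s = s'" using s'(1) by (auto simp: s_def)
  let ?n = "cnorm c x\<^sub>0"
  define B where "B k = {z \<in> fst c. ?n (snd c z - snd c x\<^sub>0) < k * s}" for k :: real
  have B3: "B 3 \<subseteq> W'"
    using s'(2) chart_inv_chart[OF cA] unfolding B_def s3 by fastforce
  have clB3: "closure (B 3) \<subseteq> W" using closure_mono[OF B3] W'(3) by blast
  define F where "F p z = (if z \<in> fst c then min (?n (snd c z - snd c p)) (2 * s) else 2 * s)" for p z
  have F_far: "F p z = 2 * s" if "p \<in> B 1" "z \<notin> B 3" for p z
  proof (cases "z \<in> fst c")
    case True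
    then have "3 * s \<le> ?n (snd c z - snd c x\<^sub>0)" using that(2) by (auto simp: B_def)
    also have "\<dots> \<le> ?n (snd c z - snd c p) + ?n (snd c p - snd c x\<^sub>0)"
      using cnorm_triangle[OF c, of "snd c z - snd c p" "snd c p - snd c x\<^sub>0"] by simp
    finally have "2 * s \<le> ?n (snd c z - snd c p)" using that(1) by (simp add: B_def)
    then show ?thesis by (simp add: F_def)
  qed (simp add: F_def)
  have F_growth: "\<bar>F p (\<gamma> t) - F p (\<gamma> r)\<bar> \<le> (1 + \<epsilon>) * len r t \<gamma>"
    if p: "p \<in> B 1" and rt: "r < t" and C1: "C1_path_on atlas r t \<gamma>" for p r t \<gamma>
  proof -
    have "\<bar>F p (\<gamma> t) - F p (\<gamma> r)\<bar> \<le> integral {r..t} (\<lambda>\<tau>. (1 + \<epsilon>) * speed r t \<gamma> \<tau>)"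
    proof (rule growth_bound[where h = "\<lambda>\<tau>. F p (\<gamma> \<tau>)"])
      show "r \<le> t" using rt by simp
      show "continuous_on {r..t} (\<lambda>\<tau>. (1 + \<epsilon>) * speed r t \<gamma> \<tau>)"
        by (intro continuous_intros speed_continuous C1 rt)
      fix \<tau> \<eta> :: real assume \<tau>: "\<tau> \<in> {r..t}" and \<eta>: "0 < \<eta>"
      have cont: "(\<gamma> \<longlongrightarrow> \<gamma> \<tau>) (at \<tau> within {r..t})"
        using C1_path_continuous[OF C1 \<tau>] by (simp add: continuous_within)
      show "\<forall>\<^sub>F u in at \<tau> within {r..t}. \<bar>F p (\<gamma> u) - F p (\<gamma> \<tau>)\<bar> \<le> ((1 + \<epsilon>) * speed r t \<gamma> \<tau> + \<eta>) * \<bar>u - \<tau>\<bar>"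
      proof (cases "\<gamma> \<tau> \<in> W")
        case True
        then have c\<tau>: "c \<in> charts_at atlas (\<gamma> \<tau>)" using W(3) cA by (auto simp: charts_at_def)
        obtain w where w: "((snd c \<circ> \<gamma>) has_vector_derivative w) (at \<tau> within {r..t})"
          using C1_path_derivative[OF C1 \<tau> c\<tau>] by blast
        obtain b where b: "0 < b" "\<And>v. ?n v \<le> b * norm v" by (rule cnorm_equivalent[OF c]) blast
        \<comment> \<open>The lower half of (P2) on \<open>W\<close> is what turns coordinate
          velocity into speed.\<close>
        have nw: "?n w \<le> (1 + \<epsilon>) * speed r t \<gamma> \<tau>"
          using speed_eq_cnorm[OF C1 rt \<tau> c\<tau> w] W(4)[OF True] by simp
        have "\<forall>\<^sub>F u in at \<tau> within {r..t}. \<gamma> u \<in> fst c"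
          using cont chart_open(1)[OF cA] c\<tau> charts_atD by (blast intro: topological_tendstoD)
        moreover have "\<forall>\<^sub>F u in at \<tau> within {r..t}. norm (snd c (\<gamma> u) - snd c (\<gamma> \<tau>) - (u - \<tau>) *\<^sub>R w) \<le> \<eta> / b * \<bar>u - \<tau>\<bar>"
        proof -
          obtain \<delta> where "0 < \<delta>" "\<And>u. u \<in> {r..t} \<Longrightarrow> norm (u - \<tau>) < \<delta> \<Longrightarrow>
              norm ((snd c \<circ> \<gamma>) u - (snd c \<circ> \<gamma>) \<tau> - (u - \<tau>) *\<^sub>R w) \<le> \<eta> / b * norm (u - \<tau>)"
            using w[unfolded has_vector_derivative_def has_derivative_within_alt] divide_pos_pos[OF \<eta> b(1)] by blast
          then show ?thesis unfolding eventually_at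
            by (intro exI[of _ \<delta>]) (auto simp: dist_real_def)
        qed
        ultimately show ?thesis
        proof eventually_elim
          case (elim u)
          let ?z = "snd c (\<gamma> u) - snd c (\<gamma> \<tau>)"
          have "\<bar>F p (\<gamma> u) - F p (\<gamma> \<tau>)\<bar> \<le> \<bar>?n (snd c (\<gamma> u) - snd c p) - ?n (snd c (\<gamma> \<tau>) - snd c p)\<bar>"
            using elim charts_atD(2)[OF c\<tau>] by (auto simp: F_def min_def)
          also have "\<dots> \<le> ?n ?z"
            using cnorm_triangle3[OF c, of "snd c (\<gamma> u) - snd c p" "snd c (\<gamma> \<tau>) - snd c p"] by simp
          also have "\<dots> \<le> ?n ((u - \<tau>) *\<^sub>R w) + ?n (?z - (u - \<tau>) *\<^sub>R w)"
            using cnorm_triangle[OF c, of "(u - \<tau>) *\<^sub>R w" "?z - (u - \<tau>) *\<^sub>R w"] by simp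
          also have "?n ((u - \<tau>) *\<^sub>R w) \<le> \<bar>u - \<tau>\<bar> * ((1 + \<epsilon>) * speed r t \<gamma> \<tau>)"
            unfolding cnorm_scaleR[OF c] using nw by (intro mult_left_mono) auto
          also have "?n (?z - (u - \<tau>) *\<^sub>R w) \<le> b * (\<eta> / b * \<bar>u - \<tau>\<bar>)"
            using b(2)[of "?z - (u - \<tau>) *\<^sub>R w"] elim(2) b(1) by (meson mult_left_mono less_imp_le order_trans)
          also have "b * (\<eta> / b * \<bar>u - \<tau>\<bar>) = \<eta> * \<bar>u - \<tau>\<bar>" using b(1) by simp
          finally show ?case by (simp add: algebra_simps)
        qed
      next
        case False
        \<comment> \<open>Here the closed margin inside \<open>W\<close> is used: a point outside
          \<open>W\<close> has a whole neighbourhood off \<open>B 3\<close>, on which the truncated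
          function is constant.\<close>
        then have "\<gamma> \<tau> \<in> - closure (B 3)" using clB3 by blast
        then have "\<forall>\<^sub>F u in at \<tau> within {r..t}. \<gamma> u \<in> - closure (B 3)"
          by (intro topological_tendstoD[OF cont] open_Compl closed_closure)
        then show ?thesis
        proof eventually_elim
          case (elim u)
          then have "\<gamma> u \<notin> B 3" "\<gamma> \<tau> \<notin> B 3" using closure_subset \<open>\<gamma> \<tau> \<in> - closure (B 3)\<close> by blast+
          then show ?case using F_far[OF p] speed_nonneg[OF C1 rt \<tau>] \<eta> \<epsilon> by (simp add: add_nonneg_nonneg)
        qed
      qed
    qed
    then show ?thesis by (simp add: len_eq)
  qed
  have F_joined: "\<bar>F p y - F p x\<bar> \<le> (1 + \<epsilon>) * l" if "joined x y l" "p \<in> B 1" for x y l p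
    using that
  proof (induction rule: joined.induct)
    case (joined_step x \<gamma> r l t)
    then show ?case using F_growth[of p r t \<gamma>] by (simp add: algebra_simps)
  qed simp
  have F_le: "F x y \<le> (1 + \<epsilon>) * d x y" if x: "x \<in> B 1" for x y
  proof -
    have "F x y / (1 + \<epsilon>) \<le> d x y"
    proof (rule d_greatest)
      fix l assume "joined x y l"
      from F_joined[OF this x] have "F x y \<le> (1 + \<epsilon>) * l"
        using x s by (simp add: F_def B_def cnorm_0[OF c])
      then show "F x y / (1 + \<epsilon>) \<le> l" using \<epsilon> by (simp add: field_simps)
    qed
    then show ?thesis using \<epsilon> by (simp add: field_simps)
  qed
  have x0: "x\<^sub>0 \<in> B 1" using charts_atD(2)[OF c] s by (simp add: B_def cnorm_0[OF c])
  \<comment> \<open>A value of \<open>F\<close> below \<open>s\<close> is below the truncation level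
    \<open>2 * s\<close>, which is the value off the chart domain; so the point must lie in the
    chart.\<close>
  have near: "y \<in> B 1" if "d x\<^sub>0 y < s / (1 + \<epsilon>)" for y
  proof -
    have "F x\<^sub>0 y < s" using F_le[OF x0, of y] that \<epsilon> by (simp add: field_simps)
    then show ?thesis using s by (auto simp: F_def B_def split: if_splits)
  qed
  \<comment> \<open>Two points of \<open>B 1\<close> are at chart distance below
    \<open>2 * s\<close>, so the truncation does not affect them.\<close>
  have lower: "?n (snd c x - snd c y) \<le> (1 + \<epsilon>) * d x y" if x: "x \<in> B 1" and y: "y \<in> B 1" for x y
  proof -
    have "?n (snd c y - snd c x) \<le> ?n (snd c y - snd c x\<^sub>0) + ?n (snd c x\<^sub>0 - snd c x)"
      using cnorm_triangle[OF c, of "snd c y - snd c x\<^sub>0" "snd c x\<^sub>0 - snd c x"] by simp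
    also have "\<dots> < 2 * s" using x y cnorm_minus_commute[OF c, of "snd c x\<^sub>0"] by (simp add: B_def)
    finally have "F x y = ?n (snd c x - snd c y)"
      using y cnorm_minus_commute[OF c, of "snd c y"] by (simp add: F_def B_def)
    then show ?thesis using F_le[OF x, of y] by simp
  qed
  have upper: "d x y \<le> (1 + \<epsilon>) * ?n (snd c x - snd c y)" if x: "x \<in> B 1" and y: "y \<in> B 1" for x y
  proof -
    have sW: "v \<in> snd c ` fst c \<and> chart_inv c v \<in> W" if "?n (v - snd c x\<^sub>0) < s" for v
      using s'(2)[of v] that s W'(3) closure_subset s3 by fastforce
    obtain l where "l \<le> (1 + \<epsilon>) * ?n (snd c x - snd c y)" "joined x y l"
      using joined_locally[OF c \<epsilon> W(5) sW, where x = x and y = y] x y unfolding B_def by auto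
    then show ?thesis using d_le by fastforce
  qed
  have "v \<in> snd c ` fst c \<and> chart_inv c v \<in> V" if "?n (v - snd c x\<^sub>0) < s" for v
    using s'(2)[of v] that s s3 by auto
  then show ?thesis
    using s near lower upper unfolding B_def by (intro exI[of _ s]) auto
qed

lemma eventually_d_less:
  assumes "0 < e" shows "\<forall>\<^sub>F y in nhds x. d x y < e"
proof -
  obtain c where c: "c \<in> charts_at atlas x" using charts_at_nonempty by blast
  obtain s where s: "0 < s" "\<And>y. y \<in> fst c \<Longrightarrow> cnorm c x (snd c y - snd c x) < s \<Longrightarrow> d x y \<le> (1 + 1) * cnorm c x (snd c x - snd c y)"
    using local_structure[OF c zero_less_one open_UNIV UNIV_I] charts_atD(2)[OF c] cnorm_0[OF c] by auto
  have "0 < min s (e / 2)" using s(1) assms by simp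
  from eventually_cnorm_less[OF c this] show ?thesis
  proof eventually_elim
    case (elim y)
    then have "d x y \<le> 2 * cnorm c x (snd c y - snd c x)"
      using s(2)[of y] cnorm_minus_commute[OF c, of "snd c x"] by simp
    then show ?case using elim by simp
  qed
qed

lemma open_imp_d_ball:
  assumes "open V" "x \<in> V" shows "\<exists>e>0. \<forall>y. d x y < e \<longrightarrow> y \<in> V"
proof -
  obtain c where c: "c \<in> charts_at atlas x" using charts_at_nonempty by blast
  obtain s where s: "0 < s" "\<And>v. cnorm c x (v - snd c x) < s \<Longrightarrow> chart_inv c v \<in> V"
    "\<And>y. d x y < s / (1 + 1) \<Longrightarrow> y \<in> fst c \<and> cnorm c x (snd c y - snd c x) < s"
    using local_structure[OF c zero_less_one assms] by auto
  have "y \<in> V" if "d x y < s / 2" for y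
    using s(2)[of "snd c y"] s(3)[of y] that chart_inv_chart[OF charts_atD(1)[OF c]] by auto
  then show ?thesis using s(1) by (intro exI[of _ "s / 2"]) auto
qed

text \<open>The Finsler metric induces the manifold topology, which makes the metric balls and the
  chart neighbourhoods interchangeable from here on.\<close>

lemma eventually_nhds_d: "(\<forall>\<^sub>F y in nhds x. P y) \<longleftrightarrow> (\<exists>e>0. \<forall>y. d x y < e \<longrightarrow> P y)"
proof
  assume "\<forall>\<^sub>F y in nhds x. P y"
  then obtain V where "open V" "x \<in> V" "\<And>y. y \<in> V \<Longrightarrow> P y" unfolding eventually_nhds by blast
  then show "\<exists>e>0. \<forall>y. d x y < e \<longrightarrow> P y" using open_imp_d_ball[of V x] by auto
next
  assume "\<exists>e>0. \<forall>y. d x y < e \<longrightarrow> P y"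
  then obtain e where "0 < e" "\<And>y. d x y < e \<Longrightarrow> P y" by blast
  then show "\<forall>\<^sub>F y in nhds x. P y" using eventually_mono[OF eventually_d_less[of e x]] by auto
qed

lemma open_d_iff: "open V \<longleftrightarrow> (\<forall>x\<in>V. \<exists>e>0. \<forall>y. d x y < e \<longrightarrow> y \<in> V)"
proof
  assume "open V"
  then show "\<forall>x\<in>V. \<exists>e>0. \<forall>y. d x y < e \<longrightarrow> y \<in> V" using open_imp_d_ball by auto
next
  assume V: "\<forall>x\<in>V. \<exists>e>0. \<forall>y. d x y < e \<longrightarrow> y \<in> V"
  have "\<exists>T. open T \<and> x \<in> T \<and> T \<subseteq> V" if "x \<in> V" for x
  proof -
    have "\<forall>\<^sub>F y in nhds x. y \<in> V" unfolding eventually_nhds_d using V that by auto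
    then show ?thesis unfolding eventually_nhds by auto
  qed
  then show "open V" by (subst open_subopen) auto
qed

lemma d_eq_0: "d x y = 0 \<longleftrightarrow> x = y"
proof
  assume xy: "d x y = 0"
  show "x = y"
  proof (rule ccontr)
    assume "x \<noteq> y"
    then obtain V where "open V" "x \<in> V" "y \<notin> V" using t1_space by blast
    then show False using open_imp_d_ball[of V x] xy by auto
  qed
qed (simp add: d_refl)

lemma d_pos: "x \<noteq> y \<Longrightarrow> 0 < d x y"
  using d_nonneg[of x y] d_eq_0[of x y] by linarith

lemma tendsto_d_iff: "(f \<longlongrightarrow> l) F \<longleftrightarrow> ((\<lambda>n. d l (f n)) \<longlongrightarrow> 0) F"
proof
  assume f: "(f \<longlongrightarrow> l) F"
  show "((\<lambda>n. d l (f n)) \<longlongrightarrow> 0) F"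
    unfolding tendsto_iff
  proof (intro allI impI)
    fix e :: real assume "0 < e"
    from eventually_compose_filterlim[OF eventually_d_less[OF this] f]
    show "\<forall>\<^sub>F n in F. dist (d l (f n)) 0 < e" by (simp add: d_nonneg)
  qed
next
  assume d0: "((\<lambda>n. d l (f n)) \<longlongrightarrow> 0) F"
  show "(f \<longlongrightarrow> l) F"
  proof (rule topological_tendstoI)
    fix V assume "open V" "l \<in> V"
    then obtain e where e: "0 < e" "\<And>y. d l y < e \<Longrightarrow> y \<in> V" using open_imp_d_ball by blast
    from order_tendstoD(2)[OF d0 e(1)] show "\<forall>\<^sub>F n in F. f n \<in> V"
      by eventually_elim (rule e(2))
  qed
qed

lemma tendsto_d:
  assumes "(f \<longlongrightarrow> x) F" "(g \<longlongrightarrow> y) F"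
  shows "((\<lambda>n. d (f n) (g n)) \<longlongrightarrow> d x y) F"
proof (rule LIM_zero_cancel, rule Lim_null_comparison)
  have "\<bar>d (f n) (g n) - d x y\<bar> \<le> d x (f n) + d y (g n)" for n
    using d_abs_triangle[of "f n" "g n" x] d_abs_triangle[of "g n" x y] d_sym by (smt (verit))
  then show "\<forall>\<^sub>F n in F. norm (d (f n) (g n) - d x y) \<le> d x (f n) + d y (g n)" by simp
  show "((\<lambda>n. d x (f n) + d y (g n)) \<longlongrightarrow> 0) F"
    using tendsto_add[OF assms(1)[unfolded tendsto_d_iff] assms(2)[unfolded tendsto_d_iff]] by simp
qed


text \<open>The distance from \<open>x\<close> varies continuously along the chain and so takes the
  value \<open>h\<close> at some point \<open>z\<close>. The part of the chain before
  \<open>z\<close> has length at least \<open>d x z = h\<close>, which leaves at most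
  \<open>l - h\<close> for the rest.\<close>

lemma joined_intermediate:
  "joined x y l \<Longrightarrow> 0 \<le> h \<Longrightarrow> h \<le> d x y \<Longrightarrow> \<exists>z. d x z = h \<and> d z y \<le> l - h"
proof (induction rule: joined.induct)
  case (joined_refl x)
  then have "h = 0" by (simp add: d_refl)
  then show ?case by (intro exI[of _ x]) (simp add: d_refl)
next
  case (joined_step x \<gamma> s l t)
  show ?case
  proof (cases "h \<le> d x (\<gamma> s)")
    case True
    have "\<exists>z. d x z = h \<and> d z (\<gamma> s) \<le> l - h"
      by (rule joined_step.IH[OF joined_step.prems(1) True])
    then obtain z where z: "d x z = h" "d z (\<gamma> s) \<le> l - h" by (elim exE conjE)
    have "d z (\<gamma> t) \<le> d z (\<gamma> s) + d (\<gamma> s) (\<gamma> t)" by (rule d_triangle)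
    also have "d (\<gamma> s) (\<gamma> t) \<le> len s t \<gamma>" by (rule d_le[OF joined_path[OF joined_step(2,3)]])
    finally show ?thesis using z by (intro exI[of _ z]) auto
  next
    case False
    have "continuous_on {s..t} (\<lambda>\<tau>. d x (\<gamma> \<tau>))"
      unfolding continuous_on_def
      by (intro ballI tendsto_d tendsto_const C1_path_continuous[OF joined_step(3), unfolded continuous_within])
    then obtain \<tau> where \<tau>: "s \<le> \<tau>" "\<tau> \<le> t" "d x (\<gamma> \<tau>) = h"
      using IVT'[of "\<lambda>\<tau>. d x (\<gamma> \<tau>)" s h t] False joined_step.prems joined_step(2) by auto
    have "s \<noteq> \<tau>" using False \<tau> by auto
    then have s\<tau>: "s < \<tau>" using \<tau> by simp
    show ?thesis
    proof (cases "\<tau> = t")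
      case True
      have "d x (\<gamma> t) \<le> l + len s t \<gamma>" by (rule d_le[OF joined.joined_step[OF joined_step(1,2,3)]])
      then show ?thesis using \<tau> True by (intro exI[of _ "\<gamma> \<tau>"]) (simp add: d_refl)
    next
      case False
      then have \<tau>t: "\<tau> < t" using \<tau> by simp
      have "d x (\<gamma> \<tau>) \<le> l + len s \<tau> \<gamma>"
        using joined_step(1) s\<tau> C1_path_subinterval[OF joined_step(3), of s \<tau>] \<tau>
        by (intro d_le joined.joined_step) auto
      moreover have "d (\<gamma> \<tau>) (\<gamma> t) \<le> len \<tau> t \<gamma>"
        using \<tau>t C1_path_subinterval[OF joined_step(3), of \<tau> t] \<tau> by (intro d_le joined_path) auto
      moreover have "len s t \<gamma> = len s \<tau> \<gamma> + len \<tau> t \<gamma>" by (rule len_split[OF joined_step(3) s\<tau> \<tau>t])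
      ultimately show ?thesis using \<tau>(3) by (intro exI[of _ "\<gamma> \<tau>"]) auto
    qed
  qed
qed

text \<open>Substitute for a point on a minimizing geodesic, which need not exist.
  \<open>slope_lower\<close> obtains from it a direction in which the distance decreases at almost
  unit rate.\<close>

lemma d_intermediate:
  assumes "0 \<le> h" "h \<le> d x y" "0 < e"
  shows "\<exists>z. d x z = h \<and> d z y \<le> d x y - h + e"
proof -
  obtain l where "l < d x y + e" "joined x y l" using d_less_joined[of x y "d x y + e"] assms by auto
  with joined_intermediate[OF _ assms(1,2)] show ?thesis by fastforce
qed

end

section \<open>Differentials and dual norms\<close>

context C1_finsler_manifold
begin

abbreviation dn :: "('m \<Rightarrow> real) \<Rightarrow> 'm \<Rightarrow> real" where
  "dn g x \<equiv> dual_norm atlas nrm x (differential atlas g x)"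

abbreviation dchart :: "('m \<Rightarrow> real) \<Rightarrow> ('m, 'x) chart \<Rightarrow> 'm \<Rightarrow> 'x \<Rightarrow> real" where
  "dchart g c x \<equiv> frechet_derivative (g \<circ> chart_inv c) (at (snd c x))"

lemma dchart_has_derivative:
  assumes g: "C1_fun atlas g" and c: "c \<in> charts_at atlas x"
  shows "((g \<circ> chart_inv c) has_derivative dchart g c x) (at (snd c x))"
proof -
  have "C1_on (snd c ` fst c) (g \<circ> chart_inv c)" using g charts_atD(1)[OF c] unfolding C1_fun_def by blast
  then show ?thesis by (rule C1_on_differentiable) (use charts_atD(2)[OF c] in blast)
qed

lemma differential_apply:
  assumes g: "C1_fun atlas g" and c: "c \<in> charts_at atlas x" and \<xi>: "\<xi> \<in> tangent_space atlas x"
  shows "differential atlas g x \<xi> = dchart g c x (\<xi> c)"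
proof -
  define c\<^sub>0 where "c\<^sub>0 = (SOME c. c \<in> charts_at atlas x)"
  have c\<^sub>0: "c\<^sub>0 \<in> charts_at atlas x" unfolding c\<^sub>0_def using someI[of "\<lambda>c. c \<in> charts_at atlas x" c] c by simp
  have x: "chart_inv c\<^sub>0 (snd c\<^sub>0 x) = x" by (rule chart_inv_chart[OF charts_atD[OF c\<^sub>0]])
  have "((g \<circ> chart_inv c) \<circ> (snd c \<circ> chart_inv c\<^sub>0) has_derivative
      dchart g c x \<circ> transition_deriv c\<^sub>0 c x) (at (snd c\<^sub>0 x))"
    by (rule diff_chain_at[OF transition_has_derivative[OF c\<^sub>0 c]])
      (use dchart_has_derivative[OF g c] x in simp)
  moreover have "\<forall>\<^sub>F v in nhds (snd c\<^sub>0 x). ((g \<circ> chart_inv c) \<circ> (snd c \<circ> chart_inv c\<^sub>0)) v = (g \<circ> chart_inv c\<^sub>0) v"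
    using eventually_chart_inv[OF c\<^sub>0 eventually_nhds_in_open[OF chart_open(1)[OF charts_atD(1)[OF c]] charts_atD(2)[OF c]]]
    by eventually_elim (simp add: chart_inv_chart[OF charts_atD(1)[OF c]])
  ultimately have "((g \<circ> chart_inv c\<^sub>0) has_derivative dchart g c x \<circ> transition_deriv c\<^sub>0 c x) (at (snd c\<^sub>0 x))"
    by (rule has_derivative_cong_nhds)
  from has_derivative_unique[OF dchart_has_derivative[OF g c\<^sub>0] this]
  have "dchart g c\<^sub>0 x (\<xi> c\<^sub>0) = dchart g c x (transition_deriv c\<^sub>0 c x (\<xi> c\<^sub>0))" by simp
  moreover have "\<xi> c = transition_deriv c\<^sub>0 c x (\<xi> c\<^sub>0)"
    using \<xi> c c\<^sub>0 unfolding tangent_space_def transition_deriv_def by blast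
  ultimately show ?thesis
    unfolding differential_def Let_def c\<^sub>0_def[symmetric] using \<xi> by simp
qed

lemma differential_eqI:
  assumes "C1_fun atlas g" "C1_fun atlas h" and c: "c \<in> charts_at atlas x"
    and "\<And>v. dchart g c x v = dchart h c x v"
  shows "differential atlas g x = differential atlas h x"
proof
  fix \<xi>
  show "differential atlas g x \<xi> = differential atlas h x \<xi>"
  proof (cases "\<xi> \<in> tangent_space atlas x")
    case True
    then show ?thesis using assms by (simp add: differential_apply[OF _ c])
  next
    case False
    then show ?thesis unfolding differential_def Let_def restrict_def by simp
  qed
qed

context
  fixes g c x D
  assumes g: "C1_fun atlas g" and c: "c \<in> charts_at atlas x"
    and D: "((g \<circ> chart_inv c) has_derivative D) (at (snd c x))"
begin

lemma dchart_eq: "dchart g c x = D"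
  by (rule has_derivative_unique[OF dchart_has_derivative[OF g c] D])

lemma dual_norm_bdd: "\<exists>M. \<forall>v. cnorm c x v = 1 \<longrightarrow> \<bar>D v\<bar> \<le> M"
proof -
  obtain a b where ab: "0 < a" "\<And>v. a * norm v \<le> cnorm c x v" by (rule cnorm_equivalent[OF c]) blast
  obtain K where K: "0 < K" "\<And>v. norm (D v) \<le> norm v * K"
    using bounded_linear.pos_bounded[OF has_derivative_bounded_linear[OF D]] by auto
  have "\<bar>D v\<bar> \<le> 1 / a * K" if v: "cnorm c x v = 1" for v
  proof -
    have "norm v \<le> 1 / a" using ab(2)[of v] ab(1) v by (simp add: field_simps)
    then have "norm v * K \<le> 1 / a * K" using K(1) by (intro mult_right_mono) auto
    then show ?thesis using K(2)[of v] by simp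
  qed
  then show ?thesis by blast
qed

lemma dual_norm_set:
  "{\<bar>differential atlas g x \<xi>\<bar> | \<xi>. \<xi> \<in> tangent_space atlas x \<and> nrm x \<xi> = 1} = {\<bar>D v\<bar> | v. cnorm c x v = 1}"
proof
  show "{\<bar>differential atlas g x \<xi>\<bar> | \<xi>. \<xi> \<in> tangent_space atlas x \<and> nrm x \<xi> = 1} \<subseteq> {\<bar>D v\<bar> | v. cnorm c x v = 1}"
  proof
    fix z assume "z \<in> {\<bar>differential atlas g x \<xi>\<bar> | \<xi>. \<xi> \<in> tangent_space atlas x \<and> nrm x \<xi> = 1}"
    then obtain \<xi> where \<xi>: "z = \<bar>differential atlas g x \<xi>\<bar>" "\<xi> \<in> tangent_space atlas x" "nrm x \<xi> = 1" by blast
    then have "cnorm c x (\<xi> c) = 1"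
      unfolding cnorm_def using tangent_space_eq_tangent_of[OF \<xi>(2) c] by simp
    then show "z \<in> {\<bar>D v\<bar> | v. cnorm c x v = 1}"
      using \<xi>(1) differential_apply[OF g c \<xi>(2)] dchart_eq by auto
  qed
  show "{\<bar>D v\<bar> | v. cnorm c x v = 1} \<subseteq> {\<bar>differential atlas g x \<xi>\<bar> | \<xi>. \<xi> \<in> tangent_space atlas x \<and> nrm x \<xi> = 1}"
  proof
    fix z assume "z \<in> {\<bar>D v\<bar> | v. cnorm c x v = 1}"
    then obtain v where v: "z = \<bar>D v\<bar>" "cnorm c x v = 1" by blast
    have "differential atlas g x (tangent_of atlas c x v) = D v"
      using differential_apply[OF g c tangent_of_in_tangent_space[OF c]] dchart_eq tangent_of_self[OF c] by simp
    then show "z \<in> {\<bar>differential atlas g x \<xi>\<bar> | \<xi>. \<xi> \<in> tangent_space atlas x \<and> nrm x \<xi> = 1}"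
      using v tangent_of_in_tangent_space[OF c] unfolding cnorm_def by force
  qed
qed

lemma dn_eq: "dn g x = Sup (insert 0 {\<bar>D v\<bar> | v. cnorm c x v = 1})"
  unfolding dual_norm_def dual_norm_set ..

lemma dn_bdd_above: "bdd_above (insert 0 {\<bar>D v\<bar> | v. cnorm c x v = 1})"
proof -
  obtain M where M: "\<forall>v. cnorm c x v = 1 \<longrightarrow> \<bar>D v\<bar> \<le> M" using dual_norm_bdd by blast
  show ?thesis by (rule bdd_aboveI[of _ "max 0 M"]) (use M in \<open>auto simp: le_max_iff_disj\<close>)
qed

lemma dn_nonneg: "0 \<le> dn g x"
  unfolding dn_eq by (rule cSup_upper[OF _ dn_bdd_above]) simp

lemma dn_ge: "\<bar>D v\<bar> \<le> dn g x * cnorm c x v"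
proof (cases "cnorm c x v = 0")
  case True
  then have "v = 0" by (simp add: cnorm_eq_0[OF c])
  then show ?thesis using linear_0[OF has_derivative_linear[OF D]] True by simp
next
  case False
  then have pos: "0 < cnorm c x v" using cnorm_nonneg[OF c, of v] by simp
  let ?w = "(1 / cnorm c x v) *\<^sub>R v"
  have "cnorm c x ?w = 1" unfolding cnorm_scaleR[OF c] using pos by simp
  then have "\<bar>D ?w\<bar> \<le> dn g x" unfolding dn_eq by (intro cSup_upper[OF _ dn_bdd_above]) blast
  moreover have "D ?w = (1 / cnorm c x v) * D v"
    using linear_scale[OF has_derivative_linear[OF D], of "1 / cnorm c x v" v] by simp
  ultimately show ?thesis using pos by (simp add: abs_mult field_simps)
qed

text \<open>Together with \<open>dn_ge\<close> this characterizes the dual norm as the least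
  nonnegative constant bounding \<open>D\<close> by the chart norm. In this form the
  zero-dimensional model space is no exception, and the chart norms of neighbouring points can be
  compared directly.\<close>

lemma dn_le:
  assumes "0 \<le> k" "\<And>v. \<bar>D v\<bar> \<le> k * cnorm c x v"
  shows "dn g x \<le> k"
proof -
  have "\<bar>D v\<bar> \<le> k" if "cnorm c x v = 1" for v using assms(2)[of v] that by simp
  then show ?thesis unfolding dn_eq using assms(1) by (intro cSup_least) auto
qed

end

lemma dn_nonneg': "C1_fun atlas g \<Longrightarrow> 0 \<le> dn g x"
  using charts_at_nonempty[of x] dn_nonneg dchart_has_derivative by blast

text \<open>A function glued by a cutoff is known near each point in one convenient chart only;
  smoothness of the transition maps carries this to all other charts.\<close>

lemma C1_fun_localI:
  assumes loc: "\<And>x. \<exists>c\<in>charts_at atlas x. \<exists>h T. open T \<and> snd c x \<in> T \<and> C1_on T h \<and> (\<forall>\<^sub>F y in nhds x. g y = h (snd c y))"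
  shows "C1_fun atlas g"
  unfolding C1_fun_def
proof
  fix c' assume c': "c' \<in> atlas"
  show "C1_on (snd c' ` fst c') (g \<circ> chart_inv c')"
  proof (rule C1_on_local)
    fix v assume "v \<in> snd c' ` fst c'"
    then obtain x where x: "x \<in> fst c'" "v = snd c' x" by blast
    have c'x: "c' \<in> charts_at atlas x" using c' x by (simp add: charts_at_def)
    obtain c h T where c: "c \<in> charts_at atlas x" and T: "open T" "snd c x \<in> T" "C1_on T h"
      and gh: "\<forall>\<^sub>F y in nhds x. g y = h (snd c y)"
      using loc[of x] by blast
    have "\<forall>\<^sub>F y in nhds x. (y \<in> fst c \<and> snd c y \<in> T) \<and> g y = h (snd c y)"
      by (intro eventually_conj gh eventually_chart[OF c] eventually_nhds_in_open T)
    from eventually_chart_inv[OF c'x this]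
    obtain S where S: "open S" "snd c' x \<in> S" and S': "\<And>w. w \<in> S \<Longrightarrow> w \<in> snd c' ` fst c' \<and> chart_inv c' w \<in> fst c' \<and>
        (chart_inv c' w \<in> fst c \<and> snd c (chart_inv c' w) \<in> T) \<and> g (chart_inv c' w) = h (snd c (chart_inv c' w))"
      unfolding eventually_nhds by blast
    have "S \<subseteq> snd c' ` (fst c' \<inter> fst c)"
    proof
      fix w assume "w \<in> S"
      note w = S'[OF this]
      then have "snd c' (chart_inv c' w) = w" "chart_inv c' w \<in> fst c' \<inter> fst c"
        by (auto intro: chart_chart_inv)
      then show "w \<in> snd c' ` (fst c' \<inter> fst c)" by (intro image_eqI[of _ _ "chart_inv c' w"]) simp_all
    qed
    moreover have "C1_on (snd c' ` (fst c' \<inter> fst c)) (snd c \<circ> chart_inv c')"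
      using compatible[OF c' charts_atD(1)[OF c]] unfolding C1_compatible_def by blast
    ultimately have "C1_on S (snd c \<circ> chart_inv c')" by (rule C1_on_subset[rotated])
    then have "C1_on S (h \<circ> (snd c \<circ> chart_inv c'))"
      by (rule C1_on_compose[OF _ T(3)]) (use S' in auto)
    then have "C1_on S (g \<circ> chart_inv c')"
      by (rule C1_on_cong[OF _ S(1)]) (use S' in auto)
    then show "\<exists>S. open S \<and> v \<in> S \<and> C1_on S (g \<circ> chart_inv c')" using S x(2) by blast
  qed
qed

lemma C1_fun_add:
  "C1_fun atlas g \<Longrightarrow> C1_fun atlas h \<Longrightarrow> C1_fun atlas (\<lambda>x. g x + h x)"
  unfolding C1_fun_def comp_def by (auto intro: C1_on_add)

lemma C1_fun_const: "C1_fun atlas (\<lambda>x. k)"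
  unfolding C1_fun_def comp_def by (auto intro: C1_on_const)

lemma C1_fun_mult:
  "C1_fun atlas g \<Longrightarrow> C1_fun atlas h \<Longrightarrow> C1_fun atlas (\<lambda>x. g x * h x)"
  unfolding C1_fun_def comp_def by (auto intro: C1_on_mult)

lemma C1_fun_continuous:
  assumes g: "C1_fun atlas g" and e: "0 < e"
  shows "\<forall>\<^sub>F y in nhds x. \<bar>g y - g x\<bar> < e"
proof -
  obtain c where c: "c \<in> charts_at atlas x" using charts_at_nonempty by blast
  have "isCont (g \<circ> chart_inv c) (snd c x)"
    using dchart_has_derivative[OF g c] by (rule has_derivative_continuous)
  from tendstoD[OF isCont_tendsto_nhds[OF this] e]
  have "\<forall>\<^sub>F y in nhds x. y \<in> fst c \<and> dist ((g \<circ> chart_inv c) (snd c y)) ((g \<circ> chart_inv c) (snd c x)) < e"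
    by (rule eventually_chart[OF c])
  then show ?thesis
    by eventually_elim
      (auto simp: dist_real_def chart_inv_chart[OF charts_atD(1)[OF c]] chart_inv_chart[OF charts_atD[OF c]])
qed

lemma dn_add_scaled:
  assumes g: "C1_fun atlas g" and h: "C1_fun atlas h"
  shows "\<bar>dn (\<lambda>y. g y + k * h y) x - dn g x\<bar> \<le> \<bar>k\<bar> * dn h x"
proof -
  obtain c where c: "c \<in> charts_at atlas x" using charts_at_nonempty by blast
  note Dg = dchart_has_derivative[OF g c] and Dh = dchart_has_derivative[OF h c]
  have s: "C1_fun atlas (\<lambda>y. g y + k * h y)" by (intro C1_fun_add C1_fun_mult C1_fun_const g h)
  have Ds: "(((\<lambda>y. g y + k * h y) \<circ> chart_inv c) has_derivative (\<lambda>v. dchart g c x v + k * dchart h c x v)) (at (snd c x))"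
    using has_derivative_add[OF Dg has_derivative_mult_right[OF Dh, of k]] by (simp add: comp_def)
  have kh: "\<bar>k * dchart h c x v\<bar> \<le> \<bar>k\<bar> * dn h x * cnorm c x v" for v
    using dn_ge[OF h c Dh, of v] by (simp add: abs_mult mult.assoc mult_left_mono)
  have "dn (\<lambda>y. g y + k * h y) x \<le> dn g x + \<bar>k\<bar> * dn h x"
  proof (rule dn_le[OF s c Ds])
    show "0 \<le> dn g x + \<bar>k\<bar> * dn h x" using dn_nonneg[OF g c Dg] dn_nonneg[OF h c Dh] by simp
    show "\<bar>dchart g c x v + k * dchart h c x v\<bar> \<le> (dn g x + \<bar>k\<bar> * dn h x) * cnorm c x v" for v
      using kh[of v] dn_ge[OF g c Dg, of v] by (simp add: distrib_right)
  qed
  moreover have "dn g x \<le> dn (\<lambda>y. g y + k * h y) x + \<bar>k\<bar> * dn h x"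
  proof (rule dn_le[OF g c Dg])
    show "0 \<le> dn (\<lambda>y. g y + k * h y) x + \<bar>k\<bar> * dn h x" using dn_nonneg[OF s c Ds] dn_nonneg[OF h c Dh] by simp
    show "\<bar>dchart g c x v\<bar> \<le> (dn (\<lambda>y. g y + k * h y) x + \<bar>k\<bar> * dn h x) * cnorm c x v" for v
      using kh[of v] dn_ge[OF s c Ds, of v] by (simp add: distrib_right)
  qed
  ultimately show ?thesis by linarith
qed

lemma differential_eq_of_local_min:
  assumes g: "C1_fun atlas g" and h: "C1_fun atlas h"
    and min: "\<forall>\<^sub>F y in nhds x. g x - h x \<le> g y - h y"
  shows "differential atlas g x = differential atlas h x"
proof -
  obtain c where c: "c \<in> charts_at atlas x" using charts_at_nonempty by blast
  note D = has_derivative_diff[OF dchart_has_derivative[OF g c] dchart_has_derivative[OF h c]]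
  have "\<forall>\<^sub>F v in nhds (snd c x). (g \<circ> chart_inv c) (snd c x) - (h \<circ> chart_inv c) (snd c x)
      \<le> (g \<circ> chart_inv c) v - (h \<circ> chart_inv c) v"
    using eventually_chart_inv[OF c min]
    by eventually_elim (simp add: chart_inv_chart[OF charts_atD[OF c]])
  from has_derivative_local_min_zero[OF D this]
  show ?thesis by (intro differential_eqI[OF g h c]) simp
qed

text \<open>Two things vary with the point: the coordinate derivative, continuous in operator norm,
  and the norm against which it is measured, controlled by (P2). Perron's method uses the lemma to
  keep the argument of \<open>H\<close> close to its value at the base point.\<close>

lemma dn_continuous:
  assumes g: "C1_fun atlas g" and e: "0 < e"
  shows "\<forall>\<^sub>F y in nhds x. \<bar>dn g y - dn g x\<bar> < e"
proof -
  obtain c where c: "c \<in> charts_at atlas x" using charts_at_nonempty by blast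
  note cA = charts_atD(1)[OF c]
  obtain a b where ab: "0 < a" "\<And>v. a * norm v \<le> cnorm c x v" by (rule cnorm_equivalent[OF c]) blast
  obtain D where D: "\<And>v. v \<in> snd c ` fst c \<Longrightarrow> (g \<circ> chart_inv c has_derivative blinfun_apply (D v)) (at v)"
    "continuous_on (snd c ` fst c) D"
    using g cA unfolding C1_fun_def C1_on_def by blast
  define T where "T = dn g x"
  have T: "0 \<le> T" unfolding T_def by (rule dn_nonneg'[OF g])
  \<comment> \<open>\<open>\<epsilon>\<close> is the norm distortion and is multiplied by the size
    \<open>T\<close> of the differential, hence the division by \<open>T + 2\<close>;
    \<open>\<eta>\<close> bounds the variation of the differential itself.\<close>
  define \<epsilon> where "\<epsilon> = min 1 (e / (4 * (T + 2)))"
  define \<eta> where "\<eta> = min 1 (e / 8)"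
  have \<eta>: "0 < \<eta>" "\<eta> \<le> 1" "\<eta> \<le> e / 8" using e by (auto simp: \<eta>_def)
  have "0 < \<epsilon>" "\<epsilon> \<le> 1" and \<epsilon>': "\<epsilon> \<le> e / (4 * (T + 2))" using e T by (auto simp: \<epsilon>_def)
  then have \<epsilon>: "0 < \<epsilon>" "\<epsilon> \<le> 1" "4 * (\<epsilon> * T) + 8 * \<epsilon> \<le> e"
    using T by (auto simp: pos_le_divide_eq algebra_simps)
  obtain W where W: "open W" "x \<in> W" "W \<subseteq> fst c"
    "\<And>y v. y \<in> W \<Longrightarrow> cnorm c x v \<le> (1 + \<epsilon>) * cnorm c y v"
    "\<And>y v. y \<in> W \<Longrightarrow> cnorm c y v \<le> (1 + \<epsilon>) * cnorm c x v"
    by (rule cnorm_palais[OF c \<epsilon>(1)]) blast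
  have "isCont D (snd c x)"
    using D(2) chart_open(2)[OF cA] charts_atD(2)[OF c] continuous_on_eq_continuous_at by blast
  from tendstoD[OF isCont_tendsto_nhds[OF this], of "a * \<eta>"]
  have "\<forall>\<^sub>F v in nhds (snd c x). dist (D v) (D (snd c x)) < a * \<eta>" using ab \<eta> by simp
  from eventually_conj[OF eventually_chart[OF c this] eventually_nhds_in_open[OF W(1,2)]]
  show ?thesis
  proof eventually_elim
    case (elim y)
    have cy: "c \<in> charts_at atlas y" using elim cA by (simp add: charts_at_def)
    have Dy: "(g \<circ> chart_inv c has_derivative blinfun_apply (D (snd c y))) (at (snd c y))"
      and Dx: "(g \<circ> chart_inv c has_derivative blinfun_apply (D (snd c x))) (at (snd c x))"
      using elim charts_atD(2)[OF c] by (auto intro: D(1))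
    have diff: "\<bar>D (snd c y) v - D (snd c x) v\<bar> \<le> \<eta> * cnorm c x v" for v
    proof -
      have "\<bar>D (snd c y) v - D (snd c x) v\<bar> \<le> norm (D (snd c y) - D (snd c x)) * norm v"
        using norm_blinfun[of "D (snd c y) - D (snd c x)" v] by (simp add: blinfun.diff_left)
      also have "\<dots> \<le> a * \<eta> * norm v" using elim by (intro mult_right_mono) (auto simp: dist_norm)
      also have "\<dots> = \<eta> * (a * norm v)" by simp
      also have "\<dots> \<le> \<eta> * cnorm c x v" using ab(2) \<eta> by (intro mult_left_mono) auto
      finally show ?thesis .
    qed
    have up: "dn g y \<le> (T + \<eta>) * (1 + \<epsilon>)"
    proof (rule dn_le[OF g cy Dy])
      show "0 \<le> (T + \<eta>) * (1 + \<epsilon>)" using T \<eta> \<epsilon> by simp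
      show "\<bar>D (snd c y) v\<bar> \<le> (T + \<eta>) * (1 + \<epsilon>) * cnorm c y v" for v
      proof -
        have "\<bar>D (snd c y) v\<bar> \<le> (T + \<eta>) * cnorm c x v"
          using diff[of v] dn_ge[OF g c Dx, of v] unfolding T_def[symmetric] distrib_right by linarith
        also have "\<dots> \<le> (T + \<eta>) * ((1 + \<epsilon>) * cnorm c y v)"
          using W(4) elim T \<eta> by (intro mult_left_mono) auto
        finally show ?thesis by (simp add: mult.assoc)
      qed
    qed
    have low: "T \<le> dn g y * (1 + \<epsilon>) + \<eta>"
      unfolding T_def
    proof (rule dn_le[OF g c Dx])
      show "0 \<le> dn g y * (1 + \<epsilon>) + \<eta>" using dn_nonneg'[OF g, of y] \<eta> \<epsilon> by simp
      show "\<bar>D (snd c x) v\<bar> \<le> (dn g y * (1 + \<epsilon>) + \<eta>) * cnorm c x v" for v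
      proof -
        have "\<bar>D (snd c y) v\<bar> \<le> dn g y * ((1 + \<epsilon>) * cnorm c x v)"
          using dn_ge[OF g cy Dy, of v] W(5)[of y v] elim dn_nonneg'[OF g, of y]
          by (meson mult_left_mono order_trans)
        then show ?thesis using diff[of v] unfolding distrib_right mult.assoc by linarith
      qed
    qed
    have "\<eta> * \<epsilon> \<le> \<eta>" using \<eta> \<epsilon> by (simp add: mult_left_le)
    then have u: "dn g y \<le> T + T * \<epsilon> + 2 * \<eta>" using up by (simp add: algebra_simps)
    then have "dn g y * \<epsilon> \<le> (T + T * \<epsilon> + 2 * \<eta>) * \<epsilon>" using \<epsilon> by (intro mult_right_mono) auto
    also have "\<dots> \<le> (2 * T + 2) * \<epsilon>"
      using \<epsilon> \<eta> T mult_left_le[of \<epsilon> T] by (intro mult_right_mono) auto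
    finally have "T - dn g y \<le> 2 * (\<epsilon> * T) + 2 * \<epsilon> + \<eta>" using low by (simp add: algebra_simps)
    then show ?case using u \<epsilon> \<eta> e T unfolding T_def[symmetric]
      by (simp add: abs_less_iff mult.commute)
  qed
qed

end

section \<open>Bump functions and test functions\<close>

lemma real_cutoff_exists:
  "\<exists>\<sigma> \<sigma>' :: real \<Rightarrow> real. (\<forall>t. (\<sigma> has_real_derivative \<sigma>' t) (at t)) \<and> continuous_on UNIV \<sigma>' \<and>
     (\<forall>t. 0 \<le> \<sigma> t \<and> \<sigma> t \<le> 1) \<and> (\<forall>t\<le>1/4. \<sigma> t = 1) \<and> (\<forall>t\<ge>1. \<sigma> t = 0)"
proof -
  \<comment> \<open>The factor \<open>2\<close> makes \<open>p\<close> negative from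
    \<open>1\<close> on, as \<open>2 * (3/4)\<^sup>2 > 1\<close>; both squares keep the composite
    C1.\<close>
  define p where "p t = 1 - 2 * (max 0 (t - 1/4))\<^sup>2" for t :: real
  define \<sigma> where "\<sigma> t = (max 0 (p t))\<^sup>2" for t
  define \<sigma>' where "\<sigma>' t = 2 * max 0 (p t) * (- 4 * max 0 (t - 1/4))" for t
  have p: "(p has_real_derivative - 4 * max 0 (t - 1/4)) (at t)" for t
  proof -
    have "((\<lambda>t. (max 0 (t - 1/4))\<^sup>2) has_real_derivative (2 * max 0 (t - 1/4)) * 1) (at t)"
      by (rule DERIV_chain2[OF has_real_derivative_max0_sq]) (auto intro!: derivative_eq_intros)
    from DERIV_diff[OF DERIV_const DERIV_cmult[OF this, of 2], of 1]
    show ?thesis unfolding p_def[abs_def] by simp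
  qed
  have "(\<sigma> has_real_derivative \<sigma>' t) (at t)" for t
    unfolding \<sigma>_def[abs_def] \<sigma>'_def by (rule DERIV_chain2[OF has_real_derivative_max0_sq p])
  moreover have "continuous_on UNIV \<sigma>'"
    unfolding \<sigma>'_def p_def by (intro continuous_intros)
  moreover have "0 \<le> \<sigma> t \<and> \<sigma> t \<le> 1" for t
    unfolding \<sigma>_def p_def by (auto intro!: power_le_one)
  moreover have "\<sigma> t = 1" if "t \<le> 1/4" for t
  proof -
    have "max 0 (t - 1/4) = 0" using that by simp
    then show ?thesis by (simp add: \<sigma>_def p_def)
  qed
  moreover have "\<sigma> t = 0" if "1 \<le> t" for t
  proof -
    have "(3/4)\<^sup>2 \<le> (max 0 (t - 1/4))\<^sup>2" using that by (intro power_mono) auto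
    then have "p t \<le> 0" by (simp add: p_def power2_eq_square)
    then show ?thesis by (simp add: \<sigma>_def)
  qed
  ultimately show ?thesis by (intro exI[of _ \<sigma>] exI[of _ \<sigma>']) auto
qed

locale bumpable_finsler_manifold = complete_C1_finsler_manifold atlas nrm + smooth_gauge N N' B L
  for atlas :: "('m::t2_space, 'x::banach) chart set" and nrm and N :: "'x \<Rightarrow> real" and N' B L
begin

text \<open>In a chart, the cutoff of a rescaled gauge is \<open>1\<close> near the centre, where
  the gauge is close to \<open>0\<close>, and \<open>0\<close> outside a ball, where it is at least
  \<open>1\<close>. Its derivative is bounded by the data of gauge and cutoff, and (P2) turns this
  into a bound on dual norms.\<close>

lemma bump_exists:
  assumes W: "open W" "x\<^sub>0 \<in> W"
  shows "\<exists>\<beta> K M. C1_fun atlas \<beta> \<and> (\<forall>y. 0 \<le> \<beta> y \<and> \<beta> y \<le> 1) \<and> closed K \<and> K \<subseteq> W \<and> (\<forall>y. y \<notin> K \<longrightarrow> \<beta> y = 0) \<and>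
    (\<forall>\<^sub>F y in nhds x\<^sub>0. \<beta> y = 1) \<and> 0 \<le> M \<and> (\<forall>y. dn \<beta> y \<le> M)"
proof -
  obtain c where c: "c \<in> charts_at atlas x\<^sub>0" using charts_at_nonempty by blast
  note cA = charts_atD(1)[OF c]
  obtain a b where ab: "0 < a" "\<And>v. a * norm v \<le> cnorm c x\<^sub>0 v" by (rule cnorm_equivalent[OF c]) blast
  obtain W1 where W1: "open W1" "x\<^sub>0 \<in> W1" "W1 \<subseteq> fst c"
    "\<And>x v. x \<in> W1 \<Longrightarrow> cnorm c x\<^sub>0 v \<le> (1 + 1) * cnorm c x v"
    by (rule cnorm_palais[OF c zero_less_one]) blast
  obtain e where e: "0 < e" "\<And>y. d x\<^sub>0 y < e \<Longrightarrow> y \<in> W \<inter> W1"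
    using open_imp_d_ball[OF open_Int[OF W(1) W1(1)]] W(2) W1(2) by blast
  \<comment> \<open>Extension by \<open>0\<close> is C1 only if the set kept is closed in the
    manifold, not merely in the chart. A closed ball of the Finsler metric guarantees this, and
    \<open>r\<close> is chosen so that the chart function vanishes off it.\<close>
  define K where "K = {y. d x\<^sub>0 y \<le> e / 2}"
  have KW: "K \<subseteq> W \<inter> W1" using e by (auto simp: K_def)
  have "open (- K)"
    unfolding open_d_iff
  proof
    fix y assume y: "y \<in> - K"
    have "z \<in> - K" if "d y z < d x\<^sub>0 y - e / 2" for z
      using d_triangle[of x\<^sub>0 y z] d_sym[of z y] that by (simp add: K_def)
    then show "\<exists>r>0. \<forall>z. d y z < r \<longrightarrow> z \<in> - K" using y by (intro exI[of _ "d x\<^sub>0 y - e / 2"]) (auto simp: K_def)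
  qed
  then have K: "closed K" by (simp add: closed_def)
  have "\<forall>\<^sub>F v in nhds (snd c x\<^sub>0). v \<in> snd c ` fst c \<and> chart_inv c v \<in> fst c \<and> d x\<^sub>0 (chart_inv c v) < e / 2"
    using e(1) by (intro eventually_chart_inv[OF c] eventually_d_less) simp
  then obtain r where r: "0 < r" "\<And>v. dist v (snd c x\<^sub>0) < r \<Longrightarrow> d x\<^sub>0 (chart_inv c v) < e / 2"
    unfolding eventually_nhds_metric by blast
  obtain \<sigma> \<sigma>' :: "real \<Rightarrow> real" where \<sigma>: "\<And>t. (\<sigma> has_real_derivative \<sigma>' t) (at t)" "continuous_on UNIV \<sigma>'"
    "\<And>t. 0 \<le> \<sigma> t \<and> \<sigma> t \<le> 1" "\<And>t. t \<le> 1/4 \<Longrightarrow> \<sigma> t = 1" "\<And>t. 1 \<le> t \<Longrightarrow> \<sigma> t = 0"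
    using real_cutoff_exists by auto
  \<comment> \<open>Only gauge values are inserted into the cutoff, so its derivative has to be
    bounded on the compact interval \<open>{0..B}\<close> alone.\<close>
  have "\<exists>C. \<forall>t\<in>{0..B}. \<bar>\<sigma>' t\<bar> \<le> C"
    using compact_imp_bounded[OF compact_continuous_image[OF continuous_on_subset[OF \<sigma>(2) subset_UNIV] compact_Icc, of 0 B]]
    unfolding bounded_iff by simp
  then obtain C where C: "\<And>t. t \<in> {0..B} \<Longrightarrow> \<bar>\<sigma>' t\<bar> \<le> C" by blast
  have C0: "0 \<le> C" using C[of 0] B_nonneg abs_ge_zero[of "\<sigma>' 0"] by force
  define h where "h v = \<sigma> (N ((1 / r) *\<^sub>R (v - snd c x\<^sub>0)))" for v
  have h_C1: "C1_on UNIV h"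
  proof -
    have "C1_on UNIV (N \<circ> (\<lambda>v. (1 / r) *\<^sub>R (v - snd c x\<^sub>0)))"
      by (rule C1_on_compose[OF C1_on_blinfun_affine C1_on_N]) simp
    then have "C1_on UNIV (\<sigma> \<circ> (N \<circ> (\<lambda>v. (1 / r) *\<^sub>R (v - snd c x\<^sub>0))))"
      by (rule C1_on_compose[OF _ C1_on_real[OF \<sigma>(1,2)]]) simp
    then show ?thesis unfolding h_def[abs_def] comp_def .
  qed
  have h_deriv: "\<exists>D. (h has_derivative D) (at v) \<and> (\<forall>w. \<bar>D w\<bar> \<le> C * (L / r) * norm w)" for v
  proof -
    let ?z = "(1 / r) *\<^sub>R (v - snd c x\<^sub>0)"
    have "(h has_derivative (\<lambda>w. \<sigma>' (N ?z) * ((1 / r) *\<^sub>R N' ?z) w)) (at v)"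
      unfolding h_def[abs_def]
      by (rule has_derivative_compose[OF N_affine_deriv \<sigma>(1)[unfolded has_field_derivative_def]])
    moreover have "\<bar>\<sigma>' (N ?z) * ((1 / r) *\<^sub>R N' ?z) w\<bar> \<le> C * (L / r) * norm w" for w
    proof -
      have "\<bar>((1 / r) *\<^sub>R N' ?z) w\<bar> \<le> norm ((1 / r) *\<^sub>R N' ?z) * norm w"
        using norm_blinfun[of "(1 / r) *\<^sub>R N' ?z" w] by simp
      also have "\<dots> \<le> L / r * norm w"
        using N'_bound[of ?z] r(1) by (intro mult_right_mono) (auto simp: divide_right_mono)
      finally have "\<bar>\<sigma>' (N ?z)\<bar> * \<bar>((1 / r) *\<^sub>R N' ?z) w\<bar> \<le> C * (L / r * norm w)"
        using C[of "N ?z"] N_nonneg[of ?z] N_le[of ?z] C0 by (intro mult_mono) auto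
      then show ?thesis by (simp add: abs_mult mult.assoc)
    qed
    ultimately show ?thesis by blast
  qed
  have h_out: "h v = 0" if "r \<le> norm (v - snd c x\<^sub>0)" for v
    unfolding h_def using that r(1) by (intro \<sigma>(5) N_ge_1) (simp add: norm_scaleR del: scaleR_right_diff_distrib)
  define \<beta> where "\<beta> y = (if y \<in> K then h (snd c y) else 0)" for y
  have K_fst: "K \<subseteq> fst c" using KW W1(3) by blast
  have \<beta>_eq: "\<beta> y = h (snd c y)" if "y \<in> fst c" for y
  proof (cases "y \<in> K")
    case False
    then have "r \<le> norm (snd c y - snd c x\<^sub>0)"
      using r(2)[of "snd c y"] chart_inv_chart[OF cA that] by (force simp: K_def dist_norm)
    then show ?thesis using False by (simp add: \<beta>_def h_out)
  qed (simp add: \<beta>_def)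
  have \<beta>_near: "\<forall>\<^sub>F z in nhds y. \<beta> z = h (snd c z)" if "y \<in> fst c" for y
    using eventually_nhds_in_open[OF chart_open(1)[OF cA] that] by eventually_elim (rule \<beta>_eq)
  have \<beta>_off: "\<forall>\<^sub>F z in nhds y. \<beta> z = 0" if "y \<notin> K" for y
  proof -
    have "\<forall>\<^sub>F z in nhds y. z \<in> - K" using that K by (intro eventually_nhds_in_open) (auto simp: open_Compl)
    then show ?thesis by eventually_elim (simp add: \<beta>_def)
  qed
  have \<beta>_C1: "C1_fun atlas \<beta>"
  proof (rule C1_fun_localI)
    fix y
    show "\<exists>c\<in>charts_at atlas y. \<exists>h T. open T \<and> snd c y \<in> T \<and> C1_on T h \<and> (\<forall>\<^sub>F z in nhds y. \<beta> z = h (snd c z))"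
    proof (cases "y \<in> K")
      case True
      then have "y \<in> fst c" using K_fst by blast
      then have "c \<in> charts_at atlas y" using cA by (simp add: charts_at_def)
      then show ?thesis using h_C1 \<beta>_near[OF \<open>y \<in> fst c\<close>]
        by (intro bexI[of _ c] exI[of _ h] exI[of _ UNIV]) auto
    next
      case False
      obtain c' where "c' \<in> charts_at atlas y" using charts_at_nonempty by blast
      then show ?thesis using \<beta>_off[OF False]
        by (intro bexI[of _ c'] exI[of _ "\<lambda>_. 0"] exI[of _ UNIV]) (auto intro: C1_on_const)
    qed
  qed
  define M where "M = C * (L / r) * (2 / a)"
  have M: "0 \<le> M" using C0 L_nonneg r(1) ab(1) by (simp add: M_def)
  have \<beta>_dn: "dn \<beta> y \<le> M" for y
  proof (cases "y \<in> K")
    case True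
    then have y: "y \<in> fst c" "y \<in> W1" using K_fst KW by auto
    then have cy: "c \<in> charts_at atlas y" using cA by (simp add: charts_at_def)
    obtain D where D: "(h has_derivative D) (at (snd c y))" "\<And>w. \<bar>D w\<bar> \<le> C * (L / r) * norm w"
      using h_deriv by blast
    have "\<forall>\<^sub>F v in nhds (snd c y). h v = (\<beta> \<circ> chart_inv c) v"
      using eventually_chart_inv[OF cy eventually_True]
      by eventually_elim (simp add: \<beta>_eq chart_chart_inv)
    note D\<beta> = has_derivative_cong_nhds[OF D(1) this]
    show ?thesis
    proof (rule dn_le[OF \<beta>_C1 cy D\<beta> M])
      fix w
      have "a * norm w \<le> 2 * cnorm c y w" using ab(2)[of w] W1(4)[OF y(2), of w] by simp
      then have "norm w \<le> 2 / a * cnorm c y w" using ab(1) by (simp add: field_simps)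
      then have "C * (L / r) * norm w \<le> C * (L / r) * (2 / a * cnorm c y w)"
        using C0 L_nonneg r(1) by (intro mult_left_mono) auto
      then show "\<bar>D w\<bar> \<le> M * cnorm c y w" using D(2)[of w] by (simp add: M_def mult.assoc)
    qed
  next
    case False
    obtain c' where c': "c' \<in> charts_at atlas y" using charts_at_nonempty by blast
    have "\<forall>\<^sub>F v in nhds (snd c' y). 0 = (\<beta> \<circ> chart_inv c') v"
      using eventually_chart_inv[OF c' \<beta>_off[OF False]] by eventually_elim simp
    note D\<beta> = has_derivative_cong_nhds[OF has_derivative_const this]
    show ?thesis by (rule dn_le[OF \<beta>_C1 c' D\<beta> M]) (use M cnorm_nonneg[OF c'] in simp)
  qed
  have "\<forall>\<^sub>F y in nhds x\<^sub>0. \<beta> y = 1"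
  proof -
    have "isCont (\<lambda>v. N ((1 / r) *\<^sub>R (v - snd c x\<^sub>0))) (snd c x\<^sub>0)"
      using N_affine_deriv by (rule has_derivative_continuous)
    from order_tendstoD(2)[OF isCont_tendsto_nhds[OF this], of "1/4"]
    have "\<forall>\<^sub>F v in nhds (snd c x\<^sub>0). N ((1 / r) *\<^sub>R (v - snd c x\<^sub>0)) < 1/4" by (simp add: N_0)
    from eventually_chart[OF c this] show ?thesis
      by eventually_elim (simp add: \<beta>_eq h_def \<sigma>(4))
  qed
  moreover have "0 \<le> \<beta> y \<and> \<beta> y \<le> 1" for y using \<sigma>(3) by (simp add: \<beta>_def h_def)
  moreover have "K \<subseteq> W" using KW by blast
  moreover have "\<beta> y = 0" if "y \<notin> K" for y using that by (simp add: \<beta>_def)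
  ultimately show ?thesis
    using \<beta>_C1 K M \<beta>_dn by (intro exI[of _ \<beta>] exI[of _ K] exI[of _ M] conjI) auto
qed

text \<open>Test functions must be C1 on the whole manifold, whereas variational principles deliver
  them in a chart; a bump function keeps the germ and discards the rest.\<close>

lemma C1_extension:
  assumes c: "c \<in> charts_at atlas x" and T: "open T" "snd c x \<in> T" "C1_on T h"
  shows "\<exists>g. C1_fun atlas g \<and> (\<forall>\<^sub>F y in nhds x. g y = h (snd c y))"
proof -
  note cA = charts_atD(1)[OF c]
  have "\<forall>\<^sub>F y in nhds x. y \<in> fst c \<and> snd c y \<in> T" by (rule eventually_chart[OF c eventually_nhds_in_open[OF T(1,2)]])
  then obtain W where W: "open W" "x \<in> W" "\<And>y. y \<in> W \<Longrightarrow> y \<in> fst c \<and> snd c y \<in> T"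
    unfolding eventually_nhds by blast
  obtain \<beta> K where \<beta>: "C1_fun atlas \<beta>" and K: "closed K" "K \<subseteq> W" "\<And>y. y \<notin> K \<Longrightarrow> \<beta> y = 0"
    and \<beta>1: "\<forall>\<^sub>F y in nhds x. \<beta> y = 1"
    using bump_exists[OF W(1,2)] by blast
  define g where "g y = \<beta> y * h (snd c y)" for y
  have "C1_fun atlas g"
  proof (rule C1_fun_localI)
    fix y
    show "\<exists>c\<in>charts_at atlas y. \<exists>h T. open T \<and> snd c y \<in> T \<and> C1_on T h \<and> (\<forall>\<^sub>F z in nhds y. g z = h (snd c z))"
    proof (cases "y \<in> K")
      case True
      then have y: "y \<in> fst c" "snd c y \<in> T" using W(3) K(2) by auto
      then have cy: "c \<in> charts_at atlas y" using cA by (simp add: charts_at_def)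
      have "C1_on (T \<inter> snd c ` fst c) (\<lambda>v. (\<beta> \<circ> chart_inv c) v * h v)"
      proof (rule C1_on_mult)
        show "C1_on (T \<inter> snd c ` fst c) (\<beta> \<circ> chart_inv c)"
          by (rule C1_on_subset[of "snd c ` fst c"]) (use \<beta> cA in \<open>auto simp: C1_fun_def\<close>)
        show "C1_on (T \<inter> snd c ` fst c) h" by (rule C1_on_subset[OF T(3)]) simp
      qed
      moreover have "open (T \<inter> snd c ` fst c)" using T(1) chart_open(2)[OF cA] by blast
      moreover have "\<forall>\<^sub>F z in nhds y. g z = (\<beta> \<circ> chart_inv c) (snd c z) * h (snd c z)"
        using eventually_nhds_in_open[OF chart_open(1)[OF cA] y(1)]
        by eventually_elim (simp add: g_def chart_inv_chart[OF cA])
      ultimately show ?thesis using cy y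
        by (intro bexI[of _ c] exI[of _ "\<lambda>v. (\<beta> \<circ> chart_inv c) v * h v"] exI[of _ "T \<inter> snd c ` fst c"]) auto
    next
      case False
      obtain c' where c': "c' \<in> charts_at atlas y" using charts_at_nonempty by blast
      have "\<forall>\<^sub>F z in nhds y. z \<in> - K" using False K by (intro eventually_nhds_in_open) (auto simp: open_Compl)
      then have "\<forall>\<^sub>F z in nhds y. g z = 0" by eventually_elim (simp add: g_def K(3))
      then show ?thesis using c'
        by (intro bexI[of _ c'] exI[of _ "\<lambda>_. 0"] exI[of _ UNIV]) (auto intro: C1_on_const)
    qed
  qed
  moreover have "\<forall>\<^sub>F y in nhds x. g y = h (snd c y)"
    using \<beta>1 by eventually_elim (simp add: g_def)
  ultimately show ?thesis by blast
qed

text \<open>The last two clauses say that \<open>dn g x\<close> is the least bound for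
  \<open>D\<close>. Later estimates use the dual norm through these clauses alone and thus stay in
  coordinates.\<close>

lemma chart_test_function:
  assumes c: "c \<in> charts_at atlas x" and h: "C1_on UNIV h" "(h has_derivative D) (at (snd c x))"
  shows "\<exists>g. C1_fun atlas g \<and> (\<forall>\<^sub>F y in nhds x. g y = h (snd c y)) \<and> 0 \<le> dn g x \<and>
    (\<forall>v. \<bar>D v\<bar> \<le> dn g x * cnorm c x v) \<and> (\<forall>k\<ge>0. (\<forall>v. \<bar>D v\<bar> \<le> k * cnorm c x v) \<longrightarrow> dn g x \<le> k)"
proof -
  obtain g where g: "C1_fun atlas g" "\<forall>\<^sub>F y in nhds x. g y = h (snd c y)"
    using C1_extension[OF c open_UNIV UNIV_I h(1)] by blast
  have "\<forall>\<^sub>F v in nhds (snd c x). h v = (g \<circ> chart_inv c) v"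
    using eventually_chart_inv[OF c g(2)] by eventually_elim (simp add: chart_chart_inv)
  note D = has_derivative_cong_nhds[OF h(2) this]
  show ?thesis using g dn_nonneg[OF g(1) c D] dn_ge[OF g(1) c D] dn_le[OF g(1) c D]
    by (intro exI[of _ g]) blast
qed

lemma superdifferential_chart_test:
  assumes c: "c \<in> charts_at atlas x" and h: "C1_on UNIV h" "(h has_derivative D) (at (snd c x))"
    and max: "\<forall>\<^sub>F y in nhds x. u y - h (snd c y) \<le> u x - h (snd c x)"
  shows "\<exists>\<Delta>\<in>superdifferential atlas u x. 0 \<le> dual_norm atlas nrm x \<Delta> \<and>
    (\<forall>v. \<bar>D v\<bar> \<le> dual_norm atlas nrm x \<Delta> * cnorm c x v) \<and>
    (\<forall>k\<ge>0. (\<forall>v. \<bar>D v\<bar> \<le> k * cnorm c x v) \<longrightarrow> dual_norm atlas nrm x \<Delta> \<le> k)"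
proof -
  obtain g where g: "C1_fun atlas g" "\<forall>\<^sub>F y in nhds x. g y = h (snd c y)" and
    dn: "0 \<le> dn g x" "\<forall>v. \<bar>D v\<bar> \<le> dn g x * cnorm c x v" "\<forall>k\<ge>0. (\<forall>v. \<bar>D v\<bar> \<le> k * cnorm c x v) \<longrightarrow> dn g x \<le> k"
    using chart_test_function[OF c h] by auto
  have gx: "g x = h (snd c x)" using g(2) by (rule eventually_nhds_x_imp_x)
  have "\<forall>\<^sub>F y in nhds x. u y - g y \<le> u x - g x"
    using g(2) max by eventually_elim (simp add: gx)
  then have "differential atlas g x \<in> superdifferential atlas u x"
    unfolding superdifferential_def using g(1) by blast
  then show ?thesis using dn by blast
qed

lemma subdifferential_chart_test:
  assumes c: "c \<in> charts_at atlas x" and h: "C1_on UNIV h" "(h has_derivative D) (at (snd c x))"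
    and min: "\<forall>\<^sub>F y in nhds x. u x + h (snd c x) \<le> u y + h (snd c y)"
  shows "\<exists>\<Delta>\<in>subdifferential atlas u x. 0 \<le> dual_norm atlas nrm x \<Delta> \<and>
    (\<forall>v. \<bar>D v\<bar> \<le> dual_norm atlas nrm x \<Delta> * cnorm c x v) \<and>
    (\<forall>k\<ge>0. (\<forall>v. \<bar>D v\<bar> \<le> k * cnorm c x v) \<longrightarrow> dual_norm atlas nrm x \<Delta> \<le> k)"
proof -
  have h': "C1_on UNIV (\<lambda>v. (- 1) * h v)" "((\<lambda>v. (- 1) * h v) has_derivative (\<lambda>v. - D v)) (at (snd c x))"
    by (intro C1_on_mult C1_on_const h) (use has_derivative_minus[OF h(2)] in simp)
  obtain g where g: "C1_fun atlas g" "\<forall>\<^sub>F y in nhds x. g y = (- 1) * h (snd c y)" and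
    dn: "0 \<le> dn g x" "\<forall>v. \<bar>D v\<bar> \<le> dn g x * cnorm c x v" "\<forall>k\<ge>0. (\<forall>v. \<bar>D v\<bar> \<le> k * cnorm c x v) \<longrightarrow> dn g x \<le> k"
    using chart_test_function[OF c h'] by auto
  have gx: "g x = - h (snd c x)" using eventually_nhds_x_imp_x[OF g(2)] by simp
  have "\<forall>\<^sub>F y in nhds x. u x - g x \<le> u y - g y"
    using g(2) min by eventually_elim (simp add: gx)
  then have "differential atlas g x \<in> subdifferential atlas u x"
    unfolding subdifferential_def using g(1) by blast
  then show ?thesis using dn by blast
qed

end

section \<open>Slopes of functions of the distance\<close>

context C1_finsler_manifold
begin

lemma eventually_theta_d:
  assumes \<theta>: "(\<theta> has_real_derivative t) (at (d x y))" and \<eta>: "0 < \<eta>"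
  shows "\<forall>\<^sub>F z in nhds x. \<bar>\<theta> (d z y) - \<theta> (d x y) - t * (d z y - d x y)\<bar> \<le> \<eta> * d z x"
proof -
  obtain r where r: "0 < r" "\<And>s. \<bar>s - d x y\<bar> < r \<Longrightarrow> \<bar>\<theta> s - \<theta> (d x y) - t * (s - d x y)\<bar> \<le> \<eta> * \<bar>s - d x y\<bar>"
    using \<theta>[unfolded has_field_derivative_def has_derivative_at_alt] \<eta> by auto
  from eventually_d_less[OF r(1), of x] show ?thesis
  proof eventually_elim
    case (elim z)
    have le: "\<bar>d z y - d x y\<bar> \<le> d z x" by (rule d_abs_triangle)
    then have "\<bar>\<theta> (d z y) - \<theta> (d x y) - t * (d z y - d x y)\<bar> \<le> \<eta> * \<bar>d z y - d x y\<bar>"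
      using elim by (intro r(2)) (simp add: d_sym[of z x])
    also have "\<dots> \<le> \<eta> * d z x" using le \<eta> by (intro mult_left_mono) auto
    finally show ?case .
  qed
qed

text \<open>Near \<open>x\<close> the function
  \<open>\<theta> (d z y) + \<delta> * d z x\<^sub>0\<close> of \<open>z\<close> has Lipschitz
  constant at most \<open>t + \<delta> + \<eta>\<close> at \<open>x\<close>, and \<open>h\<close>
  touches it from below there, so \<open>h\<close> cannot rise faster. The factor
  \<open>1 + \<epsilon>\<close> converts the metric into the chart norm.\<close>

lemma slope_upper:
  assumes c: "c \<in> charts_at atlas x\<^sub>0" and x: "c \<in> charts_at atlas x" and \<epsilon>: "0 < \<epsilon>" and \<eta>: "0 < \<eta>" and \<delta>: "0 \<le> \<delta>"
    and near: "\<forall>\<^sub>F z in nhds x. d z x \<le> (1 + \<epsilon>) * cnorm c x\<^sub>0 (snd c z - snd c x)"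
    and \<theta>: "(\<theta> has_real_derivative t) (at (d x y))" and t: "0 \<le> t"
    and h: "(h has_derivative D) (at (snd c x))"
    and min: "\<forall>\<^sub>F z in nhds x. \<theta> (d x y) + \<delta> * d x x\<^sub>0 - h (snd c x) \<le> \<theta> (d z y) + \<delta> * d z x\<^sub>0 - h (snd c z)"
  shows "\<bar>D v\<bar> \<le> (1 + \<epsilon>) * (t + \<delta> + \<eta>) * cnorm c x\<^sub>0 v"
proof -
  let ?n = "cnorm c x\<^sub>0" and ?k = "(1 + \<epsilon>) * (t + \<delta> + \<eta>)"
  have "\<forall>\<^sub>F z in nhds x. h (snd c z) - h (snd c x) \<le> ?k * ?n (snd c z - snd c x)"
    using min near eventually_theta_d[OF \<theta> \<eta>]
  proof eventually_elim
    case (elim z)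
    have "t * (d z y - d x y) \<le> t * d z x"
      using d_abs_triangle[of z y x] t by (intro mult_left_mono) auto
    moreover have "\<delta> * (d z x\<^sub>0 - d x x\<^sub>0) \<le> \<delta> * d z x"
      using d_abs_triangle[of z x\<^sub>0 x] \<delta> by (intro mult_left_mono) auto
    ultimately have "h (snd c z) - h (snd c x) \<le> (t + \<delta> + \<eta>) * d z x"
      using elim(1,3) by (simp add: algebra_simps)
    also have "\<dots> \<le> (t + \<delta> + \<eta>) * ((1 + \<epsilon>) * ?n (snd c z - snd c x))"
      using elim(2) t \<delta> \<eta> by (intro mult_left_mono) auto
    finally show ?case by (simp add: mult_ac)
  qed
  from eventually_chart_inv[OF x this]
  have ev: "\<forall>\<^sub>F w in nhds (snd c x). h w - h (snd c x) \<le> ?k * ?n (w - snd c x)"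
    by eventually_elim (auto simp: chart_chart_inv)
  have *: "D v \<le> ?k * ?n v" for v
  proof (rule has_derivative_le_of_eventually[OF h])
    have "((\<lambda>t. snd c x + t *\<^sub>R v) \<longlongrightarrow> snd c x) (at_right 0)"
      by (auto intro!: tendsto_eq_intros)
    from eventually_compose_filterlim[OF ev this] eventually_at_right_less[of "0::real"]
    show "\<forall>\<^sub>F t in at_right 0. h (snd c x + t *\<^sub>R v) - h (snd c x) \<le> ?k * ?n v * t"
      by eventually_elim (simp add: cnorm_scaleR[OF c] mult_ac)
  qed
  have "D (- v) = - D v" using linear_neg[OF has_derivative_linear[OF h]] by simp
  then show ?thesis using *[of v] *[of "- v"] by (simp add: cnorm_minus[OF c] abs_le_iff)
qed

text \<open>Moving from \<open>x\<close> towards \<open>y\<close> along an almost minimizing path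
  lowers \<open>d z y\<close> at nearly unit rate, so \<open>\<theta> (d z y)\<close> drops at
  nearly the rate \<open>t\<close>. As \<open>h\<close> touches from below it has to drop as well,
  and this bounds its slope from below by \<open>t\<close> up to errors.\<close>

lemma slope_lower:
  assumes c: "c \<in> charts_at atlas x\<^sub>0" and x: "c \<in> charts_at atlas x" and \<epsilon>: "0 < \<epsilon>" and \<eta>: "0 < \<eta>" and \<delta>: "0 \<le> \<delta>"
    and near: "\<forall>\<^sub>F z in nhds x. cnorm c x\<^sub>0 (snd c z - snd c x) \<le> (1 + \<epsilon>) * d z x"
    and \<theta>: "(\<theta> has_real_derivative t) (at (d x y))" and t: "0 \<le> t" and xy: "x \<noteq> y"
    and h: "(h has_derivative D) (at (snd c x))"
    and min: "\<forall>\<^sub>F z in nhds x. \<theta> (d x y) + \<delta> * d x x\<^sub>0 - h (snd c x) \<le> \<theta> (d z y) + \<delta> * d z x\<^sub>0 - h (snd c z)"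
    and k: "0 \<le> k" "\<And>v. \<bar>D v\<bar> \<le> k * cnorm c x\<^sub>0 v"
  shows "t - \<delta> - \<eta> \<le> (1 + \<epsilon>) * k"
proof -
  let ?n = "cnorm c x\<^sub>0"
  obtain a b where a: "0 < a" "\<And>v. a * norm v \<le> ?n v" by (rule cnorm_equivalent[OF c]) blast
  \<comment> \<open>Chosen so that the first-order error
    \<open>\<mu> * norm (snd c z - snd c x)\<close> of \<open>h\<close> is at most
    \<open>\<eta> / 3 * d z x\<close>. Of the three parts of \<open>\<eta>\<close> the others go to
    the error of \<open>\<theta>\<close> and to the imperfect geodesic.\<close>
  define \<mu> where "\<mu> = a * \<eta> / (3 * (1 + \<epsilon>))"
  have \<mu>: "0 < \<mu>" using a \<eta> \<epsilon> by (simp add: \<mu>_def)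
  have "\<forall>\<^sub>F w in nhds (snd c x). norm (h w - h (snd c x) - D (w - snd c x)) \<le> \<mu> * norm (w - snd c x)"
    using h[unfolded has_derivative_at_alt] \<mu> unfolding eventually_nhds_metric dist_norm by blast
  note h_ev = eventually_chart[OF x this]
  have \<theta>_ev: "\<forall>\<^sub>F z in nhds x. \<bar>\<theta> (d z y) - \<theta> (d x y) - t * (d z y - d x y)\<bar> \<le> \<eta> / 3 * d z x"
    by (rule eventually_theta_d[OF \<theta>]) (use \<eta> in simp)
  from h_ev near min \<theta>_ev
  have "\<forall>\<^sub>F z in nhds x. - ((1 + \<epsilon>) * k + \<eta> / 3 + \<delta>) * d z x \<le> t * (d z y - d x y) + \<eta> / 3 * d z x"
  proof eventually_elim
    case (elim z)
    let ?w = "snd c z - snd c x"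
    have "\<mu> * norm ?w \<le> \<mu> / a * ?n ?w" using a(2)[of ?w] \<mu> a(1) by (simp add: field_simps)
    also have "\<dots> \<le> \<mu> / a * ((1 + \<epsilon>) * d z x)" using elim(2) \<mu> a(1) by (intro mult_left_mono) auto
    also have "\<dots> = \<eta> / 3 * d z x" using a(1) \<epsilon> by (simp add: \<mu>_def divide_simps)
    finally have 2: "\<mu> * norm ?w \<le> \<eta> / 3 * d z x" .
    have 3: "k * ?n ?w \<le> k * ((1 + \<epsilon>) * d z x)" using elim(2) k(1) by (intro mult_left_mono) auto
    have "\<delta> * (d z x\<^sub>0 - d x x\<^sub>0) \<le> \<delta> * d z x"
      using d_abs_triangle[of z x\<^sub>0 x] \<delta> by (intro mult_left_mono) auto
    moreover have "- (\<mu> * norm ?w) \<le> h (snd c z) - h (snd c x) - D ?w" using elim(1) by (simp add: abs_le_iff)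
    moreover have "- (k * ?n ?w) \<le> D ?w" using k(2)[of ?w] by (simp add: abs_le_iff)
    moreover have "\<theta> (d z y) - \<theta> (d x y) \<le> t * (d z y - d x y) + \<eta> / 3 * d z x" using elim(4) by linarith
    ultimately have "- (k * ((1 + \<epsilon>) * d z x)) - \<eta> / 3 * d z x - \<delta> * d z x \<le> t * (d z y - d x y) + \<eta> / 3 * d z x"
      using elim(3) 2 3 unfolding right_diff_distrib by linarith
    then show ?case by (simp add: algebra_simps)
  qed
  then obtain r where r: "0 < r" "\<And>z. d x z < r \<Longrightarrow> - ((1 + \<epsilon>) * k + \<eta> / 3 + \<delta>) * d z x \<le> t * (d z y - d x y) + \<eta> / 3 * d z x"
    unfolding eventually_nhds_d by blast
  \<comment> \<open>The intermediate point must stay in the neighbourhood just found and not pass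
    \<open>y\<close>. The slack is taken proportional to \<open>s\<close>, so that it survives
    division by \<open>s\<close>.\<close>
  define s where "s = min (r / 2) (d x y)"
  have s: "0 < s" "s < r" "s \<le> d x y" using r(1) d_pos[OF xy] by (auto simp: s_def)
  define e where "e = \<eta> / (3 * (t + 1))"
  have e: "0 < e" "t * e \<le> \<eta> / 3" using \<eta> t by (auto simp: e_def field_simps)
  obtain z where z: "d x z = s" "d z y \<le> d x y - s + s * e"
    using d_intermediate[of s x y "s * e"] s e by auto
  have "- ((1 + \<epsilon>) * k + \<eta> / 3 + \<delta>) * s \<le> t * (d z y - d x y) + \<eta> / 3 * s"
    using r(2)[of z] z(1) s(2) d_sym[of z x] by simp
  also have "t * (d z y - d x y) \<le> t * (s * e - s)" using z(2) t by (intro mult_left_mono) auto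
  also have "t * (s * e - s) = (t * e) * s - t * s" by (simp add: algebra_simps)
  also have "(t * e) * s \<le> \<eta> / 3 * s" using e(2) s(1) by (intro mult_right_mono) auto
  finally have "t * s \<le> ((1 + \<epsilon>) * k + \<delta> + \<eta>) * s" by (simp add: algebra_simps)
  then have "t \<le> (1 + \<epsilon>) * k + \<delta> + \<eta>" using s(1) by simp
  then show ?thesis by simp
qed

text \<open>Two nearby points occur: \<open>E\<close> and \<open>h\<close> belong to
  \<open>x\<close>, where the distance is tested, while \<open>P\<close>, \<open>D\<close> and the
  norm \<open>m\<close> belong to the point where the semicontinuous function is tested. Both norms
  are compared with the one at \<open>x\<^sub>0\<close>. The term
  \<open>2 * \<delta> * d z x\<^sub>0\<close> shifts the slope by at most
  \<open>2 * \<delta>\<close>, and the condition on \<open>\<epsilon>\<close> fits all distortions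
  into another \<open>\<delta>\<close>.\<close>

lemma slope_estimate:
  assumes c: "c \<in> charts_at atlas x\<^sub>0" and \<epsilon>: "0 < \<epsilon>" "\<epsilon> \<le> 1" "\<epsilon> * (10 + 3 * T + 12 * \<delta>) \<le> \<delta>" and \<delta>: "0 < \<delta>" and T: "0 \<le> T"
    and x: "c \<in> charts_at atlas x"
    and near: "\<forall>\<^sub>F z in nhds x. cnorm c x\<^sub>0 (snd c z - snd c x) \<le> (1 + \<epsilon>) * d z x"
      "\<forall>\<^sub>F z in nhds x. d z x \<le> (1 + \<epsilon>) * cnorm c x\<^sub>0 (snd c z - snd c x)"
    and \<theta>: "(\<theta> has_real_derivative t) (at (d x y))" and t: "0 \<le> t" "\<bar>t - T\<bar> \<le> \<epsilon>" and xy: "x \<noteq> y \<or> t = 0"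
    and h: "(h has_derivative E) (at (snd c x))"
    and min: "\<forall>\<^sub>F z in nhds x. \<theta> (d x y) + 2 * \<delta> * d x x\<^sub>0 - h (snd c x) \<le> \<theta> (d z y) + 2 * \<delta> * d z x\<^sub>0 - h (snd c z)"
    and DE: "\<And>v. \<bar>D v - E v\<bar> \<le> \<epsilon> * cnorm c x\<^sub>0 v"
    and m: "\<And>v. cnorm c x\<^sub>0 v \<le> (1 + \<epsilon>) * m v" "\<And>v. m v \<le> (1 + \<epsilon>) * cnorm c x\<^sub>0 v"
    and P: "0 \<le> P" "\<And>v. \<bar>D v\<bar> \<le> P * m v" "\<And>k. 0 \<le> k \<Longrightarrow> (\<And>v. \<bar>D v\<bar> \<le> k * m v) \<Longrightarrow> P \<le> k"
  shows "\<bar>P - T\<bar> \<le> 4 * \<delta>"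
proof -
  let ?n = "cnorm c x\<^sub>0"
  have \<delta>2: "0 \<le> 2 * \<delta>" using \<delta> by simp
  note E = slope_upper[OF c x \<epsilon>(1) \<epsilon>(1) \<delta>2 near(2) \<theta> t(1) h min]
  have \<epsilon>2: "\<epsilon> * \<epsilon> \<le> \<epsilon>" using \<epsilon> by (simp add: mult_left_le)
  define Q where "Q = (1 + \<epsilon>) * (t + 2 * \<delta> + \<epsilon>) + \<epsilon>"
  have Q: "0 \<le> Q" using t \<delta> \<epsilon> by (simp add: Q_def)
  have up: "P \<le> Q * (1 + \<epsilon>)"
  proof (rule P(3))
    show "0 \<le> Q * (1 + \<epsilon>)" using Q \<epsilon> by simp
    fix v
    have "\<bar>D v\<bar> \<le> Q * ?n v" using E[of v] DE[of v] by (simp add: Q_def distrib_right)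
    also have "\<dots> \<le> Q * ((1 + \<epsilon>) * m v)" using m(1) Q by (intro mult_left_mono) auto
    finally show "\<bar>D v\<bar> \<le> Q * (1 + \<epsilon>) * m v" by (simp add: mult.assoc)
  qed
  have low: "t - 2 * \<delta> - \<epsilon> \<le> (1 + \<epsilon>) * (P * (1 + \<epsilon>) + \<epsilon>)"
  proof (cases "t = 0")
    case True
    have "0 \<le> (1 + \<epsilon>) * (P * (1 + \<epsilon>) + \<epsilon>)" using P(1) \<epsilon> by simp
    then show ?thesis using True \<delta> \<epsilon> by linarith
  next
    case False
    show ?thesis
    proof (rule slope_lower[OF c x \<epsilon>(1) \<epsilon>(1) \<delta>2 near(1) \<theta> t(1) _ h min])
      show "x \<noteq> y" using False xy by simp
      show "0 \<le> P * (1 + \<epsilon>) + \<epsilon>" using P(1) \<epsilon> by simp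
      fix v
      have "P * m v \<le> P * ((1 + \<epsilon>) * ?n v)" using m(2) P(1) by (intro mult_left_mono) auto
      then show "\<bar>E v\<bar> \<le> (P * (1 + \<epsilon>) + \<epsilon>) * ?n v"
        using P(2)[of v] DE[of v] by (simp add: algebra_simps)
    qed
  qed
  define e2 where "e2 = (1 + \<epsilon>) * (1 + \<epsilon>)"
  have e2: "1 \<le> e2" "e2 \<le> 1 + 3 * \<epsilon>" using \<epsilon> \<epsilon>2 by (auto simp: e2_def algebra_simps)
  have e1: "\<epsilon> * (1 + \<epsilon>) \<le> 2 * \<epsilon>" using \<epsilon>2 by (simp add: algebra_simps)
  have "P \<le> e2 * (t + 2 * \<delta> + \<epsilon>) + \<epsilon> * (1 + \<epsilon>)" using up by (simp add: Q_def e2_def algebra_simps)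
  also have "e2 * (t + 2 * \<delta> + \<epsilon>) \<le> (1 + 3 * \<epsilon>) * (T + 2 * \<delta> + 2 * \<epsilon>)"
    using e2 t \<delta> \<epsilon> by (intro mult_mono) auto
  also have "(1 + 3 * \<epsilon>) * (T + 2 * \<delta> + 2 * \<epsilon>) \<le> T + 2 * \<delta> + \<epsilon> * (8 + 3 * T + 6 * \<delta>)"
    using \<epsilon>2 by (simp add: algebra_simps)
  finally have "P \<le> T + 2 * \<delta> + \<epsilon> * (10 + 3 * T + 6 * \<delta>)" using e1 by (simp add: algebra_simps)
  moreover have "\<epsilon> * (10 + 3 * T + 6 * \<delta>) \<le> \<epsilon> * (10 + 3 * T + 12 * \<delta>)" using \<epsilon> \<delta> by (intro mult_left_mono) auto
  ultimately have P_up: "P \<le> T + 3 * \<delta>" using \<epsilon>(3) by linarith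
  have "T - 2 * \<delta> - 2 * \<epsilon> \<le> e2 * P + \<epsilon> * (1 + \<epsilon>)" using low t by (simp add: e2_def algebra_simps)
  also have "e2 * P \<le> (1 + 3 * \<epsilon>) * P" using e2 P(1) by (intro mult_right_mono) auto
  also have "(1 + 3 * \<epsilon>) * P \<le> P + 3 * \<epsilon> * (T + 3 * \<delta>)" using P_up \<epsilon> by (simp add: distrib_right mult_left_mono)
  finally have "T - 2 * \<delta> - \<epsilon> * (4 + 3 * T + 9 * \<delta>) \<le> P" using e1 by (simp add: algebra_simps)
  moreover have "\<epsilon> * (4 + 3 * T + 9 * \<delta>) \<le> \<epsilon> * (10 + 3 * T + 12 * \<delta>)" using \<epsilon> \<delta> by (intro mult_left_mono) auto
  ultimately show ?thesis using P_up \<epsilon>(3) \<delta> by (simp add: abs_le_iff)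
qed

end

section \<open>Doubling of variables\<close>

lemma upper_semicontinuousD:
  "upper_semicontinuous u \<Longrightarrow> u x < r \<Longrightarrow> \<forall>\<^sub>F y in nhds x. u y < r"
  unfolding upper_semicontinuous_def using eventually_nhds_in_open[of "{y. u y < r}" x] by simp

lemma lower_semicontinuousD:
  "lower_semicontinuous u \<Longrightarrow> r < u x \<Longrightarrow> \<forall>\<^sub>F y in nhds x. r < u y"
  unfolding lower_semicontinuous_def using eventually_nhds_in_open[of "{y. r < u y}" x] by simp

section \<open>Ekeland's principle for the penalized difference on the product\<close>

context complete_C1_finsler_manifold
begin

lemma d_Metric_space: "Metric_space UNIV d"
  by unfold_locales (auto simp: d_nonneg d_eq_0 d_triangle intro: d_sym)

lemma d_complete:
  assumes "\<And>n. d (x n) (x (Suc n)) \<le> (1 / 2) ^ n"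
  shows "\<exists>l. x \<longlonglongrightarrow> l"
proof -
  interpret M: Metric_space UNIV d by (rule d_Metric_space)
  have step: "d (x n) (x (n + k)) \<le> 2 * (1 / 2) ^ n - 2 * (1 / 2) ^ (n + k)" for n k
  proof (induction k)
    case (Suc k)
    show ?case using d_triangle[of "x n" "x (n + Suc k)" "x (n + k)"] Suc assms[of "n + k"] by simp
  qed (simp add: d_refl)
  have le: "d (x m) (x n) \<le> 2 * (1 / 2) ^ N" if "N \<le> m" "N \<le> n" for m n N
  proof -
    have "d (x m) (x n) \<le> 2 * (1 / 2) ^ min m n"
    proof (cases "m \<le> n")
      case True
      have "0 \<le> (1 / 2 :: real) ^ n" by simp
      then show ?thesis using step[of m "n - m"] True by (simp add: min_def del: zero_le_power)
    next
      case False
      have "0 \<le> (1 / 2 :: real) ^ m" by simp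
      then show ?thesis using step[of n "m - n"] False d_sym[of "x m" "x n"] by (simp add: min_def del: zero_le_power)
    qed
    also have "\<dots> \<le> 2 * (1 / 2) ^ N" using that by (intro mult_left_mono power_decreasing) auto
    finally show ?thesis .
  qed
  have "M.MCauchy x"
    unfolding M.MCauchy_def
  proof (intro conjI allI impI)
    fix e :: real assume "0 < e"
    then obtain N where N: "(1 / 2 :: real) ^ N < e / 2" using real_arch_pow_inv[of "e / 2" "1 / 2"] by auto
    have "d (x n) (x n') < e" if "N \<le> n" "N \<le> n'" for n n'
      using le[OF that] N by simp
    then show "\<exists>N. \<forall>n n'. N \<le> n \<longrightarrow> N \<le> n' \<longrightarrow> d (x n) (x n') < e" by blast
  qed simp
  then obtain l where "limitin M.mtopology x l sequentially"
    using complete unfolding M.mcomplete_def by blast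
  then have "(\<lambda>n. d l (x n)) \<longlonglongrightarrow> 0"
    unfolding M.limitin_metric tendsto_iff by (simp add: d_nonneg d_sym[of l])
  then show ?thesis unfolding tendsto_d_iff[symmetric] by blast
qed

text \<open>One perturbation yields both conclusions. The first compares with distant points at a
  fixed cost and controls the value; the second has a cost that vanishes at the minimizer and is the
  starting point of the local analysis.\<close>

lemma ekeland:
  fixes u v :: "'a \<Rightarrow> real" and \<theta> :: "real \<Rightarrow> real"
  assumes u: "upper_semicontinuous u" "\<And>x. u x \<le> U" and v: "lower_semicontinuous v" "\<And>y. V \<le> v y"
    and \<theta>: "continuous_on UNIV \<theta>" "\<And>s. 0 \<le> s \<Longrightarrow> 0 \<le> \<theta> s" and \<delta>: "0 < \<delta>"
  shows "\<exists>x\<^sub>0 y\<^sub>0. \<forall>x y. v y\<^sub>0 - u x\<^sub>0 + \<theta> (d x\<^sub>0 y\<^sub>0) \<le> v y - u x + \<theta> (d x y) + \<delta> \<and>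
    v y\<^sub>0 - u x\<^sub>0 + \<theta> (d x\<^sub>0 y\<^sub>0) \<le> v y - u x + \<theta> (d x y) + \<delta> * (d x x\<^sub>0 + d y y\<^sub>0)"
proof -
  define f where "f z = v (snd z) - u (fst z) + \<theta> (d (fst z) (snd z))" for z
  define D where "D z w = d (fst z) (fst w) + d (snd z) (snd w)" for z w :: "'a \<times> 'a"
  define \<rho> where "\<rho> n p z = min 1 (2 ^ n * D p z)" for n :: nat and p z
  \<comment> \<open>The perturbation is bounded by \<open>2 * c\<close>, and its Lipschitz constant
    with respect to \<open>D\<close> is also at most \<open>2 * c\<close>, because
    \<open>\<rho> n\<close> has constant \<open>2 ^ n\<close> and weight
    \<open>c / 4 ^ n\<close>.\<close>
  define c where "c = \<delta> / 2"
  have c: "0 < c" using \<delta> by (simp add: c_def)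
  have D0: "0 \<le> D z w" for z w unfolding D_def using d_nonneg by (simp add: add_nonneg_nonneg)
  have D_tri: "D p z \<le> D p w + D z w" for p z w
    using d_triangle[of "fst p" "fst z" "fst w"] d_triangle[of "snd p" "snd z" "snd w"]
      d_sym[of "fst z" "fst w"] d_sym[of "snd z" "snd w"] by (simp add: D_def)
  have \<rho>01: "0 \<le> \<rho> n p z" "\<rho> n p z \<le> 1" for n p z unfolding \<rho>_def using D0 by auto
  have "\<exists>p. \<exists>l\<in>UNIV. \<forall>x\<in>UNIV. f l + (\<Sum>n. c / 4 ^ n * \<rho> n (p n) l) \<le> f x + (\<Sum>n. c / 4 ^ n * \<rho> n (p n) x)"
  proof (rule gauge_variational_principle[where m = "V - U" and M = 1])
    show "V - U \<le> f x" for x unfolding f_def using u(2)[of "fst x"] v(2)[of "snd x"] \<theta>(2)[OF d_nonneg, of "fst x" "snd x"] by linarith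
    show "\<rho> n p p = 0" for n p by (simp add: \<rho>_def D_def d_refl)
    show "continuous_on UNIV (\<rho> n p)" for n p
      unfolding \<rho>_def D_def continuous_on_def
      by (intro ballI tendsto_min tendsto_const tendsto_mult tendsto_add tendsto_d tendsto_fst tendsto_snd tendsto_ident_at)
  next
    fix z :: "nat \<Rightarrow> 'a \<times> 'a"
    assume "\<And>n. \<rho> n (z n) (z (Suc n)) < 1"
    then have "2 ^ n * D (z n) (z (Suc n)) < 1" for n unfolding \<rho>_def by (simp add: min_less_iff_disj)
    then have le: "D (z n) (z (Suc n)) \<le> (1 / 2) ^ n" for n
      by (simp add: power_one_over pos_le_divide_eq mult.commute less_imp_le)
    have "d (fst (z n)) (fst (z (Suc n))) \<le> (1 / 2) ^ n" "d (snd (z n)) (snd (z (Suc n))) \<le> (1 / 2) ^ n" for n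
      using le[of n] d_nonneg[of "fst (z n)" "fst (z (Suc n))"] d_nonneg[of "snd (z n)" "snd (z (Suc n))"]
      unfolding D_def by linarith+
    then obtain l1 l2 where "(\<lambda>n. fst (z n)) \<longlonglongrightarrow> l1" "(\<lambda>n. snd (z n)) \<longlonglongrightarrow> l2"
      using d_complete[of "\<lambda>n. fst (z n)"] d_complete[of "\<lambda>n. snd (z n)"] by blast
    then have "(\<lambda>n. (fst (z n), snd (z n))) \<longlonglongrightarrow> (l1, l2)" by (rule tendsto_Pair)
    then show "\<exists>l\<in>UNIV. z \<longlonglongrightarrow> l" by auto
  next
    fix z :: "nat \<Rightarrow> 'a \<times> 'a" and l and e :: real
    assume lim: "z \<longlonglongrightarrow> l" and e: "0 < e"
    have l1: "(\<lambda>n. fst (z n)) \<longlonglongrightarrow> fst l" and l2: "(\<lambda>n. snd (z n)) \<longlonglongrightarrow> snd l"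
      using lim by (rule tendsto_fst, rule tendsto_snd)
    have 1: "\<forall>\<^sub>F n in sequentially. u (fst (z n)) < u (fst l) + e / 3"
      by (rule eventually_compose_filterlim[OF upper_semicontinuousD[OF u(1)] l1]) (use e in simp)
    have 2: "\<forall>\<^sub>F n in sequentially. v (snd l) - e / 3 < v (snd (z n))"
      by (rule eventually_compose_filterlim[OF lower_semicontinuousD[OF v(1)] l2]) (use e in simp)
    have "(\<lambda>n. \<theta> (d (fst (z n)) (snd (z n)))) \<longlonglongrightarrow> \<theta> (d (fst l) (snd l))"
      by (rule continuous_on_tendsto_compose[OF \<theta>(1) tendsto_d[OF l1 l2]]) auto
    then have 3: "\<forall>\<^sub>F n in sequentially. \<theta> (d (fst l) (snd l)) - e / 3 < \<theta> (d (fst (z n)) (snd (z n)))"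
      by (rule order_tendstoD(1)) (use e in simp)
    from 1 2 3 show "\<forall>\<^sub>F n in sequentially. f l < f (z n) + e"
      by eventually_elim (simp add: f_def)
  qed (use c \<rho>01 in auto)
  then obtain p l where l: "\<And>x. f l + (\<Sum>n. c / 4 ^ n * \<rho> n (p n) l) \<le> f x + (\<Sum>n. c / 4 ^ n * \<rho> n (p n) x)" by blast
  have g2: "summable (\<lambda>n. k * (1 / 2) ^ n)" "(\<Sum>n. k * (1 / 2) ^ n) = 2 * k" for k :: real
    using suminf_mult[of "\<lambda>n. (1 / 2 :: real) ^ n" k] by (auto simp: suminf_geometric intro!: summable_mult summable_geometric)
  have summ: "summable (\<lambda>n. c / 4 ^ n * \<rho> n (p n) x)" for x
  proof (rule summable_comparison_test'[OF g2(1)[of c]])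
    fix n
    have "c / 4 ^ n * \<rho> n (p n) x \<le> c / 2 ^ n * 1"
      using c \<rho>01 by (intro mult_mono divide_left_mono power_mono) auto
    then show "norm (c / 4 ^ n * \<rho> n (p n) x) \<le> c * (1 / 2) ^ n"
      using c \<rho>01 by (simp add: power_one_over)
  qed
  have le1: "f l \<le> f x + \<delta>" and le2: "f l \<le> f x + \<delta> * D x l" for x
  proof -
    have "c / 4 ^ n * \<rho> n (p n) x \<le> c * (1 / 2) ^ n + c / 4 ^ n * \<rho> n (p n) l" for n
    proof -
      have "c / 4 ^ n * \<rho> n (p n) x \<le> c / 2 ^ n * 1"
        using c \<rho>01 by (intro mult_mono divide_left_mono power_mono) auto
      moreover have "0 \<le> c / 4 ^ n * \<rho> n (p n) l" using c \<rho>01 by simp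
      ultimately show ?thesis by (simp add: power_one_over)
    qed
    then have "(\<Sum>n. c / 4 ^ n * \<rho> n (p n) x) \<le> (\<Sum>n. c * (1 / 2) ^ n + c / 4 ^ n * \<rho> n (p n) l)"
      by (intro suminf_le summ summable_add g2)
    also have "\<dots> = 2 * c + (\<Sum>n. c / 4 ^ n * \<rho> n (p n) l)"
      using suminf_add[OF g2(1)[of c] summ[of l]] g2(2)[of c] by simp
    finally show "f l \<le> f x + \<delta>" using l[of x] by (simp add: c_def)
    have "c / 4 ^ n * \<rho> n (p n) x \<le> c * D x l * (1 / 2) ^ n + c / 4 ^ n * \<rho> n (p n) l" for n
    proof -
      have "2 ^ n * D (p n) x \<le> 2 ^ n * D (p n) l + 2 ^ n * D x l"
        using mult_left_mono[OF D_tri[of "p n" x l], of "2 ^ n"] by (simp add: distrib_left)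
      moreover have "0 \<le> 2 ^ n * D x l" using D0 by simp
      ultimately have "\<rho> n (p n) x \<le> \<rho> n (p n) l + 2 ^ n * D x l"
        unfolding \<rho>_def by linarith
      then have "c / 4 ^ n * \<rho> n (p n) x \<le> c / 4 ^ n * (\<rho> n (p n) l + 2 ^ n * D x l)"
        using c by (intro mult_left_mono) auto
      also have "\<dots> = c / 4 ^ n * \<rho> n (p n) l + c * D x l * (2 ^ n / 4 ^ n)" by (simp add: distrib_left)
      also have "(2 ^ n / 4 ^ n :: real) = (1 / 2) ^ n" by (simp flip: power_divide)
      finally show ?thesis by simp
    qed
    then have "(\<Sum>n. c / 4 ^ n * \<rho> n (p n) x) \<le> (\<Sum>n. c * D x l * (1 / 2) ^ n + c / 4 ^ n * \<rho> n (p n) l)"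
      by (intro suminf_le summ summable_add g2)
    also have "\<dots> = 2 * (c * D x l) + (\<Sum>n. c / 4 ^ n * \<rho> n (p n) l)"
      using suminf_add[OF g2(1)[of "c * D x l"] summ[of l]] g2(2)[of "c * D x l"] by simp
    finally show "f l \<le> f x + \<delta> * D x l" using l[of x] by (simp add: c_def)
  qed
  show ?thesis
    using le1 le2 by (intro exI[of _ "fst l"] exI[of _ "snd l"]) (auto simp: f_def D_def)
qed

end

section \<open>Almost isometric chart balls\<close>

context C1_finsler_manifold
begin

text \<open>Rephrases \<open>local_structure\<close> and (P2) on a ball of the norm of the model
  space, the setting of \<open>fuzzy_sum_rule\<close>.\<close>

lemma chart_window:
  assumes c: "c \<in> charts_at atlas x\<^sub>0" and \<epsilon>: "0 < \<epsilon>" and V: "open V" "x\<^sub>0 \<in> V"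
  shows "\<exists>r a b. 0 < r \<and> 0 < a \<and> 0 < b \<and>
    (\<forall>v. a * norm v \<le> cnorm c x\<^sub>0 v) \<and> (\<forall>v. cnorm c x\<^sub>0 v \<le> b * norm v) \<and>
    (\<forall>z\<in>cball (snd c x\<^sub>0) r. z \<in> snd c ` fst c \<and> chart_inv c z \<in> V \<and> c \<in> charts_at atlas (chart_inv c z) \<and> snd c (chart_inv c z) = z) \<and>
    (\<forall>z\<in>cball (snd c x\<^sub>0) r. \<forall>w\<in>cball (snd c x\<^sub>0) r.
       cnorm c x\<^sub>0 (z - w) \<le> (1 + \<epsilon>) * d (chart_inv c z) (chart_inv c w) \<and>
       d (chart_inv c z) (chart_inv c w) \<le> (1 + \<epsilon>) * cnorm c x\<^sub>0 (z - w)) \<and>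
    (\<forall>z\<in>cball (snd c x\<^sub>0) r. \<forall>v. cnorm c x\<^sub>0 v \<le> (1 + \<epsilon>) * cnorm c (chart_inv c z) v \<and>
       cnorm c (chart_inv c z) v \<le> (1 + \<epsilon>) * cnorm c x\<^sub>0 v)"
proof -
  note cA = charts_atD(1)[OF c]
  let ?n = "cnorm c x\<^sub>0"
  obtain W where W: "open W" "x\<^sub>0 \<in> W" "W \<subseteq> fst c"
    "\<And>x v. x \<in> W \<Longrightarrow> ?n v \<le> (1 + \<epsilon>) * cnorm c x v"
    "\<And>x v. x \<in> W \<Longrightarrow> cnorm c x v \<le> (1 + \<epsilon>) * ?n v"
    by (rule cnorm_palais[OF c \<epsilon>]) blast
  obtain a b where ab: "0 < a" "0 < b" "\<And>v. a * norm v \<le> ?n v" "\<And>v. ?n v \<le> b * norm v"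
    by (rule cnorm_equivalent[OF c]) blast
  obtain s where s: "0 < s" "\<forall>v. ?n (v - snd c x\<^sub>0) < s \<longrightarrow> v \<in> snd c ` fst c \<and> chart_inv c v \<in> W \<inter> V"
    "\<forall>x y. x \<in> fst c \<and> ?n (snd c x - snd c x\<^sub>0) < s \<and> y \<in> fst c \<and> ?n (snd c y - snd c x\<^sub>0) < s \<longrightarrow>
       ?n (snd c x - snd c y) \<le> (1 + \<epsilon>) * d x y \<and> d x y \<le> (1 + \<epsilon>) * ?n (snd c x - snd c y)"
    using local_structure[OF c \<epsilon> open_Int[OF W(1) V(1)]] W(2) V(2) by auto
  \<comment> \<open>Gives chart norm at most \<open>b * r = s / 2\<close> on the closed
    ball.\<close>
  define r where "r = s / (2 * b)"
  have ns: "?n (z - snd c x\<^sub>0) < s" if "z \<in> cball (snd c x\<^sub>0) r" for z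
  proof -
    have "?n (z - snd c x\<^sub>0) \<le> b * norm (z - snd c x\<^sub>0)" by (rule ab(4))
    also have "\<dots> \<le> b * r" using that ab(2) by (intro mult_left_mono) (auto simp: dist_norm norm_minus_commute)
    also have "\<dots> < s" using ab(2) s(1) by (simp add: r_def)
    finally show ?thesis .
  qed
  have in_chart: "z \<in> snd c ` fst c" "chart_inv c z \<in> W \<inter> V" "chart_inv c z \<in> fst c" "snd c (chart_inv c z) = z"
    if "z \<in> cball (snd c x\<^sub>0) r" for z
  proof -
    show z: "z \<in> snd c ` fst c" "chart_inv c z \<in> W \<inter> V" using s(2) ns[OF that] by auto
    show "chart_inv c z \<in> fst c" "snd c (chart_inv c z) = z"
      by (rule chart_inv_in[OF z(1)], rule chart_chart_inv[OF z(1)])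
  qed
  have "c \<in> charts_at atlas (chart_inv c z)" if "z \<in> cball (snd c x\<^sub>0) r" for z
    using in_chart(3)[OF that] cA by (simp add: charts_at_def)
  moreover have "?n (z - w) \<le> (1 + \<epsilon>) * d (chart_inv c z) (chart_inv c w) \<and>
       d (chart_inv c z) (chart_inv c w) \<le> (1 + \<epsilon>) * ?n (z - w)"
    if z: "z \<in> cball (snd c x\<^sub>0) r" and w: "w \<in> cball (snd c x\<^sub>0) r" for z w
    using s(3)[rule_format, of "chart_inv c z" "chart_inv c w"] in_chart[OF z] in_chart[OF w] ns[OF z] ns[OF w] by simp
  moreover have "0 < r" using s(1) ab(2) by (simp add: r_def)
  ultimately show ?thesis
    using ab in_chart W(4,5) by (intro exI[of _ r] exI[of _ a] exI[of _ b] conjI ballI allI) auto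
qed

lemma eventually_chart_ball:
  assumes c: "c \<in> charts_at atlas (chart_inv c z)" and z: "snd c (chart_inv c z) = z" "z \<in> ball p r"
  shows "\<forall>\<^sub>F w in nhds (chart_inv c z). w \<in> fst c \<and> snd c w \<in> ball p r \<and> chart_inv c (snd c w) = w"
proof -
  have "\<forall>\<^sub>F v in nhds (snd c (chart_inv c z)). v \<in> ball p r"
    using z by (intro eventually_nhds_in_open) auto
  from eventually_chart[OF c this] show ?thesis
    by eventually_elim (simp add: chart_inv_chart[OF charts_atD(1)[OF c]])
qed

lemma d_lipschitz: "\<bar>d x y - d x' y'\<bar> \<le> d x x' + d y y'"
  using d_abs_triangle[of x y x'] d_abs_triangle[of y x' y'] d_sym[of x' y] d_sym[of x' y'] by linarith

end

section \<open>Sub- and superdifferentials near an Ekeland point\<close>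

context bumpable_finsler_manifold
begin

text \<open>The case \<open>x\<^sub>0 = y\<^sub>0\<close> with \<open>k > 0\<close> is excluded
  since the penalty then has the vertex of a cone at the point, where slopes between
  \<open>0\<close> and \<open>k\<close> occur. For \<open>k = 0\<close> the slope of the penalty
  vanishes on the diagonal and the estimate remains correct.\<close>

lemma doubling_local:
  assumes u: "upper_semicontinuous u" and v: "lower_semicontinuous v"
    and lam: "0 \<le> lam" and k: "0 \<le> k" and \<delta>: "0 < \<delta>" and \<rho>: "0 < \<rho>"
    and xy: "x\<^sub>0 \<noteq> y\<^sub>0 \<or> k = 0"
    and ek: "\<And>x y. v y\<^sub>0 - u x\<^sub>0 + (lam * (d x\<^sub>0 y\<^sub>0)\<^sup>2 + k * d x\<^sub>0 y\<^sub>0)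
                \<le> v y - u x + (lam * (d x y)\<^sup>2 + k * d x y) + \<delta> * (d x x\<^sub>0 + d y y\<^sub>0)"
  shows "\<exists>x y. \<exists>p\<in>superdifferential atlas u x. \<exists>q\<in>subdifferential atlas v y.
    d x x\<^sub>0 < \<rho> \<and> d y y\<^sub>0 < \<rho> \<and> u x\<^sub>0 - v y\<^sub>0 - \<rho> \<le> u x - v y \<and>
    \<bar>dual_norm atlas nrm x p - (2 * lam * d x\<^sub>0 y\<^sub>0 + k)\<bar> \<le> 4 * \<delta> \<and>
    \<bar>dual_norm atlas nrm y q - (2 * lam * d x\<^sub>0 y\<^sub>0 + k)\<bar> \<le> 4 * \<delta>"
proof -
  define T where "T = 2 * lam * d x\<^sub>0 y\<^sub>0 + k"
  have T: "0 \<le> T" using lam k d_nonneg[of x\<^sub>0 y\<^sub>0] by (simp add: T_def)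
  define \<epsilon> where "\<epsilon> = min 1 (\<delta> / (10 + 3 * T + 12 * \<delta>))"
  have pos: "0 < 10 + 3 * T + 12 * \<delta>" using T \<delta> by simp
  have \<epsilon>: "0 < \<epsilon>" "\<epsilon> \<le> 1" using \<delta> pos by (auto simp: \<epsilon>_def)
  have "\<epsilon> \<le> \<delta> / (10 + 3 * T + 12 * \<delta>)" unfolding \<epsilon>_def by (rule min.cobounded2)
  then have \<epsilon>': "\<epsilon> * (10 + 3 * T + 12 * \<delta>) \<le> \<delta>" using pos by (simp add: pos_le_divide_eq)
  \<comment> \<open>Bound on how far the distance of the pair may change: the points stay within
    \<open>\<rho>\<close>, the slope \<open>2 * lam * d + k\<close> changes by at most
    \<open>\<epsilon>\<close>, and two different points cannot merge.\<close>
  define \<mu> where "\<mu> = min (min 1 \<rho>) (min (\<epsilon> / (2 * lam + 1)) (if x\<^sub>0 = y\<^sub>0 then 1 else d x\<^sub>0 y\<^sub>0))"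
  have \<mu>: "0 < \<mu>" "\<mu> \<le> 1" "\<mu> \<le> \<rho>" "x\<^sub>0 \<noteq> y\<^sub>0 \<Longrightarrow> \<mu> \<le> d x\<^sub>0 y\<^sub>0"
    using \<epsilon> lam \<rho> d_pos by (auto simp: \<mu>_def)
  have "\<mu> \<le> \<epsilon> / (2 * lam + 1)" unfolding \<mu>_def by auto
  then have \<mu>': "2 * lam * \<mu> \<le> \<epsilon>" using lam \<mu>(1) by (simp add: pos_le_divide_eq algebra_simps)
  define S where "S = d x\<^sub>0 y\<^sub>0 + \<mu>"
  define \<theta> where "\<theta> s = lam * s\<^sup>2 + k * s" for s :: real
  have \<theta>_deriv: "(\<theta> has_real_derivative 2 * lam * s + k) (at s)" for s
    unfolding \<theta>_def[abs_def] by (auto intro!: derivative_eq_intros)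
  obtain c where c: "c \<in> charts_at atlas x\<^sub>0" using charts_at_nonempty by blast
  obtain c' where c': "c' \<in> charts_at atlas y\<^sub>0" using charts_at_nonempty by blast
  let ?n = "cnorm c x\<^sub>0" and ?n' = "cnorm c' y\<^sub>0"
  let ?X = "chart_inv c" and ?Y = "chart_inv c'"
  let ?a = "snd c x\<^sub>0" and ?b = "snd c' y\<^sub>0"
  have X0: "?X ?a = x\<^sub>0" by (rule chart_inv_chart[OF charts_atD[OF c]])
  have Y0: "?Y ?b = y\<^sub>0" by (rule chart_inv_chart[OF charts_atD[OF c']])
  obtain V where V: "open V" "x\<^sub>0 \<in> V" "\<And>z. z \<in> V \<Longrightarrow> u z < u x\<^sub>0 + 1 \<and> d x\<^sub>0 z < \<mu> / 2"
    using eventually_conj[OF upper_semicontinuousD[OF u, of x\<^sub>0 "u x\<^sub>0 + 1"] eventually_d_less[of "\<mu> / 2" x\<^sub>0]] \<mu>(1)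
    unfolding eventually_nhds by auto
  obtain V' where V': "open V'" "y\<^sub>0 \<in> V'" "\<And>z. z \<in> V' \<Longrightarrow> v y\<^sub>0 - 1 < v z \<and> d y\<^sub>0 z < \<mu> / 2"
    using eventually_conj[OF lower_semicontinuousD[OF v, of "v y\<^sub>0 - 1" y\<^sub>0] eventually_d_less[of "\<mu> / 2" y\<^sub>0]] \<mu>(1)
    unfolding eventually_nhds by auto
  obtain r1 a1 b1 where w1: "0 < r1" "0 < a1" "0 < b1" "\<forall>v. a1 * norm v \<le> ?n v" "\<forall>v. ?n v \<le> b1 * norm v"
    and chart1: "\<forall>z\<in>cball ?a r1. z \<in> snd c ` fst c \<and> ?X z \<in> V \<and> c \<in> charts_at atlas (?X z) \<and> snd c (?X z) = z"
    and dist1: "\<forall>z\<in>cball ?a r1. \<forall>w\<in>cball ?a r1. ?n (z - w) \<le> (1 + \<epsilon>) * d (?X z) (?X w) \<and> d (?X z) (?X w) \<le> (1 + \<epsilon>) * ?n (z - w)"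
    and pal1: "\<forall>z\<in>cball ?a r1. \<forall>v. ?n v \<le> (1 + \<epsilon>) * cnorm c (?X z) v \<and> cnorm c (?X z) v \<le> (1 + \<epsilon>) * ?n v"
    using chart_window[OF c \<epsilon>(1) V(1,2)] by (elim exE conjE) (rule that)
  obtain r2 a2 b2 where w2: "0 < r2" "0 < a2" "0 < b2" "\<forall>v. a2 * norm v \<le> ?n' v" "\<forall>v. ?n' v \<le> b2 * norm v"
    and chart2: "\<forall>z\<in>cball ?b r2. z \<in> snd c' ` fst c' \<and> ?Y z \<in> V' \<and> c' \<in> charts_at atlas (?Y z) \<and> snd c' (?Y z) = z"
    and dist2: "\<forall>z\<in>cball ?b r2. \<forall>w\<in>cball ?b r2. ?n' (z - w) \<le> (1 + \<epsilon>) * d (?Y z) (?Y w) \<and> d (?Y z) (?Y w) \<le> (1 + \<epsilon>) * ?n' (z - w)"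
    and pal2: "\<forall>z\<in>cball ?b r2. \<forall>v. ?n' v \<le> (1 + \<epsilon>) * cnorm c' (?Y z) v \<and> cnorm c' (?Y z) v \<le> (1 + \<epsilon>) * ?n' v"
    using chart_window[OF c' \<epsilon>(1) V'(1,2)] by (elim exE conjE) (rule that)
  define r where "r = min r1 r2"
  have r: "0 < r" "cball ?a r \<subseteq> cball ?a r1" "cball ?b r \<subseteq> cball ?b r2" using w1(1) w2(1) by (auto simp: r_def)
  have X: "?X z \<in> V" "c \<in> charts_at atlas (?X z)" "snd c (?X z) = z" "z \<in> snd c ` fst c" "d (?X z) x\<^sub>0 < \<mu> / 2"
    if "z \<in> cball ?a r" for z
  proof -
    have z: "z \<in> cball ?a r1" using that r(2) by blast
    show "?X z \<in> V" "c \<in> charts_at atlas (?X z)" "snd c (?X z) = z" "z \<in> snd c ` fst c" using chart1 z by blast+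
    show "d (?X z) x\<^sub>0 < \<mu> / 2" using V(3) chart1 z d_sym[of x\<^sub>0] by metis
  qed
  have Y: "?Y z \<in> V'" "c' \<in> charts_at atlas (?Y z)" "snd c' (?Y z) = z" "z \<in> snd c' ` fst c'" "d (?Y z) y\<^sub>0 < \<mu> / 2"
    if "z \<in> cball ?b r" for z
  proof -
    have z: "z \<in> cball ?b r2" using that r(3) by blast
    show "?Y z \<in> V'" "c' \<in> charts_at atlas (?Y z)" "snd c' (?Y z) = z" "z \<in> snd c' ` fst c'" using chart2 z by blast+
    show "d (?Y z) y\<^sub>0 < \<mu> / 2" using V'(3) chart2 z d_sym[of y\<^sub>0] by metis
  qed
  have d_near: "\<bar>d (?X z) (?Y w) - d x\<^sub>0 y\<^sub>0\<bar> < \<mu>" if "z \<in> cball ?a r" "w \<in> cball ?b r" for z w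
    using d_lipschitz[of "?X z" "?Y w" x\<^sub>0 y\<^sub>0] X(5)[OF that(1)] Y(5)[OF that(2)] by linarith
  define A where "A z = - u (?X z)" for z
  define A' where "A' w = v (?Y w)" for w
  \<comment> \<open>Ekeland's principle allows a decrease of \<open>\<delta>\<close> times the
    distance to the base pair. Adding \<open>2 * \<delta>\<close> times this distance leaves a
    growth of \<open>\<delta>\<close>, which makes the minimum strict.\<close>
  define G where "G z w = \<theta> (d (?X z) (?Y w)) + 2 * \<delta> * (d (?X z) x\<^sub>0 + d (?Y w) y\<^sub>0)" for z w
  \<comment> \<open>\<open>\<kappa>\<close> is that growth and \<open>\<Lambda>\<close> the
    Lipschitz constant of \<open>G\<close>, both expressed in the model norm;
    \<open>\<sigma>\<close> makes the slope mismatch of the fuzzy sum rule at most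
    \<open>\<epsilon>\<close> in the chart norms.\<close>
  define \<kappa> where "\<kappa> = \<delta> * min a1 a2 / (1 + \<epsilon>)"
  define \<Lambda> where "\<Lambda> = (1 + \<epsilon>) * (b1 + b2) * (2 * lam * S + k + 2 * \<delta>)"
  define \<sigma> where "\<sigma> = min \<rho> (\<epsilon> * min a1 a2)"
  have S: "0 \<le> S" using d_nonneg[of x\<^sub>0 y\<^sub>0] \<mu>(1) by (simp add: S_def)
  have \<kappa>: "0 < \<kappa>" using \<delta> \<epsilon> w1 w2 by (simp add: \<kappa>_def)
  have \<Lambda>: "0 \<le> \<Lambda>" using \<epsilon> w1 w2 lam S k \<delta> by (simp add: \<Lambda>_def)
  have \<sigma>: "0 < \<sigma>" using \<rho> \<epsilon> w1 w2 by (simp add: \<sigma>_def)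
  have X_tendsto: "(\<lambda>n. ?X (z n)) \<longlonglongrightarrow> ?X l" if "z \<longlonglongrightarrow> l" "l \<in> cball ?a r" for z l
  proof -
    have "isCont ?X l"
      using chart_inv_continuous[OF charts_atD(1)[OF c]] chart_open(2)[OF charts_atD(1)[OF c]] X(4)[OF that(2)]
        continuous_on_eq_continuous_at by blast
    then show ?thesis using that(1) by (rule isCont_tendsto_compose)
  qed
  have Y_tendsto: "(\<lambda>n. ?Y (z n)) \<longlonglongrightarrow> ?Y l" if "z \<longlonglongrightarrow> l" "l \<in> cball ?b r" for z l
  proof -
    have "isCont ?Y l"
      using chart_inv_continuous[OF charts_atD(1)[OF c']] chart_open(2)[OF charts_atD(1)[OF c']] Y(4)[OF that(2)]
        continuous_on_eq_continuous_at by blast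
    then show ?thesis using that(1) by (rule isCont_tendsto_compose)
  qed
  have lscA: "\<forall>\<^sub>F n in sequentially. A l < A (z n) + e"
    if "z \<longlonglongrightarrow> l" "l \<in> cball ?a r" "0 < e" for z l and e :: real
  proof -
    have "\<forall>\<^sub>F n in sequentially. u (?X (z n)) < u (?X l) + e"
      by (rule eventually_compose_filterlim[OF upper_semicontinuousD[OF u] X_tendsto[OF that(1,2)]]) (use that in simp)
    then show ?thesis by eventually_elim (simp add: A_def)
  qed
  have lscA': "\<forall>\<^sub>F n in sequentially. A' l < A' (z n) + e"
    if "z \<longlonglongrightarrow> l" "l \<in> cball ?b r" "0 < e" for z l and e :: real
  proof -
    have "\<forall>\<^sub>F n in sequentially. v (?Y l) - e < v (?Y (z n))"
      by (rule eventually_compose_filterlim[OF lower_semicontinuousD[OF v] Y_tendsto[OF that(1,2)]]) (use that in simp)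
    then show ?thesis by eventually_elim (simp add: A'_def)
  qed
  define m\<^sub>0 where "m\<^sub>0 = min (- (u x\<^sub>0 + 1)) (v y\<^sub>0 - 1)"
  have lowA: "m\<^sub>0 \<le> A z" if "z \<in> cball ?a r" for z
    using V(3)[OF X(1)[OF that]] by (simp add: m\<^sub>0_def A_def min_le_iff_disj)
  have lowA': "m\<^sub>0 \<le> A' z" if "z \<in> cball ?b r" for z
    using V'(3)[OF Y(1)[OF that]] by (simp add: m\<^sub>0_def A'_def min_le_iff_disj)
  have G_lip: "\<bar>G z w - G z' w'\<bar> \<le> \<Lambda> * (norm (z - z') + norm (w - w'))"
    if z: "z \<in> cball ?a r" and z': "z' \<in> cball ?a r" and w: "w \<in> cball ?b r" and w': "w' \<in> cball ?b r" for z w z' w'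
  proof -
    define e where "e = d (?X z) (?X z') + d (?Y w) (?Y w')"
    have e0: "0 \<le> e" unfolding e_def by (intro add_nonneg_nonneg d_nonneg)
    define s1 where "s1 = d (?X z) (?Y w)"
    define s2 where "s2 = d (?X z') (?Y w')"
    have s12: "\<bar>s1 - s2\<bar> \<le> e" unfolding s1_def s2_def e_def by (rule d_lipschitz)
    have sS: "0 \<le> s1" "0 \<le> s2" "s1 \<le> S" "s2 \<le> S"
      using d_near[OF z w] d_near[OF z' w'] d_nonneg[of "?X z" "?Y w"] d_nonneg[of "?X z'" "?Y w'"]
      unfolding s1_def s2_def S_def by linarith+
    have "\<theta> s1 - \<theta> s2 = (s1 - s2) * (lam * (s1 + s2) + k)" by (simp add: \<theta>_def power2_eq_square algebra_simps)
    then have "\<bar>\<theta> s1 - \<theta> s2\<bar> = \<bar>s1 - s2\<bar> * (lam * (s1 + s2) + k)" using lam k sS by (simp add: abs_mult)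
    also have "\<dots> \<le> e * (lam * (S + S) + k)"
      using s12 sS lam k e0 by (intro mult_mono add_mono mult_left_mono) auto
    finally have 1: "\<bar>\<theta> s1 - \<theta> s2\<bar> \<le> e * (2 * lam * S + k)" by (simp add: algebra_simps)
    have 2: "\<bar>d (?X z) x\<^sub>0 - d (?X z') x\<^sub>0\<bar> \<le> d (?X z) (?X z')" "\<bar>d (?Y w) y\<^sub>0 - d (?Y w') y\<^sub>0\<bar> \<le> d (?Y w) (?Y w')"
      by (rule d_abs_triangle)+
    have "\<bar>(d (?X z) x\<^sub>0 + d (?Y w) y\<^sub>0) - (d (?X z') x\<^sub>0 + d (?Y w') y\<^sub>0)\<bar> \<le> e"
      using 2 unfolding e_def by linarith
    then have "2 * \<delta> * \<bar>(d (?X z) x\<^sub>0 + d (?Y w) y\<^sub>0) - (d (?X z') x\<^sub>0 + d (?Y w') y\<^sub>0)\<bar> \<le> 2 * \<delta> * e"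
      using \<delta> by (intro mult_left_mono) auto
    then have 3: "\<bar>2 * \<delta> * (d (?X z) x\<^sub>0 + d (?Y w) y\<^sub>0) - 2 * \<delta> * (d (?X z') x\<^sub>0 + d (?Y w') y\<^sub>0)\<bar> \<le> 2 * \<delta> * e"
      using \<delta> by (simp add: abs_mult flip: right_diff_distrib)
    have "\<bar>G z w - G z' w'\<bar> \<le> \<bar>\<theta> s1 - \<theta> s2\<bar> + \<bar>2 * \<delta> * (d (?X z) x\<^sub>0 + d (?Y w) y\<^sub>0) - 2 * \<delta> * (d (?X z') x\<^sub>0 + d (?Y w') y\<^sub>0)\<bar>"
      unfolding G_def s1_def s2_def by linarith
    also have "\<dots> \<le> e * (2 * lam * S + k + 2 * \<delta>)" using 1 3 by (simp add: algebra_simps)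
    also have "e \<le> (1 + \<epsilon>) * (b1 + b2) * (norm (z - z') + norm (w - w'))"
    proof -
      have zz: "z \<in> cball ?a r1" "z' \<in> cball ?a r1" "w \<in> cball ?b r2" "w' \<in> cball ?b r2" using r z z' w w' by blast+
      have "e \<le> (1 + \<epsilon>) * ?n (z - z') + (1 + \<epsilon>) * ?n' (w - w')"
        using dist1[rule_format, OF zz(1,2)] dist2[rule_format, OF zz(3,4)] unfolding e_def by linarith
      also have "\<dots> = (1 + \<epsilon>) * (?n (z - z') + ?n' (w - w'))" by (simp add: algebra_simps)
      also have "\<dots> \<le> (1 + \<epsilon>) * (b1 * norm (z - z') + b2 * norm (w - w'))"
        using w1(5) w2(5) \<epsilon> by (intro mult_left_mono add_mono) auto
      also have "\<dots> \<le> (1 + \<epsilon>) * ((b1 + b2) * (norm (z - z') + norm (w - w')))"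
        using w1(3) w2(3) \<epsilon> by (intro mult_left_mono) (auto simp: algebra_simps)
      finally show ?thesis by (simp add: mult.assoc)
    qed
    then have "e * (2 * lam * S + k + 2 * \<delta>) \<le> (1 + \<epsilon>) * (b1 + b2) * (norm (z - z') + norm (w - w')) * (2 * lam * S + k + 2 * \<delta>)"
      using lam S k \<delta> by (intro mult_right_mono) auto
    finally show ?thesis by (simp add: \<Lambda>_def mult_ac)
  qed
  have a_in: "?a \<in> cball ?a r" "?b \<in> cball ?b r" using r(1) by auto
  have min: "A ?a + A' ?b + G ?a ?b + \<kappa> * (norm (z - ?a) + norm (w - ?b)) \<le> A z + A' w + G z w"
    if z: "z \<in> cball ?a r" and w: "w \<in> cball ?b r" for z w
  proof -
    have zz: "z \<in> cball ?a r1" "?a \<in> cball ?a r1" "w \<in> cball ?b r2" "?b \<in> cball ?b r2"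
      using r z w a_in by blast+
    define q where "q = min a1 a2"
    have q: "0 < q" "q \<le> a1" "q \<le> a2" using w1 w2 by (auto simp: q_def)
    have "q * norm (z - ?a) \<le> (1 + \<epsilon>) * d (?X z) x\<^sub>0"
      using mult_right_mono[OF q(2) norm_ge_zero[of "z - ?a"]] w1(4)[rule_format, of "z - ?a"]
        dist1[rule_format, OF zz(1,2)] X0 by simp
    moreover have "q * norm (w - ?b) \<le> (1 + \<epsilon>) * d (?Y w) y\<^sub>0"
      using mult_right_mono[OF q(3) norm_ge_zero[of "w - ?b"]] w2(4)[rule_format, of "w - ?b"]
        dist2[rule_format, OF zz(3,4)] Y0 by simp
    ultimately have "q * (norm (z - ?a) + norm (w - ?b)) \<le> (1 + \<epsilon>) * (d (?X z) x\<^sub>0 + d (?Y w) y\<^sub>0)"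
      by (simp add: algebra_simps)
    then have "\<delta> * (q * (norm (z - ?a) + norm (w - ?b))) \<le> \<delta> * ((1 + \<epsilon>) * (d (?X z) x\<^sub>0 + d (?Y w) y\<^sub>0))"
      using \<delta> by (intro mult_left_mono) auto
    then have "\<kappa> * (norm (z - ?a) + norm (w - ?b)) \<le> \<delta> * (d (?X z) x\<^sub>0 + d (?Y w) y\<^sub>0)"
      using \<epsilon>(1) by (simp add: \<kappa>_def q_def[symmetric] pos_divide_le_eq mult_ac)
    then show ?thesis
      using ek[of "?Y w" "?X z"] by (simp add: A_def A'_def G_def \<theta>_def X0 Y0 d_refl algebra_simps)
  qed
  obtain x y x' y' g\<^sub>1 g\<^sub>2 h\<^sub>1 h\<^sub>2 D\<^sub>1 D\<^sub>2 E\<^sub>1 E\<^sub>2 where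
    pts: "x \<in> ball ?a \<sigma> \<inter> ball ?a r" "x' \<in> ball ?a \<sigma> \<inter> ball ?a r" "y \<in> ball ?b \<sigma> \<inter> ball ?b r" "y' \<in> ball ?b \<sigma> \<inter> ball ?b r"
    and val: "A x + A' y \<le> A ?a + A' ?b + \<sigma>"
    and g: "C1_on UNIV g\<^sub>1" "C1_on UNIV g\<^sub>2" "(g\<^sub>1 has_derivative D\<^sub>1) (at x)" "(g\<^sub>2 has_derivative D\<^sub>2) (at y)"
    and h: "(h\<^sub>1 has_derivative E\<^sub>1) (at x')" "(h\<^sub>2 has_derivative E\<^sub>2) (at y')"
    and m: "\<forall>z\<in>cball ?a r. A x + g\<^sub>1 x \<le> A z + g\<^sub>1 z" "\<forall>z\<in>cball ?b r. A' y + g\<^sub>2 y \<le> A' z + g\<^sub>2 z"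
      "\<forall>z\<in>cball ?a r. G x' y' - h\<^sub>1 x' \<le> G z y' - h\<^sub>1 z" "\<forall>z\<in>cball ?b r. G x' y' - h\<^sub>2 y' \<le> G x' z - h\<^sub>2 z"
    and DE: "\<forall>v. \<bar>D\<^sub>1 v - E\<^sub>1 v\<bar> \<le> \<sigma> * norm v" "\<forall>v. \<bar>D\<^sub>2 v - E\<^sub>2 v\<bar> \<le> \<sigma> * norm v"
  proof (rule fuzzy_sum_rule[where A = A and A' = A' and G = G and m\<^sub>0 = m\<^sub>0 and a = ?a and b = ?b, OF r(1) \<kappa> \<Lambda> \<sigma>])
    fix z l and e :: real assume "\<And>n. z n \<in> cball ?a r" "z \<longlonglongrightarrow> l" "l \<in> cball ?a r" "0 < e"
    then show "\<forall>\<^sub>F n in sequentially. A l < A (z n) + e" by (intro lscA)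
  next
    fix z l and e :: real assume "\<And>n. z n \<in> cball ?b r" "z \<longlonglongrightarrow> l" "l \<in> cball ?b r" "0 < e"
    then show "\<forall>\<^sub>F n in sequentially. A' l < A' (z n) + e" by (intro lscA')
  qed (rule lowA lowA' G_lip min that; assumption)+
  have in_r: "x \<in> cball ?a r" "x' \<in> cball ?a r" "y \<in> cball ?b r" "y' \<in> cball ?b r" using pts by auto
  have in_r1: "x \<in> cball ?a r1" "x' \<in> cball ?a r1" "y \<in> cball ?b r2" "y' \<in> cball ?b r2" using in_r r by blast+
  define t where "t = 2 * lam * d (?X x') (?Y y') + k"
  have t: "0 \<le> t" using lam k d_nonneg[of "?X x'" "?Y y'"] by (simp add: t_def)
  have tT: "\<bar>t - T\<bar> \<le> \<epsilon>"
  proof -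
    have "\<bar>t - T\<bar> = 2 * lam * \<bar>d (?X x') (?Y y') - d x\<^sub>0 y\<^sub>0\<bar>"
      using lam by (simp add: t_def T_def abs_mult flip: right_diff_distrib)
    also have "\<dots> \<le> 2 * lam * \<mu>" using d_near[OF in_r(2,4)] lam by (intro mult_left_mono) auto
    finally show ?thesis using \<mu>' by simp
  qed
  \<comment> \<open>If the decoupled points coincide, the choice of \<open>\<mu>\<close> leaves only
    \<open>x\<^sub>0 = y\<^sub>0\<close>; then \<open>k = 0\<close> and the slope is zero.\<close>
  have X'Y': "?X x' \<noteq> ?Y y' \<or> t = 0"
  proof (cases "?X x' = ?Y y'")
    case True
    then have "d x\<^sub>0 y\<^sub>0 < \<mu>" using d_near[OF in_r(2,4)] by (simp add: d_refl)
    then have "x\<^sub>0 = y\<^sub>0" using \<mu>(4) by force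
    then show ?thesis using True xy by (simp add: t_def d_refl)
  qed simp
  have \<sigma>n: "\<sigma> * norm v \<le> \<epsilon> * ?n v" "\<sigma> * norm v \<le> \<epsilon> * ?n' v" for v
  proof -
    have "\<sigma> \<le> \<epsilon> * min a1 a2" unfolding \<sigma>_def by (rule min.cobounded2)
    moreover have "\<epsilon> * min a1 a2 \<le> \<epsilon> * a1" "\<epsilon> * min a1 a2 \<le> \<epsilon> * a2" using \<epsilon> by (intro mult_left_mono; simp)+
    ultimately have "\<sigma> * norm v \<le> \<epsilon> * a1 * norm v" "\<sigma> * norm v \<le> \<epsilon> * a2 * norm v"
      by (intro mult_right_mono; simp)+
    moreover have "\<epsilon> * (a1 * norm v) \<le> \<epsilon> * ?n v" "\<epsilon> * (a2 * norm v) \<le> \<epsilon> * ?n' v"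
      using w1(4) w2(4) \<epsilon> by (intro mult_left_mono; simp)+
    ultimately show "\<sigma> * norm v \<le> \<epsilon> * ?n v" "\<sigma> * norm v \<le> \<epsilon> * ?n' v" by (simp_all add: mult.assoc)
  qed
  have "\<forall>\<^sub>F z in nhds (?X x). u z - g\<^sub>1 (snd c z) \<le> u (?X x) - g\<^sub>1 (snd c (?X x))"
  proof (rule eventually_mono[OF eventually_chart_ball[OF X(2,3)[OF in_r(1)], of ?a r]])
    show "x \<in> ball ?a r" using pts(1) by simp
    fix z assume z: "z \<in> fst c \<and> snd c z \<in> ball ?a r \<and> ?X (snd c z) = z"
    then show "u z - g\<^sub>1 (snd c z) \<le> u (?X x) - g\<^sub>1 (snd c (?X x))"
      using m(1)[rule_format, of "snd c z"] X(3)[OF in_r(1)] by (simp add: A_def)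
  qed
  then obtain p where p: "p \<in> superdifferential atlas u (?X x)" "0 \<le> dual_norm atlas nrm (?X x) p"
    "\<forall>v. \<bar>D\<^sub>1 v\<bar> \<le> dual_norm atlas nrm (?X x) p * cnorm c (?X x) v"
    "\<forall>k\<ge>0. (\<forall>v. \<bar>D\<^sub>1 v\<bar> \<le> k * cnorm c (?X x) v) \<longrightarrow> dual_norm atlas nrm (?X x) p \<le> k"
    using superdifferential_chart_test[OF X(2)[OF in_r(1)] g(1), of D\<^sub>1 u] g(3) X(3)[OF in_r(1)] by auto
  have "\<forall>\<^sub>F z in nhds (?Y y). v (?Y y) + g\<^sub>2 (snd c' (?Y y)) \<le> v z + g\<^sub>2 (snd c' z)"
  proof (rule eventually_mono[OF eventually_chart_ball[OF Y(2,3)[OF in_r(3)], of ?b r]])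
    show "y \<in> ball ?b r" using pts(3) by simp
    fix z assume z: "z \<in> fst c' \<and> snd c' z \<in> ball ?b r \<and> ?Y (snd c' z) = z"
    then show "v (?Y y) + g\<^sub>2 (snd c' (?Y y)) \<le> v z + g\<^sub>2 (snd c' z)"
      using m(2)[rule_format, of "snd c' z"] Y(3)[OF in_r(3)] by (simp add: A'_def)
  qed
  then obtain q where q: "q \<in> subdifferential atlas v (?Y y)" "0 \<le> dual_norm atlas nrm (?Y y) q"
    "\<forall>v. \<bar>D\<^sub>2 v\<bar> \<le> dual_norm atlas nrm (?Y y) q * cnorm c' (?Y y) v"
    "\<forall>k\<ge>0. (\<forall>v. \<bar>D\<^sub>2 v\<bar> \<le> k * cnorm c' (?Y y) v) \<longrightarrow> dual_norm atlas nrm (?Y y) q \<le> k"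
    using subdifferential_chart_test[OF Y(2)[OF in_r(3)] g(2), of D\<^sub>2 v] g(4) Y(3)[OF in_r(3)] by auto
  have evX: "\<forall>\<^sub>F z in nhds (?X x'). z \<in> fst c \<and> snd c z \<in> ball ?a r \<and> ?X (snd c z) = z"
    using pts(2) by (intro eventually_chart_ball X(2,3) in_r) auto
  have evY: "\<forall>\<^sub>F z in nhds (?Y y'). z \<in> fst c' \<and> snd c' z \<in> ball ?b r \<and> ?Y (snd c' z) = z"
    using pts(4) by (intro eventually_chart_ball Y(2,3) in_r) auto
  have P: "\<bar>dual_norm atlas nrm (?X x) p - T\<bar> \<le> 4 * \<delta>"
  proof (rule slope_estimate[OF c \<epsilon> \<epsilon>' \<delta> T X(2)[OF in_r(2)] _ _ \<theta>_deriv[of "d (?X x') (?Y y')", folded t_def] t tT X'Y',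
        where h = h\<^sub>1 and E = E\<^sub>1 and D = D\<^sub>1 and m = "cnorm c (?X x)"])
    show "\<forall>\<^sub>F z in nhds (?X x'). ?n (snd c z - snd c (?X x')) \<le> (1 + \<epsilon>) * d z (?X x')"
      using evX
    proof eventually_elim
      case (elim z)
      then have "snd c z \<in> cball ?a r1" by (intro subsetD[OF r(2)]) auto
      then show ?case using dist1[rule_format, OF _ in_r1(2), of "snd c z"] elim X(3)[OF in_r(2)] by simp
    qed
    show "\<forall>\<^sub>F z in nhds (?X x'). d z (?X x') \<le> (1 + \<epsilon>) * ?n (snd c z - snd c (?X x'))"
      using evX
    proof eventually_elim
      case (elim z)
      then have "snd c z \<in> cball ?a r1" by (intro subsetD[OF r(2)]) auto
      then show ?case using dist1[rule_format, OF _ in_r1(2), of "snd c z"] elim X(3)[OF in_r(2)] by simp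
    qed
    show "(h\<^sub>1 has_derivative E\<^sub>1) (at (snd c (?X x')))" using h(1) X(3)[OF in_r(2)] by simp
    show "\<forall>\<^sub>F z in nhds (?X x'). \<theta> (d (?X x') (?Y y')) + 2 * \<delta> * d (?X x') x\<^sub>0 - h\<^sub>1 (snd c (?X x'))
        \<le> \<theta> (d z (?Y y')) + 2 * \<delta> * d z x\<^sub>0 - h\<^sub>1 (snd c z)"
      using evX
    proof eventually_elim
      case (elim z)
      then show ?case using m(3)[rule_format, of "snd c z"] X(3)[OF in_r(2)] by (simp add: G_def algebra_simps)
    qed
    show "\<bar>D\<^sub>1 v - E\<^sub>1 v\<bar> \<le> \<epsilon> * ?n v" for v using DE(1)[rule_format, of v] \<sigma>n(1)[of v] by linarith
    show "?n v \<le> (1 + \<epsilon>) * cnorm c (?X x) v" "cnorm c (?X x) v \<le> (1 + \<epsilon>) * ?n v" for v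
      using pal1 in_r1(1) by blast+
    show "0 \<le> dual_norm atlas nrm (?X x) p" by (rule p(2))
    show "\<bar>D\<^sub>1 v\<bar> \<le> dual_norm atlas nrm (?X x) p * cnorm c (?X x) v" for v using p(3) by blast
    show "dual_norm atlas nrm (?X x) p \<le> k" if "0 \<le> k" "\<And>v. \<bar>D\<^sub>1 v\<bar> \<le> k * cnorm c (?X x) v" for k
      using p(4) that by blast
  qed
  have Y'X': "?Y y' \<noteq> ?X x' \<or> t = 0" using X'Y' by auto
  have t_sym: "t = 2 * lam * d (?Y y') (?X x') + k" unfolding t_def by (simp add: d_sym)
  have Q: "\<bar>dual_norm atlas nrm (?Y y) q - T\<bar> \<le> 4 * \<delta>"
  proof (rule slope_estimate[OF c' \<epsilon> \<epsilon>' \<delta> T Y(2)[OF in_r(4)] _ _ \<theta>_deriv[of "d (?Y y') (?X x')", folded t_sym] t tT Y'X',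
        where h = h\<^sub>2 and E = E\<^sub>2 and D = D\<^sub>2 and m = "cnorm c' (?Y y)"])
    show "\<forall>\<^sub>F z in nhds (?Y y'). ?n' (snd c' z - snd c' (?Y y')) \<le> (1 + \<epsilon>) * d z (?Y y')"
      using evY
    proof eventually_elim
      case (elim z)
      then have "snd c' z \<in> cball ?b r2" by (intro subsetD[OF r(3)]) auto
      then show ?case using dist2[rule_format, OF _ in_r1(4), of "snd c' z"] elim Y(3)[OF in_r(4)] by simp
    qed
    show "\<forall>\<^sub>F z in nhds (?Y y'). d z (?Y y') \<le> (1 + \<epsilon>) * ?n' (snd c' z - snd c' (?Y y'))"
      using evY
    proof eventually_elim
      case (elim z)
      then have "snd c' z \<in> cball ?b r2" by (intro subsetD[OF r(3)]) auto
      then show ?case using dist2[rule_format, OF _ in_r1(4), of "snd c' z"] elim Y(3)[OF in_r(4)] by simp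
    qed
    show "(h\<^sub>2 has_derivative E\<^sub>2) (at (snd c' (?Y y')))" using h(2) Y(3)[OF in_r(4)] by simp
    show "\<forall>\<^sub>F z in nhds (?Y y'). \<theta> (d (?Y y') (?X x')) + 2 * \<delta> * d (?Y y') y\<^sub>0 - h\<^sub>2 (snd c' (?Y y'))
        \<le> \<theta> (d z (?X x')) + 2 * \<delta> * d z y\<^sub>0 - h\<^sub>2 (snd c' z)"
      using evY
    proof eventually_elim
      case (elim z)
      then show ?case
        using m(4)[rule_format, of "snd c' z"] Y(3)[OF in_r(4)] d_sym[of "?X x'" z] d_sym[of "?X x'" "?Y y'"]
        by (simp add: G_def algebra_simps)
    qed
    show "\<bar>D\<^sub>2 v - E\<^sub>2 v\<bar> \<le> \<epsilon> * ?n' v" for v using DE(2)[rule_format, of v] \<sigma>n(2)[of v] by linarith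
    show "?n' v \<le> (1 + \<epsilon>) * cnorm c' (?Y y) v" "cnorm c' (?Y y) v \<le> (1 + \<epsilon>) * ?n' v" for v
      using pal2 in_r1(3) by blast+
    show "0 \<le> dual_norm atlas nrm (?Y y) q" by (rule q(2))
    show "\<bar>D\<^sub>2 v\<bar> \<le> dual_norm atlas nrm (?Y y) q * cnorm c' (?Y y) v" for v using q(3) by blast
    show "dual_norm atlas nrm (?Y y) q \<le> k" if "0 \<le> k" "\<And>v. \<bar>D\<^sub>2 v\<bar> \<le> k * cnorm c' (?Y y) v" for k
      using q(4) that by blast
  qed
  have "d (?X x) x\<^sub>0 < \<rho>" "d (?Y y) y\<^sub>0 < \<rho>"
    using X(5)[OF in_r(1)] Y(5)[OF in_r(3)] \<mu>(1,3) by linarith+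
  moreover have "u x\<^sub>0 - v y\<^sub>0 - \<rho> \<le> u (?X x) - v (?Y y)"
  proof -
    have "\<sigma> \<le> \<rho>" unfolding \<sigma>_def by (rule min.cobounded1)
    then show ?thesis using val by (simp add: A_def A'_def X0 Y0)
  qed
  ultimately show ?thesis
    using p(1) q(1) P Q unfolding T_def
    by (intro exI[of _ "?X x"] exI[of _ "?Y y"] bexI[of _ p] bexI[of _ q] conjI) auto
qed

end

section \<open>Perron's method\<close>

context bumpable_finsler_manifold
begin

text \<open>The penalty is used in two pure forms: quadratic (\<open>k = 0\<close>) for the
  comparison and for the supremum of the class, linear (\<open>lam = 0\<close>) for the Lipschitz
  estimate, where a slope prescribed in advance is wanted.\<close>

lemma doubling:
  assumes u: "upper_semicontinuous u" "\<And>x. u x \<le> U" and v: "lower_semicontinuous v" "\<And>y. V \<le> v y"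
    and lam: "0 \<le> lam" and k: "0 \<le> k" and \<delta>: "0 < \<delta>"
  shows "\<exists>x\<^sub>0 y\<^sub>0.
    (\<forall>x y. v y\<^sub>0 - u x\<^sub>0 + (lam * (d x\<^sub>0 y\<^sub>0)\<^sup>2 + k * d x\<^sub>0 y\<^sub>0) \<le> v y - u x + (lam * (d x y)\<^sup>2 + k * d x y) + \<delta>) \<and>
    (\<forall>x y. v y\<^sub>0 - u x\<^sub>0 + (lam * (d x\<^sub>0 y\<^sub>0)\<^sup>2 + k * d x\<^sub>0 y\<^sub>0)
       \<le> v y - u x + (lam * (d x y)\<^sup>2 + k * d x y) + \<delta> * (d x x\<^sub>0 + d y y\<^sub>0)) \<and>
    (x\<^sub>0 \<noteq> y\<^sub>0 \<or> k = 0 \<longrightarrow> (\<forall>\<rho>>0. \<exists>x y. \<exists>p\<in>superdifferential atlas u x. \<exists>q\<in>subdifferential atlas v y.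
       d x x\<^sub>0 < \<rho> \<and> d y y\<^sub>0 < \<rho> \<and> u x\<^sub>0 - v y\<^sub>0 - \<rho> \<le> u x - v y \<and>
       \<bar>dual_norm atlas nrm x p - (2 * lam * d x\<^sub>0 y\<^sub>0 + k)\<bar> \<le> 4 * \<delta> \<and>
       \<bar>dual_norm atlas nrm y q - (2 * lam * d x\<^sub>0 y\<^sub>0 + k)\<bar> \<le> 4 * \<delta>))"
proof -
  have \<theta>: "continuous_on UNIV (\<lambda>s. lam * s\<^sup>2 + k * s)" "\<And>s. 0 \<le> s \<Longrightarrow> 0 \<le> lam * s\<^sup>2 + k * s"
    using lam k by (auto intro!: continuous_intros add_nonneg_nonneg)
  obtain x\<^sub>0 y\<^sub>0 where xy: "\<And>x y. v y\<^sub>0 - u x\<^sub>0 + (lam * (d x\<^sub>0 y\<^sub>0)\<^sup>2 + k * d x\<^sub>0 y\<^sub>0) \<le> v y - u x + (lam * (d x y)\<^sup>2 + k * d x y) + \<delta>"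
    "\<And>x y. v y\<^sub>0 - u x\<^sub>0 + (lam * (d x\<^sub>0 y\<^sub>0)\<^sup>2 + k * d x\<^sub>0 y\<^sub>0)
       \<le> v y - u x + (lam * (d x y)\<^sup>2 + k * d x y) + \<delta> * (d x x\<^sub>0 + d y y\<^sub>0)"
    using ekeland[OF u v \<theta> \<delta>] by auto
  show ?thesis
  proof (rule exI[of _ x\<^sub>0], rule exI[of _ y\<^sub>0], intro conjI allI impI)
    fix \<rho> :: real assume "x\<^sub>0 \<noteq> y\<^sub>0 \<or> k = 0" "0 < \<rho>"
    then show "\<exists>x y. \<exists>p\<in>superdifferential atlas u x. \<exists>q\<in>subdifferential atlas v y.
       d x x\<^sub>0 < \<rho> \<and> d y y\<^sub>0 < \<rho> \<and> u x\<^sub>0 - v y\<^sub>0 - \<rho> \<le> u x - v y \<and>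
       \<bar>dual_norm atlas nrm x p - (2 * lam * d x\<^sub>0 y\<^sub>0 + k)\<bar> \<le> 4 * \<delta> \<and>
       \<bar>dual_norm atlas nrm y q - (2 * lam * d x\<^sub>0 y\<^sub>0 + k)\<bar> \<le> 4 * \<delta>"
      by (intro doubling_local[OF u(1) v(1) lam k \<delta>] xy(2))
  qed (rule xy)+
qed

lemma dn_const: "dn (\<lambda>_. r) x = 0"
proof -
  obtain c where c: "c \<in> charts_at atlas x" using charts_at_nonempty by blast
  have D: "((\<lambda>_. r) \<circ> chart_inv c has_derivative (\<lambda>_. 0)) (at (snd c x))" by (simp add: comp_def)
  have "dn (\<lambda>_. r) x \<le> 0" by (rule dn_le[OF C1_fun_const c D]) auto
  moreover have "0 \<le> dn (\<lambda>_. r) x" by (rule dn_nonneg'[OF C1_fun_const])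
  ultimately show ?thesis by simp
qed

end

text \<open>Both alternatives of the theorem enter only through \<open>H_structure\<close> and \<open>H_coercive\<close>.\<close>

locale hamilton_jacobi = bumpable_finsler_manifold atlas nrm N N' B L
  for atlas :: "('m::t2_space, 'x::banach) chart set" and nrm and N :: "'x \<Rightarrow> real" and N' B L +
  fixes H :: "'m \<Rightarrow> real \<Rightarrow> real" and K\<^sub>0 K\<^sub>1 C :: real
  assumes H_cont: "continuous_on UNIV (\<lambda>(x, t). H x t)"
    and K\<^sub>0_pos: "0 < K\<^sub>0" and K\<^sub>1_pos: "0 < K\<^sub>1"
    and H_0: "K\<^sub>0 \<le> H x 0" "H x 0 \<le> K\<^sub>1"
    and C_nonneg: "0 \<le> C"
    and H_structure: "0 < \<eta> \<Longrightarrow> \<exists>\<delta>>0. \<forall>x y s t. d x y < \<delta> \<and> \<bar>s - t\<bar> < \<delta> \<longrightarrow>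
          \<bar>H x s - H y t\<bar> \<le> \<eta> + C * max \<bar>s\<bar> \<bar>t\<bar> * d x y"
    and H_coercive: "\<exists>e>0. \<exists>R. \<forall>x. d x\<^sub>0 x < e \<longrightarrow> (\<forall>t\<ge>R. K\<^sub>1 < H x t)"
begin

abbreviation subsolution :: "('m \<Rightarrow> real) \<Rightarrow> bool" where
  "subsolution \<equiv> viscosity_subsolution atlas nrm H"

abbreviation supersolution :: "('m \<Rightarrow> real) \<Rightarrow> bool" where
  "supersolution \<equiv> viscosity_supersolution atlas nrm H"

lemma subsolutionD:
  "subsolution u \<Longrightarrow> upper_semicontinuous u"
  "subsolution u \<Longrightarrow> p \<in> superdifferential atlas u x \<Longrightarrow> u x + H x (dual_norm atlas nrm x p) \<le> 0"
  unfolding viscosity_subsolution_def by auto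

lemma supersolutionD:
  "supersolution u \<Longrightarrow> lower_semicontinuous u"
  "supersolution u \<Longrightarrow> p \<in> subdifferential atlas u x \<Longrightarrow> 0 \<le> u x + H x (dual_norm atlas nrm x p)"
  unfolding viscosity_supersolution_def by auto

lemma H_near:
  assumes "0 < \<nu>"
  shows "\<exists>e>0. \<exists>\<tau>>0. \<forall>x t. d x\<^sub>0 x < e \<and> \<bar>t - t\<^sub>0\<bar> < \<tau> \<longrightarrow> \<bar>H x t - H x\<^sub>0 t\<^sub>0\<bar> < \<nu>"
proof -
  have "isCont (\<lambda>(x, t). H x t) (x\<^sub>0, t\<^sub>0)"
    using H_cont by (simp add: continuous_on_eq_continuous_at)
  from tendstoD[OF isCont_tendsto_nhds[OF this] assms]
  have "\<forall>\<^sub>F z in nhds x\<^sub>0 \<times>\<^sub>F nhds t\<^sub>0. dist (case z of (x, t) \<Rightarrow> H x t) (H x\<^sub>0 t\<^sub>0) < \<nu>"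
    by (simp add: nhds_prod)
  then obtain P Q where P: "\<forall>\<^sub>F x in nhds x\<^sub>0. P x" and Q: "\<forall>\<^sub>F t in nhds t\<^sub>0. Q t"
    and PQ: "\<And>x t. P x \<Longrightarrow> Q t \<Longrightarrow> \<bar>H x t - H x\<^sub>0 t\<^sub>0\<bar> < \<nu>"
    unfolding eventually_prod_filter by (auto simp: dist_real_def)
  obtain e where "0 < e" "\<And>x. d x\<^sub>0 x < e \<Longrightarrow> P x" using P unfolding eventually_nhds_d by blast
  moreover obtain \<tau> where "0 < \<tau>" "\<And>t. \<bar>t - t\<^sub>0\<bar> < \<tau> \<Longrightarrow> Q t"
    using Q unfolding eventually_nhds_metric dist_real_def by blast
  ultimately show ?thesis using PQ by (intro exI[of _ e] exI[of _ \<tau>] conjI) auto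
qed

text \<open>If \<open>u\<close> exceeds \<open>v\<close> by \<open>\<mu>\<close> somewhere, doubling
  gives points with almost equal slopes, and subtracting the two inequalities bounds
  \<open>u - v\<close> there by a difference of values of \<open>H\<close>. The slopes are about
  \<open>2 * lam * d\<close> and may be huge, so the last term of \<open>H_structure\<close> is
  harmless only if \<open>lam * d\<^sup>2\<close> is small.\<close>

lemma comparison:
  assumes u: "subsolution u" "\<And>x. u x \<le> U" and v: "supersolution v" "\<And>y. V \<le> v y"
  shows "u x \<le> v x"
proof (rule ccontr)
  assume "\<not> u x \<le> v x"
  define \<mu> where "\<mu> = u x - v x"
  have \<mu>: "0 < \<mu>" using \<open>\<not> u x \<le> v x\<close> by (simp add: \<mu>_def)
  obtain \<delta>\<^sub>0 where \<delta>\<^sub>0: "0 < \<delta>\<^sub>0" "\<And>x y s t. d x y < \<delta>\<^sub>0 \<Longrightarrow> \<bar>s - t\<bar> < \<delta>\<^sub>0 \<Longrightarrow>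
      \<bar>H x s - H y t\<bar> \<le> \<mu> / 4 + C * max \<bar>s\<bar> \<bar>t\<bar> * d x y"
    using H_structure[of "\<mu> / 4"] \<mu> by auto
  \<comment> \<open>In turn: distance at most \<open>1\<close>; slopes differ by less than
    \<open>\<delta>\<^sub>0\<close>; distance at most \<open>\<delta>\<^sub>0 / 2\<close>; values
    lose at most \<open>\<mu> / 4\<close>, from \<open>\<delta>\<close> and \<open>\<rho>\<close>;
    and \<open>C * (14 * \<delta>) \<le> \<mu> / 8\<close>, with \<open>14 * \<delta>\<close> the
    bound for slope times distance obtained below. At the end \<open>3 * \<mu> / 4\<close> would be
    at most \<open>3 * \<mu> / 8\<close>.\<close>
  define \<delta> where "\<delta> = min (min (1/4) (\<delta>\<^sub>0 / 16)) (min (\<delta>\<^sub>0\<^sup>2 / 16) (min (\<mu> / 8) (\<mu> / (112 * (C + 1)))))"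
  have \<delta>: "0 < \<delta>" "\<delta> \<le> 1/4" "\<delta> \<le> \<delta>\<^sub>0 / 16" "\<delta> \<le> \<delta>\<^sub>0\<^sup>2 / 16" "\<delta> \<le> \<mu> / 8" and "\<delta> \<le> \<mu> / (112 * (C + 1))"
  proof -
    have "0 < \<delta>\<^sub>0\<^sup>2 / 16" "0 < \<mu> / (112 * (C + 1))" using \<delta>\<^sub>0(1) \<mu> C_nonneg by auto
    then show "0 < \<delta>" "\<delta> \<le> 1/4" "\<delta> \<le> \<delta>\<^sub>0 / 16" "\<delta> \<le> \<delta>\<^sub>0\<^sup>2 / 16" "\<delta> \<le> \<mu> / 8" "\<delta> \<le> \<mu> / (112 * (C + 1))"
      unfolding \<delta>_def using \<delta>\<^sub>0(1) \<mu> by linarith+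
  qed
  then have C\<delta>: "C * (14 * \<delta>) \<le> \<mu> / 8" using C_nonneg by (simp add: pos_le_divide_eq algebra_simps)
  define F where "F j z = v (snd z) - u (fst z) + 2 ^ j * (d (fst z) (snd z))\<^sup>2" for j :: nat and z
  define M where "M j = (INF z. F j z)" for j
  have bdd: "bdd_below (range (F j))" for j
  proof (rule bdd_belowI2)
    fix z
    have "0 \<le> 2 ^ j * (d (fst z) (snd z))\<^sup>2" by simp
    then show "V - U \<le> F j z" using u(2)[of "fst z"] v(2)[of "snd z"] unfolding F_def by linarith
  qed
  have M_le: "M j \<le> F j z" for j z unfolding M_def by (rule cINF_lower[OF bdd]) simp
  have M_neg: "M j \<le> - \<mu>" for j using M_le[of j "(x, x)"] by (simp add: F_def \<mu>_def d_refl)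
  \<comment> \<open>Otherwise the infima would grow by \<open>\<delta>\<close> at every step, but
    the diagonal keeps them all below \<open>- \<mu>\<close>.\<close>
  have "\<exists>j. M (Suc j) < M j + \<delta>"
  proof (rule ccontr)
    assume "\<nexists>j. M (Suc j) < M j + \<delta>"
    then have step: "M j + \<delta> \<le> M (Suc j)" for j by (auto simp: not_less)
    have "M 0 + real j * \<delta> \<le> M j" for j
    proof (induction j)
      case (Suc j)
      then show ?case using step[of j] by (simp add: algebra_simps)
    qed simp
    then have "real j * \<delta> \<le> - \<mu> - M 0" for j using M_neg[of j] by (smt (verit))
    moreover obtain j where "- \<mu> - M 0 < real j * \<delta>" using reals_Archimedean3[OF \<delta>(1)] by blast
    ultimately show False by (meson not_le)
  qed
  then obtain j where j: "M (Suc j) < M j + \<delta>" by blast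
  define lam where "lam = (2 :: real) ^ Suc j"
  have lam: "1 \<le> lam" unfolding lam_def by (rule one_le_power) simp
  then have lam0: "0 \<le> lam" by simp
  obtain x\<^sub>0 y\<^sub>0 where xy: "\<And>x y. v y\<^sub>0 - u x\<^sub>0 + lam * (d x\<^sub>0 y\<^sub>0)\<^sup>2 \<le> v y - u x + lam * (d x y)\<^sup>2 + \<delta>"
    and loc: "\<And>\<rho>. 0 < \<rho> \<Longrightarrow> \<exists>x y. \<exists>p\<in>superdifferential atlas u x. \<exists>q\<in>subdifferential atlas v y.
       d x x\<^sub>0 < \<rho> \<and> d y y\<^sub>0 < \<rho> \<and> u x\<^sub>0 - v y\<^sub>0 - \<rho> \<le> u x - v y \<and>
       \<bar>dual_norm atlas nrm x p - 2 * lam * d x\<^sub>0 y\<^sub>0\<bar> \<le> 4 * \<delta> \<and>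
       \<bar>dual_norm atlas nrm y q - 2 * lam * d x\<^sub>0 y\<^sub>0\<bar> \<le> 4 * \<delta>"
    using doubling[OF subsolutionD(1)[OF u(1)] u(2) supersolutionD(1)[OF v(1)] v(2) lam0 order_refl \<delta>(1)]
    by auto
  let ?d = "d x\<^sub>0 y\<^sub>0"
  have "F (Suc j) (x\<^sub>0, y\<^sub>0) \<le> M (Suc j) + \<delta>"
  proof -
    have "F (Suc j) (x\<^sub>0, y\<^sub>0) - \<delta> \<le> M (Suc j)"
      unfolding M_def
    proof (rule cINF_greatest)
      fix z show "F (Suc j) (x\<^sub>0, y\<^sub>0) - \<delta> \<le> F (Suc j) z"
        using xy[of "snd z" "fst z"] by (simp add: F_def lam_def)
    qed simp
    then show ?thesis by simp
  qed
  moreover have "F (Suc j) (x\<^sub>0, y\<^sub>0) - lam / 2 * ?d\<^sup>2 = F j (x\<^sub>0, y\<^sub>0)" by (simp add: F_def lam_def)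
  \<comment> \<open>Halving the penalty at the chosen pair lowers the functional by
    \<open>lam / 2 * d\<^sup>2\<close>, yet not below \<open>M j\<close>, which is less than
    \<open>2 * \<delta>\<close> away.\<close>
  ultimately have lamd: "lam * ?d\<^sup>2 \<le> 4 * \<delta>" using M_le[of j "(x\<^sub>0, y\<^sub>0)"] j by simp
  have "?d\<^sup>2 \<le> lam * ?d\<^sup>2" using mult_right_mono[OF lam, of "?d\<^sup>2"] by simp
  then have dsq: "?d\<^sup>2 \<le> 4 * \<delta>" using lamd by simp
  have "?d\<^sup>2 \<le> (\<delta>\<^sub>0 / 2)\<^sup>2" using dsq \<delta>(4) by (simp add: power_divide)
  then have d1: "?d \<le> \<delta>\<^sub>0 / 2" by (rule power2_le_imp_le) (use \<delta>\<^sub>0 in simp)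
  have "?d\<^sup>2 \<le> 1\<^sup>2" using dsq \<delta>(2) by simp
  then have d2: "?d \<le> 1" by (rule power2_le_imp_le) simp
  define T where "T = 2 * lam * ?d"
  have T: "0 \<le> T" using lam0 d_nonneg by (simp add: T_def)
  \<comment> \<open>The displacement of the points enters multiplied by the possibly large slope, so
    it is made small relative to \<open>T\<close>.\<close>
  define \<rho> where "\<rho> = min \<delta> (\<delta> / (T + 4 * \<delta>))"
  have T4: "0 < T + 4 * \<delta>" using T \<delta>(1) by simp
  have \<rho>: "0 < \<rho>" "\<rho> \<le> \<delta>" and "\<rho> \<le> \<delta> / (T + 4 * \<delta>)" unfolding \<rho>_def using \<delta>(1) T4 by auto
  then have \<rho>T: "(T + 4 * \<delta>) * \<rho> \<le> \<delta>" using T4 by (simp add: pos_le_divide_eq mult.commute)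
  obtain x' y' p q where p: "p \<in> superdifferential atlas u x'" and q: "q \<in> subdifferential atlas v y'"
    and near: "d x' x\<^sub>0 < \<rho>" "d y' y\<^sub>0 < \<rho>" and val: "u x\<^sub>0 - v y\<^sub>0 - \<rho> \<le> u x' - v y'"
    and P: "\<bar>dual_norm atlas nrm x' p - T\<bar> \<le> 4 * \<delta>" and Q: "\<bar>dual_norm atlas nrm y' q - T\<bar> \<le> 4 * \<delta>"
    using loc[OF \<rho>(1)] unfolding T_def by auto
  let ?P = "dual_norm atlas nrm x' p" and ?Q = "dual_norm atlas nrm y' q"
  have d': "d x' y' \<le> ?d + 2 * \<rho>" using d_lipschitz[of x' y' x\<^sub>0 y\<^sub>0] near by linarith
  then have "d x' y' < \<delta>\<^sub>0" using d1 \<rho>(2) \<delta>(1,3) by linarith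
  moreover have "\<bar>?P - ?Q\<bar> < \<delta>\<^sub>0" using P Q \<delta>(1,3) by linarith
  ultimately have "\<bar>H x' ?P - H y' ?Q\<bar> \<le> \<mu> / 4 + C * max \<bar>?P\<bar> \<bar>?Q\<bar> * d x' y'" by (rule \<delta>\<^sub>0(2))
  moreover have "C * max \<bar>?P\<bar> \<bar>?Q\<bar> * d x' y' \<le> \<mu> / 8"
  proof -
    have "max \<bar>?P\<bar> \<bar>?Q\<bar> \<le> T + 4 * \<delta>" using P Q T by (simp add: abs_le_iff)
    then have "max \<bar>?P\<bar> \<bar>?Q\<bar> * d x' y' \<le> (T + 4 * \<delta>) * (?d + 2 * \<rho>)"
      using d' d_nonneg T4 by (intro mult_mono) auto
    also have "\<dots> = 2 * (lam * ?d\<^sup>2) + 4 * \<delta> * ?d + 2 * ((T + 4 * \<delta>) * \<rho>)"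
      by (simp add: T_def power2_eq_square algebra_simps)
    also have "\<dots> \<le> 2 * (4 * \<delta>) + 4 * \<delta> * 1 + 2 * \<delta>"
      using lamd d2 \<rho>T \<delta>(1) by (intro add_mono mult_left_mono) auto
    finally have "max \<bar>?P\<bar> \<bar>?Q\<bar> * d x' y' \<le> 14 * \<delta>" by simp
    then have "C * (max \<bar>?P\<bar> \<bar>?Q\<bar> * d x' y') \<le> C * (14 * \<delta>)" using C_nonneg by (rule mult_left_mono)
    then show ?thesis using C\<delta> by (simp add: mult.assoc)
  qed
  moreover have "u x' + H x' ?P \<le> 0" by (rule subsolutionD(2)[OF u(1) p])
  moreover have "0 \<le> v y' + H y' ?Q" by (rule supersolutionD(2)[OF v(1) q])
  moreover have "\<mu> - \<delta> \<le> u x\<^sub>0 - v y\<^sub>0"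
  proof -
    have "0 \<le> lam * ?d\<^sup>2" using lam0 by simp
    then show ?thesis using xy[of x x] by (simp add: \<mu>_def d_refl)
  qed
  ultimately show False using val \<rho>(2) \<delta>(5) \<mu> by linarith
qed

definition perron_class :: "('m \<Rightarrow> real) set" where
  "perron_class = {w. (\<forall>y. - K\<^sub>1 \<le> w y \<and> w y \<le> - K\<^sub>0) \<and> subsolution w}"

text \<open>If the bound fails, doubling with the linear penalty \<open>A * d\<close> gives an
  off-diagonal pair, and \<open>w\<close> has a superdifferential of norm about \<open>A\<close> at
  a point near \<open>x\<^sub>0\<close>. There coercivity makes \<open>H\<close> exceed
  \<open>K\<^sub>1\<close>, which contradicts the subsolution property since
  \<open>w \<ge> - K\<^sub>1\<close>. The constants depend only on \<open>H\<close>, hence are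
  common to the whole class.\<close>

lemma perron_class_lipschitz:
  "\<exists>r>0. \<exists>A\<ge>0. \<forall>w\<in>perron_class. \<forall>x y. d x\<^sub>0 y < r \<longrightarrow> w x - w y \<le> A * d x y"
proof -
  obtain e R where e: "0 < e" and R: "\<And>x t. d x\<^sub>0 x < e \<Longrightarrow> R \<le> t \<Longrightarrow> K\<^sub>1 < H x t"
    using H_coercive[of x\<^sub>0] by blast
  \<comment> \<open>Three steps of length below \<open>r\<close> lead from \<open>x\<^sub>0\<close>
    to the point where \<open>H\<close> is evaluated: to \<open>y\<^sub>1\<close>, to
    \<open>x'\<close> and to \<open>x\<close>.\<close>
  define r where "r = e / 3"
  have r: "0 < r" using e by (simp add: r_def)
  \<comment> \<open>The first entry keeps the slope, known up to
    \<open>4 * \<delta> \<le> 1/2\<close>, above \<open>R\<close>. The second gives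
    \<open>A * r > K\<^sub>1\<close>, more than the oscillation of \<open>w\<close>, which keeps
    \<open>x'\<close> within \<open>r\<close> of \<open>y\<^sub>1\<close>.\<close>
  define A where "A = max (R + 1) (K\<^sub>1 / r + 1)"
  have A: "R + 1 \<le> A" "K\<^sub>1 / r + 1 \<le> A" by (auto simp: A_def)
  have "0 < K\<^sub>1 / r" using r K\<^sub>1_pos by simp
  then have A1: "1 < A" using A(2) by linarith
  have "K\<^sub>1 = K\<^sub>1 / r * r" using r by simp
  also have "\<dots> < A * r" using A(2) r by (intro mult_strict_right_mono) auto
  finally have Ar: "K\<^sub>1 < A * r" .
  have "w x\<^sub>1 - w y\<^sub>1 \<le> A * d x\<^sub>1 y\<^sub>1" if w: "w \<in> perron_class" and y\<^sub>1: "d x\<^sub>0 y\<^sub>1 < r" for w x\<^sub>1 y\<^sub>1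
  proof (rule ccontr)
    assume neg: "\<not> w x\<^sub>1 - w y\<^sub>1 \<le> A * d x\<^sub>1 y\<^sub>1"
    have w_sub: "subsolution w" and wb: "\<And>y. - K\<^sub>1 \<le> w y" "\<And>y. w y \<le> - K\<^sub>0" using w unfolding perron_class_def by auto
    define \<gamma> where "\<gamma> = w x\<^sub>1 - w y\<^sub>1 - A * d x\<^sub>1 y\<^sub>1"
    have \<gamma>: "0 < \<gamma>" using neg by (simp add: \<gamma>_def)
    define \<delta> where "\<delta> = min (\<gamma> / 2) (1 / 8)"
    have \<delta>: "0 < \<delta>" "\<delta> < \<gamma>" "\<delta> \<le> 1 / 8" using \<gamma> by (auto simp: \<delta>_def)
    \<comment> \<open>The cone ties the doubled pair to \<open>y\<^sub>1\<close>. Its slope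
      \<open>2 * A\<close> is steeper than the penalty, which is what excludes the diagonal.\<close>
    define v where "v y = w y\<^sub>1 + 2 * A * d y y\<^sub>1" for y
    have v_lsc: "lower_semicontinuous v"
      unfolding lower_semicontinuous_def
    proof (intro allI)
      fix s
      have "continuous_on UNIV v"
        unfolding v_def continuous_on_def
        by (intro ballI tendsto_add tendsto_const tendsto_mult tendsto_d tendsto_ident_at)
      then show "open {x. s < v x}" by (intro open_Collect_less continuous_on_const)
    qed
    have v_low: "w y\<^sub>1 \<le> v y" for y using A1 d_nonneg[of y y\<^sub>1] by (simp add: v_def)
    have A0: "0 \<le> A" using A1 by simp
    obtain x' y' where xy: "\<And>x y. v y' - w x' + A * d x' y' \<le> v y - w x + A * d x y + \<delta>"
      "\<And>x y. v y' - w x' + A * d x' y' \<le> v y - w x + A * d x y + \<delta> * (d x x' + d y y')"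
      and loc: "x' \<noteq> y' \<Longrightarrow> \<exists>x y. \<exists>p\<in>superdifferential atlas w x. \<exists>q\<in>subdifferential atlas v y.
         d x x' < r \<and> \<bar>dual_norm atlas nrm x p - A\<bar> \<le> 4 * \<delta>"
    proof -
      obtain x' y' where *: "\<forall>x y. v y' - w x' + A * d x' y' \<le> v y - w x + A * d x y + \<delta>"
        "\<forall>x y. v y' - w x' + A * d x' y' \<le> v y - w x + A * d x y + \<delta> * (d x x' + d y y')"
        "x' \<noteq> y' \<longrightarrow> (\<forall>\<rho>>0. \<exists>x y. \<exists>p\<in>superdifferential atlas w x. \<exists>q\<in>subdifferential atlas v y.
         d x x' < \<rho> \<and> d y y' < \<rho> \<and> w x' - v y' - \<rho> \<le> w x - v y \<and>
         \<bar>dual_norm atlas nrm x p - A\<bar> \<le> 4 * \<delta> \<and> \<bar>dual_norm atlas nrm y q - A\<bar> \<le> 4 * \<delta>)"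
        using doubling[OF subsolutionD(1)[OF w_sub] wb(2) v_lsc v_low order_refl A0 \<delta>(1)] A1 by auto
      show ?thesis by (rule that[of y' x']) (use * r in blast)+
    qed
    have neg': "v y' - w x' + A * d x' y' < 0"
      using xy(1)[of y\<^sub>1 x\<^sub>1] \<delta>(2) by (simp add: v_def d_refl \<gamma>_def)
    \<comment> \<open>From a diagonal point, moving \<open>y'\<close> to \<open>y\<^sub>1\<close>
      saves \<open>2 * A * d x' y\<^sub>1\<close> and costs only
      \<open>(A + \<delta>) * d x' y\<^sub>1\<close>. So the point would be \<open>y\<^sub>1\<close>
      itself, where the functional is \<open>0\<close> and not negative.\<close>
    have ne: "x' \<noteq> y'"
    proof
      assume eq: "x' = y'"
      have "2 * A * d x' y\<^sub>1 \<le> A * d x' y\<^sub>1 + \<delta> * d x' y\<^sub>1"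
        using xy(2)[of y\<^sub>1 x'] by (simp add: eq v_def d_refl d_sym[of y\<^sub>1])
      then have "(A - \<delta>) * d x' y\<^sub>1 \<le> 0" by (simp add: algebra_simps)
      then have "d x' y\<^sub>1 \<le> 0" using A1 \<delta>(3) by (simp add: mult_le_0_iff)
      then have "x' = y\<^sub>1" using d_nonneg[of x' y\<^sub>1] d_eq_0[of x' y\<^sub>1] by linarith
      then show False using neg' eq by (simp add: v_def d_refl)
    qed
    obtain x p where p: "p \<in> superdifferential atlas w x" and x: "d x x' < r" and P: "\<bar>dual_norm atlas nrm x p - A\<bar> \<le> 4 * \<delta>"
      using loc[OF ne] by blast
    have "A * (d x' y' + d y' y\<^sub>1) < A * r"
    proof -
      have "0 \<le> A * d y' y\<^sub>1" using A0 d_nonneg by simp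
      then have "A * (d x' y' + d y' y\<^sub>1) < w x' - w y\<^sub>1" using neg' unfolding v_def by (simp add: algebra_simps)
      also have "\<dots> \<le> K\<^sub>1" using wb(1)[of y\<^sub>1] wb(2)[of x'] K\<^sub>0_pos by simp
      finally show ?thesis using Ar by simp
    qed
    then have "d x' y\<^sub>1 < r" using A1 d_triangle[of x' y\<^sub>1 y'] by simp
    then have "d x\<^sub>0 x < e"
      using x y\<^sub>1 d_triangle[of x\<^sub>0 x x'] d_triangle[of x\<^sub>0 x' y\<^sub>1] d_sym[of x' x] d_sym[of x' y\<^sub>1] by (simp add: r_def)
    moreover have "R \<le> dual_norm atlas nrm x p" using P A(1) \<delta>(3) by linarith
    ultimately have "K\<^sub>1 < H x (dual_norm atlas nrm x p)" by (rule R)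
    then show False using subsolutionD(2)[OF w_sub p] wb(1)[of x] by linarith
  qed
  then show ?thesis using r A1 by (intro exI[of _ r] conjI exI[of _ A]) auto
qed

text \<open>A C1 function touching a constant has differential \<open>0\<close>, and
  \<open>H x 0 \<le> K\<^sub>1\<close>.\<close>

lemma subsolution_const: "subsolution (\<lambda>_. - K\<^sub>1)"
  unfolding viscosity_subsolution_def
proof (intro conjI allI ballI)
  show "upper_semicontinuous (\<lambda>_ :: 'm. - K\<^sub>1)" unfolding upper_semicontinuous_def by simp
  fix x p assume "p \<in> superdifferential atlas (\<lambda>_. - K\<^sub>1) x"
  then obtain g where g: "p = differential atlas g x" "C1_fun atlas g" "\<forall>\<^sub>F y in nhds x. - K\<^sub>1 - g y \<le> - K\<^sub>1 - g x"
    unfolding superdifferential_def by blast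
  have "\<forall>\<^sub>F y in nhds x. g x - 0 \<le> g y - (0 :: real)" using g(3) by eventually_elim simp
  from differential_eq_of_local_min[OF g(2) C1_fun_const this] dn_const[where r = 0 and x = x]
  show "- K\<^sub>1 + H x (dual_norm atlas nrm x p) \<le> 0" using H_0(2)[of x] g(1) by simp
qed

section \<open>The supremum of the class: bounds, continuity and local Lipschitz constants\<close>

definition perron :: "'m \<Rightarrow> real" where
  "perron x = (SUP w\<in>perron_class. w x)"

lemma const_in_perron_class: "(\<lambda>_. - K\<^sub>1) \<in> perron_class"
proof -
  \<comment> \<open>Some point is needed to read off \<open>K\<^sub>0 \<le> K\<^sub>1\<close> from
    the bounds on \<open>H x 0\<close>.\<close>
  obtain x :: 'm where True by blast
  have "K\<^sub>0 \<le> K\<^sub>1" using H_0[of x] by simp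
  then show ?thesis unfolding perron_class_def using subsolution_const by simp
qed

lemma perron_bdd: "bdd_above ((\<lambda>w. w x) ` perron_class)"
  by (rule bdd_aboveI2[of _ _ "- K\<^sub>0"]) (simp add: perron_class_def)

lemma perron_upper: "w \<in> perron_class \<Longrightarrow> w x \<le> perron x"
  unfolding perron_def by (rule cSUP_upper[OF _ perron_bdd])

lemma perron_le: "(\<And>w. w \<in> perron_class \<Longrightarrow> w x \<le> k) \<Longrightarrow> perron x \<le> k"
  unfolding perron_def using const_in_perron_class by (intro cSUP_least) auto

lemma perron_bounds: "- K\<^sub>1 \<le> perron x" "perron x \<le> - K\<^sub>0"
  by (rule perron_upper[OF const_in_perron_class], rule perron_le, simp add: perron_class_def)

text \<open>A supremum of functions with a common Lipschitz bound inherits it. Only \<open>y\<close>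
  is confined to a ball, as in the class; this is how \<open>perron_subsolution\<close> can apply it
  to a pair of which just one point is located.\<close>

lemma perron_lipschitz: "\<exists>r>0. \<exists>A\<ge>0. \<forall>x y. d x\<^sub>0 y < r \<longrightarrow> perron x - perron y \<le> A * d x y"
proof -
  obtain r A where r: "0 < r" "0 \<le> A" "\<forall>w\<in>perron_class. \<forall>x y. d x\<^sub>0 y < r \<longrightarrow> w x - w y \<le> A * d x y"
    using perron_class_lipschitz[of x\<^sub>0] by blast
  have "perron x - perron y \<le> A * d x y" if y: "d x\<^sub>0 y < r" for x y
  proof -
    have "perron x \<le> perron y + A * d x y"
    proof (rule perron_le)
      fix w assume w: "w \<in> perron_class"
      have "w x - w y \<le> A * d x y" using r(3) w y by blast
      then show "w x \<le> perron y + A * d x y" using perron_upper[OF w, of y] by linarith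
    qed
    then show ?thesis by simp
  qed
  then show ?thesis using r by blast
qed

lemma perron_near: "0 < e \<Longrightarrow> \<forall>\<^sub>F y in nhds x. \<bar>perron y - perron x\<bar> < e"
proof -
  assume e: "0 < e"
  obtain r A where r: "0 < r" "0 \<le> A" "\<And>z y. d x y < r \<Longrightarrow> perron z - perron y \<le> A * d z y"
    using perron_lipschitz[of x] by blast
  have "0 < min r (e / (A + 1))" using r e by simp
  from eventually_d_less[OF this, of x] show ?thesis
  proof eventually_elim
    case (elim y)
    have "(A + 1) * d x y < e" using elim r(2) by (simp add: pos_less_divide_eq mult.commute)
    then have Ad: "A * d x y < e" using d_nonneg[of x y] by (simp add: distrib_right)
    then show ?case
      using r(3)[of y x] r(3)[of x y] elim r(1) d_refl[of x] d_sym[of x y] by (simp add: abs_less_iff)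
  qed
qed

lemma perron_usc: "upper_semicontinuous perron"
  unfolding upper_semicontinuous_def
proof (intro allI)
  fix r
  have "\<forall>\<^sub>F y in nhds x. perron y < r" if "perron x < r" for x
    using perron_near[of "r - perron x" x] that by (auto elim: eventually_mono)
  then show "open {x. perron x < r}" unfolding open_d_iff eventually_nhds_d by auto
qed

lemma perron_lsc: "lower_semicontinuous perron"
  unfolding lower_semicontinuous_def
proof (intro allI)
  fix r
  have "\<forall>\<^sub>F y in nhds x. r < perron y" if "r < perron x" for x
    using perron_near[of "perron x - r" x] that by (auto elim: eventually_mono)
  then show "open {x. r < perron x}" unfolding open_d_iff eventually_nhds_d by auto
qed

lemma perron_locally_lipschitz: "locally_lipschitz d perron"
  unfolding locally_lipschitz_def
proof
  fix x
  obtain r A where r: "0 < r" "0 \<le> A" "\<And>z y. d x y < r \<Longrightarrow> perron z - perron y \<le> A * d z y"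
    using perron_lipschitz[of x] by blast
  obtain V where V: "open V" "x \<in> V" "\<And>y. y \<in> V \<Longrightarrow> d x y < r"
    using eventually_d_less[OF r(1), of x] unfolding eventually_nhds by blast
  have "\<bar>perron y - perron z\<bar> \<le> A * d y z" if "y \<in> V" "z \<in> V" for y z
    using r(3)[OF V(3)[OF that(1)], of z] r(3)[OF V(3)[OF that(2)], of y] d_sym[of y z] by (simp add: abs_le_iff)
  then show "\<exists>V. open V \<and> x \<in> V \<and> (\<exists>A. \<forall>y\<in>V. \<forall>z\<in>V. \<bar>perron y - perron z\<bar> \<le> A * d y z)"
    using V by blast
qed

text \<open>No single member attains the supremum. A member \<open>w\<close> with nearly the right
  value at \<open>x\<^sub>0\<close> is doubled against the test function lifted by
  \<open>\<kappa>\<close> away from \<open>x\<^sub>0\<close>: the lift forces the point of the test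
  function into the small set \<open>K\<close>, and the slope of \<open>w\<close> at the partner
  point is then close to \<open>t\<^sub>0\<close>.\<close>

lemma perron_subsolution: "subsolution perron"
  unfolding viscosity_subsolution_def
proof (intro conjI allI ballI perron_usc)
  fix x\<^sub>0 p assume "p \<in> superdifferential atlas perron x\<^sub>0"
  then obtain g where g: "p = differential atlas g x\<^sub>0" "C1_fun atlas g"
    and max: "\<forall>\<^sub>F y in nhds x\<^sub>0. perron y - g y \<le> perron x\<^sub>0 - g x\<^sub>0"
    unfolding superdifferential_def by blast
  define t\<^sub>0 where "t\<^sub>0 = dn g x\<^sub>0"
  have "perron x\<^sub>0 + H x\<^sub>0 t\<^sub>0 \<le> 0"
  proof (rule ccontr)
    assume neg: "\<not> perron x\<^sub>0 + H x\<^sub>0 t\<^sub>0 \<le> 0"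
    \<comment> \<open>Of the excess \<open>3 * \<nu>\<close>, one \<open>\<nu>\<close> is lost in
      the value of \<open>w\<close>, one in the value of \<open>H\<close>, and one remains for the
      contradiction.\<close>
    define \<nu> where "\<nu> = (perron x\<^sub>0 + H x\<^sub>0 t\<^sub>0) / 3"
    have \<nu>: "0 < \<nu>" using neg by (simp add: \<nu>_def)
    obtain e\<^sub>1 \<tau> where e\<^sub>1: "0 < e\<^sub>1" and \<tau>: "0 < \<tau>"
      and H: "\<And>x t. d x\<^sub>0 x < e\<^sub>1 \<Longrightarrow> \<bar>t - t\<^sub>0\<bar> < \<tau> \<Longrightarrow> \<bar>H x t - H x\<^sub>0 t\<^sub>0\<bar> < \<nu>"
      using H_near[OF \<nu>, of x\<^sub>0 t\<^sub>0] by blast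
    have "\<forall>\<^sub>F y in nhds x\<^sub>0. perron y - g y \<le> perron x\<^sub>0 - g x\<^sub>0 \<and> \<bar>dn g y - dn g x\<^sub>0\<bar> < \<tau> / 3 \<and> \<bar>g y - g x\<^sub>0\<bar> < min (\<nu> / 2) 1"
      using \<tau> \<nu> by (intro eventually_conj max dn_continuous C1_fun_continuous g) auto
    then obtain e\<^sub>2 where e\<^sub>2: "0 < e\<^sub>2" "\<And>y. d x\<^sub>0 y < e\<^sub>2 \<Longrightarrow> perron y - g y \<le> perron x\<^sub>0 - g x\<^sub>0 \<and> \<bar>dn g y - dn g x\<^sub>0\<bar> < \<tau> / 3 \<and> \<bar>g y - g x\<^sub>0\<bar> < min (\<nu> / 2) 1"
      unfolding eventually_nhds_d by blast
    obtain e\<^sub>3 A where e\<^sub>3: "0 < e\<^sub>3" "0 \<le> A" "\<And>x y. d x\<^sub>0 y < e\<^sub>3 \<Longrightarrow> perron x - perron y \<le> A * d x y"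
      using perron_lipschitz[of x\<^sub>0] by blast
    define e where "e = min (min e\<^sub>1 e\<^sub>2) e\<^sub>3 / 4"
    have e: "0 < e" "4 * e \<le> e\<^sub>1" "4 * e \<le> e\<^sub>2" "4 * e \<le> e\<^sub>3" using e\<^sub>1 e\<^sub>2(1) e\<^sub>3(1) by (auto simp: e_def)
    obtain W where W: "open W" "x\<^sub>0 \<in> W" "\<And>y. y \<in> W \<Longrightarrow> d x\<^sub>0 y < e"
      using eventually_d_less[OF e(1), of x\<^sub>0] unfolding eventually_nhds by blast
    obtain \<beta> K M where \<beta>: "C1_fun atlas \<beta>" "\<And>y. 0 \<le> \<beta> y" "\<And>y. \<beta> y \<le> 1" and K: "K \<subseteq> W" "\<And>y. y \<notin> K \<Longrightarrow> \<beta> y = 0"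
      and \<beta>1: "\<forall>\<^sub>F y in nhds x\<^sub>0. \<beta> y = 1" and M: "0 \<le> M" "\<And>y. dn \<beta> y \<le> M"
      using bump_exists[OF W(1,2)] by blast
    have \<beta>x\<^sub>0: "\<beta> x\<^sub>0 = 1" using \<beta>1 by (rule eventually_nhds_x_imp_x)
    \<comment> \<open>The lift changes dual norms by at most
      \<open>\<kappa> * M \<le> \<tau> / 3\<close>.\<close>
    define \<kappa> where "\<kappa> = min 1 (\<tau> / (3 * (M + 1)))"
    have \<kappa>: "0 < \<kappa>" "\<kappa> \<le> 1" and "\<kappa> \<le> \<tau> / (3 * (M + 1))" unfolding \<kappa>_def using \<tau> M(1) by auto
    then have \<kappa>M: "\<kappa> * M \<le> \<tau> / 3" using M(1) by (simp add: pos_le_divide_eq algebra_simps)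
    define r\<^sub>0 where "r\<^sub>0 = perron x\<^sub>0 - g x\<^sub>0 + \<kappa>"
    \<comment> \<open>The bump cancels the lift at \<open>x\<^sub>0\<close>, so \<open>G\<close>
      agrees with \<open>perron\<close> there and is above it by \<open>\<kappa>\<close> off
      \<open>K\<close>. The factor \<open>1\<close> gives the added constant the shape required by
      \<open>dn_add_scaled\<close>.\<close>
    define G where "G y = (g y + 1 * r\<^sub>0) + (- \<kappa>) * \<beta> y" for y
    have g': "C1_fun atlas (\<lambda>y. g y + 1 * r\<^sub>0)" by (intro C1_fun_add g(2) C1_fun_const)
    have G: "C1_fun atlas G" unfolding G_def by (intro C1_fun_add C1_fun_mult C1_fun_const g(2) \<beta>(1))
    have dn_G: "\<bar>dn G y - dn g y\<bar> \<le> \<tau> / 3" for y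
    proof -
      have "\<bar>dn (\<lambda>y. g y + 1 * r\<^sub>0) y - dn g y\<bar> \<le> \<bar>1\<bar> * dn (\<lambda>_. r\<^sub>0) y"
        by (rule dn_add_scaled[OF g(2) C1_fun_const])
      moreover have "\<bar>dn G y - dn (\<lambda>y. g y + 1 * r\<^sub>0) y\<bar> \<le> \<bar>- \<kappa>\<bar> * dn \<beta> y"
        unfolding G_def by (rule dn_add_scaled[OF g' \<beta>(1)])
      moreover have "\<bar>- \<kappa>\<bar> * dn \<beta> y \<le> \<kappa> * M" using M(2) \<kappa>(1) by (simp add: mult_left_mono)
      ultimately show ?thesis using \<kappa>M dn_const[where r = r\<^sub>0 and x = y] by simp
    qed
    have \<kappa>\<beta>: "0 \<le> \<kappa> * \<beta> y" "\<kappa> * \<beta> y \<le> \<kappa>" for y using \<beta>(2,3)[of y] \<kappa>(1) by (auto simp: mult_left_le)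
    have G_low: "g y - g x\<^sub>0 + perron x\<^sub>0 \<le> G y" for y using \<kappa>\<beta>(2)[of y] by (simp add: G_def r\<^sub>0_def)
    have G_up: "G y \<le> g y - g x\<^sub>0 + perron x\<^sub>0 + \<kappa>" for y using \<kappa>\<beta>(1)[of y] by (simp add: G_def r\<^sub>0_def)
    \<comment> \<open>Doubling asks for a global function bounded below. The value \<open>3\<close>
      exceeds \<open>G\<close> on the closed ball, so the jump is upward and keeps \<open>v\<close>
      lower semicontinuous; it also exceeds \<open>perron + \<kappa>\<close>, as
      \<open>perron\<close> is negative and \<open>\<kappa> \<le> 1\<close>.\<close>
    define v where "v y = (if d x\<^sub>0 y \<le> 2 * e then G y else 3)" for y
    have u_neg: "perron y < 0" for y using perron_bounds(2)[of y] K\<^sub>0_pos by simp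
    have G3: "G y < 3" and G_low': "- K\<^sub>1 - 1 \<le> G y" if "d x\<^sub>0 y \<le> 2 * e" for y
    proof -
      have "d x\<^sub>0 y < e\<^sub>2" using that e by linarith
      from e\<^sub>2(2)[OF this] show "G y < 3" "- K\<^sub>1 - 1 \<le> G y"
        using G_up[of y] G_low[of y] \<kappa>(2) u_neg[of x\<^sub>0] perron_bounds(1)[of x\<^sub>0] by linarith+
    qed
    have v_low: "- K\<^sub>1 - 1 \<le> v y" for y using G_low'[of y] K\<^sub>1_pos by (simp add: v_def)
    have v_lsc: "lower_semicontinuous v"
      unfolding lower_semicontinuous_def
    proof (intro allI)
      fix r
      have "\<forall>\<^sub>F z in nhds y. r < v z" if y: "r < v y" for y
      proof (cases "d x\<^sub>0 y \<le> 2 * e")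
        case True
        then have "r < G y" "r < 3" using y G3[OF True] by (auto simp: v_def)
        then have "\<forall>\<^sub>F z in nhds y. \<bar>G z - G y\<bar> < G y - r" by (intro C1_fun_continuous G) simp
        then show ?thesis by eventually_elim (use \<open>r < 3\<close> in \<open>auto simp: v_def\<close>)
      next
        case False
        have "\<forall>\<^sub>F z in nhds y. d y z < d x\<^sub>0 y - 2 * e" using False by (intro eventually_d_less) simp
        then show ?thesis
        proof eventually_elim
          case (elim z)
          then have "\<not> d x\<^sub>0 z \<le> 2 * e" using d_triangle[of x\<^sub>0 y z] d_sym[of z y] by linarith
          then show ?case using y False by (simp add: v_def)
        qed
      qed
      then show "open {x. r < v x}" unfolding open_d_iff eventually_nhds_d by auto
    qed
    have v_gap: "perron y + \<kappa> \<le> v y" if "y \<notin> K" for y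
    proof (cases "d x\<^sub>0 y \<le> 2 * e")
      case True
      then have "d x\<^sub>0 y < e\<^sub>2" using e by linarith
      from e\<^sub>2(2)[OF this] show ?thesis using True K(2)[OF that] by (simp add: v_def G_def r\<^sub>0_def)
    next
      case False
      then show ?thesis using u_neg[of y] \<kappa>(2) by (simp add: v_def)
    qed
    have vx\<^sub>0: "v x\<^sub>0 = perron x\<^sub>0" using e(1) by (simp add: v_def d_refl G_def r\<^sub>0_def \<beta>x\<^sub>0)
    \<comment> \<open>Over the distance \<open>3 * \<rho>\<close> of the final pair,
      \<open>perron\<close> rises by at most \<open>\<kappa> / 4\<close>.\<close>
    define \<rho> where "\<rho> = min e (\<kappa> / (12 * (A + 1)))"
    have \<rho>: "0 < \<rho>" "\<rho> \<le> e" and "\<rho> \<le> \<kappa> / (12 * (A + 1))" unfolding \<rho>_def using e \<kappa> e\<^sub>3(2) by auto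
    then have A\<rho>: "A * (3 * \<rho>) \<le> \<kappa> / 4" using e\<^sub>3(2) by (simp add: pos_le_divide_eq algebra_simps)
    \<comment> \<open>\<open>3 * \<zeta>\<close> stays below the remaining lift
      \<open>3 * \<kappa> / 4\<close> and within \<open>\<nu> / 2\<close>; the two slopes, each
      within \<open>4 * \<zeta>\<close> of the penalty's, differ by at most
      \<open>\<tau> / 6\<close>.\<close>
    define \<zeta> where "\<zeta> = min (min (\<kappa> / 8) (\<nu> / 6)) (min (\<tau> / 48) \<rho>)"
    have \<zeta>: "0 < \<zeta>" "\<zeta> \<le> \<kappa> / 8" "\<zeta> \<le> \<nu> / 6" "\<zeta> \<le> \<tau> / 48" "\<zeta> \<le> \<rho>"
      unfolding \<zeta>_def using \<kappa>(1) \<nu> \<tau> \<rho>(1) by linarith+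
    obtain w where w: "w \<in> perron_class" "perron x\<^sub>0 - \<zeta> < w x\<^sub>0"
    proof -
      have "perron x\<^sub>0 - \<zeta> < (SUP w\<in>perron_class. w x\<^sub>0)" using \<zeta>(1) by (simp add: perron_def)
      then have "\<exists>w\<in>perron_class. perron x\<^sub>0 - \<zeta> < w x\<^sub>0"
        using const_in_perron_class by (subst (asm) less_cSUP_iff[OF _ perron_bdd]) auto
      then show ?thesis using that by blast
    qed
    have w_sub: "subsolution w" and wb: "\<And>y. w y \<le> - K\<^sub>0" using w(1) unfolding perron_class_def by auto
    \<comment> \<open>At the chosen pair the penalty is at most \<open>3 + K\<^sub>1\<close> by the
      bounds on \<open>w\<close> and \<open>v\<close>, so this weight gives a distance of at most
      \<open>\<rho>\<close>.\<close>
    define lam where "lam = (3 + K\<^sub>1) / \<rho>\<^sup>2"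
    have lam: "0 \<le> lam" using K\<^sub>1_pos by (simp add: lam_def)
    obtain x' y' where xy: "\<And>x y. v y' - w x' + lam * (d x' y')\<^sup>2 \<le> v y - w x + lam * (d x y)\<^sup>2 + \<zeta>"
      and loc: "\<And>\<rho>. 0 < \<rho> \<Longrightarrow> \<exists>x y. \<exists>p\<in>superdifferential atlas w x. \<exists>q\<in>subdifferential atlas v y.
         d x x' < \<rho> \<and> d y y' < \<rho> \<and> w x' - v y' - \<rho> \<le> w x - v y \<and>
         \<bar>dual_norm atlas nrm x p - 2 * lam * d x' y'\<bar> \<le> 4 * \<zeta> \<and>
         \<bar>dual_norm atlas nrm y q - 2 * lam * d x' y'\<bar> \<le> 4 * \<zeta>"
      using doubling[OF subsolutionD(1)[OF w_sub] wb v_lsc v_low lam order_refl \<zeta>(1)] by auto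
    have val0: "v y' - w x' + lam * (d x' y')\<^sup>2 < 2 * \<zeta>"
      using xy[of x\<^sub>0 x\<^sub>0] w(2) by (simp add: vx\<^sub>0 d_refl)
    have "lam * (d x' y')\<^sup>2 \<le> 3 + K\<^sub>1"
      using val0 v_low[of y'] wb[of x'] K\<^sub>0_pos \<zeta>(2) \<kappa>(2) by linarith
    then have "(d x' y')\<^sup>2 \<le> \<rho>\<^sup>2" using K\<^sub>1_pos \<rho>(1) by (simp add: lam_def pos_divide_le_eq mult.commute)
    then have d': "d x' y' \<le> \<rho>" by (rule power2_le_imp_le) (use \<rho> in simp)
    have val': "- 2 * \<zeta> < w x' - v y'"
    proof -
      have "0 \<le> lam * (d x' y')\<^sup>2" using lam by simp
      then show ?thesis using val0 by simp
    qed
    obtain x y p' q where p': "p' \<in> superdifferential atlas w x" and q: "q \<in> subdifferential atlas v y"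
      and near: "d x x' < \<zeta>" "d y y' < \<zeta>" and val: "w x' - v y' - \<zeta> \<le> w x - v y"
      and PQ: "\<bar>dual_norm atlas nrm x p' - 2 * lam * d x' y'\<bar> \<le> 4 * \<zeta>"
        "\<bar>dual_norm atlas nrm y q - 2 * lam * d x' y'\<bar> \<le> 4 * \<zeta>"
      using loc[OF \<zeta>(1)] by blast
    have dxy: "d x y \<le> 3 * \<rho>" using d_lipschitz[of x y x' y'] near d' \<zeta>(5) by linarith
    have val3: "- 3 * \<zeta> < w x - v y" using val val' by linarith
    have y_in: "d x\<^sub>0 y \<le> 2 * e"
    proof (rule ccontr)
      assume "\<not> d x\<^sub>0 y \<le> 2 * e"
      then have "v y = 3" by (simp add: v_def)
      then show False using val3 wb[of x] K\<^sub>0_pos \<zeta>(2) \<kappa>(2) by linarith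
    qed
    \<comment> \<open>Off \<open>K\<close> the lift would exceed what \<open>perron\<close> can rise
      between the two points, while \<open>w \<le> perron\<close> nearly reaches
      \<open>v y\<close>.\<close>
    have yK: "y \<in> K"
    proof (rule ccontr)
      assume "y \<notin> K"
      have "perron x - perron y \<le> A * d x y" using y_in e by (intro e\<^sub>3(3)) linarith
      also have "\<dots> \<le> A * (3 * \<rho>)" using dxy e\<^sub>3(2) by (rule mult_left_mono)
      finally show False
        using v_gap[OF \<open>y \<notin> K\<close>] perron_upper[OF w(1), of x] A\<rho> val3 \<zeta>(2) \<kappa>(1) by linarith
    qed
    then have y_near: "d x\<^sub>0 y < e" using K(1) W(3) by blast
    \<comment> \<open>\<open>v\<close> coincides with the C1 function \<open>G\<close> near
      \<open>y\<close>, so its only subdifferential there is the differential of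
      \<open>G\<close>.\<close>
    have dnG: "dual_norm atlas nrm y q = dn G y"
    proof -
      obtain h where h: "q = differential atlas h y" "C1_fun atlas h" and min: "\<forall>\<^sub>F z in nhds y. v y - h y \<le> v z - h z"
        using q unfolding subdifferential_def by blast
      have "\<forall>\<^sub>F z in nhds y. d y z < e" by (rule eventually_d_less[OF e(1)])
      with min have "\<forall>\<^sub>F z in nhds y. G y - h y \<le> G z - h z"
      proof eventually_elim
        case (elim z)
        have "d x\<^sub>0 z \<le> 2 * e" using d_triangle[of x\<^sub>0 z y] elim(2) y_near by linarith
        then show ?case using elim(1) y_in by (simp add: v_def)
      qed
      from differential_eq_of_local_min[OF G h(2) this] show ?thesis by (simp add: h(1))
    qed
    have y2: "d x\<^sub>0 y < e\<^sub>2" using y_near e by linarith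
    have "\<bar>dual_norm atlas nrm x p' - t\<^sub>0\<bar> < \<tau>"
      using e\<^sub>2(2)[OF y2] dn_G[of y] PQ \<zeta>(4) \<tau> unfolding dnG t\<^sub>0_def by linarith
    moreover have "d x\<^sub>0 x < e\<^sub>1"
      using d_triangle[of x\<^sub>0 x y] d_sym[of x y] y_near dxy \<rho>(2) e(2) by linarith
    ultimately have "\<bar>H x (dual_norm atlas nrm x p') - H x\<^sub>0 t\<^sub>0\<bar> < \<nu>" by (intro H)
    moreover have "w x + H x (dual_norm atlas nrm x p') \<le> 0" by (rule subsolutionD(2)[OF w_sub p'])
    moreover have "perron x\<^sub>0 - \<nu> < w x"
    proof -
      have "v y = G y" using y_in by (simp add: v_def)
      then show ?thesis using val3 G_low[of y] e\<^sub>2(2)[OF y2] \<zeta>(3) \<nu> by linarith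
    qed
    moreover have "H x\<^sub>0 t\<^sub>0 = 3 * \<nu> - perron x\<^sub>0" by (simp add: \<nu>_def field_simps)
    ultimately show False using \<nu> by linarith
  qed
  then show "perron x\<^sub>0 + H x\<^sub>0 (dual_norm atlas nrm x\<^sub>0 p) \<le> 0" by (simp add: g(1) t\<^sub>0_def)
qed

text \<open>If the inequality failed at \<open>x\<^sub>0\<close>, the test function could be pushed
  slightly above \<open>perron\<close> near \<open>x\<^sub>0\<close> and still satisfy the strict
  subsolution inequality; the maximum of both would be a member of the class above its
  supremum.\<close>

lemma perron_supersolution: "supersolution perron"
  unfolding viscosity_supersolution_def
proof (intro conjI allI ballI perron_lsc)
  fix x\<^sub>0 p assume "p \<in> subdifferential atlas perron x\<^sub>0"
  then obtain g where g: "p = differential atlas g x\<^sub>0" "C1_fun atlas g"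
    and min: "\<forall>\<^sub>F y in nhds x\<^sub>0. perron x\<^sub>0 - g x\<^sub>0 \<le> perron y - g y"
    unfolding subdifferential_def by blast
  define t\<^sub>0 where "t\<^sub>0 = dn g x\<^sub>0"
  have "0 \<le> perron x\<^sub>0 + H x\<^sub>0 t\<^sub>0"
  proof (rule ccontr)
    assume "\<not> 0 \<le> perron x\<^sub>0 + H x\<^sub>0 t\<^sub>0"
    define \<nu> where "\<nu> = - (perron x\<^sub>0 + H x\<^sub>0 t\<^sub>0) / 3"
    have \<nu>: "0 < \<nu>" using \<open>\<not> 0 \<le> perron x\<^sub>0 + H x\<^sub>0 t\<^sub>0\<close> by (simp add: \<nu>_def)
    \<comment> \<open>Pushing upwards must respect the bound \<open>- K\<^sub>0\<close>. Where
      \<open>perron\<close> attains it, \<open>perron\<close> has a maximum, so \<open>g\<close> has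
      differential \<open>0\<close>, and \<open>K\<^sub>0 \<le> H x\<^sub>0 0\<close> gives the
      inequality directly.\<close>
    have u_lt: "perron x\<^sub>0 < - K\<^sub>0"
    proof (rule ccontr)
      assume "\<not> perron x\<^sub>0 < - K\<^sub>0"
      then have eq: "perron x\<^sub>0 = - K\<^sub>0" using perron_bounds(2)[of x\<^sub>0] by simp
      have "\<forall>\<^sub>F y in nhds x\<^sub>0. 0 - g x\<^sub>0 \<le> (0 :: real) - g y"
        using min by eventually_elim (use eq perron_bounds(2) in \<open>smt (verit)\<close>)
      from differential_eq_of_local_min[OF C1_fun_const g(2) this] have "t\<^sub>0 = 0"
        using dn_const[where r = 0 and x = x\<^sub>0] by (simp add: t\<^sub>0_def)
      then show False using H_0(1)[of x\<^sub>0] eq \<nu> by (simp add: \<nu>_def)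
    qed
    define gap where "gap = - K\<^sub>0 - perron x\<^sub>0"
    have gap: "0 < gap" using u_lt by (simp add: gap_def)
    obtain e\<^sub>1 \<tau> where e\<^sub>1: "0 < e\<^sub>1" and \<tau>: "0 < \<tau>"
      and H: "\<And>x t. d x\<^sub>0 x < e\<^sub>1 \<Longrightarrow> \<bar>t - t\<^sub>0\<bar> < \<tau> \<Longrightarrow> \<bar>H x t - H x\<^sub>0 t\<^sub>0\<bar> < \<nu>"
      using H_near[OF \<nu>, of x\<^sub>0 t\<^sub>0] by blast
    have "\<forall>\<^sub>F y in nhds x\<^sub>0. perron x\<^sub>0 - g x\<^sub>0 \<le> perron y - g y \<and> \<bar>dn g y - dn g x\<^sub>0\<bar> < \<tau> / 3 \<and> \<bar>g y - g x\<^sub>0\<bar> < min \<nu> (gap / 2)"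
      using \<tau> \<nu> gap by (intro eventually_conj min dn_continuous C1_fun_continuous g) auto
    then obtain e\<^sub>2 where e\<^sub>2: "0 < e\<^sub>2" "\<And>y. d x\<^sub>0 y < e\<^sub>2 \<Longrightarrow> perron x\<^sub>0 - g x\<^sub>0 \<le> perron y - g y \<and> \<bar>dn g y - dn g x\<^sub>0\<bar> < \<tau> / 3 \<and> \<bar>g y - g x\<^sub>0\<bar> < min \<nu> (gap / 2)"
      unfolding eventually_nhds_d by blast
    define e where "e = min e\<^sub>1 e\<^sub>2"
    have e: "0 < e" "e \<le> e\<^sub>1" "e \<le> e\<^sub>2" using e\<^sub>1 e\<^sub>2(1) by (auto simp: e_def)
    obtain W where W: "open W" "x\<^sub>0 \<in> W" "\<And>y. y \<in> W \<Longrightarrow> d x\<^sub>0 y < e"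
      using eventually_d_less[OF e(1), of x\<^sub>0] unfolding eventually_nhds by blast
    obtain \<beta> K M where \<beta>: "C1_fun atlas \<beta>" "\<And>y. 0 \<le> \<beta> y" "\<And>y. \<beta> y \<le> 1" and K: "closed K" "K \<subseteq> W" "\<And>y. y \<notin> K \<Longrightarrow> \<beta> y = 0"
      and \<beta>1: "\<forall>\<^sub>F y in nhds x\<^sub>0. \<beta> y = 1" and M: "0 \<le> M" "\<And>y. dn \<beta> y \<le> M"
      using bump_exists[OF W(1,2)] by blast
    have \<beta>x\<^sub>0: "\<beta> x\<^sub>0 = 1" using \<beta>1 by (rule eventually_nhds_x_imp_x)
    \<comment> \<open>The raise costs at most \<open>\<nu> / 2\<close> in value, uses half of the
      gap to \<open>- K\<^sub>0\<close>, and changes dual norms by at most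
      \<open>2 * \<eta> * M \<le> \<tau> / 3\<close>.\<close>
    define \<eta> where "\<eta> = min (min (\<nu> / 2) (gap / 2)) (\<tau> / (6 * (M + 1)))"
    have \<eta>: "0 < \<eta>" "\<eta> \<le> \<nu> / 2" "\<eta> \<le> gap / 2" and "\<eta> \<le> \<tau> / (6 * (M + 1))"
    proof -
      have "0 < \<tau> / (6 * (M + 1))" using \<tau> M(1) by simp
      then show "0 < \<eta>" "\<eta> \<le> \<nu> / 2" "\<eta> \<le> gap / 2" "\<eta> \<le> \<tau> / (6 * (M + 1))"
        unfolding \<eta>_def using \<nu> gap by linarith+
    qed
    then have \<eta>M: "2 * \<eta> * M \<le> \<tau> / 3" using M(1) by (simp add: pos_le_divide_eq algebra_simps)
    define r\<^sub>0 where "r\<^sub>0 = perron x\<^sub>0 - g x\<^sub>0 - \<eta>"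
    \<comment> \<open>Lowered by \<open>\<eta>\<close> and raised by \<open>2 * \<eta>\<close> times
      the bump: below \<open>perron\<close> on \<open>W\<close> off \<open>K\<close>, and above it
      by \<open>\<eta>\<close> at \<open>x\<^sub>0\<close>.\<close>
    define \<psi> where "\<psi> y = (g y + 1 * r\<^sub>0) + (2 * \<eta>) * \<beta> y" for y
    have g': "C1_fun atlas (\<lambda>y. g y + 1 * r\<^sub>0)" by (intro C1_fun_add g(2) C1_fun_const)
    have \<psi>: "C1_fun atlas \<psi>" unfolding \<psi>_def by (intro C1_fun_add C1_fun_mult C1_fun_const g(2) \<beta>(1))
    have dn_\<psi>: "\<bar>dn \<psi> y - dn g y\<bar> \<le> \<tau> / 3" for y
    proof -
      have "\<bar>dn (\<lambda>y. g y + 1 * r\<^sub>0) y - dn g y\<bar> \<le> \<bar>1\<bar> * dn (\<lambda>_. r\<^sub>0) y"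
        by (rule dn_add_scaled[OF g(2) C1_fun_const])
      moreover have "\<bar>dn \<psi> y - dn (\<lambda>y. g y + 1 * r\<^sub>0) y\<bar> \<le> \<bar>2 * \<eta>\<bar> * dn \<beta> y"
        unfolding \<psi>_def by (rule dn_add_scaled[OF g' \<beta>(1)])
      moreover have "\<bar>2 * \<eta>\<bar> * dn \<beta> y \<le> 2 * \<eta> * M" using M(2) \<eta>(1) by (simp add: mult_left_mono)
      ultimately show ?thesis using \<eta>M dn_const[where r = r\<^sub>0 and x = y] by simp
    qed
    define w where "w y = (if y \<in> K then max (perron y) (\<psi> y) else perron y)" for y
    have w_W: "w y = max (perron y) (\<psi> y)" if "y \<in> W" for y
    proof (cases "y \<in> K")
      case False
      have "d x\<^sub>0 y < e\<^sub>2" using W(3)[OF that] e by simp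
      then have "\<psi> y \<le> perron y" using e\<^sub>2(2)[of y] K(3)[OF False] \<eta>(1) by (simp add: \<psi>_def r\<^sub>0_def)
      then show ?thesis using False by (simp add: w_def)
    qed (simp add: w_def)
    \<comment> \<open>\<open>W\<close> and the complement of the closed set \<open>K\<close> are
      open and cover the space, so near every point one of the two formulas for \<open>w\<close>
      holds throughout.\<close>
    have ev: "(\<forall>\<^sub>F z in nhds y. w z = max (perron z) (\<psi> z)) \<or> (\<forall>\<^sub>F z in nhds y. w z = perron z)" for y
    proof (cases "y \<in> W")
      case True
      have "\<forall>\<^sub>F z in nhds y. w z = max (perron z) (\<psi> z)"
        using eventually_nhds_in_open[OF W(1) True] by eventually_elim (rule w_W)
      then show ?thesis ..
    next
      case False
      then have "\<forall>\<^sub>F z in nhds y. z \<in> - K" using K by (intro eventually_nhds_in_open) (auto simp: open_Compl)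
      then have "\<forall>\<^sub>F z in nhds y. w z = perron z" by eventually_elim (simp add: w_def)
      then show ?thesis ..
    qed
    have w_ge: "perron y \<le> w y" for y by (simp add: w_def)
    have w_usc: "upper_semicontinuous w"
      unfolding upper_semicontinuous_def
    proof (intro allI)
      fix r
      have "\<forall>\<^sub>F z in nhds y. w z < r" if y: "w y < r" for y
      proof -
        have P: "\<forall>\<^sub>F z in nhds y. perron z < r"
          using w_ge[of y] y by (intro upper_semicontinuousD[OF perron_usc]) simp
        from ev[of y] show ?thesis
        proof
          assume 1: "\<forall>\<^sub>F z in nhds y. w z = max (perron z) (\<psi> z)"
          have "\<psi> y < r" using eventually_nhds_x_imp_x[OF 1] y by simp
          then have "\<forall>\<^sub>F z in nhds y. \<bar>\<psi> z - \<psi> y\<bar> < r - \<psi> y" by (intro C1_fun_continuous \<psi>) simp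
          with 1 P show ?thesis by eventually_elim auto
        next
          assume 1: "\<forall>\<^sub>F z in nhds y. w z = perron z"
          with P show ?thesis by eventually_elim simp
        qed
      qed
      then show "open {x. w x < r}" unfolding open_d_iff eventually_nhds_d by auto
    qed
    have "w \<in> perron_class"
      unfolding perron_class_def viscosity_subsolution_def
    proof (intro CollectI conjI allI ballI w_usc)
      show "- K\<^sub>1 \<le> w y" for y using w_ge[of y] perron_bounds(1)[of y] by simp
      show "w y \<le> - K\<^sub>0" for y
      proof (cases "y \<in> K")
        case True
        then have "d x\<^sub>0 y < e\<^sub>2" using W(3) K(2) e by fastforce
        moreover have "2 * \<eta> * \<beta> y \<le> 2 * \<eta> * 1" using \<beta>(3) \<eta>(1) by (intro mult_left_mono) auto
        moreover have "g y - g x\<^sub>0 < gap / 2" if "d x\<^sub>0 y < e\<^sub>2"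
          using e\<^sub>2(2)[OF that] by linarith
        ultimately have "g y - g x\<^sub>0 < gap / 2" "2 * \<eta> * \<beta> y \<le> 2 * \<eta> * 1" by auto
        moreover have "\<psi> y = perron x\<^sub>0 + (g y - g x\<^sub>0) + 2 * \<eta> * \<beta> y - \<eta>" by (simp add: \<psi>_def r\<^sub>0_def)
        ultimately have "\<psi> y \<le> perron x\<^sub>0 + gap" using \<eta>(3) by simp
        then have "\<psi> y \<le> - K\<^sub>0" by (simp add: gap_def)
        then show ?thesis using perron_bounds(2)[of y] True by (simp add: w_def)
      qed (simp add: w_def perron_bounds)
      fix y q assume "q \<in> superdifferential atlas w y"
      then obtain h where h: "q = differential atlas h y" "C1_fun atlas h" and max: "\<forall>\<^sub>F z in nhds y. w z - h z \<le> w y - h y"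
        unfolding superdifferential_def by blast
      show "w y + H y (dual_norm atlas nrm y q) \<le> 0"
      \<comment> \<open>Whichever of \<open>perron\<close> and \<open>\<psi>\<close> attains the
        maximum at \<open>y\<close> is also touched from above by the test function: the first is a
        subsolution, and the second is C1 and pins down the differential.\<close>
      proof (cases "w y = perron y")
        case True
        have "\<forall>\<^sub>F z in nhds y. perron z - h z \<le> perron y - h y"
          using max
        proof eventually_elim
          case (elim z)
          then show ?case using w_ge[of z] True by linarith
        qed
        then have "q \<in> superdifferential atlas perron y"
          unfolding superdifferential_def using h by blast
        from subsolutionD(2)[OF perron_subsolution this]
        show ?thesis using True by simp
      next
        case False
        then have yK: "y \<in> K" and wy: "w y = \<psi> y" by (auto simp: w_def max_def split: if_splits)
        have yW: "y \<in> W" using yK K(2) by blast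
        have "\<forall>\<^sub>F z in nhds y. h y - \<psi> y \<le> h z - \<psi> z"
          using max eventually_nhds_in_open[OF W(1) yW]
        proof eventually_elim
          case (elim z)
          have "\<psi> z \<le> w z" using w_W[OF elim(2)] by simp
          then show ?case using elim(1) wy by linarith
        qed
        from differential_eq_of_local_min[OF h(2) \<psi> this] have q: "dual_norm atlas nrm y q = dn \<psi> y" by (simp add: h(1))
        have y2: "d x\<^sub>0 y < e\<^sub>2" "d x\<^sub>0 y < e\<^sub>1" using W(3)[OF yW] e by auto
        have "\<bar>dn \<psi> y - t\<^sub>0\<bar> < \<tau>" using e\<^sub>2(2)[OF y2(1)] dn_\<psi>[of y] \<tau> unfolding t\<^sub>0_def by linarith
        then have "\<bar>H y (dn \<psi> y) - H x\<^sub>0 t\<^sub>0\<bar> < \<nu>" by (rule H[OF y2(2)])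
        moreover have "2 * \<eta> * \<beta> y \<le> 2 * \<eta> * 1" using \<beta>(3) \<eta>(1) by (intro mult_left_mono) auto
        moreover have "g y - g x\<^sub>0 < \<nu>" using e\<^sub>2(2)[OF y2(1)] by linarith
        ultimately have "\<psi> y \<le> perron x\<^sub>0 + \<nu> + \<nu> / 2" "\<bar>H y (dn \<psi> y) - H x\<^sub>0 t\<^sub>0\<bar> < \<nu>"
          using \<eta>(2) by (simp_all add: \<psi>_def r\<^sub>0_def)
        moreover have "H x\<^sub>0 t\<^sub>0 = - 3 * \<nu> - perron x\<^sub>0" by (simp add: \<nu>_def field_simps)
        ultimately show ?thesis using wy q \<nu> by simp
      qed
    qed
    then have "w x\<^sub>0 \<le> perron x\<^sub>0" by (rule perron_upper)
    moreover have "\<psi> x\<^sub>0 \<le> w x\<^sub>0" using w_W[OF W(2)] by simp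
    ultimately show False using \<eta>(1) \<beta>x\<^sub>0 by (simp add: \<psi>_def r\<^sub>0_def)
  qed
  then show "0 \<le> perron x\<^sub>0 + H x\<^sub>0 (dual_norm atlas nrm x\<^sub>0 p)" by (simp add: g(1) t\<^sub>0_def)
qed

lemma perron_solution: "viscosity_solution atlas nrm H perron"
  unfolding viscosity_solution_def using perron_subsolution perron_supersolution by simp

section \<open>Uniqueness, and the reduction of the two alternatives to the common structure\<close>

lemma bounded_solution_unique:
  assumes "bounded (range u)" "viscosity_solution atlas nrm H u"
    and "bounded (range v)" "viscosity_solution atlas nrm H v"
  shows "u = v"
proof
  fix x
  have b: "\<exists>M. \<forall>x. - M \<le> w x \<and> w x \<le> M" if "bounded (range w)" for w :: "'m \<Rightarrow> real"
    using that unfolding bounded_iff by (auto simp: abs_le_iff) (metis minus_le_iff)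
  obtain U V where "\<And>x. - U \<le> u x \<and> u x \<le> U" "\<And>x. - V \<le> v x \<and> v x \<le> V"
    using b[OF assms(1)] b[OF assms(3)] by blast
  then show "u x = v x"
    using assms(2,4) unfolding viscosity_solution_def
    by (intro antisym comparison[of u U v "- V"] comparison[of v V u "- U"]) auto
qed

lemma perron_bounded: "bounded (range perron)"
proof -
  have "\<bar>perron x\<bar> \<le> K\<^sub>1" for x using perron_bounds[of x] K\<^sub>0_pos K\<^sub>1_pos by linarith
  then show ?thesis unfolding bounded_iff by (intro exI[of _ K\<^sub>1]) auto
qed

end

text \<open>Continuity at the origin with \<open>\<omega> (0, 0) = 0\<close> makes
  \<open>\<omega>\<close> smaller than any given error once distance and difference of slopes are
  small, uniformly in all four arguments of \<open>H\<close>.\<close>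

lemma condition_A_imp_structure:
  assumes "condition_A dd H" "\<And>x y. 0 \<le> dd x y"
  obtains C where "0 \<le> C" "\<And>\<eta>. 0 < \<eta> \<Longrightarrow> \<exists>\<delta>>0. \<forall>x y s t. dd x y < \<delta> \<and> \<bar>s - t\<bar> < \<delta> \<longrightarrow>
          \<bar>H x s - H y t\<bar> \<le> \<eta> + C * max \<bar>s\<bar> \<bar>t\<bar> * dd x y"
proof -
  obtain C \<omega> where C: "0 \<le> C" and \<omega>: "continuous_on UNIV \<omega>" "\<omega> (0, 0) = 0"
    and H: "\<And>x y s t. \<bar>H x s - H y t\<bar> \<le> \<omega> (dd x y, s - t) + C * max \<bar>s\<bar> \<bar>t\<bar> * dd x y"
    using assms(1) unfolding condition_A_def by blast
  have "\<exists>\<delta>>0. \<forall>x y s t. dd x y < \<delta> \<and> \<bar>s - t\<bar> < \<delta> \<longrightarrow> \<bar>H x s - H y t\<bar> \<le> \<eta> + C * max \<bar>s\<bar> \<bar>t\<bar> * dd x y"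
    if \<eta>: "0 < \<eta>" for \<eta>
  proof -
    obtain \<delta> where \<delta>: "0 < \<delta>" "\<And>z. dist z (0, 0) < \<delta> \<Longrightarrow> \<bar>\<omega> z\<bar> < \<eta>"
      using \<omega> \<eta> unfolding continuous_on_iff by (metis UNIV_I dist_real_def diff_zero)
    have "\<bar>H x s - H y t\<bar> \<le> \<eta> + C * max \<bar>s\<bar> \<bar>t\<bar> * dd x y" if "dd x y < \<delta> / 2" "\<bar>s - t\<bar> < \<delta> / 2" for x y s t
    proof -
      have "dist (dd x y, s - t) (0, 0) \<le> \<bar>dd x y\<bar> + \<bar>s - t\<bar>"
        unfolding dist_Pair_Pair dist_real_def by (simp add: sqrt_sum_squares_le_sum_abs)
      then have "\<bar>\<omega> (dd x y, s - t)\<bar> < \<eta>" using that assms(2)[of x y] by (intro \<delta>(2)) simp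
      then show ?thesis using H[of x s y t] by linarith
    qed
    then show ?thesis using \<delta>(1) by (intro exI[of _ "\<delta> / 2"]) auto
  qed
  then show ?thesis using C by (intro that)
qed

theorem corollary4p12:
  fixes atlas :: "('m::t2_space, 'x::banach) chart set"
    and nrm :: "'m \<Rightarrow> ('m, 'x) tangent \<Rightarrow> real"
    and H :: "'m \<Rightarrow> real \<Rightarrow> real"
    and K\<^sub>0 K\<^sub>1 :: real
  assumes "complete_C1_finsler_manifold atlas nrm"
    and "\<exists>b :: 'x \<Rightarrow> real. C1_lipschitz_bump b"
    and "continuous_on UNIV (\<lambda>(x, t). H x t)"
    and "0 < K\<^sub>0" and "0 < K\<^sub>1"
    and "\<And>x. K\<^sub>0 \<le> H x 0 \<and> H x 0 \<le> K\<^sub>1"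
    and "(uniformly_continuous_H (finsler_dist atlas nrm) H \<and>
            (\<forall>x. Liminf at_top (\<lambda>t. ereal (H x t)) > ereal K\<^sub>1)) \<or>
         (condition_A (finsler_dist atlas nrm) H \<and>
            (\<exists>K\<^sub>1' > K\<^sub>1.
               (\<forall>x. Liminf at_top (\<lambda>t. ereal (H x t)) \<ge> ereal K\<^sub>1') \<and>
               (\<forall>x\<^sub>0. \<forall>\<eta>>0. \<exists>V R. open V \<and> x\<^sub>0 \<in> V \<and> 0 < R \<and>
                  (\<forall>x\<in>V. \<forall>t\<ge>R. H x t \<ge> K\<^sub>1' - \<eta>))))"
  shows "(\<exists>!u. bounded (range u) \<and> viscosity_solution atlas nrm H u) \<and>
         (\<forall>u. bounded (range u) \<and> viscosity_solution atlas nrm H u \<longrightarrow>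
            (\<forall>x. u x = (SUP w \<in> {w. (\<forall>y. - K\<^sub>1 \<le> w y \<and> w y \<le> - K\<^sub>0) \<and>
                                  viscosity_subsolution atlas nrm H w}. w x)) \<and>
            locally_lipschitz (finsler_dist atlas nrm) u)"
proof -
  let ?d = "finsler_dist atlas nrm"
  interpret M: complete_C1_finsler_manifold atlas nrm by (rule assms(1))
  obtain N :: "'x \<Rightarrow> real" and N' B L where "smooth_gauge N N' B L"
    using assms(2) smooth_gauge_exists by metis
  then interpret gauge: smooth_gauge N N' B L .
  have "\<exists>C\<ge>0. (\<forall>\<eta>>0. \<exists>\<delta>>0. \<forall>x y s t. ?d x y < \<delta> \<and> \<bar>s - t\<bar> < \<delta> \<longrightarrow>
          \<bar>H x s - H y t\<bar> \<le> \<eta> + C * max \<bar>s\<bar> \<bar>t\<bar> * ?d x y) \<and>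
      (\<forall>x\<^sub>0. \<exists>e>0. \<exists>R. \<forall>x. ?d x\<^sub>0 x < e \<longrightarrow> (\<forall>t\<ge>R. K\<^sub>1 < H x t))"
    using assms(7)
  proof (elim disjE conjE exE)
    assume uc: "uniformly_continuous_H ?d H" and li: "\<forall>x. Liminf at_top (\<lambda>t. ereal (H x t)) > ereal K\<^sub>1"
    \<comment> \<open>The lower limit is known at each point separately. Uniform continuity
      transfers the bound \<open>H x\<^sub>0 t > k\<close> for \<open>t \<ge> R\<close> to a whole
      ball with the same \<open>R\<close>, losing less than \<open>k - K\<^sub>1\<close>.\<close>
    have "\<exists>e>0. \<exists>R. \<forall>x. ?d x\<^sub>0 x < e \<longrightarrow> (\<forall>t\<ge>R. K\<^sub>1 < H x t)" for x\<^sub>0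
    proof -
      obtain k where k: "ereal K\<^sub>1 < ereal k" "ereal k < Liminf at_top (\<lambda>t. ereal (H x\<^sub>0 t))"
        using ereal_dense2[of "ereal K\<^sub>1"] li by blast
      have "\<forall>\<^sub>F t in at_top. ereal k < ereal (H x\<^sub>0 t)" using less_LiminfD[OF k(2)] .
      then obtain R where R: "\<And>t. R \<le> t \<Longrightarrow> k < H x\<^sub>0 t" unfolding eventually_at_top_linorder by auto
      obtain \<delta> where \<delta>: "0 < \<delta>" "\<And>x y s t. ?d x y < \<delta> \<and> \<bar>s - t\<bar> < \<delta> \<Longrightarrow> \<bar>H x s - H y t\<bar> < k - K\<^sub>1"
        using uc k(1) unfolding uniformly_continuous_H_def by (metis diff_gt_0_iff_gt less_ereal.simps(1))
      have "K\<^sub>1 < H x t" if "?d x\<^sub>0 x < \<delta>" "R \<le> t" for x t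
        using \<delta>(2)[of x\<^sub>0 x t t] R[OF that(2)] that(1) \<delta>(1) by (simp add: abs_less_iff)
      then show ?thesis using \<delta>(1) by blast
    qed
    \<comment> \<open>Under uniform continuity the structural condition holds with
      \<open>C = 0\<close>.\<close>
    moreover have "\<exists>\<delta>>0. \<forall>x y s t. ?d x y < \<delta> \<and> \<bar>s - t\<bar> < \<delta> \<longrightarrow>
          \<bar>H x s - H y t\<bar> \<le> \<eta> + 0 * max \<bar>s\<bar> \<bar>t\<bar> * ?d x y" if \<eta>: "0 < \<eta>" for \<eta>
    proof -
      obtain \<delta> where "0 < \<delta>" "\<And>x y s t. ?d x y < \<delta> \<and> \<bar>s - t\<bar> < \<delta> \<Longrightarrow> \<bar>H x s - H y t\<bar> < \<eta>"
        using uc \<eta> unfolding uniformly_continuous_H_def by meson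
      then show ?thesis by (intro exI[of _ \<delta>]) (simp add: less_imp_le)
    qed
    ultimately show ?thesis by (intro exI[of _ 0]) auto
  next
    fix K\<^sub>1' assume A: "condition_A ?d H" and K: "K\<^sub>1 < K\<^sub>1'"
      and unif: "\<forall>x\<^sub>0. \<forall>\<eta>>0. \<exists>V R. open V \<and> x\<^sub>0 \<in> V \<and> 0 < R \<and> (\<forall>x\<in>V. \<forall>t\<ge>R. H x t \<ge> K\<^sub>1' - \<eta>)"
    obtain C where C: "0 \<le> C" "\<And>\<eta>. 0 < \<eta> \<Longrightarrow> \<exists>\<delta>>0. \<forall>x y s t. ?d x y < \<delta> \<and> \<bar>s - t\<bar> < \<delta> \<longrightarrow>
          \<bar>H x s - H y t\<bar> \<le> \<eta> + C * max \<bar>s\<bar> \<bar>t\<bar> * ?d x y"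
      using condition_A_imp_structure[OF A M.d_nonneg] by blast
    have "\<exists>e>0. \<exists>R. \<forall>x. ?d x\<^sub>0 x < e \<longrightarrow> (\<forall>t\<ge>R. K\<^sub>1 < H x t)" for x\<^sub>0
    proof -
      \<comment> \<open>Half of the gap is given up for uniformity on a neighbourhood; the other
        half keeps the inequality strict.\<close>
      have "0 < (K\<^sub>1' - K\<^sub>1) / 2" using K by simp
      then obtain V R where V: "open V" "x\<^sub>0 \<in> V" "\<And>x t. x \<in> V \<Longrightarrow> R \<le> t \<Longrightarrow> K\<^sub>1' - (K\<^sub>1' - K\<^sub>1) / 2 \<le> H x t"
        using unif by meson
      obtain e where e: "0 < e" "\<And>x. ?d x\<^sub>0 x < e \<Longrightarrow> x \<in> V" using M.open_imp_d_ball[OF V(1,2)] by blast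
      have "K\<^sub>1 < H x t" if "?d x\<^sub>0 x < e" "R \<le> t" for x t
        using V(3)[OF e(2)[OF that(1)] that(2)] K by (simp add: field_simps)
      then show ?thesis using e(1) by blast
    qed
    then show ?thesis using C by blast
  qed
  then obtain C where C: "0 \<le> C" "\<And>\<eta>. 0 < \<eta> \<Longrightarrow> \<exists>\<delta>>0. \<forall>x y s t. ?d x y < \<delta> \<and> \<bar>s - t\<bar> < \<delta> \<longrightarrow>
          \<bar>H x s - H y t\<bar> \<le> \<eta> + C * max \<bar>s\<bar> \<bar>t\<bar> * ?d x y"
    "\<And>x\<^sub>0. \<exists>e>0. \<exists>R. \<forall>x. ?d x\<^sub>0 x < e \<longrightarrow> (\<forall>t\<ge>R. K\<^sub>1 < H x t)" by blast
  interpret hamilton_jacobi atlas nrm N N' B L H K\<^sub>0 K\<^sub>1 C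
    by unfold_locales (use assms(3-6) C in auto)
  note uniq = bounded_solution_unique[OF _ _ perron_bounded perron_solution]
  have "perron x = (SUP w \<in> {w. (\<forall>y. - K\<^sub>1 \<le> w y \<and> w y \<le> - K\<^sub>0) \<and> viscosity_subsolution atlas nrm H w}. w x)" for x
    by (simp add: perron_def perron_class_def)
  then show ?thesis
    using uniq perron_bounded perron_solution perron_locally_lipschitz by blast
qed

end
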